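(* Let $n\ge 1$ and $t>0$. For every non-negative integer $m$, the holomorphic Laguerre Sobolev space $W_t^{*\,m,2}(\mathbb{C}^{2n})$ coincides with $\mathcal{B}_t^{*,m}(\mathbb{C}^{2n})$ (the completion of $G_t^m(\mathbb{C}^{2n})$), and the special Hermite semigroup operator $e^{-tL}$ is, up to a constant multiple, an isometric isomorphism of $W_L^{m,2}(\mathbb{C}^n)$ onto $\mathcal{B}_t^{*,m}(\mathbb{C}^{2n})$; that is, $e^{-tL}$ is a linear bijection between these spaces which multiplies norms by a fixed positive constant.
   Context: For $x\in\mathbb{R}^n$, $x^2=x_1^2+\cdots+x_n^2$; for $x,u\in\mathbb{R}^n$, $xu$ denotes the dot product. Let $h_k(x)=(2^kk!\sqrt{\pi})^{-1/2}(-1)^k\frac{d^k}{dx^k}(e^{-x^2})e^{x^2/2}$ and $\Phi_\alpha(x)=\prod_{i=1}^n h_{\alpha_i}(x_i)$ for $\alpha\in\mathbb{N}^n$ ($\mathbb{N}=\{0,1,2,\dots\}$) be the normalised Hermite functions. Identify $\mathbb{C}^n$ with $\mathbb{R}^{2n}$, writing a point $x+iu$ as $(x,u)$. The special Hermite functions are $$\Phi_{\alpha\beta}(x,u)=(2\pi)^{-n/2}\int_{\mathbb{R}^n}e^{ix\xi}\Phi_\alpha(\xi+\tfrac12u)\Phi_\beta(\xi-\tfrac12u)\,d\xi,\qquad \alpha,\beta\in\mathbb{N}^n;$$ they form an orthonormal basis of $L^2(\mathbb{C}^n)=L^2(\mathbb{R}^{2n})$, and are eigenfunctions of the special Hermite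 operator $L=-\Delta+\frac14(x^2+u^2)-i\sum_{j=1}^n\left(x_j\frac{\partial}{\partial u_j}-u_j\frac{\partial}{\partial x_j}\right)$ with $L\Phi_{\alpha\beta}=(2|\beta|+n)\Phi_{\alpha\beta}$. The special Hermite semigroup is $e^{-tL}f=\sum_{\alpha,\beta}e^{-(2|\beta|+n)t}(f,\Phi_{\alpha\beta})\Phi_{\alpha\beta}$, $f\in L^2(\mathbb{R}^{2n})$; $e^{-tL}f(x,u)$ extends to an entire function on $\mathbb{C}^{2n}$, denoted $e^{-tL}f(z,w)$, with $z=x+iy$, $w=u+iv\in\mathbb{C}^n$. Laguerre Sobolev space: $W_L^{m,2}(\mathbb{C}^n)$ is the set of $f\in L^2(\mathbb{C}^n)$ with $\|f\|_{W_L^{m,2}}^2=\sum_{\alpha,\beta}(2|\beta|+n)^{2m}|(f,\Phi_{\alpha\beta})|^2<\infty$. Holomorphic Laguerre Sobolev space: $W_t^{*\,m,2}(\mathbb{C}^{2n})$ is the image of $W_L^{m,2}(\mathbb{C}^n)$ under $e^{-tL}$ (as a space of entire functions), with norm $\|e^{-tL}f\|_{W_t^{*\,m,2}}=\|f\|_{W_L^{m,2}}$. Weight: $W_t(x+iy,u+iv)=4^ne^{uy-vx}\,p_{2t}(2y,2v)$, where $p_t(x,u)=(2\pi)^{-n}(\sinh t)^{-n}e^{-\frac14\coth t\,(x^2+u^2)}$. $G_t^m(\mathbb{C}^{2n})$ is the space of entire functions on $\mathbb{C}^{2n}$ square integrable with respect to $\left|\frac{d^{2m}}{dt^{2m}}W_t(z,w)\right|dz\,dw$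 (Lebesgue measure), with the inner product $(F,G)=\int_{\mathbb{C}^{2n}}F(z,w)\overline{G(z,w)}\frac{d^{2m}}{dt^{2m}}W_t(z,w)\,dz\,dw$. $\mathcal{B}_t^{*,m}(\mathbb{C}^{2n})$ is the completion of $G_t^m(\mathbb{C}^{2n})$ with respect to the norm of this inner product; the identification with $W_t^{*\,m,2}(\mathbb{C}^{2n})$ is the one extending the inclusion of $G_t^m(\mathbb{C}^{2n})$ as entire functions. *)

theory Defs
  imports "HOL-Analysis.Analysis"
begin

section \<open>Special Hermite functions\<close>

definition hermite_fun :: "nat \<Rightarrow> real \<Rightarrow> real" where
  "hermite_fun k x =
     (2 ^ k * fact k * sqrt pi) powr (-1/2) * (-1) ^ k
       * (deriv ^^ k) (\<lambda>y. exp (- y\<^sup>2)) x * exp (x\<^sup>2 / 2)"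

definition Hermite_fun :: "nat ^ 'n::finite \<Rightarrow> real ^ 'n \<Rightarrow> real" where
  "Hermite_fun \<alpha> x = (\<Prod>i\<in>UNIV. hermite_fun (\<alpha> $ i) (x $ i))"

definition special_Hermite ::
    "nat ^ 'n::finite \<Rightarrow> nat ^ 'n \<Rightarrow> (real ^ 'n) \<times> (real ^ 'n) \<Rightarrow> complex" where
  "special_Hermite \<alpha> \<beta> = (\<lambda>(x, u).
     of_real ((2 * pi) powr (- real CARD('n) / 2))
       * (\<integral>\<xi>. exp (\<i> * of_real (x \<bullet> \<xi>))
             * of_real (Hermite_fun \<alpha> (\<xi> + (1/2) *\<^sub>R u) * Hermite_fun \<beta> (\<xi> - (1/2) *\<^sub>R u))
          \<partial>lborel))"

definition eigval :: "nat ^ 'n::finite \<Rightarrow> real" where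
  "eigval \<beta> = 2 * real (\<Sum>i\<in>UNIV. \<beta> $ i) + real CARD('n)"


section \<open>The space $L^2(\mathbf{C}^n)$ and the Laguerre Sobolev spaces\<close>

text \<open>
  A point $x + iu$ of $\mathbf{C}^n$ is the pair $(x, u)$ of real vectors. Elements of $L^2$ are
  classes of square integrable Borel functions modulo equality almost everywhere; a
  function on representatives is carried to classes by \<^const>\<open>the_elem\<close> of its image.
\<close>

definition L2_fun :: "((real ^ 'n::finite) \<times> (real ^ 'n) \<Rightarrow> complex) set" where
  "L2_fun = {f. f \<in> borel_measurable lborel \<and> integrable lborel (\<lambda>p. (cmod (f p))\<^sup>2)}"

definition L2_rel :: "((real ^ 'n::finite) \<times> (real ^ 'n) \<Rightarrow> complex) rel" where
  "L2_rel = {(f, g). f \<in> L2_fun \<and> g \<in> L2_fun \<and> (AE p in lborel. f p = g p)}"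

type_synonym 'n L2_class = "((real ^ 'n) \<times> (real ^ 'n) \<Rightarrow> complex) set"

definition L2 :: "'n::finite L2_class set" where
  "L2 = L2_fun // L2_rel"

definition L2_add :: "'n::finite L2_class \<Rightarrow> 'n L2_class \<Rightarrow> 'n L2_class" where
  "L2_add A B = (\<Union>f\<in>A. \<Union>g\<in>B. L2_rel `` {\<lambda>p. f p + g p})"

definition L2_scale :: "complex \<Rightarrow> 'n::finite L2_class \<Rightarrow> 'n L2_class" where
  "L2_scale a A = (\<Union>f\<in>A. L2_rel `` {\<lambda>p. a * f p})"

definition coef :: "'n::finite L2_class \<Rightarrow> nat ^ 'n \<Rightarrow> nat ^ 'n \<Rightarrow> complex" where
  "coef A \<alpha> \<beta> = the_elem ((\<lambda>f. \<integral>p. f p * cnj (special_Hermite \<alpha> \<beta> p) \<partial>lborel) ` A)"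

definition Laguerre_Sobolev :: "nat \<Rightarrow> 'n::finite L2_class set" where
  "Laguerre_Sobolev m =
     {A \<in> L2. (\<lambda>(\<alpha>, \<beta>). eigval \<beta> ^ (2 * m) * (cmod (coef A \<alpha> \<beta>))\<^sup>2) summable_on UNIV}"

definition Laguerre_Sobolev_norm :: "nat \<Rightarrow> 'n::finite L2_class \<Rightarrow> real" where
  "Laguerre_Sobolev_norm m A =
     sqrt (\<Sum>\<^sub>\<infinity>(\<alpha>, \<beta>). eigval \<beta> ^ (2 * m) * (cmod (coef A \<alpha> \<beta>))\<^sup>2)"


section \<open>The special Hermite semigroup\<close>

definition semigroup_partial_sum ::
    "real \<Rightarrow> 'n::finite L2_class \<Rightarrow> ((nat ^ 'n) \<times> (nat ^ 'n)) set
       \<Rightarrow> (real ^ 'n) \<times> (real ^ 'n) \<Rightarrow> complex" where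
  "semigroup_partial_sum t A S p =
     (\<Sum>(\<alpha>, \<beta>)\<in>S. of_real (exp (- eigval \<beta> * t)) * coef A \<alpha> \<beta> * special_Hermite \<alpha> \<beta> p)"

text \<open>The defining series is summed unconditionally, in the $L^2$ norm.\<close>

definition special_Hermite_semigroup :: "real \<Rightarrow> 'n::finite L2_class \<Rightarrow> 'n L2_class" where
  "special_Hermite_semigroup t A = (THE B. B \<in> L2 \<and>
     (\<forall>g\<in>B. ((\<lambda>S. \<integral>p. (cmod (g p - semigroup_partial_sum t A S p))\<^sup>2 \<partial>lborel) \<longlongrightarrow> 0)
              (finite_subsets_at_top UNIV)))"

text \<open>Points of $\mathbf{C}^{2n}$ are pairs $(z, w)$ of complex vectors.\<close>

definition entire :: "((complex ^ 'n::finite) \<times> (complex ^ 'n) \<Rightarrow> complex) \<Rightarrow> bool" where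
  "entire F \<longleftrightarrow> (\<forall>p. \<exists>D. (F has_derivative D) (at p) \<and>
     (\<forall>a z w. D (a *s z, a *s w) = a * D (z, w)))"

definition restrict_real ::
    "((complex ^ 'n::finite) \<times> (complex ^ 'n) \<Rightarrow> complex)
       \<Rightarrow> (real ^ 'n) \<times> (real ^ 'n) \<Rightarrow> complex" where
  "restrict_real F = (\<lambda>(x, u). F (\<chi> i. of_real (x $ i), \<chi> i. of_real (u $ i)))"

definition semigroup_entire ::
    "real \<Rightarrow> 'n::finite L2_class \<Rightarrow> (complex ^ 'n) \<times> (complex ^ 'n) \<Rightarrow> complex" where
  "semigroup_entire t A =
     (THE F. entire F \<and> restrict_real F \<in> special_Hermite_semigroup t A)"

definition holo_Laguerre_Sobolev ::
    "real \<Rightarrow> nat \<Rightarrow> ((complex ^ 'n::finite) \<times> (complex ^ 'n) \<Rightarrow> complex) set" where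
  "holo_Laguerre_Sobolev t m = semigroup_entire t ` Laguerre_Sobolev m"

definition holo_Laguerre_Sobolev_norm ::
    "real \<Rightarrow> nat \<Rightarrow> ((complex ^ 'n::finite) \<times> (complex ^ 'n) \<Rightarrow> complex) \<Rightarrow> real" where
  "holo_Laguerre_Sobolev_norm t m F =
     Laguerre_Sobolev_norm m (the_inv_into (Laguerre_Sobolev m) (semigroup_entire t) F)"


section \<open>The weighted space of entire functions and its completion\<close>

definition heat_kernel :: "real \<Rightarrow> real ^ 'n::finite \<Rightarrow> real ^ 'n \<Rightarrow> real" where
  "heat_kernel t x u =
     1 / ((2 * pi) ^ CARD('n) * sinh t ^ CARD('n))
       * exp (- (1/4) * (cosh t / sinh t) * (x \<bullet> x + u \<bullet> u))"

definition weight :: "real \<Rightarrow> (complex ^ 'n::finite) \<times> (complex ^ 'n) \<Rightarrow> real" where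
  "weight t = (\<lambda>(z, w).
     let x = (\<chi> i. Re (z $ i)); y = (\<chi> i. Im (z $ i));
         u = (\<chi> i. Re (w $ i)); v = (\<chi> i. Im (w $ i))
     in 4 ^ CARD('n) * exp (u \<bullet> y - v \<bullet> x) * heat_kernel (2 * t) (2 *\<^sub>R y) (2 *\<^sub>R v))"

definition weight_deriv ::
    "nat \<Rightarrow> real \<Rightarrow> (complex ^ 'n::finite) \<times> (complex ^ 'n) \<Rightarrow> real" where
  "weight_deriv m t p = (deriv ^^ (2 * m)) (\<lambda>s. weight s p) t"

definition G_space ::
    "real \<Rightarrow> nat \<Rightarrow> ((complex ^ 'n::finite) \<times> (complex ^ 'n) \<Rightarrow> complex) set" where
  "G_space t m =
     {F. entire F \<and> integrable lborel (\<lambda>p. (cmod (F p))\<^sup>2 * \<bar>weight_deriv m t p\<bar>)}"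

definition G_inner ::
    "real \<Rightarrow> nat \<Rightarrow> ((complex ^ 'n::finite) \<times> (complex ^ 'n) \<Rightarrow> complex)
       \<Rightarrow> ((complex ^ 'n) \<times> (complex ^ 'n) \<Rightarrow> complex) \<Rightarrow> complex" where
  "G_inner t m F G = (\<integral>p. F p * cnj (G p) * of_real (weight_deriv m t p) \<partial>lborel)"

definition G_norm ::
    "real \<Rightarrow> nat \<Rightarrow> ((complex ^ 'n::finite) \<times> (complex ^ 'n) \<Rightarrow> complex) \<Rightarrow> real" where
  "G_norm t m F = sqrt (Re (G_inner t m F F))"

definition inner_product_on ::
    "('a \<Rightarrow> complex) set \<Rightarrow> (('a \<Rightarrow> complex) \<Rightarrow> ('a \<Rightarrow> complex) \<Rightarrow> complex) \<Rightarrow> bool" where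
  "inner_product_on V ip \<longleftrightarrow>
     (\<lambda>p. 0) \<in> V \<and>
     (\<forall>F\<in>V. \<forall>G\<in>V. (\<lambda>p. F p + G p) \<in> V) \<and>
     (\<forall>a. \<forall>F\<in>V. (\<lambda>p. a * F p) \<in> V) \<and>
     (\<forall>F\<in>V. \<forall>G\<in>V. \<forall>H\<in>V. ip (\<lambda>p. F p + G p) H = ip F H + ip G H) \<and>
     (\<forall>a. \<forall>F\<in>V. \<forall>G\<in>V. ip (\<lambda>p. a * F p) G = a * ip F G) \<and>
     (\<forall>F\<in>V. \<forall>G\<in>V. ip G F = cnj (ip F G)) \<and>
     (\<forall>F\<in>V. F \<noteq> (\<lambda>p. 0) \<longrightarrow> Re (ip F F) > 0)"

text \<open>The completion consists of Cauchy sequences modulo null sequences.\<close>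

type_synonym 'n holo_seq = "nat \<Rightarrow> (complex ^ 'n) \<times> (complex ^ 'n) \<Rightarrow> complex"

definition G_Cauchy :: "real \<Rightarrow> nat \<Rightarrow> 'n::finite holo_seq set" where
  "G_Cauchy t m = {X. (\<forall>k. X k \<in> G_space t m) \<and>
     (\<forall>\<epsilon>>0. \<exists>N. \<forall>j\<ge>N. \<forall>k\<ge>N. G_norm t m (\<lambda>p. X j p - X k p) < \<epsilon>)}"

definition B_rel :: "real \<Rightarrow> nat \<Rightarrow> 'n::finite holo_seq rel" where
  "B_rel t m = {(X, Y). X \<in> G_Cauchy t m \<and> Y \<in> G_Cauchy t m \<and>
     (\<lambda>k. G_norm t m (\<lambda>p. X k p - Y k p)) \<longlonglongrightarrow> 0}"

definition B_space :: "real \<Rightarrow> nat \<Rightarrow> 'n::finite holo_seq set set" where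
  "B_space t m = G_Cauchy t m // B_rel t m"

definition B_embed ::
    "real \<Rightarrow> nat \<Rightarrow> ((complex ^ 'n::finite) \<times> (complex ^ 'n) \<Rightarrow> complex) \<Rightarrow> 'n holo_seq set" where
  "B_embed t m F = B_rel t m `` {\<lambda>k. F}"

definition B_add ::
    "real \<Rightarrow> nat \<Rightarrow> 'n::finite holo_seq set \<Rightarrow> 'n holo_seq set \<Rightarrow> 'n holo_seq set" where
  "B_add t m b b' = (\<Union>X\<in>b. \<Union>Y\<in>b'. B_rel t m `` {\<lambda>k p. X k p + Y k p})"

definition B_scale ::
    "real \<Rightarrow> nat \<Rightarrow> complex \<Rightarrow> 'n::finite holo_seq set \<Rightarrow> 'n holo_seq set" where
  "B_scale t m a b = (\<Union>X\<in>b. B_rel t m `` {\<lambda>k p. a * X k p})"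

definition B_norm :: "real \<Rightarrow> nat \<Rightarrow> 'n::finite holo_seq set \<Rightarrow> real" where
  "B_norm t m b = the_elem ((\<lambda>X. lim (\<lambda>k. G_norm t m (X k))) ` b)"


section \<open>Linear maps between carriers\<close>

definition linear_map_on ::
    "'a set \<Rightarrow> ('a \<Rightarrow> 'a \<Rightarrow> 'a) \<Rightarrow> (complex \<Rightarrow> 'a \<Rightarrow> 'a)
       \<Rightarrow> ('b \<Rightarrow> 'b \<Rightarrow> 'b) \<Rightarrow> (complex \<Rightarrow> 'b \<Rightarrow> 'b) \<Rightarrow> ('a \<Rightarrow> 'b) \<Rightarrow> bool" where
  "linear_map_on V add scl add' scl' T \<longleftrightarrow>
     (\<forall>x\<in>V. \<forall>y\<in>V. T (add x y) = add' (T x) (T y)) \<and>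
     (\<forall>a. \<forall>x\<in>V. T (scl a x) = scl' a (T x))"

text \<open>
  An identification of the completion with the holomorphic Laguerre Sobolev space: a linear
  bijection extending the inclusion of \<^const>\<open>G_space\<close> as entire functions and scaling norms
  by a constant. Since \<^const>\<open>G_space\<close> is dense in its completion there is at most one.
\<close>

definition B_identification ::
    "real \<Rightarrow> nat \<Rightarrow> ('n::finite holo_seq set \<Rightarrow> (complex ^ 'n) \<times> (complex ^ 'n) \<Rightarrow> complex)
       \<Rightarrow> bool" where
  "B_identification t m J \<longleftrightarrow>
     bij_betw J (B_space t m) (holo_Laguerre_Sobolev t m) \<and>
     linear_map_on (B_space t m) (B_add t m) (B_scale t m)
       (\<lambda>F G p. F p + G p) (\<lambda>a F p. a * F p) J \<and>
     (\<forall>F\<in>G_space t m. J (B_embed t m F) = F) \<and>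
     (\<exists>k>0. \<forall>b\<in>B_space t m. holo_Laguerre_Sobolev_norm t m (J b) = k * B_norm t m b)"

end

theory Submission
  imports Defs "HOL-Probability.Probability" "HOL-Complex_Analysis.Complex_Analysis" "HOL-Real_Asymp.Real_Asymp"
begin

text \<open>
  The special Hermite functions are, up to a Gaussian, polynomials, so they extend to entire functions
  \<open>SH \<alpha> \<beta>\<close>. Up to the squared modulus of an entire Gaussian, \<^const>\<open>weight\<close> is rotation invariant;
  with respect to it the \<open>SH \<alpha> \<beta>\<close> are orthogonal with squared norm \<open>2\<^sup>n exp (2 \<lambda> t)\<close>, where
  \<open>\<lambda> = 2 |\<beta>| + n\<close>, and complete among entire functions (by the mean value property and a Fourier
  superposition). Hence \<open>\<integral> |F|\<^sup>2 weight s = 2\<^sup>n \<Sum> |d|\<^sup>2 exp (2 \<lambda> s)\<close> for \<open>F = \<Sum> d SH\<close> and \<open>s \<le> t\<close>.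

  The derivative of order \<open>2 m\<close> in \<open>s\<close> of the weight is a polynomial in the imaginary parts times the
  weight, positive far out; averaging over translations that preserve the remaining variables shows that
  its square integrability implies that for the weight itself. Comparing finite differences of both sides
  of the identity above gives \<open>(F, F) = 2\<^sup>n 4\<^sup>m \<Sum> \<lambda>\<^bsup>2m\<^esup> |d|\<^sup>2 exp (2 \<lambda> t)\<close>, although the
  derivative changes sign. The coefficients thus identify the completion with a weighted \<open>\<ell>\<^sup>2\<close> space,
  and finite sums are dense.
\<close>

text \<open>Two obstacles shape the proof. The derivative of the weight changes sign, so its
  quadratic form is not visibly positive and \<open>G_space\<close> is not visibly an L2 space;
  positivity and the completion are read off from coefficients. And the series for the norm at time
  s may diverge beyond t, so derivatives at t are taken one-sidedly: differences run backwards, and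
  their terms are nonnegative and bounded by those of the limit, which yields convergence and the
  value together. The constant has two sources: a factor 2 per dimension in the weighted norm, and
  (2 \<lambda>)^(2m) from differentiating exp (2 \<lambda> s).

  The eigenvalue enters as follows. With a = w + i z and \<eta> = Im z + i Im w one has w - i z =
  cnj a + 2 \<eta>, and the weight times the Gaussians of two special Hermite functions becomes exp
  (- |a|^2 / 2) exp (- \<kappa> |\<eta>|^2) in each coordinate, up to a constant, with \<kappa> =
  coth (2 t) - 1. Expanding in powers of \<eta> leaves a binomial sum with value (4 / \<kappa> +
  2)^k = 2^k exp (4 k t).\<close>

unbundle no fps_syntax
no_notation fps_nth (infixl "$" 75)

section \<open>Lebesgue measure as a product over coordinates\<close>

lemma prod_Basis_vec:
  fixes f :: "'a::euclidean_space ^ 'n::finite \<Rightarrow> 'b::comm_monoid_mult"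
  shows "(\<Prod>b\<in>Basis. f b) = (\<Prod>i\<in>UNIV. \<Prod>u\<in>Basis. f (axis i u))"
proof -
  have B: "(Basis :: ('a^'n) set) = (\<lambda>(i,u). axis i u) ` (UNIV \<times> Basis)"
    by (auto simp: Basis_vec_def)
  have "inj_on (\<lambda>(i::'n,u::'a). axis i u) (UNIV \<times> Basis)"
    by (auto simp: inj_on_def axis_eq_axis)
  then show ?thesis
    unfolding B by (subst prod.reindex) (auto simp: prod.cartesian_product case_prod_unfold)
qed

lemma prod_Basis_pair:
  fixes f :: "'a::euclidean_space \<times> 'c::euclidean_space \<Rightarrow> 'b::comm_monoid_mult"
  shows "(\<Prod>b\<in>Basis. f b) = (\<Prod>u\<in>Basis. f (u, 0)) * (\<Prod>v\<in>Basis. f (0, v))"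
proof -
  have "inj_on (\<lambda>u::'a. (u, 0::'c)) Basis" "inj_on (\<lambda>u::'c. (0::'a, u)) Basis"
    by (auto intro!: inj_onI)
  moreover have "(\<lambda>u::'a. (u, 0::'c)) ` Basis \<inter> (\<lambda>u::'c. (0::'a, u)) ` Basis = {}"
    by auto
  ultimately show ?thesis
    unfolding Basis_prod_def by (subst prod.union_disjoint) (auto simp: prod.reindex)
qed

lemma mem_box_vec: "(x :: 'a::euclidean_space ^ 'n::finite) \<in> box l u \<longleftrightarrow> (\<forall>i. x $ i \<in> box (l $ i) (u $ i))"
  by (auto simp: mem_box Basis_vec_def inner_axis)

lemma mem_box_pair: "(x, y) \<in> box (l, l') (u, u') \<longleftrightarrow> x \<in> box l u \<and> y \<in> box l' u'"
  by (auto simp: mem_box Basis_prod_def inner_Pair_0 ball_Un)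

interpretation PiL: product_sigma_finite "\<lambda>_::'i. lborel :: 'a::euclidean_space measure"
  by standard

text \<open>Pairs at each index are regrouped into a pair of vectors: the integrands below factor
  over the index, but each factor couples the two components at that index.\<close>

definition vecpair :: "('n::finite \<Rightarrow> 'a \<times> 'b) \<Rightarrow> ('a ^ 'n) \<times> ('b ^ 'n)" where
  "vecpair f = (\<chi> i. fst (f i), \<chi> i. snd (f i))"

lemma measurable_vec [measurable (raw)]:
  fixes f :: "'x \<Rightarrow> 'n::finite \<Rightarrow> 'a::euclidean_space"
  assumes "\<And>i. (\<lambda>x. f x i) \<in> borel_measurable M"
  shows "(\<lambda>x. \<chi> i. f x i) \<in> borel_measurable M"
proof (subst borel_measurable_euclidean_space, safe)
  fix b :: "'a^'n" assume "b \<in> Basis"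
  then obtain i u where "b = axis i u" by (auto simp: Basis_vec_def)
  then show "(\<lambda>x. (\<chi> i. f x i) \<bullet> b) \<in> borel_measurable M"
    using assms[of i] by (simp add: inner_axis)
qed

lemma measurable_vecpair [measurable]:
  "(vecpair :: ('n::finite \<Rightarrow> 'a::euclidean_space \<times> 'b::euclidean_space) \<Rightarrow> _)
     \<in> PiM UNIV (\<lambda>_. lborel) \<rightarrow>\<^sub>M borel"
proof -
  have "(\<lambda>f. f i) \<in> (PiM UNIV (\<lambda>_. lborel)) \<rightarrow>\<^sub>M (borel :: ('a\<times>'b) measure)" for i :: 'n
    using measurable_component_singleton[of i UNIV "\<lambda>_. lborel :: ('a\<times>'b) measure"] by simp
  then have [measurable]: "(\<lambda>f. fst (f i)) \<in> (PiM UNIV (\<lambda>_. lborel :: ('a\<times>'b) measure)) \<rightarrow>\<^sub>M borel"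
      "(\<lambda>f. snd (f i)) \<in> (PiM UNIV (\<lambda>_. lborel :: ('a\<times>'b) measure)) \<rightarrow>\<^sub>M borel" for i :: 'n
    by (rule measurable_compose[OF _ borel_measurable_continuous_onI]; simp add: continuous_on_fst continuous_on_snd)+
  show ?thesis unfolding vecpair_def
    by (subst borel_prod[symmetric]) measurable
qed

text \<open>\<open>lborel\<close> is determined by its values on boxes, and the preimage of a box
  under \<open>vecpair\<close> is a product of boxes, one for each index.\<close>

lemma lborel_vecpair:
  "(lborel :: (('a::euclidean_space ^ 'n::finite) \<times> ('b::euclidean_space ^ 'n)) measure) =
     distr (PiM UNIV (\<lambda>_. lborel)) borel vecpair"
proof (rule lborel_eqI)
  fix l u :: "('a ^ 'n) \<times> ('b ^ 'n)" assume le: "\<And>b. b \<in> Basis \<Longrightarrow> l \<bullet> b \<le> u \<bullet> b"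
  obtain l1 l2 u1 u2 where lu: "l = (l1, l2)" "u = (u1, u2)" by fastforce
  have le1: "(l1 $ i, l2 $ i) \<bullet> b \<le> (u1 $ i, u2 $ i) \<bullet> b" if bB: "b \<in> Basis" for i b
  proof -
    consider c where "b = (c, 0)" "c \<in> Basis" | c where "b = (0, c)" "c \<in> Basis"
      using bB by (auto simp: Basis_prod_def)
    then show ?thesis
    proof cases
      case 1 then show ?thesis using le[of "(axis i c, 0)"]
        by (auto simp: lu Basis_prod_def Basis_vec_def inner_axis)
    next
      case 2
      then have "(0, axis i c) \<in> (Basis :: (('a ^ 'n) \<times> ('b ^ 'n)) set)"
        unfolding Basis_prod_def by (intro UnI2 imageI) (simp add: axis_in_Basis_iff)
      from le[OF this] 2 show ?thesis by (simp add: lu inner_axis)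
    qed
  qed
  have "vecpair -` box l u \<inter> space (PiM UNIV (\<lambda>_. lborel))
      = (\<Pi>\<^sub>E i\<in>UNIV. box (l1 $ i, l2 $ i) (u1 $ i, u2 $ i))"
    by (auto simp: lu vecpair_def mem_box_pair mem_box_vec space_PiM PiE_UNIV_domain Pi_iff)
       (metis mem_box_pair prod.collapse)+
  then have "emeasure (distr (PiM UNIV (\<lambda>_. lborel)) borel vecpair) (box l u)
      = emeasure (PiM UNIV (\<lambda>_. lborel)) (\<Pi>\<^sub>E i\<in>UNIV. box (l1 $ i, l2 $ i) (u1 $ i, u2 $ i))"
    by (subst emeasure_distr) auto
  also have "\<dots> = (\<Prod>i\<in>UNIV. emeasure lborel (box (l1 $ i, l2 $ i) (u1 $ i, u2 $ i)))"
    by (subst PiL.emeasure_PiM) auto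
  also have "\<dots> = (\<Prod>i\<in>UNIV. ennreal (\<Prod>b\<in>Basis. ((u1 $ i, u2 $ i) - (l1 $ i, l2 $ i)) \<bullet> b))"
    by (intro prod.cong refl emeasure_lborel_box) (use le1 in auto)
  also have "\<dots> = ennreal (\<Prod>i\<in>UNIV. \<Prod>b\<in>Basis. ((u1 $ i, u2 $ i) - (l1 $ i, l2 $ i)) \<bullet> b)"
    by (intro prod_ennreal prod_nonneg) (metis le1 diff_ge_0_iff_ge inner_diff_left)
  also have "(\<Prod>i\<in>UNIV. \<Prod>b\<in>Basis. ((u1 $ i, u2 $ i) - (l1 $ i, l2 $ i)) \<bullet> b) = (\<Prod>b\<in>Basis. (u - l) \<bullet> b)"
    by (simp add: lu prod_Basis_pair prod_Basis_vec prod.distrib inner_axis)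
  finally show "emeasure (distr (PiM UNIV (\<lambda>_. lborel)) borel vecpair) (box l u)
      = ennreal (\<Prod>b\<in>Basis. (u - l) \<bullet> b)" .
qed simp

lemma lborel_vec:
  "(lborel :: ('a::euclidean_space ^ 'n::finite) measure) =
     distr (PiM UNIV (\<lambda>_. lborel)) borel (\<lambda>f. \<chi> i. f i)"
proof (rule lborel_eqI)
  have [measurable]: "(\<lambda>f. f i) \<in> (PiM UNIV (\<lambda>_. lborel)) \<rightarrow>\<^sub>M (borel :: 'a measure)" for i :: 'n
    using measurable_component_singleton[of i UNIV "\<lambda>_. lborel :: 'a measure"] by simp
  fix l u :: "'a ^ 'n" assume le: "\<And>b. b \<in> Basis \<Longrightarrow> l \<bullet> b \<le> u \<bullet> b"
  have le1: "l $ i \<bullet> b \<le> u $ i \<bullet> b" if "b \<in> Basis" for i b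
    using le[of "axis i b"] that by (auto simp: Basis_vec_def inner_axis)
  have "(\<lambda>f. \<chi> i. f i) -` box l u \<inter> space (PiM UNIV (\<lambda>_. lborel)) = (\<Pi>\<^sub>E i\<in>UNIV. box (l $ i) (u $ i))"
    by (auto simp: mem_box_vec space_PiM PiE_UNIV_domain Pi_iff)
  then have "emeasure (distr (PiM UNIV (\<lambda>_. lborel)) borel (\<lambda>f. \<chi> i. f i)) (box l u)
      = emeasure (PiM UNIV (\<lambda>_. lborel)) (\<Pi>\<^sub>E i\<in>UNIV. box (l $ i) (u $ i))"
    by (subst emeasure_distr) auto
  also have "\<dots> = (\<Prod>i\<in>UNIV. emeasure lborel (box (l $ i) (u $ i)))"
    by (subst PiL.emeasure_PiM) auto
  also have "\<dots> = (\<Prod>i\<in>UNIV. ennreal (\<Prod>b\<in>Basis. (u $ i - l $ i) \<bullet> b))"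
    by (intro prod.cong refl emeasure_lborel_box) (use le1 in auto)
  also have "\<dots> = ennreal (\<Prod>i\<in>UNIV. \<Prod>b\<in>Basis. (u $ i - l $ i) \<bullet> b)"
    by (intro prod_ennreal prod_nonneg) (use le1 in \<open>auto simp: inner_diff_left\<close>)
  also have "(\<Prod>i\<in>UNIV. \<Prod>b\<in>Basis. (u $ i - l $ i) \<bullet> b) = (\<Prod>b\<in>Basis. (u - l) \<bullet> b)"
    by (simp add: prod_Basis_vec inner_axis)
  finally show "emeasure (distr (PiM UNIV (\<lambda>_. lborel)) borel (\<lambda>f. \<chi> i. f i)) (box l u)
      = ennreal (\<Prod>b\<in>Basis. (u - l) \<bullet> b)" .
qed simp

lemma integral_vec_prod:
  fixes f :: "'n::finite \<Rightarrow> 'a::euclidean_space \<Rightarrow> 'b::{real_normed_field,banach,second_countable_topology}"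
  assumes int: "\<And>i. integrable lborel (f i)"
  shows "integrable lborel (\<lambda>x::'a^'n. \<Prod>i\<in>UNIV. f i (x $ i))"
    and "(\<integral>x. (\<Prod>i\<in>UNIV. f i (x $ i)) \<partial>(lborel :: ('a^'n) measure)) = (\<Prod>i\<in>UNIV. \<integral>x. f i x \<partial>lborel)"
proof -
  have [measurable]: "(\<lambda>f. f i) \<in> (PiM UNIV (\<lambda>_. lborel)) \<rightarrow>\<^sub>M (borel :: 'a measure)" for i :: 'n
    using measurable_component_singleton[of i UNIV "\<lambda>_. lborel :: 'a measure"] by simp
  have [measurable]: "f i \<in> borel_measurable borel" for i
    using borel_measurable_integrable[OF int[of i]] by simp
  have [measurable]: "(\<lambda>x::'a^'n. x $ i) \<in> borel_measurable borel" for i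
    by (intro borel_measurable_continuous_onI continuous_intros)
  show "integrable lborel (\<lambda>x::'a^'n. \<Prod>i\<in>UNIV. f i (x $ i))"
    by (subst lborel_vec, subst integrable_distr_eq)
       (auto intro!: PiL.product_integrable_prod int borel_measurable_prod)
  show "(\<integral>x. (\<Prod>i\<in>UNIV. f i (x $ i)) \<partial>(lborel :: ('a^'n) measure)) = (\<Prod>i\<in>UNIV. \<integral>x. f i x \<partial>lborel)"
    by (subst lborel_vec, subst integral_distr)
       (auto intro!: PiL.product_integral_prod int borel_measurable_prod)
qed

text \<open>The two components at one index are integrated together, as required by factors such as
  \<open>sh\<close>, which do not split into functions of one component.\<close>

lemma integral_vecpair_prod:
  fixes f :: "'n::finite \<Rightarrow> 'a::euclidean_space \<times> 'c::euclidean_space \<Rightarrow> 'b::{real_normed_field,banach,second_countable_topology}"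
  assumes int: "\<And>i. integrable lborel (f i)"
  shows "integrable lborel (\<lambda>p::('a^'n) \<times> ('c^'n). \<Prod>i\<in>UNIV. f i (fst p $ i, snd p $ i))"
    and "(\<integral>p. (\<Prod>i\<in>UNIV. f i (fst p $ i, snd p $ i)) \<partial>(lborel :: (('a^'n) \<times> ('c^'n)) measure)) = (\<Prod>i\<in>UNIV. \<integral>x. f i x \<partial>lborel)"
proof -
  have [measurable]: "f i \<in> borel_measurable borel" for i
    using borel_measurable_integrable[OF int[of i]] by simp
  have [measurable]: "(\<lambda>p::('a^'n) \<times> ('c^'n). (fst p $ i, snd p $ i)) \<in> borel_measurable borel" for i
    by (intro borel_measurable_continuous_onI continuous_intros)
  have m: "(\<lambda>p::('a^'n) \<times> ('c^'n). \<Prod>i\<in>UNIV. f i (fst p $ i, snd p $ i)) \<in> borel_measurable borel"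
    by (intro borel_measurable_prod) measurable
  show "integrable lborel (\<lambda>p::('a^'n) \<times> ('c^'n). \<Prod>i\<in>UNIV. f i (fst p $ i, snd p $ i))"
    by (subst lborel_vecpair, subst integrable_distr_eq[OF _ m])
       (auto intro!: PiL.product_integrable_prod int simp: vecpair_def)
  show "(\<integral>p. (\<Prod>i\<in>UNIV. f i (fst p $ i, snd p $ i)) \<partial>(lborel :: (('a^'n) \<times> ('c^'n)) measure)) = (\<Prod>i\<in>UNIV. \<integral>x. f i x \<partial>lborel)"
    by (subst lborel_vecpair, subst integral_distr[OF _ m])
       (auto intro!: PiL.product_integral_prod int simp: vecpair_def)
qed

section \<open>Maps that preserve Lebesgue measure\<close>

text \<open>For fixed \<open>y\<close> the map is a translation in \<open>x\<close>, so Tonelli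
  reduces the claim to translation invariance.\<close>

lemma distr_lborel_shear:
  fixes g :: "'b::euclidean_space \<Rightarrow> 'a::euclidean_space"
  assumes [measurable]: "g \<in> borel_measurable borel"
  shows "distr lborel borel (\<lambda>(x, y). (x + g y, y)) = (lborel :: ('a \<times> 'b) measure)"
proof (rule measure_eqI)
  fix A :: "('a \<times> 'b) set" assume "A \<in> sets (distr lborel borel (\<lambda>(x, y). (x + g y, y)))"
  then have [measurable]: "A \<in> sets borel" by simp
  then have [measurable]: "A \<in> sets (borel \<Otimes>\<^sub>M borel)" unfolding borel_prod .
  have m[measurable]: "(\<lambda>(x::'a, y). (x + g y, y)) \<in> borel_measurable borel"
    by (subst borel_prod[symmetric], subst borel_prod[symmetric]) measurable
  have m2: "(\<lambda>p. indicator A (fst p + g (snd p), snd p) :: ennreal) \<in> borel_measurable borel"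
    by (rule measurable_compose[OF m[unfolded case_prod_unfold] borel_measurable_indicator])
       (rule \<open>A \<in> sets borel\<close>)
  have tr: "(\<integral>\<^sup>+x. indicator A (x + g y, y) \<partial>lborel) = (\<integral>\<^sup>+x. indicator A (x, y) \<partial>lborel)" for y
  proof -
    have "(\<integral>\<^sup>+x. indicator A (x, y) \<partial>lborel) = (\<integral>\<^sup>+x. indicator A (x, y) \<partial>distr lborel borel ((+) (g y)))"
      by (simp add: lborel_distr_plus)
    also have "\<dots> = (\<integral>\<^sup>+x. indicator A (x + g y, y) \<partial>lborel)"
      by (subst nn_integral_distr) (auto simp: add.commute)
    finally show ?thesis by simp
  qed
  have "emeasure (distr lborel borel (\<lambda>(x, y). (x + g y, y))) A
      = (\<integral>\<^sup>+p. indicator A p \<partial>distr lborel borel (\<lambda>(x, y). (x + g y, y)))"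
    by simp
  also have "\<dots> = (\<integral>\<^sup>+p. indicator A (fst p + g (snd p), snd p) \<partial>(lborel \<Otimes>\<^sub>M lborel))"
    using m by (subst nn_integral_distr) (auto simp: case_prod_unfold lborel_prod)
  also have "\<dots> = (\<integral>\<^sup>+y. \<integral>\<^sup>+x. indicator A (x + g y, y) \<partial>lborel \<partial>lborel)"
    using m2 by (subst lborel_pair.nn_integral_snd[symmetric]) (auto simp: lborel_prod)
  also have "\<dots> = (\<integral>\<^sup>+p. indicator A p \<partial>(lborel \<Otimes>\<^sub>M lborel))"
    by (subst tr, subst lborel_pair.nn_integral_snd[symmetric]) (auto simp: lborel_prod)
  finally show "emeasure (distr lborel borel (\<lambda>(x, y). (x + g y, y))) A = emeasure lborel A"
    by (simp add: lborel_prod)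
qed simp

lemma distr_lborel_swap:
  "distr lborel borel prod.swap = (lborel :: ('a::euclidean_space \<times> 'b::euclidean_space) measure)"
proof -
  have "distr (lborel \<Otimes>\<^sub>M lborel) (lborel \<Otimes>\<^sub>M lborel) (\<lambda>(x, y). (y, x)) = (lborel \<Otimes>\<^sub>M lborel :: ('a \<times> 'b) measure)"
    by (rule lborel_pair.distr_pair_swap[symmetric])
  moreover have "(prod.swap :: 'b \<times> 'a \<Rightarrow> _) = (\<lambda>(x, y). (y, x))" by auto
  ultimately show ?thesis unfolding lborel_prod by (metis distr_cong sets_lborel)
qed

lemma distr_lborel_comp:
  fixes f :: "'a::euclidean_space \<Rightarrow> 'b::euclidean_space" and g :: "'b \<Rightarrow> 'c::euclidean_space"
  assumes "distr lborel borel f = lborel" "distr lborel borel g = lborel"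
    and "f \<in> borel_measurable borel" "g \<in> borel_measurable borel"
  shows "distr lborel borel (g \<circ> f) = lborel"
  using distr_distr[of g borel borel f lborel] assms by simp

lemma distr_lborel_Complex:
  "distr lborel borel (\<lambda>(x, y). Complex x y) = lborel"
proof (rule lborel_eqI[symmetric])
  have m: "(\<lambda>(x, y). Complex x y) \<in> borel_measurable borel"
    by (intro borel_measurable_continuous_onI) (auto simp: case_prod_unfold Complex_eq intro!: continuous_intros)
  fix l u :: complex assume le: "\<And>b. b \<in> Basis \<Longrightarrow> l \<bullet> b \<le> u \<bullet> b"
  then have le': "Re l \<le> Re u" "Im l \<le> Im u" using le[of 1] le[of \<i>] by (auto simp: Basis_complex_def)
  have "(\<lambda>(x, y). Complex x y) -` box l u = box (Re l, Im l) (Re u, Im u)"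
    by (auto simp: mem_box_pair) (auto simp: mem_box Basis_complex_def)
  then show "emeasure (distr lborel borel (\<lambda>(x, y). Complex x y)) (box l u) = ennreal (\<Prod>b\<in>Basis. (u - l) \<bullet> b)"
    using m le' by (subst emeasure_distr) (auto simp: emeasure_lborel_box_eq prod_Basis_pair Basis_complex_def Basis_prod_def
      Basis_real_def)
qed simp

lemma distr_lborel_Re_Im: "distr lborel borel (\<lambda>z. (Re z, Im z)) = lborel"
proof -
  have m: "(\<lambda>(x, y). Complex x y) \<in> borel_measurable borel"
    by (intro borel_measurable_continuous_onI) (auto simp: case_prod_unfold Complex_eq intro!: continuous_intros)
  have m2: "(\<lambda>z. (Re z, Im z)) \<in> borel_measurable borel"
    by (intro borel_measurable_continuous_onI continuous_intros)
  have "distr lborel borel (\<lambda>z. (Re z, Im z)) = distr lborel borel ((\<lambda>z. (Re z, Im z)) \<circ> (\<lambda>(x, y). Complex x y))"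
    using distr_distr[of "\<lambda>z. (Re z, Im z)" borel borel "\<lambda>(x, y). Complex x y" lborel] m m2
    by (simp add: distr_lborel_Complex)
  also have "(\<lambda>z. (Re z, Im z)) \<circ> (\<lambda>(x, y). Complex x y) = (\<lambda>x. x)" by auto
  finally show ?thesis by (simp cong: distr_cong) (metis distr_id2 sets_lborel)
qed

text \<open>Changes of variables are built from translations, shears and permutations of real
  coordinates, so that no determinant has to be computed.\<close>

definition lpres :: "('a::euclidean_space \<Rightarrow> 'b::euclidean_space) \<Rightarrow> bool" where
  "lpres f \<longleftrightarrow> f \<in> borel_measurable borel \<and> distr lborel borel f = lborel"

lemma lpres_comp: "lpres f \<Longrightarrow> lpres g \<Longrightarrow> lpres (\<lambda>x. g (f x))"
  unfolding lpres_def using distr_lborel_comp[of f g] by (auto simp: comp_def)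

lemma lpres_integral:
  fixes g :: "_ \<Rightarrow> 'c::{banach,second_countable_topology}"
  assumes "lpres f" "g \<in> borel_measurable borel"
  shows "(\<integral>x. g (f x) \<partial>lborel) = (\<integral>x. g x \<partial>lborel)"
  using assms integral_distr[of f lborel borel g] by (simp add: lpres_def)

lemma lpres_integrable_iff:
  fixes g :: "_ \<Rightarrow> 'c::{banach,second_countable_topology}"
  assumes "lpres f" "g \<in> borel_measurable borel"
  shows "integrable lborel (\<lambda>x. g (f x)) \<longleftrightarrow> integrable lborel g"
  using assms integrable_distr_eq[of f lborel borel g] by (simp add: lpres_def)

lemma lpres_nn_integral:
  assumes "lpres f" "g \<in> borel_measurable borel"
  shows "(\<integral>\<^sup>+x. g (f x) \<partial>lborel) = (\<integral>\<^sup>+x. g x \<partial>lborel)"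
  using assms nn_integral_distr[of f lborel borel g] by (simp add: lpres_def)

lemma lpres_shear_fst:
  fixes g :: "'b::euclidean_space \<Rightarrow> 'a::euclidean_space"
  assumes [measurable]: "g \<in> borel_measurable borel"
  shows "lpres (\<lambda>(x, y). (x + g y, y))"
  unfolding lpres_def using distr_lborel_shear[OF assms]
  by (simp, subst borel_prod[symmetric], subst borel_prod[symmetric]) measurable

lemma lpres_swap: "lpres (prod.swap :: 'a::euclidean_space \<times> 'b::euclidean_space \<Rightarrow> _)"
  unfolding lpres_def using distr_lborel_swap
  by (auto intro!: borel_measurable_continuous_onI continuous_intros continuous_on_swap)

lemma lpres_shear_snd:
  fixes g :: "'a::euclidean_space \<Rightarrow> 'b::euclidean_space"
  assumes "g \<in> borel_measurable borel"
  shows "lpres (\<lambda>(x, y). (x, y + g x))"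
proof -
  have "lpres (\<lambda>p. prod.swap (case prod.swap p of (x, y) \<Rightarrow> (x + g y, y)))"
    by (intro lpres_comp[OF _ lpres_swap] lpres_comp[OF lpres_swap lpres_shear_fst] assms)
  moreover have "(\<lambda>p. prod.swap (case prod.swap p of (x, y) \<Rightarrow> (x + g y, y))) = (\<lambda>(x, y). (x, y + g x))"
    by auto
  ultimately show ?thesis by simp
qed

lemma lpres_plus: "lpres (\<lambda>x. x + (c::'a::euclidean_space))"
  unfolding lpres_def using lborel_distr_plus[of c] by (simp add: add.commute[of _ c])

lemma lpres_Complex: "lpres (\<lambda>(x, y). Complex x y)"
  unfolding lpres_def using distr_lborel_Complex
  by (auto simp: case_prod_unfold Complex_eq intro!: borel_measurable_continuous_onI continuous_intros)

lemma lpres_Re_Im: "lpres (\<lambda>z. (Re z, Im z))"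
  unfolding lpres_def using distr_lborel_Re_Im
  by (auto intro!: borel_measurable_continuous_onI continuous_intros)

lemma lpres_map_prod:
  assumes "lpres f" "lpres g"
  shows "lpres (\<lambda>(x, y). (f x, g y))"
proof -
  have [measurable]: "f \<in> borel_measurable borel" "g \<in> borel_measurable borel"
    using assms by (auto simp: lpres_def)
  have m: "(\<lambda>(x, y). (f x, g y)) \<in> borel_measurable borel"
    by (subst borel_prod[symmetric], subst borel_prod[symmetric]) measurable
  have "distr lborel borel f \<Otimes>\<^sub>M distr lborel borel g
      = distr (lborel \<Otimes>\<^sub>M lborel) (borel \<Otimes>\<^sub>M borel) (\<lambda>(x, y). (f x, g y))"
    by (rule pair_measure_distr) (use assms in \<open>auto simp: lpres_def sigma_finite_lborel\<close>)
  then have "distr lborel borel (\<lambda>(x, y). (f x, g y)) = lborel"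
    using assms by (simp add: lpres_def lborel_prod borel_prod)
  with m show ?thesis by (simp add: lpres_def)
qed

text \<open>A map applied at every index preserves the product measure: it suffices to compare
  measurable rectangles, where both sides are products over the index.\<close>

lemma lpres_vecpair:
  fixes f :: "'a::euclidean_space \<times> 'b::euclidean_space \<Rightarrow> 'c::euclidean_space \<times> 'd::euclidean_space"
  assumes "lpres f"
  shows "lpres (\<lambda>p :: ('a ^ 'n::finite) \<times> ('b ^ 'n).
           (\<chi> i. fst (f (fst p $ i, snd p $ i)), \<chi> i. snd (f (fst p $ i, snd p $ i))))"
proof -
  let ?P = "PiM UNIV (\<lambda>_::'n. lborel :: ('a \<times> 'b) measure)"
  let ?Q = "PiM UNIV (\<lambda>_::'n. lborel :: ('c \<times> 'd) measure)"
  let ?T = "\<lambda>p :: ('a ^ 'n::finite) \<times> ('b ^ 'n).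
           (\<chi> i. fst (f (fst p $ i, snd p $ i)), \<chi> i. snd (f (fst p $ i, snd p $ i)))"
  have [measurable]: "f \<in> borel_measurable borel" and df: "distr lborel borel f = lborel"
    using assms by (auto simp: lpres_def)
  have comp[measurable]: "(\<lambda>w. w i) \<in> ?P \<rightarrow>\<^sub>M borel" for i
    using measurable_component_singleton[of i UNIV "\<lambda>_. lborel :: ('a\<times>'b) measure"] by simp
  have m0: "(\<lambda>w i. f (w i)) \<in> ?P \<rightarrow>\<^sub>M ?Q"
  proof (rule measurable_PiM_single')
    show "(\<lambda>w. f (w i)) \<in> ?P \<rightarrow>\<^sub>M lborel" for i by simp
  qed auto
  have d: "distr ?P ?Q (\<lambda>w i. f (w i)) = ?Q"
  proof (rule PiL.PiM_eqI)
    fix A :: "'n \<Rightarrow> ('c \<times> 'd) set" assume A: "\<And>i. i \<in> UNIV \<Longrightarrow> A i \<in> sets lborel"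
    have "emeasure (distr ?P ?Q (\<lambda>w i. f (w i))) (Pi\<^sub>E UNIV A) = emeasure ?P (Pi\<^sub>E UNIV (\<lambda>i. f -` A i))"
    proof (subst emeasure_distr[OF m0])
      show "Pi\<^sub>E UNIV A \<in> sets ?Q" using A by (intro sets_PiM_I_finite) auto
      have "(\<lambda>w i. f (w i)) -` Pi\<^sub>E UNIV A \<inter> space ?P = Pi\<^sub>E UNIV (\<lambda>i. f -` A i)"
        by (auto simp: space_PiM PiE_UNIV_domain)
      then show "emeasure ?P ((\<lambda>w i. f (w i)) -` Pi\<^sub>E UNIV A \<inter> space ?P) = emeasure ?P (Pi\<^sub>E UNIV (\<lambda>i. f -` A i))"
        by simp
    qed
    also have "\<dots> = (\<Prod>i\<in>UNIV. emeasure lborel (f -` A i))"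
      using A measurable_sets[OF \<open>f \<in> borel_measurable borel\<close>]
      by (subst PiL.emeasure_PiM) auto
    also have "\<dots> = (\<Prod>i\<in>UNIV. emeasure (distr lborel borel f) (A i))"
      using A by (subst emeasure_distr) auto
    finally show "emeasure (distr ?P ?Q (\<lambda>w i. f (w i))) (Pi\<^sub>E UNIV A) = (\<Prod>i\<in>UNIV. emeasure lborel (A i))"
      by (simp add: df)
  qed auto
  have [measurable]: "(\<lambda>p::('a^'n) \<times> ('b^'n). (fst p $ i, snd p $ i)) \<in> borel_measurable borel" for i
    by (intro borel_measurable_continuous_onI continuous_intros)
  have fs: "(\<lambda>p::'c \<times> 'd. fst p) \<in> borel_measurable borel" "(\<lambda>p::'c \<times> 'd. snd p) \<in> borel_measurable borel"
    by (intro borel_measurable_continuous_onI continuous_intros)+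
  have "(\<lambda>p::('a^'n) \<times> ('b^'n). fst (f (fst p $ i, snd p $ i))) \<in> borel_measurable borel"
       "(\<lambda>p::('a^'n) \<times> ('b^'n). snd (f (fst p $ i, snd p $ i))) \<in> borel_measurable borel" for i
    by (rule measurable_compose[OF _ fs(1)] measurable_compose[OF _ fs(2)]; measurable)+
  then have mT: "?T \<in> borel_measurable borel"
    by (subst (2) borel_prod[symmetric]) (intro measurable_Pair measurable_vec)
  have "distr lborel borel ?T = distr (distr ?P borel vecpair) borel ?T"
    by (simp add: lborel_vecpair)
  also have "\<dots> = distr ?P borel (?T \<circ> vecpair)"
    by (rule distr_distr) (use mT in auto)
  also have "?T \<circ> vecpair = vecpair \<circ> (\<lambda>w i. f (w i))"
    by (auto simp: vecpair_def fun_eq_iff)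
  also have "distr ?P borel (vecpair \<circ> (\<lambda>w i. f (w i))) = distr (distr ?P ?Q (\<lambda>w i. f (w i))) borel vecpair"
    by (rule distr_distr[symmetric]) (use m0 in auto)
  also have "\<dots> = lborel"
    unfolding d by (rule lborel_vecpair[symmetric])
  finally show ?thesis using mT by (simp add: lpres_def)
qed

text \<open>A rotation by \<theta> is a product of three shears with parameters - tan (\<theta>/2),
  sin \<theta>, - tan (\<theta>/2). The tangent is infinite for the half turn, hence the exclusion
  of -1.\<close>

lemma lpres_cmult_aux:
  assumes c: "norm c = 1" "c \<noteq> -1"
  shows "lpres (\<lambda>z::complex. c * z)"
proof -
  define p q where "p = Re c" and "q = Im c"
  have pq: "p\<^sup>2 + q\<^sup>2 = 1"
    using c(1) by (simp add: p_def q_def cmod_def)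
  have p1: "1 + p \<noteq> 0"
  proof
    assume "1 + p = 0"
    then have "p = -1" by simp
    moreover with pq have "q = 0" by simp
    ultimately show False using c(2) by (simp add: p_def q_def complex_eq_iff)
  qed
  define \<alpha> where "\<alpha> = - q / (1 + p)"
  have qq: "q * q = (1 - p) * (1 + p)" using pq by (simp add: power2_eq_square algebra_simps)
  have \<alpha>q: "1 + \<alpha> * q = p"
  proof -
    have "\<alpha> * q = - (q * q) / (1 + p)" by (simp add: \<alpha>_def)
    also have "\<dots> = p - 1" using p1 unfolding qq by (simp add: field_simps)
    finally show ?thesis by simp
  qed
  have \<alpha>p: "\<alpha> * (1 + p) = - q" using p1 by (simp add: \<alpha>_def)
  let ?S = "\<lambda>(x::real, y::real). (x + \<alpha> * y, y)" and ?S' = "\<lambda>(x::real, y::real). (x, y + q * x)"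
  have S: "lpres ?S" "lpres ?S'"
    by (intro lpres_shear_fst lpres_shear_snd; measurable)+
  have "lpres (\<lambda>z. (\<lambda>(x, y). Complex x y) (?S (?S' (?S (Re z, Im z)))))"
    by (intro lpres_comp[OF _ lpres_Complex] lpres_comp[OF _ S(1)] lpres_comp[OF _ S(2)] lpres_Re_Im)
  moreover have "(\<lambda>(x, y). Complex x y) (?S (?S' (?S (Re z, Im z)))) = c * z" for z
  proof -
    have 1: "Im z + q * (Re z + \<alpha> * Im z) = q * Re z + p * Im z"
      using \<alpha>q by (simp add: algebra_simps) (metis distrib_right mult.assoc mult.commute mult_1)
    have 2: "Re z + \<alpha> * Im z + \<alpha> * (q * Re z + p * Im z) = p * Re z - q * Im z"
    proof -
      have "Re z + \<alpha> * Im z + \<alpha> * (q * Re z + p * Im z) = (1 + \<alpha> * q) * Re z + \<alpha> * (1 + p) * Im z"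
        by (simp add: algebra_simps)
      then show ?thesis unfolding \<alpha>q \<alpha>p by simp
    qed
    have "(\<lambda>(x, y). Complex x y) (?S (?S' (?S (Re z, Im z))))
        = Complex (Re z + \<alpha> * Im z + \<alpha> * (q * Re z + p * Im z)) (q * Re z + p * Im z)"
      by (simp only: 1 prod.case)
    also have "\<dots> = c * z" unfolding 2 by (simp add: complex_eq_iff p_def q_def)
    finally show ?thesis .
  qed
  ultimately show ?thesis by simp
qed

text \<open>Rotate twice by a square root; the principal root has nonnegative real part and so
  avoids the excluded value -1.\<close>

lemma lpres_cmult:
  assumes "norm c = 1"
  shows "lpres (\<lambda>z::complex. c * z)"
proof -
  have n: "norm (csqrt c) = 1"
    using assms by (metis norm_csqrt real_sqrt_one)
  have "csqrt c \<noteq> -1"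
  proof
    assume eq: "csqrt c = -1"
    have "0 \<le> Re (-1 :: complex)" using Re_csqrt[of c] unfolding eq .
    then show False by simp
  qed
  from lpres_comp[OF lpres_cmult_aux[OF n this] lpres_cmult_aux[OF n this]]
  show ?thesis by (simp add: mult.assoc[symmetric] power2_eq_square[symmetric])
qed

lemma lpres_scalar:
  assumes "norm c = 1"
  shows "lpres (\<lambda>p :: (complex ^ 'n::finite) \<times> (complex ^ 'n). (c *s fst p, c *s snd p))"
proof -
  have "lpres (\<lambda>(x, y). (c * x, c * y))"
    by (intro lpres_map_prod lpres_cmult assms)
  from lpres_vecpair[OF this, where 'n='n] show ?thesis
    by (simp add: vector_scalar_mult_def)
qed

section \<open>Gaussian moments in the plane\<close>

text \<open>The disc of radius sqrt a has area pi * a, so the squared modulus has constant density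
  pi on the half line. This takes the place of polar coordinates.\<close>

lemma distr_lborel_cmod_square:
  "distr lborel borel (\<lambda>z::complex. (cmod z)\<^sup>2) = density lborel (\<lambda>r. ennreal pi * indicator {0..} r)"
proof (rule measure_eqI_generator_eq)
  let ?E = "range (\<lambda>a::real. {..a})"
  show "Int_stable ?E"
    by (auto simp: Int_stable_def intro!: image_eqI)
  show "sets (distr lborel borel (\<lambda>z::complex. (cmod z)\<^sup>2)) = sigma_sets UNIV ?E"
    "sets (density lborel (\<lambda>r. ennreal pi * indicator {0..} r)) = sigma_sets UNIV ?E"
    by (simp_all add: borel_eq_atMost)
  have m[measurable]: "(\<lambda>z::complex. (cmod z)\<^sup>2) \<in> borel_measurable borel"
    by (intro borel_measurable_continuous_onI continuous_intros)
  have 1: "emeasure (distr lborel borel (\<lambda>z::complex. (cmod z)\<^sup>2)) {..a} = ennreal (pi * max 0 a)" for a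
  proof (cases "a \<ge> 0")
    case True
    have "(\<lambda>z::complex. (cmod z)\<^sup>2) -` {..a} = cball 0 (sqrt a)"
      using True by (auto simp: real_le_rsqrt sqrt_ge_absD)
    then show ?thesis using True
      by (subst emeasure_distr) (auto simp: emeasure_cball unit_ball_vol_2 eval_unit_ball_vol)
  next
    case False
    then have "(\<lambda>z::complex. (cmod z)\<^sup>2) -` {..a} = {}"
      by (auto simp: not_le) (meson not_le order_trans zero_le_power2)
    then show ?thesis using False by (subst emeasure_distr) auto
  qed
  have 2: "emeasure (density lborel (\<lambda>r. ennreal pi * indicator {0..} r)) {..a} = ennreal (pi * max 0 a)" for a
  proof -
    have "emeasure (density lborel (\<lambda>r. ennreal pi * indicator {0..} r)) {..a}
        = (\<integral>\<^sup>+r. ennreal pi * indicator {0..a} r \<partial>lborel)"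
      by (subst emeasure_density) (auto intro!: nn_integral_cong split: split_indicator)
    also have "\<dots> = ennreal (pi * max 0 a)"
      by (subst nn_integral_cmult) (auto simp: ennreal_mult max_def)
    finally show ?thesis .
  qed
  show "emeasure (distr lborel borel (\<lambda>z::complex. (cmod z)\<^sup>2)) X = emeasure (density lborel (\<lambda>r. ennreal pi * indicator {0..} r)) X"
    if "X \<in> ?E" for X using that 1 2 by auto
  let ?A = "\<lambda>n::nat. {..real n}"
  show "range ?A \<subseteq> ?E" "(\<Union>i. ?A i) = UNIV"
    by (auto simp: real_arch_simple)
  show "emeasure (distr lborel borel (\<lambda>z::complex. (cmod z)\<^sup>2)) (?A i) \<noteq> \<infinity>" for i
    unfolding 1 by simp
qed auto

text \<open>In the variable r = |z|^2 this is pi times the Gamma integral of r^j exp (- \<gamma>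
  r).\<close>

lemma nn_integral_radial_moment:
  assumes "\<gamma> > 0"
  shows "(\<integral>\<^sup>+z. ennreal (cmod z ^ (2 * j) * exp (- \<gamma> * (cmod z)\<^sup>2)) \<partial>(lborel :: (complex) measure)) = ennreal (pi * fact j / \<gamma> ^ Suc j)"
proof -
  have m[measurable]: "(\<lambda>z::complex. (cmod z)\<^sup>2) \<in> borel_measurable borel"
    by (intro borel_measurable_continuous_onI continuous_intros)
  have "(\<integral>\<^sup>+z. ennreal (cmod z ^ (2 * j) * exp (- \<gamma> * (cmod z)\<^sup>2)) \<partial>(lborel :: (complex) measure))
     = (\<integral>\<^sup>+r. ennreal (r ^ j * exp (- \<gamma> * r)) \<partial>(distr lborel borel (\<lambda>z::complex. (cmod z)\<^sup>2)))"
    by (subst nn_integral_distr) (auto simp: power_mult)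
  also have "\<dots> = (\<integral>\<^sup>+r. ennreal pi * (ennreal (r ^ j * exp (- \<gamma> * r)) * indicator {0..} r) \<partial>lborel)"
    unfolding distr_lborel_cmod_square by (subst nn_integral_density) (auto intro!: nn_integral_cong split: split_indicator)
  also have "\<dots> = ennreal pi * (\<integral>\<^sup>+r. (ennreal (r ^ j * exp (- \<gamma> * r)) * indicator {0..} r) \<partial>lborel)"
    by (rule nn_integral_cmult) auto
  also have "(\<integral>\<^sup>+r. (ennreal (r ^ j * exp (- \<gamma> * r)) * indicator {0..} r) \<partial>lborel)
     = ennreal (1 / \<gamma>) * (\<integral>\<^sup>+r. ennreal ((r / \<gamma>) ^ j * exp (- r)) * indicator {0..} r \<partial>lborel)"
    using assms by (subst nn_integral_real_affine[where c="1 / \<gamma>" and t=0])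
      (auto intro!: arg_cong2[where f="(*)"] nn_integral_cong split: split_indicator simp: zero_le_divide_iff)
  also have "(\<integral>\<^sup>+r. ennreal ((r / \<gamma>) ^ j * exp (- r)) * indicator {0..} r \<partial>lborel)
     = (\<integral>\<^sup>+r. ennreal (1 / \<gamma> ^ j) * (ennreal (r ^ j * exp (- r)) * indicator {0..} r) \<partial>lborel)"
    using assms by (intro nn_integral_cong)
      (auto split: split_indicator simp: ennreal_mult[symmetric] power_divide)
  also have "\<dots> = ennreal (1 / \<gamma> ^ j) * real_of_nat (fact j)"
    by (subst nn_integral_cmult) (auto simp: nn_intergal_power_times_exp_Ici)
  finally show ?thesis using assms
    by (simp add: ennreal_mult[symmetric] flip: ennreal_of_nat_eq_real_of_nat)
qed

lemma integrable_radial_moment: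
  assumes "\<gamma> > 0"
  shows "integrable lborel (\<lambda>z::complex. cmod z ^ (2 * j) * exp (- \<gamma> * (cmod z)\<^sup>2))"
proof (rule integrableI_nonneg)
  show "(\<integral>\<^sup>+z. ennreal (cmod z ^ (2 * j) * exp (- \<gamma> * (cmod z)\<^sup>2)) \<partial>lborel) < \<infinity>"
    unfolding nn_integral_radial_moment[OF assms] by simp
qed (auto intro!: borel_measurable_continuous_onI continuous_intros)

lemma integrable_gauss_monomial:
  assumes "\<gamma> > 0"
  shows "integrable lborel (\<lambda>z::complex. z ^ j * cnj z ^ k * of_real (exp (- \<gamma> * (cmod z)\<^sup>2)))"
proof -
  note i = integrable_radial_moment[OF assms]
  show ?thesis
  proof (rule Bochner_Integration.integrable_bound[OF Bochner_Integration.integrable_add[OF i[of j] i[of k]]])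
    show "(\<lambda>z::complex. z ^ j * cnj z ^ k * of_real (exp (- \<gamma> * (cmod z)\<^sup>2))) \<in> borel_measurable lborel"
      by (auto intro!: borel_measurable_continuous_onI continuous_intros)
    have "cmod z ^ j * cmod z ^ k \<le> cmod z ^ (2 * j) + cmod z ^ (2 * k)" for z
    proof -
      have "2 * (cmod z ^ j * cmod z ^ k) \<le> cmod z ^ (2 * j) + cmod z ^ (2 * k)"
        using sum_squares_bound[of "cmod z ^ j" "cmod z ^ k"] by (simp add: power_mult[symmetric] mult_ac)
      moreover have "0 \<le> cmod z ^ j * cmod z ^ k" by simp
      ultimately show ?thesis by linarith
    qed
    then show "AE z in lborel. norm (z ^ j * cnj z ^ k * of_real (exp (- \<gamma> * (cmod z)\<^sup>2)))
        \<le> norm (cmod z ^ (2 * j) * exp (- \<gamma> * (cmod z)\<^sup>2) + cmod z ^ (2 * k) * exp (- \<gamma> * (cmod z)\<^sup>2))"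
      by (intro AE_I2) (simp add: norm_mult norm_power distrib_right[symmetric] mult_right_mono)
  qed
qed

lemma integral_gauss_monomial:
  assumes "\<gamma> > 0"
  shows "(\<integral>z. z ^ j * cnj z ^ k * of_real (exp (- \<gamma> * (cmod z)\<^sup>2)) \<partial>(lborel :: (complex) measure))
     = (if j = k then of_real (pi * fact j / \<gamma> ^ Suc j) else 0)"
proof (cases "j = k")
  case True
  have "(\<integral>z. z ^ j * cnj z ^ j * of_real (exp (- \<gamma> * (cmod z)\<^sup>2)) \<partial>(lborel :: (complex) measure))
     = (\<integral>z. of_real (cmod z ^ (2 * j) * exp (- \<gamma> * (cmod z)\<^sup>2)) \<partial>(lborel :: (complex) measure))"
    by (intro Bochner_Integration.integral_cong refl)
       (simp add: power_mult_distrib[symmetric] complex_norm_square[symmetric] power_mult)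
  also have "\<dots> = of_real (\<integral>z. (cmod z ^ (2 * j) * exp (- \<gamma> * (cmod z)\<^sup>2)) \<partial>(lborel :: (complex) measure))"
    by (rule integral_of_real[OF integrable_radial_moment[OF assms]])
  also have "(\<integral>z. (cmod z ^ (2 * j) * exp (- \<gamma> * (cmod z)\<^sup>2)) \<partial>(lborel :: (complex) measure)) = pi * fact j / \<gamma> ^ Suc j"
    using assms nn_integral_radial_moment[OF assms, of j]
    by (subst integral_eq_nn_integral) (auto intro!: borel_measurable_continuous_onI continuous_intros)
  finally show ?thesis using True by simp
next
  case False
  \<comment> \<open>Rotation by \<open>c\<close> multiplies the integrand by
    \<open>c ^ j * cnj c ^ k = -1\<close>, so the integral equals its own negative.\<close>
  define c where "c = cis (pi / (real j - real k))"
  have c1: "norm c = 1" by (simp add: c_def)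
  have "c ^ j * cnj c ^ k = cis (real j * (pi / (real j - real k)) - real k * (pi / (real j - real k)))"
    unfolding c_def cis_cnj Complex.DeMoivre cis_mult by (rule arg_cong[where f=cis]) simp
  also have "real j * (pi / (real j - real k)) - real k * (pi / (real j - real k)) = pi"
    by (subst left_diff_distrib[symmetric]) (use False in simp)
  finally have cc: "c ^ j * cnj c ^ k = -1" by simp
  let ?f = "\<lambda>z::complex. z ^ j * cnj z ^ k * of_real (exp (- \<gamma> * (cmod z)\<^sup>2))"
  have "integral\<^sup>L lborel ?f = (\<integral>z. ?f (c * z) \<partial>lborel)"
    by (rule lpres_integral[OF lpres_cmult[OF c1], symmetric])
       (auto intro!: borel_measurable_continuous_onI continuous_intros)
  also have "?f (c * z) = (c ^ j * cnj c ^ k) * ?f z" for z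
    by (simp add: power_mult_distrib norm_mult c1)
  then have "(\<integral>z. ?f (c * z) \<partial>lborel) = - integral\<^sup>L lborel ?f"
    by (simp add: cc)
  finally show ?thesis using False by (simp add: eq_neg_iff_add_eq_0)
qed

section \<open>Gaussian integrals and their Fourier transforms\<close>

lemma integrable_gauss_real: "s > 0 \<Longrightarrow> integrable lborel (\<lambda>x::real. exp (- s * x\<^sup>2))"
proof -
  assume s: "s > 0"
  let ?\<sigma> = "1 / sqrt (2 * s)"
  have "integrable lborel (\<lambda>x. sqrt (2 * pi * ?\<sigma>\<^sup>2) * normal_density 0 ?\<sigma> x)"
    using s by (intro integrable_mult_right integrable_normal_density) auto
  moreover have "sqrt (2 * pi * ?\<sigma>\<^sup>2) * normal_density 0 ?\<sigma> x = exp (- s * x\<^sup>2)" for x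
    using s by (simp add: normal_density_def power_divide field_simps)
  ultimately show ?thesis by simp
qed

lemma integrable_gauss:
  assumes s: "s > 0"
  shows "integrable lborel (\<lambda>x::'a::euclidean_space. exp (- s * (norm x)\<^sup>2))"
proof (rule integrableI_nonneg)
  have "(\<integral>\<^sup>+x. ennreal (exp (- s * (norm x)\<^sup>2)) \<partial>(lborel :: ('a) measure))
      = (\<integral>\<^sup>+x. (\<Prod>b\<in>Basis. ennreal (exp (- s * (x \<bullet> b)\<^sup>2))) \<partial>(lborel :: ('a) measure))"
  proof (intro nn_integral_cong)
    fix x :: 'a
    have "(norm x)\<^sup>2 = (\<Sum>b\<in>Basis. (x \<bullet> b)\<^sup>2)"
      unfolding power2_norm_eq_inner using euclidean_inner[of x x] by (simp add: power2_eq_square)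
    then show "ennreal (exp (- s * (norm x)\<^sup>2)) = (\<Prod>b\<in>Basis. ennreal (exp (- s * (x \<bullet> b)\<^sup>2)))"
      by (simp add: prod_ennreal exp_sum[symmetric] sum_distrib_left sum_negf)
  qed
  also have "\<dots> = (\<Prod>b\<in>(Basis::'a set). \<integral>\<^sup>+x. ennreal (exp (- s * x\<^sup>2)) \<partial>(lborel :: (real) measure))"
    by (rule nn_integral_lborel_prod) auto
  also have "\<dots> < \<infinity>"
    using integrable_gauss_real[OF s]
    by (simp add: integrable_iff_bounded power_less_top_ennreal)
  finally show "(\<integral>\<^sup>+x. ennreal (exp (- s * (norm x)\<^sup>2)) \<partial>(lborel :: ('a) measure)) < \<infinity>" .
qed (auto intro!: borel_measurable_continuous_onI continuous_intros)

text \<open>Half of the Gaussian absorbs the linear term, by completing the square.\<close>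

lemma integrable_gauss_linear:
  assumes s: "s > 0"
  shows "integrable lborel (\<lambda>x::'a::euclidean_space. exp (L * norm x - s * (norm x)\<^sup>2))"
proof (rule Bochner_Integration.integrable_bound)
  show "integrable lborel (\<lambda>x::'a. exp (L\<^sup>2 / (2 * s)) * exp (- (s / 2) * (norm x)\<^sup>2))"
    using s by (intro integrable_mult_right integrable_gauss) auto
  have "L * r - s * r\<^sup>2 \<le> L\<^sup>2 / (2 * s) + (- (s / 2) * r\<^sup>2)" for r
  proof -
    have "0 \<le> (s * r - L)\<^sup>2 / (2 * s)" using s by simp
    also have "\<dots> = s / 2 * r\<^sup>2 - L * r + L\<^sup>2 / (2 * s)"
      using s by (simp add: field_simps power2_eq_square)
    finally show ?thesis by (simp add: algebra_simps)
  qed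
  then show "AE x in lborel. norm (exp (L * norm x - s * (norm (x::'a))\<^sup>2)) \<le> norm (exp (L\<^sup>2 / (2 * s)) * exp (- (s / 2) * (norm x)\<^sup>2))"
    by (intro AE_I2) (simp add: exp_add[symmetric])
qed (auto intro!: borel_measurable_continuous_onI continuous_intros)

text \<open>The real part of \<open>z\<close> is removed by moving the centre of the Gaussian; what
  the imaginary part contributes is the characteristic function of the standard normal
  distribution.\<close>

lemma gauss_fourier:
  fixes z :: complex
  assumes s: "s > 0"
  shows "integrable lborel (\<lambda>\<xi>::real. exp (z * of_real \<xi> - of_real (s * \<xi>\<^sup>2)))"
    and "(\<integral>\<xi>. exp (z * of_real \<xi> - of_real (s * \<xi>\<^sup>2)) \<partial>(lborel :: (real) measure)) = of_real (sqrt (pi / s)) * exp (z\<^sup>2 / (4 * of_real s))"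
proof -
  let ?f = "\<lambda>\<xi>::real. exp (z * of_real \<xi> - of_real (s * \<xi>\<^sup>2))"
  have m: "?f \<in> borel_measurable borel"
    by (intro borel_measurable_continuous_onI continuous_intros)
  show "integrable lborel ?f"
  proof (rule Bochner_Integration.integrable_bound[OF integrable_gauss_linear[OF s, of "norm z"]])
    have "Re z * x \<le> norm z * \<bar>x\<bar>" for x
    proof -
      have "Re z * x \<le> \<bar>Re z\<bar> * \<bar>x\<bar>" by (metis abs_ge_self abs_mult)
      also have "\<dots> \<le> norm z * \<bar>x\<bar>" by (intro mult_right_mono abs_Re_le_cmod) auto
      finally show ?thesis .
    qed
    then show "AE x in lborel. norm (?f x) \<le> norm (exp (norm z * norm x - s * (norm x)\<^sup>2))"
      by (intro AE_I2) simp
  qed (use m in simp)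
  define p q where "p = Re z" and "q = Im z"
  have z: "z = Complex p q" by (simp add: p_def q_def)
  \<comment> \<open>\<open>c\<close> scales the Gaussian to variance one, and \<open>a\<close> is
    its centre, the maximum point of p \<xi> - s \<xi>^2.\<close>
  define c where "c = 1 / sqrt (2 * s)"
  define a where "a = p / (2 * s)"
  have c: "c > 0" "c\<^sup>2 = 1 / (2 * s)" using s by (auto simp: c_def power_divide)
  have ex: "z * of_real (a + c * x) - of_real (s * (a + c * x)\<^sup>2)
      = of_real (p\<^sup>2 / (4 * s)) + \<i> * of_real (p * q / (2 * s)) + (\<i> * of_real (q * c * x) - of_real (x\<^sup>2 / 2))" for x
  proof -
    have "p * (a + c * x) - s * (a + c * x)\<^sup>2 = p\<^sup>2 / (4 * s) - x\<^sup>2 / 2"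
    proof -
      have "s * (a + c * x)\<^sup>2 = s * a\<^sup>2 + 2 * s * a * c * x + s * c\<^sup>2 * x\<^sup>2"
        by (simp add: power2_eq_square algebra_simps)
      also have "\<dots> = p\<^sup>2 / (4 * s) + p * c * x + x\<^sup>2 / 2"
        using s unfolding c(2) by (simp add: a_def field_simps power2_eq_square)
      finally have "s * (a + c * x)\<^sup>2 = p\<^sup>2 / (4 * s) + p * c * x + x\<^sup>2 / 2" .
      moreover have "p * (a + c * x) = p\<^sup>2 / (2 * s) + p * c * x"
        using s by (simp add: a_def field_simps power2_eq_square)
      moreover have "p\<^sup>2 / (2 * s) = 2 * (p\<^sup>2 / (4 * s))" by simp
      ultimately show ?thesis by linarith
    qed
    moreover have "q * (a + c * x) = p * q / (2 * s) + q * c * x"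
      using s by (simp add: a_def field_simps)
    ultimately show ?thesis
      by (simp add: z complex_eq_iff del: of_real_add of_real_mult of_real_power of_real_divide)
  qed
  have std: "(\<integral>x. exp (\<i> * of_real (q * c * x) - of_real (x\<^sup>2 / 2)) \<partial>(lborel :: (real) measure)) = of_real (sqrt (2 * pi)) * of_real (exp (- (q * c)\<^sup>2 / 2))"
  proof -
    have h: "exp (w - of_real r) = exp w * of_real (exp (- r))" for w :: complex and r
      by (simp add: exp_diff exp_minus exp_of_real divide_inverse)
    have "of_real (exp (- (q * c)\<^sup>2 / 2)) = char std_normal_distribution (q * c)"
      by (simp add: char_std_normal_distribution)
    also have "\<dots> = (\<integral>x. std_normal_density x *\<^sub>R exp (\<i> * of_real (q * c * x)) \<partial>lborel)"
      unfolding char_def by (subst integral_density) (auto simp: normal_density_nonneg)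
    also have "\<dots> = (\<integral>x. of_real (1 / sqrt (2 * pi)) * exp (\<i> * of_real (q * c * x) - of_real (x\<^sup>2 / 2)) \<partial>lborel)"
      by (intro Bochner_Integration.integral_cong refl)
         (simp only: std_normal_density_def scaleR_conv_of_real h, simp)
    also have "\<dots> = of_real (1 / sqrt (2 * pi)) * (\<integral>x. exp (\<i> * of_real (q * c * x) - of_real (x\<^sup>2 / 2)) \<partial>(lborel :: (real) measure))"
      by simp
    finally show ?thesis by (simp add: field_simps)
  qed
  have "(\<integral>\<xi>. ?f \<xi> \<partial>lborel) = \<bar>c\<bar> *\<^sub>R (\<integral>x. ?f (a + c * x) \<partial>lborel)"
    by (rule lborel_integral_real_affine) (use c in auto)
  also have "(\<integral>x. ?f (a + c * x) \<partial>lborel)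
      = (\<integral>x. exp (of_real (p\<^sup>2 / (4 * s)) + \<i> * of_real (p * q / (2 * s))) * exp (\<i> * of_real (q * c * x) - of_real (x\<^sup>2 / 2)) \<partial>lborel)"
    unfolding ex exp_add ..
  also have "\<dots> = exp (of_real (p\<^sup>2 / (4 * s)) + \<i> * of_real (p * q / (2 * s))) * (of_real (sqrt (2 * pi)) * of_real (exp (- (q * c)\<^sup>2 / 2)))"
    unfolding std[symmetric] by simp
  also have "\<bar>c\<bar> *\<^sub>R \<dots> = of_real (c * sqrt (2 * pi)) * exp (of_real (p\<^sup>2 / (4 * s)) + \<i> * of_real (p * q / (2 * s)) + of_real (- (q * c)\<^sup>2 / 2))"
    unfolding exp_add[of _ "of_real (- (q * c)\<^sup>2 / 2)"] exp_of_real scaleR_conv_of_real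
        abs_of_pos[OF c(1)] of_real_mult by (simp only: mult_ac)
  also have "c * sqrt (2 * pi) = sqrt (pi / s)"
    using s by (simp add: c_def real_sqrt_mult real_sqrt_divide)
  also have "of_real (p\<^sup>2 / (4 * s)) + \<i> * of_real (p * q / (2 * s)) + of_real (- (q * c)\<^sup>2 / 2) = z\<^sup>2 / (4 * of_real s)"
  proof -
    have "- (q * c)\<^sup>2 / 2 = - q\<^sup>2 / (4 * s)" by (simp add: power_mult_distrib c(2))
    then show ?thesis using s
      by (simp add: z complex_eq_iff power2_eq_square Re_divide Im_divide field_simps)
  qed
  finally show "(\<integral>\<xi>. ?f \<xi> \<partial>lborel) = of_real (sqrt (pi / s)) * exp (z\<^sup>2 / (4 * of_real s))" .
qed

section \<open>Polynomials orthogonal for a Gaussian in the plane\<close>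

text \<open>The polynomial part of a one-dimensional special Hermite function, in the variables
  \<open>a = u + i x\<close> and \<open>b = u - i x\<close>; the recursion is what integration by parts gives.\<close>

fun PP :: "nat \<Rightarrow> nat \<Rightarrow> complex \<Rightarrow> complex \<Rightarrow> complex" where
  "PP 0 k a b = (- b) ^ k"
| "PP (Suc j) k a b = a * PP j k a b + 2 * of_nat k * PP j (k - 1) a b"

text \<open>The mirror image of the defining recursion: that one raises the first index through
  \<open>a\<close>, this one raises the second through \<open>- b\<close>. Together they make the
  span of the \<open>PP\<close> stable under multiplication by both variables.\<close>

lemma PP_mult_b: "- b * PP j k a b = PP j (Suc k) a b - 2 * of_nat j * PP (j - 1) k a b"
proof (induction j arbitrary: k)
  case (Suc j)
  \<comment> \<open>At \<open>k = 0\<close> the truncated \<open>k - 1\<close> is harmless because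
    its coefficient vanishes.\<close>
  have 1: "2 * of_nat k * (- b * PP j (k - 1) a b) = 2 * of_nat k * (PP j k a b - 2 * of_nat j * PP (j - 1) (k - 1) a b)"
  proof (cases "k = 0")
    case False
    then have "Suc (k - 1) = k" by simp
    then have "- b * PP j (k - 1) a b = PP j k a b - 2 * of_nat j * PP (j - 1) (k - 1) a b"
      using Suc.IH[of "k - 1"] by metis
    then show ?thesis by (rule arg_cong)
  qed simp
  have 2: "of_nat j * (a * PP (j - 1) k a b + 2 * of_nat k * PP (j - 1) (k - 1) a b) = of_nat j * PP j k a b"
    by (cases j) simp_all
  have "- b * PP (Suc j) k a b = a * (- b * PP j k a b) + 2 * of_nat k * (- b * PP j (k - 1) a b)"
    by (simp add: algebra_simps)
  also have "\<dots> = a * PP j (Suc k) a b + 2 * of_nat k * PP j k a b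
      - 2 * (of_nat j * (a * PP (j - 1) k a b + 2 * of_nat k * PP (j - 1) (k - 1) a b))"
    unfolding 1 unfolding Suc.IH by (simp add: algebra_simps)
  also have "\<dots> = PP (Suc j) (Suc k) a b - 2 * of_nat (Suc j) * PP (Suc j - 1) k a b"
    unfolding 2 by (simp add: algebra_simps)
  finally show ?case .
qed simp

text \<open>Differentiation in \<open>b\<close> sends \<open>PP j k\<close> to - k times
  \<open>PP j (k - 1)\<close>, as it does for powers of \<open>- b\<close>; the formula is the
  resulting Taylor expansion.\<close>

lemma PP_shift: "PP j k a (b + s) = (\<Sum>l\<le>k. of_nat (k choose l) * (- s) ^ l * PP j (k - l) a b)"
proof (induction j arbitrary: k)
  case 0
  have "(- s + - b) ^ k = (\<Sum>l\<le>k. of_nat (k choose l) * (- s) ^ l * (- b) ^ (k - l))"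
    by (rule binomial_ring)
  then show ?case by (simp add: algebra_simps)
next
  case (Suc j)
  have "2 * of_nat k * PP j (k - 1) a (b + s)
      = (\<Sum>l\<le>k. of_nat (k choose l) * (- s) ^ l * (2 * of_nat (k - l) * PP j (k - l - 1) a b))"
  proof (cases k)
    case (Suc k')
    have "2 * of_nat k * PP j (k - 1) a (b + s)
       = (\<Sum>l\<le>k'. of_nat (Suc k' * (k' choose l)) * (- s) ^ l * (2 * PP j (k' - l) a b))"
      unfolding Suc.IH by (simp add: Suc sum_distrib_left algebra_simps)
    also have "\<dots> = (\<Sum>l\<le>k'. of_nat (k choose l) * (- s) ^ l * (2 * of_nat (k - l) * PP j (k - l - 1) a b))"
    proof (intro sum.cong refl)
      fix l assume l: "l \<in> {..k'}"
      have "(Suc k' choose l) * (Suc k' - l) = Suc k' * (k' choose l)"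
        using l binomial_absorb_comp[of "Suc k'" l] by (simp add: mult.commute)
      then have e: "of_nat (Suc k' * (k' choose l)) = (of_nat (k choose l) * of_nat (k - l) :: complex)"
        unfolding Suc of_nat_mult[symmetric] by simp
      have "k - l - 1 = k' - l" using Suc by simp
      then show "of_nat (Suc k' * (k' choose l)) * (- s) ^ l * (2 * PP j (k' - l) a b)
        = of_nat (k choose l) * (- s) ^ l * (2 * of_nat (k - l) * PP j (k - l - 1) a b)"
        unfolding e by simp
    qed
    also have "\<dots> = (\<Sum>l\<le>k. of_nat (k choose l) * (- s) ^ l * (2 * of_nat (k - l) * PP j (k - l - 1) a b))"
      unfolding Suc by simp
    finally show ?thesis .
  qed simp
  then show ?case
    by (simp add: Suc.IH sum_distrib_left sum.distrib[symmetric] algebra_simps)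
qed

lemma continuous_on_PP [continuous_intros]:
  assumes "continuous_on S f" "continuous_on S g"
  shows "continuous_on S (\<lambda>x. PP j k (f x) (g x))"
  by (induction j arbitrary: k) (auto intro!: continuous_intros assms)

abbreviation gs :: "complex \<Rightarrow> complex" where
  "gs a \<equiv> of_real (exp (- (1/2) * (cmod a)\<^sup>2))"

text \<open>The quotient of factorials is a falling factorial: moments with p < j vanish, which is
  the source of orthogonality. The powers of \<open>a\<close> and of its conjugate are carried along
  so that the recursion of \<open>PP\<close> closes in the induction.\<close>

lemma PP_moment:
  "has_bochner_integral lborel (\<lambda>a. PP j k a (cnj a) * cnj a ^ p * a ^ q * gs a)
     (if j \<le> p \<and> q + j = k + p then of_real (2 * pi * (-1) ^ k * 2 ^ (j + q) * (fact p / fact (p - j)) * fact q) else 0)"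
proof (induction j arbitrary: k p q)
  case 0
  have "has_bochner_integral lborel (\<lambda>a. (-1) ^ k * (a ^ q * cnj a ^ (k + p) * gs a))
      ((-1) ^ k * (if q = k + p then of_real (pi * fact q / (1/2) ^ Suc q) else 0))"
    using integrable_gauss_monomial[of "1/2" q "k + p"] integral_gauss_monomial[of "1/2" q "k + p"]
    by (intro has_bochner_integral_mult_right) (simp add: has_bochner_integral_iff)
  moreover have "(\<lambda>a. (-1) ^ k * (a ^ q * cnj a ^ (k + p) * gs a)) = (\<lambda>a. PP 0 k a (cnj a) * cnj a ^ p * a ^ q * gs a)"
    by (simp add: fun_eq_iff power_add power_minus[of "cnj _"])
  moreover have "(-1) ^ k * (if q = k + p then of_real (pi * fact q / (1/2) ^ Suc q) else 0)
     = (if 0 \<le> p \<and> q + 0 = k + p then of_real (2 * pi * (-1) ^ k * 2 ^ (0 + q) * (fact p / fact (p - 0)) * fact q) else 0 :: complex)"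
    by (simp add: power_divide)
  ultimately show ?case by simp
next
  case (Suc j)
  let ?c = "\<lambda>j k p q. if j \<le> p \<and> q + j = k + p then of_real (2 * pi * (-1) ^ k * 2 ^ (j + q) * (fact p / fact (p - j)) * fact q) else 0 :: complex"
  have h1: "has_bochner_integral lborel (\<lambda>a. PP j k a (cnj a) * cnj a ^ p * a ^ Suc q * gs a
           + 2 * of_nat k * (PP j (k - 1) a (cnj a) * cnj a ^ p * a ^ q * gs a))
      (?c j k p (Suc q) + 2 * of_nat k * ?c j (k - 1) p q)"
    by (intro has_bochner_integral_add has_bochner_integral_mult_right Suc.IH)
  have h2: "(\<lambda>a. PP j k a (cnj a) * cnj a ^ p * a ^ Suc q * gs a
           + 2 * of_nat k * (PP j (k - 1) a (cnj a) * cnj a ^ p * a ^ q * gs a))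
      = (\<lambda>a. PP (Suc j) k a (cnj a) * cnj a ^ p * a ^ q * gs a)"
    by (simp add: fun_eq_iff algebra_simps)
  have h3: "?c j k p (Suc q) + 2 * of_nat k * ?c j (k - 1) p q = ?c (Suc j) k p q"
  proof (cases "j \<le> p \<and> Suc q + j = k + p")
    case False
    have "k = 0 \<or> \<not> (j \<le> p \<and> q + j = k - 1 + p)" using False by auto
    moreover have "\<not> (Suc j \<le> p \<and> q + Suc j = k + p)" using False by auto
    ultimately show ?thesis using False by auto
  next
    case True
    define r where "r = p - j"
    have p: "p = j + r" and q: "Suc q = k + r" using True by (auto simp: r_def)
    have k2: "of_nat k * ?c j (k - 1) p q = of_real (real k * (2 * pi * (- ((-1) ^ k)) * 2 ^ (j + q) * (fact p / fact r) * fact q))"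
      using q by (cases k) (auto simp: p)
    have k1: "?c j k p (Suc q) = of_real (2 * pi * (-1) ^ k * 2 ^ (j + q) * 2 * (fact p / fact r) * (real (k + r) * fact q))"
    proof -
      have "fact (Suc q) = real (k + r) * fact q" unfolding q[symmetric] by simp
      then show ?thesis using True by (simp add: p)
    qed
    have k3: "?c (Suc j) k p q = of_real (real r * (2 * pi * (-1) ^ k * 2 ^ (j + q) * 2 * (fact p / fact r) * fact q))"
    proof (cases r)
      case 0 then show ?thesis by (simp add: p)
    next
      case (Suc r')
      have f: "fact p / fact r' = real r * (fact p / fact r :: real)"
        unfolding Suc by (simp del: of_nat_Suc)
      have "?c (Suc j) k p q = of_real (2 * pi * (-1) ^ k * 2 ^ (Suc j + q) * (fact p / fact r') * fact q)"
        using q Suc by (simp add: p del: of_real_mult of_real_divide of_real_power)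
      then show ?thesis unfolding f by (simp add: mult_ac)
    qed
    have "?c j k p (Suc q) + 2 * of_nat k * ?c j (k - 1) p q = ?c j k p (Suc q) + 2 * (of_nat k * ?c j (k - 1) p q)"
      by (rule arg_cong[OF mult.assoc])
    also have "\<dots> = of_real (2 * pi * (-1) ^ k * 2 ^ (j + q) * 2 * (fact p / fact r) * (real (k + r) * fact q)
         + 2 * (real k * (2 * pi * (- ((-1) ^ k)) * 2 ^ (j + q) * (fact p / fact r) * fact q)))"
      unfolding k1 k2 by (simp only: of_real_add of_real_mult of_real_numeral)
    also have "\<dots> = ?c (Suc j) k p q"
      unfolding k3 by (rule arg_cong[where f=of_real]) (simp add: algebra_simps add_divide_distrib)
    finally show ?thesis .
  qed
  show ?case using h1 unfolding h2 h3 .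
qed

text \<open>The second factor is unfolded to monomials. Its top term is, up to sign,
  \<open>cnj a ^ j' * a ^ k'\<close>. Below the threshold in either variable every monomial is
  killed by \<open>PP_moment\<close>; at the threshold only the top term survives.\<close>

lemma PP_gram_aux:
  "integrable lborel (\<lambda>a. PP j k a (cnj a) * cnj a ^ p * a ^ q * cnj (PP j' k' a (cnj a)) * gs a) \<and>
   (p + j' < j \<or> q + k' < k \<longrightarrow> (\<integral>a. PP j k a (cnj a) * cnj a ^ p * a ^ q * cnj (PP j' k' a (cnj a)) * gs a \<partial>lborel) = 0) \<and>
   (p + j' = j \<and> q + k' = k \<longrightarrow> (\<integral>a. PP j k a (cnj a) * cnj a ^ p * a ^ q * cnj (PP j' k' a (cnj a)) * gs a \<partial>lborel)
       = of_real (2 * pi * (-1) ^ (k + k') * 2 ^ (j + k) * fact j * fact k))"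
proof (induction j' arbitrary: p q k')
  case 0
  have e: "(\<lambda>a. PP j k a (cnj a) * cnj a ^ p * a ^ q * cnj (PP 0 k' a (cnj a)) * gs a)
      = (\<lambda>a. (-1) ^ k' * (PP j k a (cnj a) * cnj a ^ p * a ^ (q + k') * gs a))"
  proof (rule ext)
    fix a :: complex
    show "PP j k a (cnj a) * cnj a ^ p * a ^ q * cnj (PP 0 k' a (cnj a)) * gs a
      = (-1) ^ k' * (PP j k a (cnj a) * cnj a ^ p * a ^ (q + k') * gs a)"
      by (simp add: power_add power_minus[of a k'] mult_ac)
  qed
  show ?case using PP_moment[of j k p "q + k'"] unfolding e
    by (auto simp: has_bochner_integral_iff power_add)
next
  case (Suc j')
  have e: "(\<lambda>a. PP j k a (cnj a) * cnj a ^ p * a ^ q * cnj (PP (Suc j') k' a (cnj a)) * gs a)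
      = (\<lambda>a. PP j k a (cnj a) * cnj a ^ Suc p * a ^ q * cnj (PP j' k' a (cnj a)) * gs a
         + 2 * of_nat k' * (PP j k a (cnj a) * cnj a ^ p * a ^ q * cnj (PP j' (k' - 1) a (cnj a)) * gs a))"
    by (simp add: fun_eq_iff algebra_simps)
  have i: "integrable lborel (\<lambda>a. PP j k a (cnj a) * cnj a ^ Suc p * a ^ q * cnj (PP j' k' a (cnj a)) * gs a)"
    "integrable lborel (\<lambda>a. 2 * of_nat k' * (PP j k a (cnj a) * cnj a ^ p * a ^ q * cnj (PP j' (k' - 1) a (cnj a)) * gs a))"
    by (intro integrable_mult_right Suc.IH[THEN conjunct1])+
  note I = Suc.IH[of "Suc p" q k'] Suc.IH[of p q "k' - 1"]
  show ?case unfolding e Bochner_Integration.integral_add[OF i]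
  proof (intro conjI impI Bochner_Integration.integrable_add i)
    assume h: "p + Suc j' < j \<or> q + k' < k"
    then have "Suc p + j' < j \<or> q + k' < k" "p + j' < j \<or> q + (k' - 1) < k" by auto
    with I have z: "(\<integral>a. PP j k a (cnj a) * cnj a ^ Suc p * a ^ q * cnj (PP j' k' a (cnj a)) * gs a \<partial>lborel) = 0"
      "(\<integral>a. PP j k a (cnj a) * cnj a ^ p * a ^ q * cnj (PP j' (k' - 1) a (cnj a)) * gs a \<partial>lborel) = 0"
      by blast+
    show "(\<integral>a. PP j k a (cnj a) * cnj a ^ Suc p * a ^ q * cnj (PP j' k' a (cnj a)) * gs a \<partial>lborel)
      + (\<integral>a. 2 * of_nat k' * (PP j k a (cnj a) * cnj a ^ p * a ^ q * cnj (PP j' (k' - 1) a (cnj a)) * gs a) \<partial>lborel) = 0"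
      unfolding z integral_mult_right_zero by simp
  next
    assume h: "p + Suc j' = j \<and> q + k' = k"
    then have "Suc p + j' = j \<and> q + k' = k" "p + j' < j" by auto
    with I have z: "(\<integral>a. PP j k a (cnj a) * cnj a ^ Suc p * a ^ q * cnj (PP j' k' a (cnj a)) * gs a \<partial>lborel)
         = of_real (2 * pi * (-1) ^ (k + k') * 2 ^ (j + k) * fact j * fact k)"
      "(\<integral>a. PP j k a (cnj a) * cnj a ^ p * a ^ q * cnj (PP j' (k' - 1) a (cnj a)) * gs a \<partial>lborel) = 0"
      by blast+
    show "(\<integral>a. PP j k a (cnj a) * cnj a ^ Suc p * a ^ q * cnj (PP j' k' a (cnj a)) * gs a \<partial>lborel)
      + (\<integral>a. 2 * of_nat k' * (PP j k a (cnj a) * cnj a ^ p * a ^ q * cnj (PP j' (k' - 1) a (cnj a)) * gs a) \<partial>lborel)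
      = of_real (2 * pi * (-1) ^ (k + k') * 2 ^ (j + k) * fact j * fact k)"
      unfolding z integral_mult_right_zero by simp
  qed
qed

lemma PP_gram:
  "has_bochner_integral lborel (\<lambda>a. PP j k a (cnj a) * cnj (PP j' k' a (cnj a)) * gs a)
     (if j = j' \<and> k = k' then of_real (2 * pi * 2 ^ (j + k) * fact j * fact k) else 0)"
proof -
  have i: "integrable lborel (\<lambda>a. PP j k a (cnj a) * cnj (PP j' k' a (cnj a)) * gs a)" for j k j' k'
    using PP_gram_aux[of j k 0 0 j' k'] by simp
  have z: "(\<integral>a. PP j k a (cnj a) * cnj (PP j' k' a (cnj a)) * gs a \<partial>lborel) = 0"
    if "j' < j \<or> k' < k" for j k j' k'
    using PP_gram_aux[of j k 0 0 j' k'] that by simp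
  consider "j' < j \<or> k' < k" | "j < j' \<or> k < k'" | "j = j'" "k = k'" by linarith
  then have "(\<integral>a. PP j k a (cnj a) * cnj (PP j' k' a (cnj a)) * gs a \<partial>lborel)
     = (if j = j' \<and> k = k' then of_real (2 * pi * 2 ^ (j + k) * fact j * fact k) else 0)"
  proof cases
    case 1 then show ?thesis using z by auto
  next
    \<comment> \<open>The auxiliary lemma covers a smaller index on the right; the reverse order
      follows by conjugation.\<close>
    case 2
    have "(\<integral>a. PP j k a (cnj a) * cnj (PP j' k' a (cnj a)) * gs a \<partial>lborel)
       = (\<integral>a. cnj (PP j' k' a (cnj a) * cnj (PP j k a (cnj a)) * gs a) \<partial>lborel)"
      by (intro Bochner_Integration.integral_cong) (auto simp: algebra_simps)
    also have "\<dots> = cnj (\<integral>a. PP j' k' a (cnj a) * cnj (PP j k a (cnj a)) * gs a \<partial>lborel)"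
      by (rule Bochner_Integration.integral_cnj)
    finally show ?thesis using 2 z by auto
  next
    case 3 then show ?thesis using PP_gram_aux[of j k 0 0 j' k'] by (simp add: power_add[symmetric] mult_2[symmetric])
  qed
  with i show ?thesis by (simp add: has_bochner_integral_iff)
qed

lemma has_bochner_integral_pair_mult:
  fixes f :: "'a::euclidean_space \<Rightarrow> 'c::{real_normed_field,banach,second_countable_topology}"
    and g :: "'b::euclidean_space \<Rightarrow> 'c"
  assumes "has_bochner_integral lborel f x" "has_bochner_integral lborel g y"
  shows "has_bochner_integral lborel (\<lambda>p. f (fst p) * g (snd p)) (x * y)"
proof -
  have f: "integrable lborel f" "integral\<^sup>L lborel f = x" and g: "integrable lborel g" "integral\<^sup>L lborel g = y"
    using assms by (auto simp: has_bochner_integral_iff)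
  have [measurable]: "f \<in> borel_measurable borel" "g \<in> borel_measurable borel"
    using f g by (auto dest!: borel_measurable_integrable)
  have i: "integrable (lborel \<Otimes>\<^sub>M lborel) (\<lambda>p. f (fst p) * g (snd p))"
  proof (rule lborel_pair.Fubini_integrable)
    show "integrable lborel (\<lambda>x. \<integral>y. norm (f (fst (x, y)) * g (snd (x, y))) \<partial>lborel)"
      using f g by (simp add: norm_mult)
    show "AE x in lborel. integrable lborel (\<lambda>y. f (fst (x, y)) * g (snd (x, y)))"
      using g by simp
  qed measurable
  have "(\<integral>p. f (fst p) * g (snd p) \<partial>(lborel \<Otimes>\<^sub>M lborel)) = (\<integral>x. \<integral>y. f x * g y \<partial>lborel \<partial>lborel)"
    using lborel_pair.integral_fst'[OF i] by simp
  also have "\<dots> = x * y" using f g by simp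
  finally show ?thesis using i by (simp add: has_bochner_integral_iff lborel_prod)
qed

section \<open>Hermite polynomials\<close>

text \<open>The physicists' Hermite polynomials; the recursion is what one more differentiation of
  exp (- x^2) produces, up to sign.\<close>

fun Hp :: "nat \<Rightarrow> real poly" where
  "Hp 0 = 1"
| "Hp (Suc k) = [:0, 2:] * Hp k - pderiv (Hp k)"

lemma deriv_gauss: "(deriv ^^ k) (\<lambda>y::real. exp (- y\<^sup>2)) = (\<lambda>x. (-1) ^ k * poly (Hp k) x * exp (- x\<^sup>2))"
proof (induction k)
  case (Suc k)
  have "((\<lambda>x. (-1) ^ k * poly (Hp k) x * exp (- x\<^sup>2)) has_real_derivative (-1) ^ Suc k * poly (Hp (Suc k)) x * exp (- x\<^sup>2)) (at x)" for x
    by (auto intro!: derivative_eq_intros poly_DERIV simp: algebra_simps)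
  then show ?case by (auto simp: Suc.IH fun_eq_iff intro!: DERIV_imp_deriv)
qed simp

definition hc :: "nat \<Rightarrow> real" where "hc k = (2 ^ k * fact k * sqrt pi) powr (-1/2)"

lemma hermite_fun_eq: "hermite_fun k x = hc k * poly (Hp k) x * exp (- x\<^sup>2 / 2)"
proof -
  have e: "exp (- x\<^sup>2) * exp (x\<^sup>2 / 2) = exp (- x\<^sup>2 / 2)" by (simp add: exp_add[symmetric])
  have s: "(-1) ^ k * (-1) ^ k = (1::real)" by (simp add: power_mult_distrib[symmetric])
  have "hermite_fun k x = hc k * ((-1) ^ k * (-1) ^ k) * poly (Hp k) x * (exp (- x\<^sup>2) * exp (x\<^sup>2 / 2))"
    unfolding hermite_fun_def deriv_gauss hc_def by (simp only: mult_ac)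
  then show ?thesis unfolding e s by simp
qed

lemma pderiv_Hp_Suc: "pderiv (Hp (Suc k)) = smult (2 * real (Suc k)) (Hp k)"
proof (induction k)
  case 0 show ?case by (simp add: pderiv_pCons)
next
  case (Suc k)
  have X: "pderiv [:0, 2::real:] = [:2:]" by (simp add: pderiv_pCons)
  have "pderiv (Hp (Suc (Suc k))) = [:0, 2:] * pderiv (Hp (Suc k)) + [:2:] * Hp (Suc k) - pderiv (pderiv (Hp (Suc k)))"
    by (simp only: Hp.simps(2)[of "Suc k"] pderiv_diff pderiv_mult X) (simp only: mult.commute)
  also have "\<dots> = smult (2 * real (Suc k)) ([:0, 2:] * Hp k - pderiv (Hp k)) + smult 2 (Hp (Suc k))"
    unfolding Suc.IH pderiv_smult by (simp add: smult_diff_right)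
  also have "\<dots> = smult (2 * real (Suc (Suc k))) (Hp (Suc k))"
    by (simp only: Hp.simps(2)[symmetric] smult_add_left[symmetric]) simp
  finally show ?case .
qed

lemma pderiv_Hp: "pderiv (Hp k) = smult (2 * real k) (Hp (k - 1))"
  by (cases k) (simp_all add: pderiv_Hp_Suc del: Hp.simps(2))

text \<open>Exponential growth stands in for the degree, so that the single bound
  \<open>integrable_gauss_linear\<close> serves all polynomials.\<close>

lemma poly_exp_bound: "\<exists>C L. 0 \<le> C \<and> (\<forall>x::real. \<bar>poly Q x\<bar> \<le> C * exp (L * \<bar>x\<bar>))"
proof (induction Q)
  case 0 show ?case by (auto intro: exI[of _ 0])
next
  case (pCons a Q)
  then obtain C L where C: "0 \<le> C" "\<And>x. \<bar>poly Q x\<bar> \<le> C * exp (L * \<bar>x\<bar>)" by auto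
  have "\<bar>poly (pCons a Q) x\<bar> \<le> (\<bar>a\<bar> + C) * exp ((\<bar>L\<bar> + 1) * \<bar>x\<bar>)" for x
  proof -
    have e1: "1 \<le> exp ((\<bar>L\<bar> + 1) * \<bar>x\<bar>)" by simp
    have "\<bar>x\<bar> \<le> exp \<bar>x\<bar>" using exp_ge_add_one_self[of "\<bar>x\<bar>"] by linarith
    moreover have "exp (L * \<bar>x\<bar>) \<le> exp (\<bar>L\<bar> * \<bar>x\<bar>)" by (simp add: mult_right_mono)
    ultimately have "\<bar>x\<bar> * (C * exp (L * \<bar>x\<bar>)) \<le> exp \<bar>x\<bar> * (C * exp (\<bar>L\<bar> * \<bar>x\<bar>))"
      using C by (intro mult_mono) auto
    also have "\<dots> = C * exp ((\<bar>L\<bar> + 1) * \<bar>x\<bar>)" by (simp add: exp_add algebra_simps)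
    finally have 2: "\<bar>x\<bar> * (C * exp (L * \<bar>x\<bar>)) \<le> C * exp ((\<bar>L\<bar> + 1) * \<bar>x\<bar>)" .
    have "\<bar>poly (pCons a Q) x\<bar> \<le> \<bar>a\<bar> + \<bar>x\<bar> * \<bar>poly Q x\<bar>"
      using abs_triangle_ineq[of a "x * poly Q x"] by (simp add: abs_mult)
    also have "\<dots> \<le> \<bar>a\<bar> * exp ((\<bar>L\<bar> + 1) * \<bar>x\<bar>) + \<bar>x\<bar> * (C * exp (L * \<bar>x\<bar>))"
      using e1 C by (intro add_mono mult_left_mono) (auto simp: mult_le_cancel_left1)
    also have "\<dots> \<le> (\<bar>a\<bar> + C) * exp ((\<bar>L\<bar> + 1) * \<bar>x\<bar>)" using 2 by (simp add: distrib_right)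
    finally show ?thesis .
  qed
  then show ?case using C by (intro exI[of _ "\<bar>a\<bar> + C"] exI[of _ "\<bar>L\<bar> + 1"]) auto
qed

lemma integrable_poly_gauss:
  "integrable lborel (\<lambda>\<xi>::real. exp (\<i> * of_real (x * \<xi>)) * of_real (poly Q \<xi> * exp (- \<xi>\<^sup>2)))"
proof -
  obtain C L where C: "0 \<le> C" "\<And>x. \<bar>poly Q x\<bar> \<le> C * exp (L * \<bar>x\<bar>)" using poly_exp_bound by blast
  show ?thesis
  proof (rule Bochner_Integration.integrable_bound)
    show "integrable lborel (\<lambda>x::real. C * exp (L * norm x - 1 * (norm x)\<^sup>2))"
      by (intro integrable_mult_right integrable_gauss_linear) simp
    have "\<bar>poly Q \<xi>\<bar> * exp (- \<xi>\<^sup>2) \<le> C * exp (L * \<bar>\<xi>\<bar>) * exp (- \<xi>\<^sup>2)" for \<xi>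
      using C by (intro mult_right_mono) auto
    then show "AE \<xi> in lborel. norm (exp (\<i> * of_real (x * \<xi>)) * of_real (poly Q \<xi> * exp (- \<xi>\<^sup>2))) \<le> norm (C * exp (L * norm \<xi> - 1 * (norm \<xi>)\<^sup>2))"
      using C(1) by (intro AE_I2) (simp add: norm_mult norm_inverse abs_mult exp_diff exp_minus divide_inverse)
  qed (auto intro!: borel_measurable_continuous_onI continuous_intros)
qed

lemma exp_diff_of_real: "exp (w - of_real r) = exp w * of_real (exp (- r))" for w :: complex
  by (simp add: exp_diff exp_minus exp_of_real divide_inverse)

text \<open>The Fourier transform of a polynomial times a Gaussian, taken as a functional of the
  polynomial, so that integration by parts becomes algebra on \<open>Q\<close>.\<close>

definition TT :: "real \<Rightarrow> real poly \<Rightarrow> complex" where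
  "TT x Q = (\<integral>\<xi>. exp (\<i> * of_real (x * \<xi>)) * of_real (poly Q \<xi> * exp (- \<xi>\<^sup>2)) \<partial>lborel)"

lemma TT_add: "TT x (P + Q) = TT x P + TT x Q"
  unfolding TT_def Bochner_Integration.integral_add[OF integrable_poly_gauss integrable_poly_gauss, symmetric]
  by (simp add: algebra_simps)

lemma TT_smult: "TT x (smult c Q) = of_real c * TT x Q"
  unfolding TT_def integral_mult_right_zero[symmetric] by (simp add: algebra_simps)

lemma TT_diff: "TT x (P - Q) = TT x P - TT x Q"
  using TT_add[of x P "smult (-1) Q"] TT_smult[of x "-1" Q] by simp

text \<open>Integration by parts: the derivative of exp (i x \<xi>) Q(\<xi>) exp (- \<xi>^2) has
  integral 0 over the line.\<close>

lemma TT_parts: "TT x (pderiv Q) + \<i> * of_real x * TT x Q = TT x ([:0, 2:] * Q)"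
proof -
  let ?F = "\<lambda>\<xi>::real. exp (\<i> * of_real (x * \<xi>)) * of_real (poly Q \<xi> * exp (- \<xi>\<^sup>2)) :: complex"
  let ?f = "\<lambda>\<xi>::real. exp (\<i> * of_real (x * \<xi>)) * of_real (poly (pderiv Q) \<xi> * exp (- \<xi>\<^sup>2))
     + \<i> * of_real x * (exp (\<i> * of_real (x * \<xi>)) * of_real (poly Q \<xi> * exp (- \<xi>\<^sup>2)))
     - exp (\<i> * of_real (x * \<xi>)) * of_real (poly ([:0, 2:] * Q) \<xi> * exp (- \<xi>\<^sup>2))"
  have i: "integrable lborel ?f"
    by (intro Bochner_Integration.integrable_diff Bochner_Integration.integrable_add integrable_mult_right integrable_poly_gauss)
  obtain C L where C: "0 \<le> C" "\<And>x. \<bar>poly Q x\<bar> \<le> C * exp (L * \<bar>x\<bar>)" using poly_exp_bound by blast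
  have bound: "norm (?F \<xi>) \<le> C * exp ((L + 1)\<^sup>2 / 4) * exp (- \<bar>\<xi>\<bar>)" for \<xi>
  proof -
    \<comment> \<open>The square is chosen so that the Gaussian beats (L + 1) |\<xi>|, which leaves
      the decaying factor exp (- |\<xi>|).\<close>
    have "0 \<le> (\<bar>\<xi>\<bar> - (L + 1) / 2)\<^sup>2" by simp
    then have "L * \<bar>\<xi>\<bar> - \<xi>\<^sup>2 \<le> (L + 1)\<^sup>2 / 4 - \<bar>\<xi>\<bar>"
      by (simp add: power2_eq_square field_simps)
    then have e: "exp (L * \<bar>\<xi>\<bar>) * exp (- \<xi>\<^sup>2) \<le> exp ((L + 1)\<^sup>2 / 4) * exp (- \<bar>\<xi>\<bar>)"
      by (simp add: exp_add[symmetric])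
    have "norm (?F \<xi>) = \<bar>poly Q \<xi>\<bar> * exp (- \<xi>\<^sup>2)" by (simp add: norm_mult abs_mult)
    also have "\<dots> \<le> C * exp (L * \<bar>\<xi>\<bar>) * exp (- \<xi>\<^sup>2)" using C by (intro mult_right_mono) auto
    also have "\<dots> \<le> C * (exp ((L + 1)\<^sup>2 / 4) * exp (- \<bar>\<xi>\<bar>))"
      using mult_left_mono[OF e C(1)] by (simp add: mult.assoc)
    finally show ?thesis by (simp add: mult.assoc)
  qed
  have l0: "((\<lambda>\<xi>::real. exp (- \<bar>\<xi>\<bar>)) \<longlongrightarrow> 0) at_top" "((\<lambda>\<xi>::real. exp (- \<bar>\<xi>\<bar>)) \<longlongrightarrow> 0) at_bot"
    by real_asymp+
  have lim: "(?F \<longlongrightarrow> 0) at_top" "(?F \<longlongrightarrow> 0) at_bot"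
    by (rule Lim_null_comparison[where g="\<lambda>\<xi>. C * exp ((L + 1)\<^sup>2 / 4) * exp (- \<bar>\<xi>\<bar>)"],
        use bound in simp, intro tendsto_mult_right_zero l0)+
  have "(LBINT \<xi>=-\<infinity>..\<infinity>. ?f \<xi>) = 0 - 0"
  proof (rule interval_integral_FTC_integrable[where F="?F"])
    show "(?F has_vector_derivative ?f \<xi>) (at \<xi>)" for \<xi>
    proof -
      have r: "((\<lambda>\<xi>. poly Q \<xi> * exp (- \<xi>\<^sup>2)) has_real_derivative (poly (pderiv Q) \<xi> - 2 * \<xi> * poly Q \<xi>) * exp (- \<xi>\<^sup>2)) (at \<xi>)"
        by (rule DERIV_cong[OF DERIV_mult[OF poly_DERIV DERIV_fun_exp[OF DERIV_minus[OF DERIV_power[OF DERIV_ident]]]]])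
           (simp add: algebra_simps)
      have "((\<lambda>w. exp (\<i> * of_real x * w)) has_field_derivative \<i> * of_real x * exp (\<i> * of_real x * of_real \<xi>)) (at (of_real \<xi>))"
        by (auto intro!: derivative_eq_intros)
      from has_vector_derivative_real_field[OF this]
      have e: "((\<lambda>\<xi>. exp (\<i> * of_real (x * \<xi>))) has_vector_derivative \<i> * of_real x * exp (\<i> * of_real (x * \<xi>))) (at \<xi>)"
        by (simp add: o_def mult.assoc)
      have "(?F has_vector_derivative exp (\<i> * of_real (x * \<xi>)) * of_real ((poly (pderiv Q) \<xi> - 2 * \<xi> * poly Q \<xi>) * exp (- \<xi>\<^sup>2))
          + \<i> * of_real x * exp (\<i> * of_real (x * \<xi>)) * of_real (poly Q \<xi> * exp (- \<xi>\<^sup>2))) (at \<xi>)"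
        by (intro has_vector_derivative_mult e has_vector_derivative_of_real r)
      then show ?thesis by (simp add: algebra_simps)
    qed
    have "continuous_on UNIV ?f" by (intro continuous_intros)
    then show "isCont ?f \<xi>" for \<xi> by (simp add: continuous_on_eq_continuous_at)
    show "set_integrable lborel (einterval (-\<infinity>) \<infinity>) ?f"
      using i by (simp add: set_integrable_def)
    show "((?F \<circ> real_of_ereal) \<longlongrightarrow> 0) (at_right (-\<infinity>))" "((?F \<circ> real_of_ereal) \<longlongrightarrow> 0) (at_left \<infinity>)"
      using lim by (simp_all add: ereal_tendsto_simps)
  qed simp
  then have "(\<integral>\<xi>. ?f \<xi> \<partial>lborel) = 0"
    by (simp add: interval_lebesgue_integral_def set_lebesgue_integral_def)
  also have "(\<integral>\<xi>. ?f \<xi> \<partial>lborel) = TT x (pderiv Q) + \<i> * of_real x * TT x Q - TT x ([:0, 2:] * Q)"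
    unfolding TT_def integral_mult_right_zero[symmetric]
      Bochner_Integration.integral_add[OF integrable_poly_gauss integrable_mult_right[OF integrable_poly_gauss], symmetric]
    by (rule Bochner_Integration.integral_diff[OF Bochner_Integration.integrable_add[OF integrable_poly_gauss integrable_mult_right[OF integrable_poly_gauss]]
          integrable_poly_gauss])
  finally show ?thesis by simp
qed

text \<open>Raising the first index multiplies by 2 \<xi> + u and subtracts a derivative;
  \<open>TT_parts\<close> trades 2 \<xi> for i x plus the derivative of the product. The derivative
  of the first factor cancels, and what remains is the recursion of \<open>PP\<close> in u + i x and
  u - i x.\<close>

lemma TT_Hermite:
  "TT x (pcompose (Hp j) [:u / 2, 1:] * pcompose (Hp k) [:- u / 2, 1:])
     = of_real (sqrt pi) * PP j k (of_real u + \<i> * of_real x) (of_real u - \<i> * of_real x) * of_real (exp (- x\<^sup>2 / 4))"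
proof -
  define A where "A j = pcompose (Hp j) [:u / 2, 1:]" for j
  define B where "B k = pcompose (Hp k) [:- u / 2, 1:]" for k
  have dA: "pderiv (A j) = smult (2 * real j) (A (j - 1))" for j
    unfolding A_def pderiv_pcompose pderiv_Hp by (simp add: pderiv_pCons pcompose_smult)
  have dB: "pderiv (B j) = smult (2 * real j) (B (j - 1))" for j
    unfolding B_def pderiv_pcompose pderiv_Hp by (simp add: pderiv_pCons pcompose_smult)
  have XA: "pcompose [:0, 2::real:] [:u / 2, 1:] = [:u:] + [:0, 2:]" "pcompose [:0, 2::real:] [:- u / 2, 1:] = [:-u:] + [:0, 2:]"
    by (simp_all add: pcompose_pCons)
  have sA: "A (Suc j) = [:0, 2:] * A j + smult u (A j) - smult (2 * real j) (A (j - 1))" for j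
    using dA[of j] unfolding A_def Hp.simps pcompose_diff pcompose_mult XA pderiv_pcompose
    by (simp add: distrib_right pderiv_pCons algebra_simps)
  have sB: "B (Suc j) = [:0, 2:] * B j - smult u (B j) - smult (2 * real j) (B (j - 1))" for j
    using dB[of j] unfolding B_def Hp.simps pcompose_diff pcompose_mult XA pderiv_pcompose
    by (simp add: distrib_right pderiv_pCons algebra_simps)
  define a b where "a = of_real u + \<i> * of_real x" and "b = of_real u - \<i> * of_real x"
  define E :: complex where "E = of_real (sqrt pi) * of_real (exp (- x\<^sup>2 / 4))"
  have prt: "TT x ([:0, 2:] * (A j * B k)) = of_real (2 * real j) * TT x (A (j - 1) * B k) + of_real (2 * real k) * TT x (A j * B (k - 1))
       + \<i> * of_real x * TT x (A j * B k)" for j k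
    unfolding TT_parts[symmetric] pderiv_mult dA dB TT_add
    by (simp add: TT_smult mult.commute[of "B k"] add.commute)
  have recA: "TT x (A (Suc j) * B k) = a * TT x (A j * B k) + 2 * of_nat k * TT x (A j * B (k - 1))" for j k
  proof -
    have "A (Suc j) * B k = [:0, 2:] * (A j * B k) + smult u (A j * B k) - smult (2 * real j) (A (j - 1) * B k)"
      unfolding sA by (simp add: algebra_simps)
    then have "TT x (A (Suc j) * B k) = TT x ([:0, 2:] * (A j * B k)) + of_real u * TT x (A j * B k) - of_real (2 * real j) * TT x (A (j - 1) * B k)"
      by (simp only: TT_add TT_diff TT_smult)
    then show ?thesis unfolding prt by (simp add: a_def algebra_simps)
  qed
  \<comment> \<open>The second index is raised only over the first index 0, where \<open>PP\<close>
    is a pure power of \<open>- b\<close>.\<close>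
  have recB: "TT x (A 0 * B (Suc k)) = - b * TT x (A 0 * B k)" for k
  proof -
    have "A 0 * B (Suc k) = [:0, 2:] * (A 0 * B k) - smult u (A 0 * B k) - smult (2 * real k) (A 0 * B (k - 1))"
      unfolding sB by (simp add: algebra_simps)
    then have "TT x (A 0 * B (Suc k)) = TT x ([:0, 2:] * (A 0 * B k)) - of_real u * TT x (A 0 * B k) - of_real (2 * real k) * TT x (A 0 * B (k - 1))"
      by (simp only: TT_add TT_diff TT_smult)
    then show ?thesis unfolding prt by (simp add: b_def algebra_simps)
  qed
  have base: "TT x (A 0 * B 0) = E"
  proof -
    have "TT x (A 0 * B 0) = (\<integral>\<xi>. exp ((\<i> * of_real x) * of_real \<xi> - of_real (1 * \<xi>\<^sup>2)) \<partial>lborel)"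
      unfolding TT_def A_def B_def
      by (intro Bochner_Integration.integral_cong refl) (simp only: exp_diff_of_real, simp add: pcompose_1 mult.assoc)
    also have "\<dots> = E" using gauss_fourier(2)[of 1 "\<i> * of_real x"]
      by (simp add: E_def power_mult_distrib exp_of_real[symmetric])
    finally show ?thesis .
  qed
  have b0: "TT x (A 0 * B k) = E * (- b) ^ k" for k
    by (induction k) (simp_all add: base recB)
  have "TT x (A j * B k) = E * PP j k a b"
  proof (induction j arbitrary: k)
    case (Suc j) then show ?case unfolding recA Suc.IH by (simp add: algebra_simps)
  qed (simp add: b0)
  then show ?thesis by (simp add: A_def B_def a_def b_def E_def)
qed

lemma lpres_has_bochner_integral:
  fixes g :: "_ \<Rightarrow> 'c::{banach,second_countable_topology}"
  assumes "lpres f" "g \<in> borel_measurable borel"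
  shows "has_bochner_integral lborel (\<lambda>x. g (f x)) v \<longleftrightarrow> has_bochner_integral lborel g v"
  unfolding has_bochner_integral_iff lpres_integral[OF assms] lpres_integrable_iff[OF assms] ..

lemma hc_mult: "hc j * hc k * sqrt pi = 1 / sqrt (2 ^ (j + k) * fact j * fact k)"
proof -
  have h: "hc k = 1 / (sqrt (2 ^ k * fact k) * sqrt (sqrt pi))" for k
    by (simp add: hc_def powr_minus_divide powr_half_sqrt real_sqrt_mult)
  have "sqrt (sqrt pi) * sqrt (sqrt pi) = sqrt pi" by simp
  then show ?thesis unfolding h
    by (simp add: power_add real_sqrt_mult field_simps)
qed

text \<open>The extension of the one-dimensional special Hermite function to complex arguments. The
  radicand is the squared norm found in \<open>PP_gram\<close>, so these functions are normalised on
  the real plane.\<close>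

definition sh :: "nat \<Rightarrow> nat \<Rightarrow> complex \<Rightarrow> complex \<Rightarrow> complex" where
  "sh j k z w = of_real (1 / sqrt (2 * pi * 2 ^ (j + k) * fact j * fact k))
      * PP j k (w + \<i> * z) (w - \<i> * z) * exp (- (z\<^sup>2 + w\<^sup>2) / 4)"

lemma special_Hermite_1d:
  fixes x u :: real
  shows "integrable lborel (\<lambda>\<xi>::real. exp (\<i> * of_real (x * \<xi>)) * of_real (hermite_fun j (\<xi> + u / 2) * hermite_fun k (\<xi> - u / 2)))"
    and "of_real ((2 * pi) powr (-1/2)) * (\<integral>\<xi>. exp (\<i> * of_real (x * \<xi>)) * of_real (hermite_fun j (\<xi> + u / 2) * hermite_fun k (\<xi> - u / 2)) \<partial>lborel)
      = sh j k (of_real x) (of_real u)"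
proof -
  let ?Q = "pcompose (Hp j) [:u / 2, 1:] * pcompose (Hp k) [:- u / 2, 1:]"
  have e: "exp (\<i> * of_real (x * \<xi>)) * of_real (hermite_fun j (\<xi> + u / 2) * hermite_fun k (\<xi> - u / 2))
     = of_real (hc j * hc k * exp (- u\<^sup>2 / 4)) * (exp (\<i> * of_real (x * \<xi>)) * of_real (poly ?Q \<xi> * exp (- \<xi>\<^sup>2)))" for \<xi>
  proof -
    \<comment> \<open>The Gaussians centred at - u/2 and u/2 multiply to one centred at 0 in \<xi>,
      times a factor in u alone.\<close>
    have "exp (- (\<xi> + u / 2)\<^sup>2 / 2) * exp (- (\<xi> - u / 2)\<^sup>2 / 2) = exp (- u\<^sup>2 / 4) * exp (- \<xi>\<^sup>2)"
      unfolding exp_add[symmetric] by (simp add: power2_eq_square field_simps)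
    then have h: "hermite_fun j (\<xi> + u / 2) * hermite_fun k (\<xi> - u / 2) = hc j * hc k * exp (- u\<^sup>2 / 4) * (poly ?Q \<xi> * exp (- \<xi>\<^sup>2))"
      unfolding hermite_fun_eq by (simp add: poly_pcompose add.commute mult_ac)
    show ?thesis unfolding h by (simp only: of_real_mult mult_ac)
  qed
  show "integrable lborel (\<lambda>\<xi>::real. exp (\<i> * of_real (x * \<xi>)) * of_real (hermite_fun j (\<xi> + u / 2) * hermite_fun k (\<xi> - u / 2)))"
    unfolding e by (intro integrable_mult_right integrable_poly_gauss)
  have c: "(2 * pi) powr (-1/2) * (hc j * hc k * sqrt pi) = 1 / sqrt (2 * pi * 2 ^ (j + k) * fact j * fact k)"
    unfolding hc_mult by (simp add: powr_minus_divide powr_half_sqrt real_sqrt_mult)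
  have ex: "exp (- (complex_of_real x ^ 2 + of_real u ^ 2) / 4) = of_real (exp (- u\<^sup>2 / 4)) * of_real (exp (- x\<^sup>2 / 4))"
    unfolding exp_of_real[symmetric] exp_add[symmetric]
    by (rule arg_cong[where f=exp]) (simp add: add_divide_distrib)
  have "of_real ((2 * pi) powr (-1/2)) * (\<integral>\<xi>. exp (\<i> * of_real (x * \<xi>)) * of_real (hermite_fun j (\<xi> + u / 2) * hermite_fun k (\<xi> - u / 2)) \<partial>lborel)
     = of_real ((2 * pi) powr (-1/2)) * (of_real (hc j * hc k * exp (- u\<^sup>2 / 4)) * TT x ?Q)"
    unfolding e integral_mult_right_zero TT_def ..
  also have "\<dots> = of_real ((2 * pi) powr (-1/2) * (hc j * hc k * sqrt pi)) * PP j k (of_real u + \<i> * of_real x) (of_real u - \<i> * of_real x)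
       * (of_real (exp (- u\<^sup>2 / 4)) * of_real (exp (- x\<^sup>2 / 4)))"
    unfolding TT_Hermite by (simp only: of_real_mult mult_ac)
  also have "\<dots> = sh j k (of_real x) (of_real u)"
    unfolding c sh_def ex ..
  finally show "of_real ((2 * pi) powr (-1/2)) * (\<integral>\<xi>. exp (\<i> * of_real (x * \<xi>)) * of_real (hermite_fun j (\<xi> + u / 2) * hermite_fun k (\<xi> - u / 2)) \<partial>lborel)
      = sh j k (of_real x) (of_real u)" .
qed

definition SH :: "nat ^ 'n::finite \<Rightarrow> nat ^ 'n \<Rightarrow> (complex ^ 'n) \<times> (complex ^ 'n) \<Rightarrow> complex" where
  "SH \<alpha> \<beta> p = (\<Prod>i\<in>UNIV. sh (\<alpha> $ i) (\<beta> $ i) (fst p $ i) (snd p $ i))"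

lemma special_Hermite_eq:
  fixes \<alpha> \<beta> :: "nat ^ 'n::finite"
  shows "special_Hermite \<alpha> \<beta> = restrict_real (SH \<alpha> \<beta>)"
proof (rule ext, clarify)
  fix x u :: "real ^ 'n"
  let ?f = "\<lambda>i \<xi>. exp (\<i> * of_real (x $ i * \<xi>)) * of_real (hermite_fun (\<alpha> $ i) (\<xi> + u $ i / 2) * hermite_fun (\<beta> $ i) (\<xi> - u $ i / 2))"
  have "exp (\<i> * of_real (x \<bullet> \<xi>)) * of_real (Hermite_fun \<alpha> (\<xi> + (1/2) *\<^sub>R u) * Hermite_fun \<beta> (\<xi> - (1/2) *\<^sub>R u))
     = (\<Prod>i\<in>UNIV. ?f i (\<xi> $ i))" for \<xi> :: "real ^ 'n"
    by (simp add: Hermite_fun_def inner_vec_def exp_sum sum_distrib_left prod.distrib)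
  then have "special_Hermite \<alpha> \<beta> (x, u) = of_real ((2 * pi) powr (- real CARD('n) / 2)) * (\<Prod>i\<in>UNIV. \<integral>\<xi>. ?f i \<xi> \<partial>lborel)"
    unfolding special_Hermite_def using integral_vec_prod(2)[of ?f, OF special_Hermite_1d(1)] by simp
  also have "(2 * pi) powr (- real CARD('n) / 2) = (\<Prod>i\<in>(UNIV::'n set). (2 * pi) powr (-1/2))"
  proof -
    have "(2 * pi) powr (- real CARD('n) / 2) = ((2 * pi) powr (-1/2)) powr real CARD('n)"
      by (simp add: powr_powr)
    also have "\<dots> = ((2 * pi) powr (-1/2)) ^ CARD('n)" by (rule powr_realpow) simp
    finally show ?thesis by simp
  qed
  also have "complex_of_real \<dots> * (\<Prod>i\<in>UNIV. \<integral>\<xi>. ?f i \<xi> \<partial>lborel) = (\<Prod>i\<in>UNIV. sh (\<alpha> $ i) (\<beta> $ i) (of_real (x $ i)) (of_real (u $ i)))"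
    unfolding of_real_prod prod.distrib[symmetric] special_Hermite_1d(2) ..
  finally show "special_Hermite \<alpha> \<beta> (x, u) = restrict_real (SH \<alpha> \<beta>) (x, u)"
    by (simp add: restrict_real_def SH_def)
qed

lemma continuous_on_sh [continuous_intros]:
  assumes "continuous_on S f" "continuous_on S g"
  shows "continuous_on S (\<lambda>x. sh j k (f x) (g x))"
  unfolding sh_def by (intro continuous_intros assms) auto

section \<open>Orthogonality on the real space\<close>

lemma cmod_sq: "(cmod a)\<^sup>2 = (Re a)\<^sup>2 + (Im a)\<^sup>2"
  by (simp add: cmod_def)

text \<open>With a = u + i x the arguments of \<open>PP\<close> are a and its conjugate, and the
  Gaussians of both factors combine to \<open>gs a\<close>; this is \<open>PP_gram\<close> in other
  coordinates.\<close>

lemma sh_gram_real: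
  "has_bochner_integral lborel (\<lambda>p::real \<times> real. sh j k (of_real (fst p)) (of_real (snd p)) * cnj (sh j' k' (of_real (fst p)) (of_real (snd p))))
     (if j = j' \<and> k = k' then 1 else 0)"
proof -
  let ?N = "\<lambda>j k. 1 / sqrt (2 * pi * 2 ^ (j + k) * fact j * fact k) :: real"
  let ?h = "\<lambda>a. of_real (?N j k * ?N j' k') * (PP j k a (cnj a) * cnj (PP j' k' a (cnj a)) * gs a)"
  have lp: "lpres (\<lambda>p::real \<times> real. Complex (snd p) (fst p))"
    using lpres_comp[OF lpres_swap lpres_Complex] by (simp add: case_prod_unfold)
  have m: "?h \<in> borel_measurable borel"
    by (intro borel_measurable_continuous_onI continuous_intros)
  have e: "sh j k (of_real x) (of_real u) * cnj (sh j' k' (of_real x) (of_real u)) = ?h (Complex u x)" for x u :: real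
  proof -
    have 1: "of_real u + \<i> * of_real x = Complex u x" "of_real u - \<i> * of_real x = cnj (Complex u x)"
      by (simp_all add: complex_eq_iff)
    have g: "exp (- (complex_of_real x ^ 2 + of_real u ^ 2) / 4) * cnj (exp (- (complex_of_real x ^ 2 + of_real u ^ 2) / 4)) = gs (Complex u x)"
      unfolding exp_cnj exp_add[symmetric] exp_of_real[symmetric]
      by (rule arg_cong[where f=exp]) (simp add: cmod_sq field_simps)
    have "sh j k (of_real x) (of_real u) * cnj (sh j' k' (of_real x) (of_real u))
      = of_real (?N j k * ?N j' k') * (PP j k (Complex u x) (cnj (Complex u x)) * cnj (PP j' k' (Complex u x) (cnj (Complex u x)))
        * (exp (- (complex_of_real x ^ 2 + of_real u ^ 2) / 4) * cnj (exp (- (complex_of_real x ^ 2 + of_real u ^ 2) / 4))))"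
      unfolding sh_def 1 complex_cnj_mult complex_cnj_complex_of_real of_real_mult by (simp only: mult_ac)
    then show ?thesis unfolding g .
  qed
  have "has_bochner_integral lborel ?h (of_real (?N j k * ?N j' k') * (if j = j' \<and> k = k' then of_real (2 * pi * 2 ^ (j + k) * fact j * fact k) else 0))"
    by (intro has_bochner_integral_mult_right PP_gram)
  moreover have "of_real (?N j k * ?N j' k') * (if j = j' \<and> k = k' then of_real (2 * pi * 2 ^ (j + k) * fact j * fact k) else 0) = (if j = j' \<and> k = k' then 1 else 0 :: complex)"
  proof -
    have "?N j k * ?N j k * (2 * pi * 2 ^ (j + k) * fact j * fact k) = 1"
      by simp
    then have "of_real (?N j k * ?N j k) * of_real (2 * pi * 2 ^ (j + k) * fact j * fact k) = (1::complex)"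
      unfolding of_real_mult[symmetric] by (metis of_real_1)
    then have h: "of_real (?N j k * ?N j k) * of_real (2 * pi * 2 ^ (j + k) * fact j * fact k) = (1::complex)" .
    show ?thesis
    proof (cases "j = j' \<and> k = k'")
      case True
      then have e: "j' = j" "k' = k" by auto
      show ?thesis unfolding e using h by (simp only: if_True simp_thms)
    qed auto
  qed
  ultimately have "has_bochner_integral lborel ?h (if j = j' \<and> k = k' then 1 else 0)" by simp
  then show ?thesis
    unfolding e using lpres_integral[OF lp m] lpres_integrable_iff[OF lp m] by (simp add: has_bochner_integral_iff)
qed

section \<open>Orthogonality in the weighted space\<close>

definition w1 :: "real \<Rightarrow> complex \<Rightarrow> complex \<Rightarrow> real" where
  "w1 t z w = 4 * exp (Re w * Im z - Im w * Re z) *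
     (1 / (2 * pi * sinh (2 * t)) * exp (- (cosh (2 * t) / sinh (2 * t)) * ((Im z)\<^sup>2 + (Im w)\<^sup>2)))"

lemma weight_eq_prod: "weight t p = (\<Prod>i\<in>UNIV. w1 t (fst p $ i) (snd p $ i))"
proof -
  have 1: "(\<Prod>i\<in>UNIV. w1 t (fst p $ i) (snd p $ i)) = 4 ^ CARD('a) * exp (\<Sum>i\<in>UNIV. Re (snd p $ i) * Im (fst p $ i) - Im (snd p $ i) * Re (fst p $ i))
     * (1 / ((2 * pi) ^ CARD('a) * sinh (2 * t) ^ CARD('a)) * exp (\<Sum>i\<in>UNIV. - (cosh (2 * t) / sinh (2 * t)) * ((Im (fst p $ i))\<^sup>2 + (Im (snd p $ i))\<^sup>2)))"
    unfolding w1_def prod.distrib exp_sum[OF finite] by (simp add: power_divide power_mult_distrib)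
  have 2: "- (1/4) * (cosh (2 * t) / sinh (2 * t)) * ((2 *\<^sub>R (\<chi> i. Im (fst p $ i))) \<bullet> (2 *\<^sub>R (\<chi> i. Im (fst p $ i))) + (2 *\<^sub>R (\<chi> i. Im (snd p $ i))) \<bullet> (2 *\<^sub>R (\<chi> i. Im (snd p $ i))))
     = (\<Sum>i\<in>UNIV. - (cosh (2 * t) / sinh (2 * t)) * ((Im (fst p $ i))\<^sup>2 + (Im (snd p $ i))\<^sup>2))"
    unfolding sum_distrib_left[symmetric] by (simp add: inner_vec_def sum.distrib sum_distrib_left[symmetric] power2_eq_square algebra_simps)
  show ?thesis
    unfolding 1 weight_def heat_kernel_def Let_def case_prod_unfold 2[symmetric]
    by (simp add: inner_vec_def sum_subtractf)
qed

lemma w1_pos: "t > 0 \<Longrightarrow> w1 t z w > 0"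
  unfolding w1_def by (intro mult_pos_pos) auto

lemma continuous_on_w1 [continuous_intros]:
  assumes "continuous_on S f" "continuous_on S g"
  shows "continuous_on S (\<lambda>x. w1 t (f x) (g x))"
  unfolding w1_def by (intro continuous_intros assms)

text \<open>The inverse of \<open>(z, w) \<mapsto> (w + i z, Im z + i Im w)\<close>, coordinates in which the two factors of
  the weight separate.\<close>

definition \<Theta> :: "complex \<times> complex \<Rightarrow> complex \<times> complex" where
  "\<Theta> p = (Complex (Im (fst p) - Im (snd p)) (Re (snd p)), Complex (Re (fst p) + Re (snd p)) (Im (snd p)))"

text \<open>A shear by the conjugate of the second variable, followed by a permutation of the four
  real coordinates; the permutation is checked on boxes.\<close>

lemma lpres_\<Theta>: "lpres \<Theta>"
proof -
  have "distr lborel borel (\<lambda>p::complex\<times>complex. (Complex (Im (fst p)) (Re (snd p)), Complex (Re (fst p)) (Im (snd p)))) = lborel"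
  proof (rule lborel_eqI[symmetric])
    let ?T = "\<lambda>p::complex\<times>complex. (Complex (Im (fst p)) (Re (snd p)), Complex (Re (fst p)) (Im (snd p)))"
    have m: "?T \<in> borel_measurable borel"
      by (intro borel_measurable_continuous_onI) (auto simp: Complex_eq intro!: continuous_intros)
    fix l u :: "complex \<times> complex" assume le: "\<And>b. b \<in> Basis \<Longrightarrow> l \<bullet> b \<le> u \<bullet> b"
    obtain l1 l2 u1 u2 where lu: "l = (l1, l2)" "u = (u1, u2)" by fastforce
    have B: "(1, 0) \<in> (Basis :: (complex \<times> complex) set)" "(\<i>, 0) \<in> (Basis :: (complex \<times> complex) set)"
      "(0, 1) \<in> (Basis :: (complex \<times> complex) set)" "(0, \<i>) \<in> (Basis :: (complex \<times> complex) set)"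
      by (auto simp: Basis_prod_def Basis_complex_def)
    have le': "Re l1 \<le> Re u1" "Im l1 \<le> Im u1" "Re l2 \<le> Re u2" "Im l2 \<le> Im u2"
      using le[OF B(1)] le[OF B(2)] le[OF B(3)] le[OF B(4)] by (auto simp: lu)
    have mb: "z \<in> box l u \<longleftrightarrow> Re l < Re z \<and> Re z < Re u \<and> Im l < Im z \<and> Im z < Im u" for z l u :: complex
      by (auto simp: mem_box Basis_complex_def)
    have v: "?T -` box l u = box (Complex (Re l2) (Re l1), Complex (Im l1) (Im l2)) (Complex (Re u2) (Re u1), Complex (Im u1) (Im u2))"
      by (auto simp: lu mem_box_pair mb)
    have E: "emeasure lborel (box l u) = ennreal ((Re u1 - Re l1) * (Im u1 - Im l1) * ((Re u2 - Re l2) * (Im u2 - Im l2)))"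
      if "Re l1 \<le> Re u1" "Im l1 \<le> Im u1" "Re l2 \<le> Re u2" "Im l2 \<le> Im u2" "l = (l1, l2)" "u = (u1, u2)" for l u l1 l2 u1 u2
    proof -
      have "l \<bullet> b \<le> u \<bullet> b" if "b \<in> Basis" for b :: "complex \<times> complex"
        using that \<open>Re l1 \<le> Re u1\<close> \<open>Im l1 \<le> Im u1\<close> \<open>Re l2 \<le> Re u2\<close> \<open>Im l2 \<le> Im u2\<close>
        unfolding \<open>l = _\<close> \<open>u = _\<close> Basis_prod_def Basis_complex_def by auto
      from emeasure_lborel_box[OF this] show ?thesis
        unfolding \<open>l = _\<close> \<open>u = _\<close> by (simp add: prod_Basis_pair Basis_complex_def)
    qed
    have "emeasure (distr lborel borel ?T) (box l u) = emeasure lborel (?T -` box l u)"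
      using m by (subst emeasure_distr) simp_all
    then show "emeasure (distr lborel borel ?T) (box l u) = ennreal (\<Prod>b\<in>Basis. (u - l) \<bullet> b)"
      unfolding v using E[OF _ _ _ _ refl refl, of "Complex (Re l2) (Re l1)" "Complex (Re u2) (Re u1)" "Complex (Im l1) (Im l2)" "Complex (Im u1) (Im u2)"] le'
      by (simp add: lu prod_Basis_pair Basis_complex_def mult_ac)
  qed simp
  then have P: "lpres (\<lambda>p::complex\<times>complex. (Complex (Im (fst p)) (Re (snd p)), Complex (Re (fst p)) (Im (snd p))))"
    unfolding lpres_def
    by (intro conjI borel_measurable_continuous_onI) (auto simp: Complex_eq intro!: continuous_intros)
  have "lpres (\<lambda>(a::complex, \<eta>::complex). (a + cnj \<eta>, \<eta>))"
    by (rule lpres_shear_fst) (intro borel_measurable_continuous_onI continuous_intros)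
  from lpres_comp[OF this P] show ?thesis
    by (simp add: \<Theta>_def[abs_def] case_prod_unfold)
qed

lemma \<Theta>_ab: "snd (\<Theta> (a, \<eta>)) + \<i> * fst (\<Theta> (a, \<eta>)) = a" "snd (\<Theta> (a, \<eta>)) - \<i> * fst (\<Theta> (a, \<eta>)) = cnj a + 2 * \<eta>"
  by (simp_all add: \<Theta>_def complex_eq_iff)

lemma coth_minus_1: "t > 0 \<Longrightarrow> cosh (2 * t) / sinh (2 * t) - 1 = exp (- 2 * t) / sinh (2 * t)" for t :: real
  using cosh_minus_sinh[of "2 * t"] by (simp add: field_simps)

text \<open>In the coordinates of \<open>\<Theta>\<close>, \<open>PP_shift\<close> writes the
  integrand as a finite sum of products of a function of a and a function of \<eta>. The moments in
  \<eta> force l = l', \<open>PP_gram\<close> then forces j = j' and k = k', and the surviving terms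
  form a binomial sum.\<close>

lemma sh_gram_weight:
  fixes t :: real
  assumes t: "t > 0"
  shows "has_bochner_integral lborel (\<lambda>p. sh j k (fst p) (snd p) * cnj (sh j' k' (fst p) (snd p)) * of_real (w1 t (fst p) (snd p)))
     (if j = j' \<and> k = k' then of_real (2 * exp (2 * (2 * real k + 1) * t)) else 0)"
proof -
  \<comment> \<open>The decay rate left in \<eta>: one unit of coth (2 t) is spent on turning the
    other factors into exp (- |a|^2 / 2).\<close>
  define \<kappa> where "\<kappa> = cosh (2 * t) / sinh (2 * t) - 1"
  have s: "sinh (2 * t) > 0" using t by simp
  have \<kappa>: "\<kappa> > 0" "\<kappa> * sinh (2 * t) = exp (- 2 * t)"
    using s unfolding \<kappa>_def coth_minus_1[OF t] by auto
  define N where "N j k = 1 / sqrt (2 * pi * 2 ^ (j + k) * fact j * fact k :: real)" for j k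
  define D where "D = N j k * N j' k' * (2 / (pi * sinh (2 * t)))"
  let ?F = "\<lambda>p. sh j k (fst p) (snd p) * cnj (sh j' k' (fst p) (snd p)) * complex_of_real (w1 t (fst p) (snd p))"
  let ?A = "\<lambda>l l' a. PP j (k - l) a (cnj a) * cnj (PP j' (k' - l') a (cnj a)) * gs a"
  let ?B = "\<lambda>l l' \<eta>::complex. \<eta> ^ l * cnj \<eta> ^ l' * of_real (exp (- \<kappa> * (cmod \<eta>)\<^sup>2))"
  let ?C = "\<lambda>l l'. of_nat (k choose l) * of_nat (k' choose l') * (- 2) ^ l * (- 2) ^ l' :: complex"
  let ?G = "\<lambda>p::complex \<times> complex. of_real D * (\<Sum>l\<le>k. \<Sum>l'\<le>k'. ?C l l' * (?A l l' (fst p) * ?B l l' (snd p)))"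
  have FG: "?F (\<Theta> p) = ?G p" for p
  proof -
    obtain a \<eta> where p: "p = (a, \<eta>)" by fastforce
    define z w where "z = fst (\<Theta> p)" and "w = snd (\<Theta> p)"
    have ab: "w + \<i> * z = a" "w - \<i> * z = cnj a + 2 * \<eta>" unfolding z_def w_def p by (rule \<Theta>_ab)+
    have "exp (- (z\<^sup>2 + w\<^sup>2) / 4) * cnj (exp (- (z\<^sup>2 + w\<^sup>2) / 4)) = of_real (exp (- Re (z\<^sup>2 + w\<^sup>2) / 2))"
      unfolding exp_cnj exp_add[symmetric] exp_of_real[symmetric]
      by (rule arg_cong[where f=exp]) (simp add: complex_eq_iff power2_eq_square field_simps)
    moreover have "exp (- Re (z\<^sup>2 + w\<^sup>2) / 2) * w1 t z w = 2 / (pi * sinh (2 * t)) * (exp (- (1/2) * (cmod a)\<^sup>2) * exp (- \<kappa> * (cmod \<eta>)\<^sup>2))"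
    proof -
      have c: "cosh (2 * t) / sinh (2 * t) = \<kappa> + 1" by (simp add: \<kappa>_def)
      have "- Re (z\<^sup>2 + w\<^sup>2) / 2 + (Re w * Im z - Im w * Re z) + (- (\<kappa> + 1) * ((Im z)\<^sup>2 + (Im w)\<^sup>2)) = - (1/2) * (cmod a)\<^sup>2 - \<kappa> * (cmod \<eta>)\<^sup>2"
        unfolding cmod_sq z_def w_def p \<Theta>_def by (simp add: power2_eq_square field_simps)
      then have "exp (- Re (z\<^sup>2 + w\<^sup>2) / 2) * (exp (Re w * Im z - Im w * Re z) * exp (- (\<kappa> + 1) * ((Im z)\<^sup>2 + (Im w)\<^sup>2)))
          = exp (- (1/2) * (cmod a)\<^sup>2) * exp (- \<kappa> * (cmod \<eta>)\<^sup>2)"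
        unfolding exp_add[symmetric] by (simp add: algebra_simps)
      then show ?thesis unfolding w1_def c by (simp add: field_simps)
    qed
    ultimately have g: "exp (- (z\<^sup>2 + w\<^sup>2) / 4) * cnj (exp (- (z\<^sup>2 + w\<^sup>2) / 4)) * of_real (w1 t z w)
        = of_real (2 / (pi * sinh (2 * t))) * (gs a * of_real (exp (- \<kappa> * (cmod \<eta>)\<^sup>2)))"
      by (simp only: of_real_mult[symmetric])
    have P: "PP j k a (cnj a + 2 * \<eta>) = (\<Sum>l\<le>k. of_nat (k choose l) * (- 2) ^ l * \<eta> ^ l * PP j (k - l) a (cnj a))" for j k
    proof -
      have pw: "(- (2 * \<eta>)) ^ l = (- 2) ^ l * \<eta> ^ l" for l
        by (simp add: power_mult_distrib[symmetric])
      show ?thesis unfolding PP_shift pw by (simp only: mult.assoc)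
    qed
    have "?F (\<Theta> p) = of_real (N j k * N j' k') * (PP j k a (cnj a + 2 * \<eta>) * cnj (PP j' k' a (cnj a + 2 * \<eta>)))
        * (exp (- (z\<^sup>2 + w\<^sup>2) / 4) * cnj (exp (- (z\<^sup>2 + w\<^sup>2) / 4)) * of_real (w1 t z w))"
      unfolding z_def[symmetric] w_def[symmetric] sh_def ab complex_cnj_mult complex_cnj_complex_of_real N_def of_real_mult
      by (simp only: mult_ac)
    also have "\<dots> = of_real D * ((PP j k a (cnj a + 2 * \<eta>) * cnj (PP j' k' a (cnj a + 2 * \<eta>))) * (gs a * of_real (exp (- \<kappa> * (cmod \<eta>)\<^sup>2))))"
      unfolding g D_def of_real_mult by (simp only: mult_ac)
    also have "PP j k a (cnj a + 2 * \<eta>) * cnj (PP j' k' a (cnj a + 2 * \<eta>)) = (\<Sum>l\<le>k. \<Sum>l'\<le>k'. (of_nat (k choose l) * (- 2) ^ l * \<eta> ^ l * PP j (k - l) a (cnj a)) *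
         (of_nat (k' choose l') * (- 2) ^ l' * cnj \<eta> ^ l' * cnj (PP j' (k' - l') a (cnj a))))"
      unfolding P cnj_sum sum_product by simp
    finally show ?thesis unfolding p sum_distrib_right by (simp add: mult_ac)
  qed
  define I where "I l l' = (if j = j' \<and> k - l = k' - l' then of_real (2 * pi * 2 ^ (j + (k - l)) * fact j * fact (k - l)) else 0)
     * (if l = l' then of_real (pi * fact l / \<kappa> ^ Suc l) else 0 :: complex)" for l l'
  have hb: "has_bochner_integral lborel (\<lambda>p. ?A l l' (fst p) * ?B l l' (snd p)) (I l l')" for l l'
  proof -
    have hm: "has_bochner_integral lborel (?B l l') (if l = l' then of_real (pi * fact l / \<kappa> ^ Suc l) else 0)"
      using integrable_gauss_monomial[OF \<kappa>(1), of l l'] integral_gauss_monomial[OF \<kappa>(1), of l l']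
      by (simp only: has_bochner_integral_iff simp_thms)
    show ?thesis unfolding I_def by (rule has_bochner_integral_pair_mult[OF PP_gram hm])
  qed
  have hG: "has_bochner_integral lborel ?G (of_real D * (\<Sum>l\<le>k. \<Sum>l'\<le>k'. ?C l l' * I l l'))"
    by (intro has_bochner_integral_mult_right has_bochner_integral_sum hb)
  have m: "?F \<in> borel_measurable borel"
    by (intro borel_measurable_continuous_onI continuous_intros)
  have hF: "has_bochner_integral lborel ?F (of_real D * (\<Sum>l\<le>k. \<Sum>l'\<le>k'. ?C l l' * I l l'))"
    using hG unfolding FG[symmetric] lpres_has_bochner_integral[OF lpres_\<Theta> m] .
  have "of_real D * (\<Sum>l\<le>k. \<Sum>l'\<le>k'. ?C l l' * I l l') = (if j = j' \<and> k = k' then of_real (2 * exp (2 * (2 * real k + 1) * t)) else 0)"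
  proof (cases "j = j' \<and> k = k'")
    case False
    have "I l l' = 0" if "l \<le> k" "l' \<le> k'" for l l'
      using False that by (auto simp: I_def)
    then show ?thesis using False by auto
  next
    case True
    have "(\<Sum>l\<le>k. \<Sum>l'\<le>k'. ?C l l' * I l l') = (\<Sum>l\<le>k. ?C l l * I l l)"
    proof (rule sum.cong[OF refl])
      fix l assume "l \<in> {..k}"
      then have "(\<Sum>l'\<le>k'. ?C l l' * I l l') = (\<Sum>l'\<in>{l}. ?C l l' * I l l')"
        using True by (intro sum.mono_neutral_right) (auto simp: I_def)
      then show "(\<Sum>l'\<le>k'. ?C l l' * I l l') = ?C l l * I l l" by simp
    qed
    also have "\<dots> = (\<Sum>l\<le>k. of_real (2 * pi\<^sup>2 * 2 ^ j * fact j * fact k / \<kappa>) * of_real (real (k choose l) * (4 / \<kappa>) ^ l * 2 ^ (k - l)))"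
    proof (rule sum.cong[OF refl])
      fix l assume l: "l \<in> {..k}"
      have f: "fact l * fact (k - l) * real (k choose l) = fact k"
        using l binomial_fact_lemma[of l k] by (metis atMost_iff of_nat_fact of_nat_mult)
      have "real (k choose l) * real (k choose l) * (-2) ^ l * (-2) ^ l * (2 * pi * 2 ^ (j + (k - l)) * fact j * fact (k - l) * (pi * fact l / \<kappa> ^ Suc l))
         = 2 * pi\<^sup>2 * 2 ^ j * fact j * (fact l * fact (k - l) * real (k choose l)) / \<kappa> * (real (k choose l) * (4 / \<kappa>) ^ l * 2 ^ (k - l))"
        using \<kappa>(1) by (simp add: power_add power_divide power_mult_distrib[symmetric] power2_eq_square field_simps)
      then have r: "real (k choose l) * real (k choose l) * (-2) ^ l * (-2) ^ l * (2 * pi * 2 ^ (j + (k - l)) * fact j * fact (k - l) * (pi * fact l / \<kappa> ^ Suc l))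
         = 2 * pi\<^sup>2 * 2 ^ j * fact j * fact k / \<kappa> * (real (k choose l) * (4 / \<kappa>) ^ l * 2 ^ (k - l))"
        unfolding f .
      have "?C l l * I l l = of_real (real (k choose l) * real (k choose l) * (-2) ^ l * (-2) ^ l * (2 * pi * 2 ^ (j + (k - l)) * fact j * fact (k - l) * (pi * fact l / \<kappa> ^ Suc l)))"
        using True by (simp add: I_def)
      also have "\<dots> = of_real (2 * pi\<^sup>2 * 2 ^ j * fact j * fact k / \<kappa>) * of_real (real (k choose l) * (4 / \<kappa>) ^ l * 2 ^ (k - l))"
        unfolding r of_real_mult ..
      finally show "?C l l * I l l = of_real (2 * pi\<^sup>2 * 2 ^ j * fact j * fact k / \<kappa>) * of_real (real (k choose l) * (4 / \<kappa>) ^ l * 2 ^ (k - l))" .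
    qed
    also have "\<dots> = of_real (2 * pi\<^sup>2 * 2 ^ j * fact j * fact k / \<kappa> * (4 / \<kappa> + 2) ^ k)"
      unfolding sum_distrib_left[symmetric] binomial_ring[of "4 / \<kappa>"] by simp
    finally have S: "(\<Sum>l\<le>k. \<Sum>l'\<le>k'. ?C l l' * I l l') = of_real (2 * pi\<^sup>2 * 2 ^ j * fact j * fact k / \<kappa> * (4 / \<kappa> + 2) ^ k)" .
    \<comment> \<open>Here the hyperbolic functions turn into the eigenvalue: (\<kappa> + 2) /
      \<kappa> is exp (4 t), and \<kappa> sinh (2 t) = exp (- 2 t) will supply the remaining exp (2
      t).\<close>
    have "4 / \<kappa> + 2 = 2 * exp (4 * t)"
    proof -
      have k2: "\<kappa> + 2 = exp (2 * t) / sinh (2 * t)"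
        using s cosh_plus_sinh[of "2 * t"] by (simp add: \<kappa>_def field_simps)
      have k1: "\<kappa> = exp (- 2 * t) / sinh (2 * t)" using \<kappa>(2) s by (simp add: field_simps)
      have "4 / \<kappa> + 2 = 2 * ((\<kappa> + 2) / \<kappa>)" using \<kappa>(1) by (simp add: field_simps)
      also have "(\<kappa> + 2) / \<kappa> = exp (2 * t) / exp (- 2 * t)"
        unfolding k2 using s by (subst k1) simp
      also have "\<dots> = exp (4 * t)" by (simp add: exp_diff[symmetric])
      finally show ?thesis .
    qed
    then have p: "(4 / \<kappa> + 2) ^ k = 2 ^ k * exp (4 * real k * t)"
      by (simp add: power_mult_distrib exp_of_nat_mult[symmetric] mult_ac)
    have "D = 1 / (2 * pi * 2 ^ (j + k) * fact j * fact k) * (2 / (pi * sinh (2 * t)))"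
      using True by (simp add: D_def N_def)
    then have "D * (2 * pi\<^sup>2 * 2 ^ j * fact j * fact k / \<kappa> * (4 / \<kappa> + 2) ^ k) = 2 / (\<kappa> * sinh (2 * t)) * exp (4 * real k * t)"
      unfolding p using \<kappa>(1) s by (simp add: power_add field_simps power2_eq_square)
    also have "\<dots> = 2 * exp (2 * (2 * real k + 1) * t)"
      unfolding \<kappa>(2) by (simp add: exp_minus field_simps exp_add[symmetric])
    finally show ?thesis unfolding S using True by (simp only: of_real_mult[symmetric] if_True simp_thms)
  qed
  with hF show ?thesis by simp
qed

section \<open>Entire functions\<close>

type_synonym 'n cc = "(complex ^ 'n) \<times> (complex ^ 'n)"

definition cs :: "complex \<Rightarrow> 'n::finite cc \<Rightarrow> 'n cc" where
  "cs a p = (a *s fst p, a *s snd p)"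

lemma cs_nth [simp]: "fst (cs a p) $ i = a * fst p $ i" "snd (cs a p) $ i = a * snd p $ i"
  by (simp_all add: cs_def)

lemma cs_simps [simp]: "cs 1 p = p" "cs 0 p = 0" "cs a 0 = 0" "cs a (cs b p) = cs (a * b) p"
  by (simp_all add: cs_def prod_eq_iff vec_eq_iff)

lemma cs_add: "cs (a + b) p = cs a p + cs b p" "cs a (p + q) = cs a p + cs a q"
  by (simp_all add: cs_def prod_eq_iff vec_eq_iff algebra_simps)

lemma cs_of_real: "cs (of_real r) p = r *\<^sub>R p"
  by (simp add: cs_def prod_eq_iff vec_eq_iff scaleR_conv_of_real[where 'a=complex])

lemma norm_cc_sq: "(norm (p::'n::finite cc))\<^sup>2 = (\<Sum>i\<in>UNIV. (cmod (fst p $ i))\<^sup>2 + (cmod (snd p $ i))\<^sup>2)"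
proof -
  have v: "(norm (x::complex^'n))\<^sup>2 = (\<Sum>i\<in>UNIV. (cmod (x $ i))\<^sup>2)" for x
    by (simp add: norm_vec_def L2_set_def sum_nonneg)
  have "(norm p)\<^sup>2 = (norm (fst p))\<^sup>2 + (norm (snd p))\<^sup>2"
    by (metis norm_Pair prod.collapse real_sqrt_pow2 sum_power2_ge_zero)
  then show ?thesis by (simp add: v sum.distrib)
qed

lemma norm_cs [simp]: "norm (cs a p) = cmod a * norm p"
proof -
  have "(norm (cs a p))\<^sup>2 = (cmod a * norm p)\<^sup>2"
    by (simp add: norm_cc_sq norm_mult power_mult_distrib sum_distrib_left distrib_left)
  then show ?thesis by (simp add: power2_eq_iff_nonneg)
qed

lemma linear_cs: "linear (\<lambda>a. cs a p)" "linear (cs a)"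
  by (auto intro!: linearI simp: cs_add) (auto simp: cs_def prod_eq_iff vec_eq_iff)

lemma continuous_on_vec_nth_snd [continuous_intros]: "continuous_on S f \<Longrightarrow> continuous_on S (\<lambda>x. snd (f x) $ i)"
  by (intro continuous_intros)

lemma continuous_on_cs [continuous_intros]:
  assumes "continuous_on S f" "continuous_on S g"
  shows "continuous_on S (\<lambda>x. cs (f x) (g x))"
  unfolding cs_def vector_scalar_mult_def
  by (intro continuous_intros assms continuous_on_vec_lambda)

lemma entire_iff: "entire F \<longleftrightarrow> (\<forall>p. \<exists>D. (F has_derivative D) (at p) \<and> (\<forall>a q. D (cs a q) = a * D q))"
  unfolding entire_def cs_def by simp

lemma entireI: "(\<And>p. (F has_derivative D p) (at p)) \<Longrightarrow> (\<And>p a q. D p (cs a q) = a * D p q) \<Longrightarrow> entire F"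
  unfolding entire_iff by blast

lemma entire_const: "entire (\<lambda>p. c)"
  by (rule entireI[where D="\<lambda>_ _. 0"]) auto

lemma entire_add: assumes "entire F" "entire G" shows "entire (\<lambda>p. F p + G p)"
  unfolding entire_iff
proof
  fix p
  from assms obtain D E where "(F has_derivative D) (at p)" "\<forall>a q. D (cs a q) = a * D q"
    "(G has_derivative E) (at p)" "\<forall>a q. E (cs a q) = a * E q" unfolding entire_iff by meson
  then show "\<exists>D. ((\<lambda>p. F p + G p) has_derivative D) (at p) \<and> (\<forall>a q. D (cs a q) = a * D q)"
    by (intro exI[of _ "\<lambda>h. D h + E h"] conjI has_derivative_add) (simp_all add: distrib_left)
qed

lemma entire_mult: assumes "entire F" "entire G" shows "entire (\<lambda>p. F p * G p)"
  unfolding entire_iff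
proof
  fix p
  from assms obtain D E where "(F has_derivative D) (at p)" "\<forall>a q. D (cs a q) = a * D q"
    "(G has_derivative E) (at p)" "\<forall>a q. E (cs a q) = a * E q" unfolding entire_iff by meson
  then show "\<exists>D. ((\<lambda>p. F p * G p) has_derivative D) (at p) \<and> (\<forall>a q. D (cs a q) = a * D q)"
    by (intro exI[of _ "\<lambda>h. F p * E h + D h * G p"] conjI has_derivative_mult) (simp_all add: algebra_simps)
qed

lemma entire_cmult: "entire F \<Longrightarrow> entire (\<lambda>p. c * F p)"
  by (rule entire_mult[OF entire_const])

lemma entire_diff: "entire F \<Longrightarrow> entire G \<Longrightarrow> entire (\<lambda>p. F p - G p)"
  using entire_add[of F "\<lambda>p. -1 * G p"] entire_cmult[of G "-1"] by simp

lemma entire_sum: "(\<And>i. i \<in> I \<Longrightarrow> entire (F i)) \<Longrightarrow> entire (\<lambda>p. \<Sum>i\<in>I. F i p)"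
  by (induction I rule: infinite_finite_induct) (auto intro: entire_const entire_add)

lemma entire_prod: "(\<And>i. i \<in> I \<Longrightarrow> entire (F i)) \<Longrightarrow> entire (\<lambda>p. \<Prod>i\<in>I. F i p)"
  by (induction I rule: infinite_finite_induct) (auto intro: entire_const entire_mult)

lemma entire_power: "entire F \<Longrightarrow> entire (\<lambda>p. F p ^ k)"
  by (induction k) (auto intro: entire_const entire_mult)

lemma entire_linear:
  assumes "linear f" "\<And>a q. f (cs a q) = a * f q"
  shows "entire f"
  by (rule entireI[where D="\<lambda>_. f"]) (use assms linear_imp_has_derivative in auto)

lemma entire_fst: "entire (\<lambda>p. fst p $ i)" and entire_snd: "entire (\<lambda>p. snd p $ i)"
  by (rule entire_linear; auto intro!: linearI)+

lemma entire_exp: assumes "entire F" shows "entire (\<lambda>p. exp (F p))"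
  unfolding entire_iff
proof
  fix p
  from assms obtain D where D: "(F has_derivative D) (at p)" "\<forall>a q. D (cs a q) = a * D q"
    unfolding entire_iff by meson
  have "(exp has_derivative (*) (exp (F p))) (at (F p))"
    using DERIV_exp[of "F p"] by (simp add: has_field_derivative_def)
  from has_derivative_compose[OF D(1) this]
  show "\<exists>D. ((\<lambda>p. exp (F p)) has_derivative D) (at p) \<and> (\<forall>a q. D (cs a q) = a * D q)"
    using D(2) by (intro exI[of _ "\<lambda>h. exp (F p) * D h"]) simp
qed

lemma entire_translate: assumes "entire F" shows "entire (\<lambda>p. F (p + q))"
  unfolding entire_iff
proof
  fix p
  from assms obtain D where D: "(F has_derivative D) (at (p + q))" "\<forall>a q. D (cs a q) = a * D q"
    unfolding entire_iff by meson
  have "((\<lambda>p. p + q) has_derivative (\<lambda>h. h)) (at p)" by (auto intro!: derivative_eq_intros)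
  from has_derivative_compose[OF this D(1)]
  show "\<exists>D. ((\<lambda>p. F (p + q)) has_derivative D) (at p) \<and> (\<forall>a q. D (cs a q) = a * D q)"
    using D(2) by auto
qed

lemma entire_PP: "entire F \<Longrightarrow> entire G \<Longrightarrow> entire (\<lambda>p. PP j k (F p) (G p))"
  by (induction j arbitrary: k)
     (auto intro!: entire_power entire_add entire_mult entire_const entire_cmult[of _ "-1", simplified])

lemma entire_SH: "entire (SH \<alpha> \<beta>)"
  unfolding SH_def[abs_def] sh_def divide_inverse
  by (intro entire_prod entire_mult entire_const entire_PP entire_add entire_diff entire_fst entire_snd entire_exp
      entire_cmult[of _ "-1", simplified] entire_power)

lemma entire_imp_continuous: "entire F \<Longrightarrow> continuous_on S F"
  unfolding entire_iff by (meson continuous_at_imp_continuous_on has_derivative_continuous)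

lemma entire_imp_measurable: "entire F \<Longrightarrow> F \<in> borel_measurable borel"
  by (intro borel_measurable_continuous_onI entire_imp_continuous)

text \<open>Restriction to a complex line. Complex homogeneity of the real derivative makes the
  slice complex differentiable, which gives access to the theory of one variable.\<close>

lemma entire_slice:
  assumes "entire F"
  shows "(\<lambda>c. F (p + cs c h)) holomorphic_on S"
    and "(F has_derivative D) (at p) \<Longrightarrow> ((\<lambda>c. F (p + cs c h)) has_field_derivative D h) (at 0)"
proof -
  have l: "((\<lambda>c. p + cs c h) has_derivative (\<lambda>d. cs d h)) (at c)" for c
    using has_derivative_add[OF has_derivative_const linear_imp_has_derivative[OF linear_cs(1)]] by simp
  have *: "((\<lambda>c. F (p + cs c h)) has_field_derivative D h) (at c)" if "(F has_derivative D) (at (p + cs c h))" for D c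
  proof -
    from assms obtain D' where D': "(F has_derivative D') (at (p + cs c h))" "\<forall>a q. D' (cs a q) = a * D' q"
      unfolding entire_iff by meson
    have "D = D'" using has_derivative_unique[OF that D'(1)] .
    with has_derivative_compose[OF l that] D'(2) show ?thesis
      by (simp add: has_field_derivative_def mult.commute[of _ "D' h"] cong: if_cong)
  qed
  show "(\<lambda>c. F (p + cs c h)) holomorphic_on S"
  proof (rule holomorphic_onI)
    fix c
    from assms obtain D' where D': "(F has_derivative D') (at (p + cs c h))"
      unfolding entire_iff by meson
    from *[OF this] show "(\<lambda>c. F (p + cs c h)) field_differentiable at c within S"
      using field_differentiable_at_within field_differentiable_def by blast
  qed
  show "(F has_derivative D) (at p) \<Longrightarrow> ((\<lambda>c. F (p + cs c h)) has_field_derivative D h) (at 0)"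
    using *[where c=0] by simp
qed

text \<open>With x and y the real and imaginary parts of \<open>p\<close>, the function
  \<open>c\<close> \<mapsto> F (x + c y) vanishes for real \<open>c\<close>, hence also at the
  imaginary unit.\<close>

lemma entire_eq_0_if_restrict:
  assumes F: "entire F" and z: "\<And>x u. restrict_real F (x, u) = 0"
  shows "F p = 0"
proof -
  let ?x = "(\<chi> i. of_real (Re (fst p $ i)), \<chi> i. of_real (Re (snd p $ i)))"
  let ?y = "(\<chi> i. of_real (Im (fst p $ i)), \<chi> i. of_real (Im (snd p $ i)))"
  have p: "p = ?x + cs \<i> ?y"
    by (simp add: prod_eq_iff vec_eq_iff complex_eq_iff)
  have "F (?x + cs \<i> ?y) = 0"
  proof (rule analytic_continuation[of "\<lambda>c. F (?x + cs c ?y)" UNIV \<real> 0])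
    show "(\<lambda>c. F (?x + cs c ?y)) holomorphic_on UNIV" by (rule entire_slice(1)[OF F])
    show "(0::complex) islimpt \<real>"
    proof (unfold islimpt_approachable, intro allI impI)
      fix e :: real assume "e > 0"
      then show "\<exists>x'\<in>\<real>. x' \<noteq> 0 \<and> dist x' (0::complex) < e"
        by (intro bexI[of _ "of_real (e / 2)"]) auto
    qed
    fix c :: complex assume "c \<in> \<real>"
    then obtain r where c: "c = of_real r" by (auto elim: Reals_cases)
    have "?x + cs c ?y = (\<chi> i. of_real ((\<chi> i. Re (fst p $ i) + r * Im (fst p $ i)) $ i), \<chi> i. of_real ((\<chi> i. Re (snd p $ i) + r * Im (snd p $ i)) $ i))"
      by (simp add: prod_eq_iff vec_eq_iff c)
    then show "F (?x + cs c ?y) = 0"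
      using z[of "\<chi> i. Re (fst p $ i) + r * Im (fst p $ i)" "\<chi> i. Re (snd p $ i) + r * Im (snd p $ i)"]
      by (simp add: restrict_real_def)
  qed auto
  then show ?thesis using p by simp
qed

text \<open>Cauchy's estimate on the slice in direction \<open>h\<close>; the radius 1 / norm h
  keeps the disc inside the unit ball around \<open>p\<close>.\<close>

lemma entire_deriv_bound:
  assumes F: "entire F" and D: "(F has_derivative D) (at p)" and b: "\<And>q. q \<in> cball p 1 \<Longrightarrow> cmod (F q) \<le> M"
  shows "cmod (D h) \<le> M * norm h"
proof (cases "h = 0")
  case True
  then show ?thesis using linear_0[OF has_derivative_linear[OF D]] by simp
next
  case False
  let ?f = "\<lambda>c. F (p + cs c h)"
  have "cmod ((deriv ^^ 1) ?f 0) \<le> fact 1 * M / (1 / norm h) ^ 1"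
  proof (rule Cauchy_inequality)
    show "?f holomorphic_on ball 0 (1 / norm h)" by (rule entire_slice(1)[OF F])
    show "continuous_on (cball 0 (1 / norm h)) ?f"
      using entire_slice(1)[OF F] holomorphic_on_imp_continuous_on by blast
    show "cmod (?f c) \<le> M" if "cmod (0 - c) = 1 / norm h" for c
      using that False by (intro b) (simp add: dist_norm)
  qed (use False in auto)
  then show ?thesis
    using DERIV_imp_deriv[OF entire_slice(2)[OF F D, of h]] by simp
qed

text \<open>The Weierstrass convergence theorem. Locally uniform convergence passes to the
  derivatives by \<open>entire_deriv_bound\<close>, and their complex homogeneity survives in the
  limit.\<close>

lemma entire_limit:
  fixes f :: "nat \<Rightarrow> 'n::finite cc \<Rightarrow> complex"
  assumes f: "\<And>n. entire (f n)" and u: "\<And>R. uniform_limit (cball 0 R) f F sequentially"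
  shows "entire F"
proof -
  obtain D where D: "\<And>n p. (f n has_derivative D n p) (at p)" "\<And>n p a q. D n p (cs a q) = a * D n p q"
    using f unfolding entire_iff by metis
  have C: "\<exists>N. \<forall>m\<ge>N. \<forall>n\<ge>N. \<forall>p\<in>cball 0 R. \<forall>h. cmod (D m p h - D n p h) \<le> e * norm h" if "e > 0" for e R :: real
  proof -
    \<comment> \<open>The radius \<open>R + 1\<close> leaves room for the unit balls of
      \<open>entire_deriv_bound\<close>.\<close>
    from uniform_limitD[OF u[of "R + 1"], of "e / 2"] that obtain N where N: "\<And>n q. n \<ge> N \<Longrightarrow> q \<in> cball 0 (R + 1) \<Longrightarrow> dist (f n q) (F q) < e / 2"
      unfolding eventually_sequentially by (meson half_gt_zero)
    show ?thesis
    proof (intro exI[of _ N] allI impI ballI)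
      fix m n :: nat and p h :: "'n cc" assume mn: "m \<ge> N" "n \<ge> N" and p: "p \<in> cball 0 R"
      have "cmod ((\<lambda>h. D m p h - D n p h) h) \<le> e * norm h"
      proof (rule entire_deriv_bound)
        show "entire (\<lambda>p. f m p - f n p)" by (intro entire_diff f)
        show "((\<lambda>p. f m p - f n p) has_derivative (\<lambda>h. D m p h - D n p h)) (at p)"
          by (intro has_derivative_diff D)
        fix q assume q: "q \<in> cball p 1"
        have "norm q \<le> norm p + norm (p - q)" using norm_triangle_ineq4[of p "p - q"] by simp
        then have "q \<in> cball 0 (R + 1)" using p q by (auto simp: dist_norm)
        with N[OF mn(1)] N[OF mn(2)] have "dist (f m q) (F q) < e / 2" "dist (f n q) (F q) < e / 2" by auto
        then show "cmod (f m q - f n q) \<le> e"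
          using dist_triangle_half_l[of "f m q" "F q" e "f n q"] by (simp add: dist_norm)
      qed
      then show "cmod (D m p h - D n p h) \<le> e * norm h" .
    qed
  qed
  have conv: "convergent (\<lambda>n. D n p h)" for p h
    unfolding Cauchy_convergent_iff[symmetric]
  proof (rule metric_CauchyI)
    fix e :: real assume e: "e > 0"
    have "e / (norm h + 1) > 0" using e by (simp add: add_nonneg_pos)
    from C[OF this, of "norm p"] obtain N where N: "\<And>m n. m \<ge> N \<Longrightarrow> n \<ge> N \<Longrightarrow> cmod (D m p h - D n p h) \<le> e / (norm h + 1) * norm h"
      by (metis mem_cball_0 order_refl)
    have n1: "norm h + 1 > 0" by (simp add: add_nonneg_pos)
    have "e * norm h < e * (norm h + 1)" using e by simp
    then have "e / (norm h + 1) * norm h < e" using n1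
      by (simp add: pos_divide_less_eq)
    then show "\<exists>N. \<forall>m\<ge>N. \<forall>n\<ge>N. dist (D m p h) (D n p h) < e"
      using N by (intro exI[of _ N]) (auto simp: dist_norm intro: le_less_trans)
  qed
  define D' where "D' p h = lim (\<lambda>n. D n p h)" for p h
  have L: "(\<lambda>n. D n p h) \<longlonglongrightarrow> D' p h" for p h
    unfolding D'_def using conv convergent_LIMSEQ_iff by blast
  show ?thesis
  proof (rule entireI[where D=D'])
    fix p a q
    have "(\<lambda>n. a * D n p q) \<longlonglongrightarrow> a * D' p q" by (intro tendsto_intros L)
    then show "D' p (cs a q) = a * D' p q"
      using L[of p "cs a q"] unfolding D(2) by (rule LIMSEQ_unique[rotated])
  next
    fix p
    have F: "(\<lambda>n. f n q) \<longlonglongrightarrow> F q" for q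
      using tendsto_uniform_limitI[OF u[of "norm q"]] by simp
    have "\<exists>g. \<forall>x\<in>ball p 1. (\<lambda>n. f n x) \<longlonglongrightarrow> g x \<and> (g has_derivative D' x) (at x within ball p 1)"
    proof (rule has_derivative_sequence[where ?x0.0=p and l="F p"])
      show "(f n has_derivative D n x) (at x within ball p 1)" for n x
        using D(1) has_derivative_at_withinI by blast
      fix e :: real assume "e > 0"
      from C[OF this, of "norm p + 1"] obtain N where N: "\<And>m n q h. m \<ge> N \<Longrightarrow> n \<ge> N \<Longrightarrow> q \<in> cball 0 (norm p + 1) \<Longrightarrow> cmod (D m q h - D n q h) \<le> e * norm h"
        by metis
      have "cmod (D n q h - D' q h) \<le> e * norm h" if "n \<ge> N" "q \<in> ball p 1" for n q h
      proof (rule tendsto_upperbound)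
        show "(\<lambda>m. cmod (D n q h - D m q h)) \<longlonglongrightarrow> cmod (D n q h - D' q h)"
          by (intro tendsto_intros L)
        have "norm q \<le> norm p + norm (p - q)" using norm_triangle_ineq4[of p "p - q"] by simp
        then have "q \<in> cball 0 (norm p + 1)" using that(2) by (auto simp: dist_norm)
        then show "\<forall>\<^sub>F m in sequentially. cmod (D n q h - D m q h) \<le> e * norm h"
          using N that(1) unfolding eventually_sequentially by blast
      qed simp
      then show "\<forall>\<^sub>F n in sequentially. \<forall>x\<in>ball p 1. \<forall>h. cmod (D n x h - D' x h) \<le> e * norm h"
        unfolding eventually_sequentially by blast
    qed (use F in auto)
    then obtain g where g: "\<And>x. x \<in> ball p 1 \<Longrightarrow> (\<lambda>n. f n x) \<longlonglongrightarrow> g x" "\<And>x. x \<in> ball p 1 \<Longrightarrow> (g has_derivative D' x) (at x within ball p 1)"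
      by blast
    have "g x = F x" if "x \<in> ball p 1" for x using g(1)[OF that] F LIMSEQ_unique by blast
    then have "(F has_derivative D' p) (at p within ball p 1)"
      using has_derivative_transform[OF _ _ g(2)[of p], of F] by simp
    then show "(F has_derivative D' p) (at p)"
      by (simp add: at_within_open[of p "ball p 1"])
  qed
qed

section \<open>Mean values\<close>

text \<open>Cauchy's integral formula written in the angle; the imaginary unit coming from the
  parametrisation is divided out.\<close>

lemma circle_mean:
  assumes "f holomorphic_on UNIV" "r > 0"
  shows "((\<lambda>\<theta>. f (z + of_real r * cis \<theta>)) has_integral of_real (2 * pi) * f z) {0..2 * pi}"
proof -
  have "((\<lambda>u. f u / (u - z)) has_contour_integral (2 * of_real pi * \<i> * f z)) (circlepath z r)"
    using assms holomorphic_on_subset by (intro Cauchy_integral_circlepath_simple) (auto intro: holomorphic_on_subset)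
  then have "((\<lambda>\<theta>. f (z + of_real r * cis \<theta>) / (z + of_real r * cis \<theta> - z) * of_real r * \<i> * cis \<theta>) has_integral 2 * of_real pi * \<i> * f z) {0..2 * pi}"
    unfolding circlepath_def by (subst (asm) has_contour_integral_part_circlepath_iff) auto
  moreover have "(\<lambda>\<theta>. f (z + of_real r * cis \<theta>) / (z + of_real r * cis \<theta> - z) * of_real r * \<i> * cis \<theta>) = (\<lambda>\<theta>. \<i> * f (z + of_real r * cis \<theta>))"
    using assms(2) by (simp add: fun_eq_iff)
  ultimately have "((\<lambda>\<theta>. \<i> * f (z + of_real r * cis \<theta>)) has_integral 2 * of_real pi * \<i> * f z) {0..2 * pi}" by simp
  from has_integral_mult_right[OF this, of "- \<i>"]
  have "((\<lambda>\<theta>. - \<i> * (\<i> * f (z + of_real r * cis \<theta>))) has_integral - \<i> * (\<i> * (of_real (2 * pi) * f z))) {0..2 * pi}"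
    by (simp add: mult_ac)
  moreover have "- \<i> * (\<i> * w) = w" for w by (simp add: mult.assoc[symmetric])
  ultimately show ?thesis by simp
qed

text \<open>The angle as a finite measure of total mass 2 pi, so that Tonelli and Fubini apply to
  averages over circles.\<close>

definition circ :: "real measure" where "circ = restrict_space lborel {0..2 * pi}"

lemma finite_measure_circ: "finite_measure circ"
  unfolding circ_def by (rule finite_measureI) (simp add: emeasure_restrict_space space_restrict_space)

lemma sets_circ_measurable: "(\<lambda>\<theta>. \<theta>) \<in> circ \<rightarrow>\<^sub>M borel"
  unfolding circ_def by (rule measurable_restrict_space1) simp

lemma integral_circ_mean:
  assumes "f holomorphic_on UNIV" "r > 0"
  shows "integrable circ (\<lambda>\<theta>. f (z + of_real r * cis \<theta>))"
    and "(\<integral>\<theta>. f (z + of_real r * cis \<theta>) \<partial>circ) = of_real (2 * pi) * f z"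
proof -
  have c: "continuous_on A (\<lambda>\<theta>. f (z + of_real r * cis \<theta>))" for A
    by (rule continuous_on_compose2[OF holomorphic_on_imp_continuous_on[OF assms(1)]])
       (intro continuous_intros, simp)
  have s: "set_integrable lborel {0..2 * pi} (\<lambda>\<theta>. f (z + of_real r * cis \<theta>))"
    by (intro borel_integrable_atLeastAtMost' c)
  then show "integrable circ (\<lambda>\<theta>. f (z + of_real r * cis \<theta>))"
    unfolding circ_def set_integrable_def by (subst integrable_restrict_space) auto
  have "(\<integral>\<theta>. f (z + of_real r * cis \<theta>) \<partial>circ) = (LINT \<theta>:{0..2 * pi}|lborel. f (z + of_real r * cis \<theta>))"
    unfolding circ_def set_lebesgue_integral_def by (subst integral_restrict_space) auto
  also have "\<dots> = of_real (2 * pi) * f z"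
    using set_borel_integral_eq_integral(2)[OF s] integral_unique[OF circle_mean[OF assms]] by simp
  finally show "(\<integral>\<theta>. f (z + of_real r * cis \<theta>) \<partial>circ) = of_real (2 * pi) * f z" .
qed

lemma lpres_cs: "cmod c = 1 \<Longrightarrow> lpres (cs c :: 'n::finite cc \<Rightarrow> 'n cc)"
  using lpres_scalar[of c, where 'n='n] by (simp add: cs_def[abs_def])

text \<open>Integrate over the circle group as well: each rotation preserves Lebesgue measure and
  \<psi>, while for fixed \<open>p\<close> the mean of \<open>H\<close> over the rotated points is
  \<open>H 0\<close>.\<close>

lemma entire_mean_value:
  fixes H :: "'n::finite cc \<Rightarrow> complex" and \<psi> :: "'n cc \<Rightarrow> real"
  assumes H: "entire H" and \<psi>: "continuous_on UNIV \<psi>" "\<And>c p. cmod c = 1 \<Longrightarrow> \<psi> (cs c p) = \<psi> p"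
    and i: "integrable lborel (\<lambda>p. H p * of_real (\<psi> p))" and i\<psi>: "integrable lborel \<psi>"
  shows "(\<integral>p. H p * of_real (\<psi> p) \<partial>lborel) = H 0 * of_real (\<integral>p. \<psi> p \<partial>lborel)"
proof -
  interpret C: finite_measure circ by (rule finite_measure_circ)
  interpret P: pair_sigma_finite circ "lborel :: 'n cc measure" ..
  let ?f = "\<lambda>\<theta> p. H (cs (cis \<theta>) p) * of_real (\<psi> p)"
  have cH: "continuous_on UNIV (\<lambda>x::real \<times> 'n cc. H (cs (cis (fst x)) (snd x)) * of_real (\<psi> (snd x)))"
    by (intro continuous_intros continuous_on_compose2[OF entire_imp_continuous[OF H, of UNIV]] continuous_on_compose2[OF \<psi>(1)]) auto
  have m0: "(\<lambda>x. ?f (fst x) (snd x)) \<in> borel_measurable (borel \<Otimes>\<^sub>M borel)"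
    unfolding borel_prod by (rule borel_measurable_continuous_onI[OF cH])
  have "(\<lambda>x. (fst x, snd x)) \<in> (circ \<Otimes>\<^sub>M (lborel :: 'n cc measure)) \<rightarrow>\<^sub>M borel \<Otimes>\<^sub>M borel"
    by (intro measurable_Pair measurable_compose[OF measurable_fst sets_circ_measurable]) measurable
  from measurable_compose[OF this m0]
  have m: "(\<lambda>x. ?f (fst x) (snd x)) \<in> borel_measurable (circ \<Otimes>\<^sub>M lborel)" by simp
  have mg: "(\<lambda>p. H p * of_real (\<psi> p)) \<in> borel_measurable borel"
    using entire_imp_measurable[OF H] borel_measurable_continuous_onI[OF \<psi>(1)] by measurable
  have e: "?f \<theta> p = H (cs (cis \<theta>) p) * of_real (\<psi> (cs (cis \<theta>) p))" for \<theta> p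
    using \<psi>(2) by simp
  have i1: "integrable lborel (?f \<theta>)" for \<theta>
    unfolding e using lpres_integrable_iff[OF lpres_cs mg, of "cis \<theta>"] i by simp
  have i2: "(\<integral>p. ?f \<theta> p \<partial>lborel) = (\<integral>p. H p * of_real (\<psi> p) \<partial>lborel)" for \<theta>
    unfolding e using lpres_integral[OF lpres_cs mg, of "cis \<theta>"] by simp
  have i3: "(\<integral>p. norm (?f \<theta> p) \<partial>lborel) = (\<integral>p. norm (H p * of_real (\<psi> p)) \<partial>lborel)" for \<theta>
    unfolding e using lpres_integral[OF lpres_cs, of "cis \<theta>" "\<lambda>p. norm (H p * of_real (\<psi> p))"] mg by simp
  have I: "integrable (circ \<Otimes>\<^sub>M lborel) (\<lambda>x. ?f (fst x) (snd x))"
    by (rule P.Fubini_integrable[OF m]) (simp_all add: i1 i3)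
  have e3: "(\<integral>\<theta>. ?f \<theta> p \<partial>circ) = of_real (2 * pi) * H 0 * of_real (\<psi> p)" for p
  proof -
    have "(\<integral>\<theta>. H (0 + cs (0 + of_real 1 * cis \<theta>) p) \<partial>circ) = of_real (2 * pi) * H (0 + cs 0 p)"
      by (rule integral_circ_mean(2)[OF entire_slice(1)[OF H]]) simp
    then show ?thesis by simp
  qed
  have "of_real (2 * pi) * (H 0 * of_real (\<integral>p. \<psi> p \<partial>lborel)) = (\<integral>p. \<integral>\<theta>. ?f \<theta> p \<partial>circ \<partial>lborel)"
    unfolding e3 using i\<psi> by (simp add: mult.assoc)
  also have "\<dots> = (\<integral>\<theta>. \<integral>p. ?f \<theta> p \<partial>lborel \<partial>circ)"
    using P.Fubini_integral[of ?f] I by (simp add: case_prod_unfold)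
  also have "\<dots> = of_real (2 * pi) * (\<integral>p. H p * of_real (\<psi> p) \<partial>lborel)"
    unfolding i2 by (simp add: measure_def circ_def emeasure_restrict_space space_restrict_space scaleR_conv_of_real)
  finally show ?thesis by simp
qed

section \<open>Square integrable functions\<close>

lemma borel_measurable_cnj [measurable (raw)]:
  "f \<in> borel_measurable M \<Longrightarrow> (\<lambda>x. cnj (f x)) \<in> borel_measurable M"
  by (rule measurable_compose[OF _ borel_measurable_continuous_onI[OF continuous_on_cnj[OF continuous_on_id]]])

definition sqi :: "'a measure \<Rightarrow> ('a \<Rightarrow> complex) \<Rightarrow> bool" where
  "sqi M f \<longleftrightarrow> f \<in> borel_measurable M \<and> integrable M (\<lambda>x. (cmod (f x))\<^sup>2)"

definition nm2 :: "'a measure \<Rightarrow> ('a \<Rightarrow> complex) \<Rightarrow> real" where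
  "nm2 M f = (\<integral>x. (cmod (f x))\<^sup>2 \<partial>M)"

definition ip :: "'a measure \<Rightarrow> ('a \<Rightarrow> complex) \<Rightarrow> ('a \<Rightarrow> complex) \<Rightarrow> complex" where
  "ip M f g = (\<integral>x. f x * cnj (g x) \<partial>M)"

lemma sqi_measurable: "sqi M f \<Longrightarrow> f \<in> borel_measurable M" by (simp add: sqi_def)

lemma sqi_integrable: "sqi M f \<Longrightarrow> integrable M (\<lambda>x. (cmod (f x))\<^sup>2)" by (simp add: sqi_def)

lemma nm2_nonneg: "0 \<le> nm2 M f" unfolding nm2_def by (rule Bochner_Integration.integral_nonneg) simp

lemma sqi_mult_integrable:
  assumes "sqi M f" "sqi M g" shows "integrable M (\<lambda>x. f x * cnj (g x))"
proof (rule Bochner_Integration.integrable_bound[OF Bochner_Integration.integrable_add[OF assms[THEN sqi_integrable]]])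
  have [measurable]: "f \<in> borel_measurable M" "g \<in> borel_measurable M" using assms by (auto simp: sqi_def)
  show "(\<lambda>x. f x * cnj (g x)) \<in> borel_measurable M" by measurable
  have "a * b \<le> a\<^sup>2 + b\<^sup>2" if "0 \<le> a" "0 \<le> b" for a b :: real
  proof -
    have "2 * (a * b) \<le> a\<^sup>2 + b\<^sup>2" using sum_squares_bound[of a b] by simp
    moreover have "0 \<le> a * b" using that by simp
    ultimately show ?thesis by linarith
  qed
  then show "AE x in M. norm (f x * cnj (g x)) \<le> norm ((cmod (f x))\<^sup>2 + (cmod (g x))\<^sup>2)"
    by (intro AE_I2) (simp add: norm_mult)
qed

lemma sqi_add: assumes "sqi M f" "sqi M g" shows "sqi M (\<lambda>x. f x + g x)"
  unfolding sqi_def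
proof
  have [measurable]: "f \<in> borel_measurable M" "g \<in> borel_measurable M" using assms by (auto simp: sqi_def)
  show m: "(\<lambda>x. f x + g x) \<in> borel_measurable M" by measurable
  show "integrable M (\<lambda>x. (cmod (f x + g x))\<^sup>2)"
  proof (rule Bochner_Integration.integrable_bound)
    show "integrable M (\<lambda>x. 2 * (cmod (f x))\<^sup>2 + 2 * (cmod (g x))\<^sup>2)"
      using assms by (intro Bochner_Integration.integrable_add integrable_mult_right sqi_integrable)
    have "(cmod (a + b))\<^sup>2 \<le> 2 * (cmod a)\<^sup>2 + 2 * (cmod b)\<^sup>2" for a b
    proof -
      have "(cmod (a + b))\<^sup>2 \<le> (cmod a + cmod b)\<^sup>2" by (intro power_mono norm_triangle_ineq) simp
      also have "\<dots> \<le> 2 * (cmod a)\<^sup>2 + 2 * (cmod b)\<^sup>2"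
        using sum_squares_bound[of "cmod a" "cmod b"] by (simp add: power2_sum)
      finally show ?thesis .
    qed
    then show "AE x in M. norm ((cmod (f x + g x))\<^sup>2) \<le> norm (2 * (cmod (f x))\<^sup>2 + 2 * (cmod (g x))\<^sup>2)"
      by (intro AE_I2) (simp add: abs_of_nonneg)
  qed (use m in measurable)
qed

lemma sqi_cmult: "sqi M f \<Longrightarrow> sqi M (\<lambda>x. c * f x)"
  by (auto simp: sqi_def norm_mult power_mult_distrib)

lemma sqi_diff: "sqi M f \<Longrightarrow> sqi M g \<Longrightarrow> sqi M (\<lambda>x. f x - g x)"
  using sqi_add[of M f "\<lambda>x. -1 * g x"] sqi_cmult[of M g "-1"] by simp

lemma sqi_0: "sqi M (\<lambda>x. 0)" by (simp add: sqi_def)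

lemma sqi_sum: "(\<And>i. i \<in> I \<Longrightarrow> sqi M (f i)) \<Longrightarrow> sqi M (\<lambda>x. \<Sum>i\<in>I. f i x)"
  by (induction I rule: infinite_finite_induct) (auto intro: sqi_0 sqi_add)

lemma ip_cnj: "ip M g f = cnj (ip M f g)"
  unfolding ip_def Bochner_Integration.integral_cnj[symmetric] by (simp add: mult.commute)

lemma ip_self: "ip M f f = of_real (nm2 M f)"
proof -
  have "ip M f f = (\<integral>x. complex_of_real ((cmod (f x))\<^sup>2) \<partial>M)"
    unfolding ip_def by (simp add: complex_norm_square del: of_real_power)
  then show ?thesis unfolding nm2_def by (simp only: integral_complex_of_real)
qed

lemma ip_add: "sqi M f \<Longrightarrow> sqi M g \<Longrightarrow> sqi M h \<Longrightarrow> ip M (\<lambda>x. f x + g x) h = ip M f h + ip M g h"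
  unfolding ip_def
  by (subst Bochner_Integration.integral_add[symmetric]) (auto intro: sqi_mult_integrable simp: distrib_right)

lemma ip_cmult: "ip M (\<lambda>x. c * f x) h = c * ip M f h"
  unfolding ip_def by (simp add: mult.assoc)

lemma ip_diff: "sqi M f \<Longrightarrow> sqi M g \<Longrightarrow> sqi M h \<Longrightarrow> ip M (\<lambda>x. f x - g x) h = ip M f h - ip M g h"
  using ip_add[of M f "\<lambda>x. -1 * g x" h] ip_cmult[of M "-1" g h] sqi_cmult[of M g "-1"] by simp

lemma ip_sum: "(\<And>i. i \<in> I \<Longrightarrow> sqi M (f i)) \<Longrightarrow> sqi M h \<Longrightarrow> ip M (\<lambda>x. \<Sum>i\<in>I. f i x) h = (\<Sum>i\<in>I. ip M (f i) h)"
  by (induction I rule: infinite_finite_induct) (auto simp: ip_def[of M "\<lambda>x. 0"] ip_add sqi_sum)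

lemma ip_cmult_right: "ip M h (\<lambda>x. c * f x) = cnj c * ip M h f"
  using ip_cnj[of M h "\<lambda>x. c * f x"] ip_cnj[of M h f] by (simp add: ip_cmult)

lemma ip_sum_right: "(\<And>i. i \<in> I \<Longrightarrow> sqi M (f i)) \<Longrightarrow> sqi M h \<Longrightarrow> ip M h (\<lambda>x. \<Sum>i\<in>I. f i x) = (\<Sum>i\<in>I. ip M h (f i))"
  by (subst ip_cnj, subst ip_sum) (auto simp: ip_cnj[of M h])

lemma nm2_cmult: "nm2 M (\<lambda>x. c * f x) = (cmod c)\<^sup>2 * nm2 M f"
  unfolding nm2_def by (simp add: norm_mult power_mult_distrib)

lemma nm2_add:
  assumes "sqi M f" "sqi M g"
  shows "nm2 M (\<lambda>x. f x + g x) = nm2 M f + 2 * Re (ip M f g) + nm2 M g"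
proof -
  have i: "integrable M (\<lambda>x. f x * cnj (g x))" using assms by (rule sqi_mult_integrable)
  then have iR: "integrable M (\<lambda>x. 2 * Re (f x * cnj (g x)))" by (intro integrable_mult_right integrable_Re)
  have "(cmod (a + b))\<^sup>2 = (cmod a)\<^sup>2 + 2 * Re (a * cnj b) + (cmod b)\<^sup>2" for a b
    unfolding cmod_sq by (simp add: power2_eq_square algebra_simps)
  then have "nm2 M (\<lambda>x. f x + g x) = (\<integral>x. (cmod (f x))\<^sup>2 + 2 * Re (f x * cnj (g x)) + (cmod (g x))\<^sup>2 \<partial>M)"
    unfolding nm2_def by simp
  also have "\<dots> = nm2 M f + (\<integral>x. 2 * Re (f x * cnj (g x)) \<partial>M) + nm2 M g"
    unfolding nm2_def using assms[THEN sqi_integrable] iR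
    by (simp only: Bochner_Integration.integral_add Bochner_Integration.integrable_add)
  also have "(\<integral>x. 2 * Re (f x * cnj (g x)) \<partial>M) = 2 * Re (ip M f g)"
    unfolding ip_def using i by (simp only: integral_mult_right_zero integral_Re)
  finally show ?thesis .
qed

lemma nm2_diff:
  assumes "sqi M f" "sqi M g"
  shows "nm2 M (\<lambda>x. f x - g x) = nm2 M f - 2 * Re (ip M f g) + nm2 M g"
  using nm2_add[OF assms(1) sqi_cmult[OF assms(2), of "-1"]] nm2_cmult[of M "-1" g] ip_cmult_right[of M f "-1" g] by simp

lemma ip_Cauchy_Schwarz:
  assumes "sqi M f" "sqi M g"
  shows "(cmod (ip M f g))\<^sup>2 \<le> nm2 M f * nm2 M g"
proof (cases "nm2 M g = 0")
  case True
  have "AE x in M. (cmod (g x))\<^sup>2 = 0"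
    using True integral_nonneg_eq_0_iff_AE[OF sqi_integrable[OF assms(2)]] by (simp add: nm2_def)
  then have "ip M f g = (\<integral>x. 0 \<partial>M)" unfolding ip_def
    using assms by (intro integral_cong_AE) (auto simp: sqi_def)
  then show ?thesis using True by simp
next
  case False
  then have g: "nm2 M g > 0" using nm2_nonneg[of M g] by simp
  define s where "s = ip M f g / of_real (nm2 M g)"
  have "0 \<le> nm2 M (\<lambda>x. f x - s * g x)" by (rule nm2_nonneg)
  also have "\<dots> = nm2 M f - 2 * Re (cnj s * ip M f g) + (cmod s)\<^sup>2 * nm2 M g"
    using nm2_diff[OF assms(1) sqi_cmult[OF assms(2), of s]] by (simp add: ip_cmult_right nm2_cmult)
  also have "cnj s * ip M f g = of_real ((cmod (ip M f g))\<^sup>2 / nm2 M g)"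
    by (simp add: s_def complex_norm_square mult.commute del: of_real_power)
  also have "(cmod s)\<^sup>2 * nm2 M g = (cmod (ip M f g))\<^sup>2 / nm2 M g"
    using g by (simp add: s_def norm_divide power_divide power2_eq_square)
  finally have "(cmod (ip M f g))\<^sup>2 / nm2 M g \<le> nm2 M f" by simp
  then show ?thesis using g by (simp add: divide_le_eq)
qed

section \<open>Orthogonal systems\<close>

text \<open>An increasing exhaustion by finite sets, which turns unconditional sums into limits of
  sequences.\<close>

definition stage :: "nat \<Rightarrow> 'i::countable set" where "stage n = {i. to_nat i < n}"

lemma finite_stage [simp]: "finite (stage n :: 'i::countable set)"
proof -
  have "to_nat ` (stage n :: 'i set) \<subseteq> {..<n}" by (auto simp: stage_def)
  then have "finite (to_nat ` (stage n :: 'i set))" using finite_subset by blast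
  then show ?thesis by (rule finite_imageD) (simp add: inj_on_def)
qed

lemma stage_eventually: assumes "finite S" shows "\<forall>\<^sub>F n in sequentially. S \<subseteq> stage n"
proof -
  have "\<forall>\<^sub>F n in sequentially. i \<in> stage n" for i :: 'a
    unfolding stage_def eventually_sequentially by (intro exI[of _ "Suc (to_nat i)"]) auto
  then show ?thesis using assms eventually_ball_finite[of S "\<lambda>n i. i \<in> stage n"]
    by (simp add: subset_eq)
qed

lemma stage_limit: "filterlim stage (finite_subsets_at_top UNIV) sequentially"
  unfolding filterlim_def le_filter_def eventually_filtermap
proof (intro allI impI)
  fix P :: "'a set \<Rightarrow> bool" assume "eventually P (finite_subsets_at_top UNIV)"
  then obtain X where X: "finite X" "\<And>Y. finite Y \<Longrightarrow> X \<subseteq> Y \<Longrightarrow> P Y"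
    unfolding eventually_finite_subsets_at_top by auto
  show "eventually (\<lambda>n. P (stage n)) sequentially"
    using stage_eventually[OF X(1)] by eventually_elim (simp add: X)
qed

text \<open>The squared norms are a parameter rather than 1, since the same functions are orthogonal
  for every time, with norms depending on it.\<close>

locale orthogonal_system =
  fixes M :: "'a measure" and e :: "'i::countable \<Rightarrow> 'a \<Rightarrow> complex" and N :: "'i \<Rightarrow> real"
  assumes sqi_e: "sqi M (e i)"
    and gram: "ip M (e i) (e j) = (if i = j then of_real (N i) else 0)"
    and N_pos: "N i > 0"
begin

definition fs :: "'i set \<Rightarrow> ('i \<Rightarrow> complex) \<Rightarrow> 'a \<Rightarrow> complex" where
  "fs S c x = (\<Sum>i\<in>S. c i * e i x)"

definition co :: "('a \<Rightarrow> complex) \<Rightarrow> 'i \<Rightarrow> complex" where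
  "co f i = ip M f (e i) / of_real (N i)"

lemma sqi_fs: "sqi M (fs S c)"
  unfolding fs_def by (intro sqi_sum sqi_cmult sqi_e)

lemma ip_fs: assumes "sqi M f" shows "ip M f (fs S c) = (\<Sum>i\<in>S. cnj (c i) * (co f i * of_real (N i)))"
proof -
  have "ip M f (fs S c) = (\<Sum>i\<in>S. ip M f (\<lambda>x. c i * e i x))"
    unfolding fs_def by (intro ip_sum_right sqi_cmult sqi_e assms)
  also have "\<dots> = (\<Sum>i\<in>S. cnj (c i) * (co f i * of_real (N i)))"
    using N_pos by (intro sum.cong) (auto simp: ip_cmult_right co_def less_imp_neq[symmetric])
  finally show ?thesis .
qed

lemma ip_fs_e: assumes "finite S" shows "ip M (fs S c) (e i) = (if i \<in> S then c i * of_real (N i) else 0)"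
proof -
  have "ip M (fs S c) (e i) = (\<Sum>j\<in>S. ip M (\<lambda>x. c j * e j x) (e i))"
    unfolding fs_def by (intro ip_sum sqi_cmult sqi_e)
  also have "\<dots> = (\<Sum>j\<in>S. if j = i then c i * of_real (N i) else 0)"
    by (intro sum.cong) (auto simp: ip_cmult gram)
  finally show ?thesis using assms by simp
qed

lemma co_fs: assumes "finite S" shows "co (fs S c) i = (if i \<in> S then c i else 0)"
  using N_pos[of i] by (simp add: co_def ip_fs_e[OF assms])

lemma nm2_fs: assumes "finite S" shows "nm2 M (fs S c) = (\<Sum>i\<in>S. (cmod (c i))\<^sup>2 * N i)"
proof -
  have "of_real (nm2 M (fs S c)) = ip M (fs S c) (fs S c)" by (rule ip_self[symmetric])
  also have "\<dots> = (\<Sum>i\<in>S. of_real ((cmod (c i))\<^sup>2 * N i))"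
    unfolding ip_fs[OF sqi_fs] using assms
    by (intro sum.cong) (simp_all add: co_fs complex_norm_square mult_ac del: of_real_power)
  finally show ?thesis unfolding of_real_sum[symmetric] of_real_eq_iff .
qed

lemma nm2_diff_fs:
  assumes "sqi M f" "finite S"
  shows "nm2 M (\<lambda>x. f x - fs S (co f) x) = nm2 M f - (\<Sum>i\<in>S. (cmod (co f i))\<^sup>2 * N i)"
proof -
  have "ip M f (fs S (co f)) = of_real (\<Sum>i\<in>S. (cmod (co f i))\<^sup>2 * N i)"
    unfolding ip_fs[OF assms(1)] of_real_sum
    by (intro sum.cong refl) (simp add: complex_norm_square mult_ac del: of_real_power)
  then show ?thesis unfolding nm2_diff[OF assms(1) sqi_fs] nm2_fs[OF assms(2)] by simp
qed

lemma Bessel: assumes "sqi M f" "finite S" shows "(\<Sum>i\<in>S. (cmod (co f i))\<^sup>2 * N i) \<le> nm2 M f"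
  using nm2_diff_fs[OF assms] nm2_nonneg[of M "\<lambda>x. f x - fs S (co f) x"] by simp

lemma Bessel_summable: assumes "sqi M f" shows "(\<lambda>i. (cmod (co f i))\<^sup>2 * N i) summable_on UNIV"
proof (rule nonneg_bdd_above_summable_on)
  show "bdd_above (sum (\<lambda>i. (cmod (co f i))\<^sup>2 * N i) ` {F. F \<subseteq> UNIV \<and> finite F})"
    using Bessel[OF assms] by (auto intro!: bdd_aboveI)
qed (use N_pos in \<open>simp add: less_imp_le\<close>)

text \<open>Fatou applied to tails: an almost everywhere limit of partial sums is square integrable
  and differs from each finite sum by at most the tail of the coefficient series. The rest follows
  by Cauchy-Schwarz and Bessel. A subsequence \<open>r\<close> is allowed because
  \<open>Riesz_Fischer\<close> obtains convergence only along one.\<close>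

lemma series_limit:
  assumes sm: "(\<lambda>i. (cmod (c i))\<^sup>2 * N i) summable_on UNIV"
    and m: "F \<in> borel_measurable M" and r: "strict_mono r"
    and lim: "AE x in M. (\<lambda>n. fs (stage (r n)) c x) \<longlonglongrightarrow> F x"
  shows "sqi M F" "co F = c" "nm2 M F = (\<Sum>\<^sub>\<infinity>i. (cmod (c i))\<^sup>2 * N i)"
    "finite S \<Longrightarrow> nm2 M (\<lambda>x. F x - fs S c x) = (\<Sum>\<^sub>\<infinity>i. (cmod (c i))\<^sup>2 * N i) - (\<Sum>i\<in>S. (cmod (c i))\<^sup>2 * N i)"
proof -
  let ?T = "\<Sum>\<^sub>\<infinity>i. (cmod (c i))\<^sup>2 * N i"
  let ?t = "\<lambda>S. ?T - (\<Sum>i\<in>S. (cmod (c i))\<^sup>2 * N i)"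
  have nn: "0 \<le> (cmod (c i))\<^sup>2 * N i" for i using N_pos[of i] by (simp add: less_imp_le)
  have hs: "((\<lambda>i. (cmod (c i))\<^sup>2 * N i) has_sum ?T) UNIV" using sm by simp
  have le: "(\<Sum>i\<in>S. (cmod (c i))\<^sup>2 * N i) \<le> ?T" if "finite S" for S
    using that nn by (intro finite_sum_le_infsum sm) auto
  have mfs: "fs S c \<in> borel_measurable M" for S by (rule sqi_measurable[OF sqi_fs])
  have key: "sqi M (\<lambda>x. F x - fs S c x) \<and> nm2 M (\<lambda>x. F x - fs S c x) \<le> ?t S" if S: "finite S" for S
  proof -
    have "(\<integral>\<^sup>+x. ennreal ((cmod (F x - fs S c x))\<^sup>2) \<partial>M) \<le> (\<integral>\<^sup>+x. liminf (\<lambda>n. ennreal ((cmod (fs (stage (r n)) c x - fs S c x))\<^sup>2)) \<partial>M)"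
    proof (rule nn_integral_mono_AE)
      show "AE x in M. ennreal ((cmod (F x - fs S c x))\<^sup>2) \<le> liminf (\<lambda>n. ennreal ((cmod (fs (stage (r n)) c x - fs S c x))\<^sup>2))"
        using lim
      proof eventually_elim
        case (elim x)
        have L: "(\<lambda>n. ennreal ((cmod (fs (stage (r n)) c x - fs S c x))\<^sup>2)) \<longlonglongrightarrow> ennreal ((cmod (F x - fs S c x))\<^sup>2)"
          by (intro tendsto_ennrealI tendsto_intros elim)
        show ?case unfolding lim_imp_Liminf[OF sequentially_bot L] by (rule order_refl)
      qed
    qed
    also have "\<dots> \<le> liminf (\<lambda>n. \<integral>\<^sup>+x. ennreal ((cmod (fs (stage (r n)) c x - fs S c x))\<^sup>2) \<partial>M)"
      by (rule nn_integral_liminf) (use mfs in measurable)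
    also have "\<dots> \<le> ennreal (?t S)"
    proof (rule Liminf_le)
      show "\<forall>\<^sub>F n in sequentially. (\<integral>\<^sup>+x. ennreal ((cmod (fs (stage (r n)) c x - fs S c x))\<^sup>2) \<partial>M) \<le> ennreal (?t S)"
        using filterlim_subseq[OF r, unfolded filterlim_iff, rule_format, OF stage_eventually[OF S]]
      proof eventually_elim
        case (elim n)
        have d: "fs (stage (r n)) c x - fs S c x = fs (stage (r n) - S) c x" for x
          unfolding fs_def by (simp add: sum_diff elim)
        have "(\<integral>\<^sup>+x. ennreal ((cmod (fs (stage (r n)) c x - fs S c x))\<^sup>2) \<partial>M) = ennreal (nm2 M (fs (stage (r n) - S) c))"
          unfolding d nm2_def by (rule nn_integral_eq_integral[OF sqi_integrable[OF sqi_fs]]) simp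
        also have "nm2 M (fs (stage (r n) - S) c) = (\<Sum>i\<in>stage (r n). (cmod (c i))\<^sup>2 * N i) - (\<Sum>i\<in>S. (cmod (c i))\<^sup>2 * N i)"
          by (subst nm2_fs) (simp_all add: sum_diff elim)
        also have "ennreal \<dots> \<le> ennreal (?t S)" using le[of "stage (r n)"] by (intro ennreal_leI) simp
        finally show ?case .
      qed
    qed simp
    finally have b: "(\<integral>\<^sup>+x. ennreal ((cmod (F x - fs S c x))\<^sup>2) \<partial>M) \<le> ennreal (?t S)" .
    have mF: "(\<lambda>x. (cmod (F x - fs S c x))\<^sup>2) \<in> borel_measurable M" using m mfs by measurable
    have i: "integrable M (\<lambda>x. (cmod (F x - fs S c x))\<^sup>2)"
      using b le_less_trans[OF b ennreal_less_top] by (intro integrableI_nonneg[OF mF]) auto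
    have "ennreal (nm2 M (\<lambda>x. F x - fs S c x)) \<le> ennreal (?t S)"
      unfolding nm2_def using b nn_integral_eq_integral[OF i] by simp
    then have "nm2 M (\<lambda>x. F x - fs S c x) \<le> ?t S"
      using le[OF S] by (simp add: ennreal_le_iff)
    then show ?thesis using i m mfs by (simp add: sqi_def)
  qed
  have "sqi M (\<lambda>x. F x - fs {} c x)" using key[of "{}"] by simp
  then show F: "sqi M F" by (simp add: fs_def)
  have tl: "((\<lambda>S. ?t S) \<longlongrightarrow> 0) (finite_subsets_at_top UNIV)"
    using tendsto_diff[OF tendsto_const[of ?T] hs[unfolded has_sum_def]] by simp
  show c: "co F = c"
  proof
    fix i
    have b: "(cmod (ip M F (e i) - c i * of_real (N i)))\<^sup>2 \<le> ?t S * N i" if "finite S" "i \<in> S" for S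
    proof -
      have "ip M F (e i) - c i * of_real (N i) = ip M (\<lambda>x. F x - fs S c x) (e i)"
        using ip_fs_e[OF that(1), of c i] that by (simp add: ip_diff[OF F sqi_fs sqi_e])
      then have "(cmod (ip M F (e i) - c i * of_real (N i)))\<^sup>2 \<le> nm2 M (\<lambda>x. F x - fs S c x) * nm2 M (e i)"
        using ip_Cauchy_Schwarz[OF _ sqi_e] key[OF that(1)] by simp
      also have "nm2 M (e i) = N i" using ip_self[of M "e i"] gram[of i i] by simp
      also have "nm2 M (\<lambda>x. F x - fs S c x) * N i \<le> ?t S * N i"
        using key[OF that(1)] N_pos[of i] by (intro mult_right_mono) auto
      finally show ?thesis .
    qed
    have "((\<lambda>S. ?t S * N i) \<longlongrightarrow> 0) (finite_subsets_at_top UNIV)"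
      using tendsto_mult[OF tl tendsto_const[of "N i"]] by simp
    then have "(cmod (ip M F (e i) - c i * of_real (N i)))\<^sup>2 \<le> 0"
    proof (rule tendsto_lowerbound)
      show "\<forall>\<^sub>F S in finite_subsets_at_top UNIV. (cmod (ip M F (e i) - c i * of_real (N i)))\<^sup>2 \<le> ?t S * N i"
        unfolding eventually_finite_subsets_at_top by (intro exI[of _ "{i}"]) (use b in auto)
    qed simp_all
    then show "co F i = c i" using N_pos[of i] by (simp add: co_def)
  qed
  \<comment> \<open>The residual is squeezed between 0, by Bessel, and the tail of the coefficient
    series, so the two limits agree.\<close>
  have "((\<lambda>S. nm2 M F - (\<Sum>i\<in>S. (cmod (c i))\<^sup>2 * N i)) \<longlongrightarrow> nm2 M F - ?T) (finite_subsets_at_top UNIV)"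
    by (intro tendsto_intros hs[unfolded has_sum_def])
  moreover have "((\<lambda>S. nm2 M F - (\<Sum>i\<in>S. (cmod (c i))\<^sup>2 * N i)) \<longlongrightarrow> 0) (finite_subsets_at_top UNIV)"
  proof (rule tendsto_sandwich[OF _ _ tendsto_const tl])
    show "\<forall>\<^sub>F S in finite_subsets_at_top UNIV. 0 \<le> nm2 M F - (\<Sum>i\<in>S. (cmod (c i))\<^sup>2 * N i)"
      using Bessel[OF F] unfolding c by (intro eventually_finite_subsets_at_top_weakI) simp
    show "\<forall>\<^sub>F S in finite_subsets_at_top UNIV. nm2 M F - (\<Sum>i\<in>S. (cmod (c i))\<^sup>2 * N i) \<le> ?t S"
      using key nm2_diff_fs[OF F] unfolding c by (intro eventually_finite_subsets_at_top_weakI) auto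
  qed
  ultimately show n: "nm2 M F = ?T"
    using tendsto_unique[OF finite_subsets_at_top_neq_bot] by fastforce
  show "nm2 M (\<lambda>x. F x - fs S c x) = ?t S" if "finite S"
    using nm2_diff_fs[OF F that] unfolding c n .
qed

text \<open>Multiplication by a nowhere vanishing square integrable \<open>g\<close> turns a Cauchy
  sequence in L2 into one in L1, where an almost everywhere convergent subsequence is available;
  division by \<open>g\<close> recovers the limit.\<close>

lemma Riesz_Fischer:
  assumes sm: "(\<lambda>i. (cmod (c i))\<^sup>2 * N i) summable_on UNIV"
    and g: "sqi M g" "\<And>x. g x \<noteq> 0"
  shows "\<exists>F. sqi M F \<and> co F = c \<and> (\<forall>S. finite S \<longrightarrow> nm2 M (\<lambda>x. F x - fs S c x) = (\<Sum>\<^sub>\<infinity>i. (cmod (c i))\<^sup>2 * N i) - (\<Sum>i\<in>S. (cmod (c i))\<^sup>2 * N i))"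
proof -
  let ?a = "\<lambda>n. \<Sum>i\<in>stage n. (cmod (c i))\<^sup>2 * N i"
  let ?G = "nm2 M g"
  define u where "u = (\<lambda>n x. fs (stage n) c x * g x)"
  have conv: "?a \<longlonglongrightarrow> (\<Sum>\<^sub>\<infinity>i. (cmod (c i))\<^sup>2 * N i)"
    using filterlim_compose[OF _ stage_limit, of "sum (\<lambda>i. (cmod (c i))\<^sup>2 * N i)"] has_sum_infsum[OF sm] unfolding has_sum_def by auto
  have cg: "sqi M (\<lambda>x. cnj (g x))"
    using g(1) by (auto simp: sqi_def)
  have ui: "integrable M (u n)" for n
    using sqi_mult_integrable[OF sqi_fs cg] by (simp add: u_def)
  \<comment> \<open>Cauchy-Schwarz with \<open>g\<close> as the second factor bounds the L1 distance
    by a block of the coefficient series.\<close>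
  have bound: "(\<integral>x. norm (u i x - u j x) \<partial>M)\<^sup>2 \<le> \<bar>?a i - ?a j\<bar> * ?G" for i j
  proof (induction i j rule: linorder_wlog)
    case (le i j)
    have sub: "stage i \<subseteq> (stage j :: 'i set)" using le by (auto simp: stage_def)
    let ?d = "fs (stage j - stage i) c"
    have d: "u i x - u j x = - (?d x * g x)" for x
      unfolding u_def fs_def by (simp add: sum_diff sub algebra_simps)
    have s: "sqi M (\<lambda>x. of_real (cmod (?d x)))" "sqi M (\<lambda>x. of_real (cmod (g x)))"
      using sqi_fs[of "stage j - stage i" c] g(1) by (auto simp: sqi_def)
    have "ip M (\<lambda>x. of_real (cmod (?d x))) (\<lambda>x. of_real (cmod (g x))) = of_real (\<integral>x. norm (u i x - u j x) \<partial>M)"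
      unfolding ip_def d integral_complex_of_real[symmetric] by (simp add: norm_mult)
    then have "(\<integral>x. norm (u i x - u j x) \<partial>M)\<^sup>2 = (cmod (ip M (\<lambda>x. of_real (cmod (?d x))) (\<lambda>x. of_real (cmod (g x)))))\<^sup>2" by simp
    also have "\<dots> \<le> nm2 M (\<lambda>x. of_real (cmod (?d x))) * nm2 M (\<lambda>x. of_real (cmod (g x)))"
      by (rule ip_Cauchy_Schwarz[OF s])
    also have "nm2 M (\<lambda>x. of_real (cmod (?d x))) = nm2 M ?d" by (simp add: nm2_def)
    also have "nm2 M (\<lambda>x. of_real (cmod (g x))) = ?G" by (simp add: nm2_def)
    also have "nm2 M ?d = ?a j - ?a i" by (subst nm2_fs) (simp_all add: sum_diff sub)
    also have "(?a j - ?a i) * ?G \<le> \<bar>?a i - ?a j\<bar> * ?G" by (intro mult_right_mono nm2_nonneg) simp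
    finally show ?case .
  next
    case (sym i j)
    then show ?case by (simp add: norm_minus_commute abs_minus_commute)
  qed
  have "\<exists>N. \<forall>i\<ge>N. \<forall>j\<ge>N. (\<integral>x. norm (u i x - u j x) \<partial>M) < e" if e: "e > 0" for e :: real
  proof -
    have "e\<^sup>2 / (?G + 1) > 0" using e nm2_nonneg[of M g] by simp
    from metric_CauchyD[OF LIMSEQ_imp_Cauchy[OF conv] this] obtain m where m: "\<And>i j. i \<ge> m \<Longrightarrow> j \<ge> m \<Longrightarrow> \<bar>?a i - ?a j\<bar> < e\<^sup>2 / (?G + 1)"
      by (auto simp: dist_real_def)
    have "(\<integral>x. norm (u i x - u j x) \<partial>M) < e" if "i \<ge> m" "j \<ge> m" for i j
    proof -
      have "(\<integral>x. norm (u i x - u j x) \<partial>M)\<^sup>2 \<le> \<bar>?a i - ?a j\<bar> * ?G" by (rule bound)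
      also have "\<dots> \<le> e\<^sup>2 / (?G + 1) * ?G" using m[OF that] nm2_nonneg[of M g] by (intro mult_right_mono) auto
      also have "\<dots> < e\<^sup>2" using e nm2_nonneg[of M g] by (simp add: field_simps)
      finally show ?thesis using e by (simp add: power2_less_imp_less)
    qed
    then show "\<exists>N. \<forall>i\<ge>N. \<forall>j\<ge>N. (\<integral>x. norm (u i x - u j x) \<partial>M) < e" by blast
  qed
  from cauchy_L1_AE_cauchy_subseq[OF ui this]
  obtain r where r: "strict_mono r" "AE x in M. Cauchy (\<lambda>n. u (r n) x)" by metis
  define F where "F = (\<lambda>x. lim (\<lambda>n. fs (stage (r n)) c x))"
  have m: "F \<in> borel_measurable M"
    unfolding F_def by (rule borel_measurable_lim_metric) (rule sqi_measurable[OF sqi_fs])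
  have "AE x in M. (\<lambda>n. fs (stage (r n)) c x) \<longlonglongrightarrow> F x"
    using r(2)
  proof eventually_elim
    case (elim x)
    then obtain l where "(\<lambda>n. u (r n) x) \<longlonglongrightarrow> l" using Cauchy_convergent convergent_def by blast
    from tendsto_divide[OF this tendsto_const[of "g x"]] have "(\<lambda>n. fs (stage (r n)) c x) \<longlonglongrightarrow> l / g x"
      using g(2)[of x] by (simp add: u_def)
    then show ?case unfolding F_def by (simp add: limI)
  qed
  from series_limit[OF sm m r(1) this] show ?thesis by blast
qed

end

section \<open>The reproducing kernel\<close>

definition S2 :: "'n::finite cc \<Rightarrow> complex" where
  "S2 p = (\<Sum>i\<in>UNIV. (fst p $ i)\<^sup>2 + (snd p $ i)\<^sup>2)"

text \<open>The weight is \<open>exp (- Qf c p)\<close> up to a constant and the squared modulus of an entire Gaussian, with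
  \<open>c = coth (2 t)\<close>. The form \<open>Bf\<close> is Hermitian with diagonal \<open>Qf\<close>, so \<open>Qf\<close> is invariant under
  multiplication by unimodular scalars.\<close>

definition Bf :: "real \<Rightarrow> 'n::finite cc \<Rightarrow> 'n cc \<Rightarrow> complex" where
  "Bf c p q = (\<Sum>i\<in>UNIV. of_real (c / 2) * (fst p $ i * cnj (fst q $ i) + snd p $ i * cnj (snd q $ i))
      + (snd p $ i * cnj (fst q $ i) - fst p $ i * cnj (snd q $ i)) * (- \<i> / 2))"

definition Qf :: "real \<Rightarrow> 'n::finite cc \<Rightarrow> real" where
  "Qf c p = (\<Sum>i\<in>UNIV. c / 2 * ((cmod (fst p $ i))\<^sup>2 + (cmod (snd p $ i))\<^sup>2) + Im (snd p $ i * cnj (fst p $ i)))"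

lemma Bf_self: "Bf c p p = of_real (Qf c p)"
  unfolding Bf_def Qf_def of_real_sum
  unfolding cmod_sq by (intro sum.cong refl) (simp add: complex_eq_iff power2_eq_square field_simps)

lemma Bf_cnj: "cnj (Bf c p q) = Bf c q p"
  unfolding Bf_def cnj_sum
  by (intro sum.cong refl) (simp add: complex_eq_iff algebra_simps)

lemma Bf_add_left: "Bf c (p + q) r = Bf c p r + Bf c q r"
  unfolding Bf_def sum.distrib[symmetric]
  by (intro sum.cong refl) (simp add: algebra_simps)

lemma Bf_add_right: "Bf c p (q + r) = Bf c p q + Bf c p r"
  using Bf_add_left[of c q r p] by (metis Bf_cnj complex_cnj_add)

lemma Bf_cs: "Bf c (cs a p) q = a * Bf c p q"
  unfolding Bf_def sum_distrib_left
  by (intro sum.cong refl) (simp add: algebra_simps)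

lemma linear_Bf: "linear (\<lambda>p. Bf c p q)"
  by (rule linearI) (simp_all add: Bf_add_left Bf_cs scaleR_conv_of_real flip: cs_of_real)

lemma entire_Bf: "entire (\<lambda>p. Bf c p q)"
  by (rule entire_linear[OF linear_Bf Bf_cs])

lemma Bf_bound: "\<exists>L. 0 \<le> L \<and> (\<forall>p. cmod (Bf c p q) \<le> L * norm p)"
proof -
  have "bounded_linear (\<lambda>p. Bf c p q)" using linear_Bf linear_conv_bounded_linear by blast
  from bounded_linear.nonneg_bounded[OF this] show ?thesis by (auto simp: mult.commute)
qed

lemma Qf_add: "Qf c (p + q) = Qf c p + Qf c q + 2 * Re (Bf c p q)"
proof -
  have "complex_of_real (Qf c (p + q)) = Bf c p p + Bf c q q + (Bf c p q + cnj (Bf c p q))"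
    unfolding Bf_self[symmetric] by (simp add: Bf_add_left Bf_add_right Bf_cnj)
  also have "\<dots> = of_real (Qf c p + Qf c q + 2 * Re (Bf c p q))"
    unfolding complex_add_cnj Bf_self by simp
  finally show ?thesis unfolding of_real_eq_iff .
qed

lemma Bf_cs_right: "Bf c p (cs a q) = cnj a * Bf c p q"
  by (metis Bf_cnj Bf_cs complex_cnj_mult)

lemma Qf_cs: "cmod a = 1 \<Longrightarrow> Qf c (cs a p) = Qf c p"
proof -
  assume a: "cmod a = 1"
  have "complex_of_real (Qf c (cs a p)) = (a * cnj a) * of_real (Qf c p)"
    unfolding Bf_self[symmetric] by (simp add: Bf_cs Bf_cs_right)
  then show ?thesis using a by (simp add: complex_norm_square[symmetric])
qed

text \<open>The imaginary part of w cnj z is at least - (|z|^2 + |w|^2) / 2, so the form is positive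
  definite for c > 1.\<close>

lemma Qf_lower: "(c - 1) / 2 * (norm p)\<^sup>2 \<le> Qf c p"
  unfolding norm_cc_sq Qf_def sum_distrib_left
proof (rule sum_mono)
  fix i
  let ?z = "fst p $ i" and ?w = "snd p $ i"
  have "- Im (?w * cnj ?z) \<le> cmod (?w * cnj ?z)" using abs_Im_le_cmod[of "?w * cnj ?z"] by linarith
  also have "\<dots> \<le> ((cmod ?z)\<^sup>2 + (cmod ?w)\<^sup>2) / 2"
    using sum_squares_bound[of "cmod ?w" "cmod ?z"] by (simp add: norm_mult)
  finally show "(c - 1) / 2 * ((cmod ?z)\<^sup>2 + (cmod ?w)\<^sup>2) \<le> c / 2 * ((cmod ?z)\<^sup>2 + (cmod ?w)\<^sup>2) + Im (?w * cnj ?z)"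
    by (simp add: field_simps)
qed

lemma continuous_on_Qf [continuous_intros]: "continuous_on S f \<Longrightarrow> continuous_on S (\<lambda>x. Qf c (f x))"
  unfolding Qf_def by (intro continuous_intros)

lemma continuous_on_S2 [continuous_intros]: "continuous_on S f \<Longrightarrow> continuous_on S (\<lambda>x. S2 (f x))"
  unfolding S2_def by (intro continuous_intros)

lemma integrable_exp_Qf:
  assumes "c > 1" and "f \<in> borel_measurable borel" and "\<And>p. \<bar>f p\<bar> \<le> exp (L * norm p)"
  shows "integrable lborel (\<lambda>p::'n::finite cc. f p * exp (- Qf c p))"
proof (rule Bochner_Integration.integrable_bound)
  show "integrable lborel (\<lambda>p::'n cc. exp (L * norm p - (c - 1) / 2 * (norm p)\<^sup>2))"
    using assms(1) by (intro integrable_gauss_linear) simp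
  have [measurable]: "(\<lambda>p::'n cc. exp (- Qf c p)) \<in> borel_measurable borel"
    by (intro borel_measurable_continuous_onI continuous_intros)
  show "(\<lambda>p::'n cc. f p * exp (- Qf c p)) \<in> borel_measurable lborel" using assms(2) by measurable
  have "\<bar>f p\<bar> * exp (- Qf c p) \<le> exp (L * norm p) * exp (- ((c - 1) / 2 * (norm p)\<^sup>2))" for p
    using Qf_lower[of c p] assms(3)[of p] by (intro mult_mono) auto
  then show "AE p in lborel. norm (f p * exp (- Qf c p)) \<le> norm (exp (L * norm p - (c - 1) / 2 * (norm p)\<^sup>2))"
    by (intro AE_I2) (simp add: abs_mult exp_add[symmetric])
qed

definition MQ :: "real \<Rightarrow> 'n::finite cc measure" where
  "MQ c = density lborel (\<lambda>p. ennreal (exp (- Qf c p)))"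

text \<open>The total mass of the Gaussian; only its positivity matters, and it is never
  evaluated.\<close>

definition KQ :: "'n::finite itself \<Rightarrow> real \<Rightarrow> real" where
  "KQ _ c = (\<integral>p. exp (- Qf c p) \<partial>(lborel :: 'n cc measure))"

lemma measurable_exp_Qf [measurable]: "(\<lambda>p::'n::finite cc. exp (- Qf c p)) \<in> borel_measurable borel"
  by (intro borel_measurable_continuous_onI continuous_intros)

lemma measurable_MQ [simp]: "borel_measurable (MQ c) = borel_measurable borel"
  by (intro measurable_cong_sets) (simp_all add: MQ_def)

lemma integrable_MQ:
  fixes f :: "'n::finite cc \<Rightarrow> 'b::{banach,second_countable_topology}"
  assumes "f \<in> borel_measurable borel"
  shows "integrable (MQ c) f \<longleftrightarrow> integrable lborel (\<lambda>p. exp (- Qf c p) *\<^sub>R f p)"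
  unfolding MQ_def using assms by (subst integrable_density) auto

lemma integral_MQ:
  fixes f :: "'n::finite cc \<Rightarrow> 'b::{banach,second_countable_topology}"
  assumes "f \<in> borel_measurable borel"
  shows "(\<integral>p. f p \<partial>(MQ c)) = (\<integral>p. exp (- Qf c p) *\<^sub>R f p \<partial>lborel)"
  unfolding MQ_def using assms by (subst integral_density) auto

text \<open>Completing the square: the squared modulus of the kernel times the Gaussian is the
  Gaussian translated by \<open>q\<close>, times exp (Qf c q).\<close>

lemma sqi_exp_Bf:
  fixes q :: "'n::finite cc"
  assumes c: "c > 1"
  shows "sqi (MQ c) (\<lambda>p. exp (Bf c p q))" "nm2 (MQ c) (\<lambda>p. exp (Bf c p q)) = KQ TYPE('n) c * exp (Qf c q)"
proof -
  have m: "(\<lambda>p. exp (Bf c p q)) \<in> borel_measurable borel"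
    by (intro entire_imp_measurable entire_exp entire_Bf)
  have e: "(cmod (exp (Bf c p q)))\<^sup>2 = exp (2 * Re (Bf c p q))" for p
    by (simp add: exp_double[symmetric])
  have m2: "(\<lambda>p. exp (2 * Re (Bf c p q))) \<in> borel_measurable borel" using m unfolding e[symmetric] by measurable
  obtain L where L: "\<And>p. cmod (Bf c p q) \<le> L * norm p" using Bf_bound by blast
  have b: "\<bar>exp (2 * Re (Bf c p q))\<bar> \<le> exp ((2 * L) * norm p)" for p
    using L[of p] complex_Re_le_cmod[of "Bf c p q"] by simp
  show "sqi (MQ c) (\<lambda>p. exp (Bf c p q))"
    unfolding sqi_def e using m m2 integrable_exp_Qf[OF c m2 b]
    by (simp add: integrable_MQ[OF m2] mult.commute)
  have "nm2 (MQ c) (\<lambda>p. exp (Bf c p q)) = (\<integral>p. exp (- Qf c p) * exp (2 * Re (Bf c p q)) \<partial>lborel)"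
    unfolding nm2_def e by (subst integral_MQ[OF m2]) simp
  also have "\<dots> = (\<integral>p. exp (Qf c q) * exp (- Qf c (p + (-q))) \<partial>lborel)"
  proof (rule Bochner_Integration.integral_cong[OF refl])
    fix p
    have "Bf c p (- q) = - Bf c p q" using Bf_cs_right[of c p "-1" q] cs_of_real[of "-1" q] by simp
    moreover have "Qf c (- q) = Qf c q" using Qf_cs[of "-1" c q] cs_of_real[of "-1" q] by simp
    ultimately show "exp (- Qf c p) * exp (2 * Re (Bf c p q)) = exp (Qf c q) * exp (- Qf c (p + (-q)))"
      unfolding exp_add[symmetric] Qf_add by simp
  qed
  also have "\<dots> = exp (Qf c q) * (\<integral>p. exp (- Qf c (p + (-q))) \<partial>lborel)" by simp
  also have "(\<integral>p. exp (- Qf c (p + (-q))) \<partial>lborel) = KQ TYPE('n) c"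
    unfolding KQ_def by (rule lpres_integral[OF lpres_plus]) simp
  finally show "nm2 (MQ c) (\<lambda>p. exp (Bf c p q)) = KQ TYPE('n) c * exp (Qf c q)" by simp
qed

lemma KQ_pos: assumes "c > 1" shows "KQ TYPE('n::finite) c > 0"
proof -
  have i: "integrable lborel (\<lambda>p::'n cc. exp (- Qf c p))"
    using integrable_exp_Qf[OF assms, of "\<lambda>_. 1" 0] by simp
  have "KQ TYPE('n) c \<ge> 0" unfolding KQ_def by simp
  moreover have "KQ TYPE('n) c \<noteq> 0"
  proof
    assume "KQ TYPE('n) c = 0"
    then have "AE p in (lborel :: 'n cc measure). exp (- Qf c p) = 0"
      unfolding KQ_def using integral_nonneg_eq_0_iff_AE[OF i] by simp
    then have "AE p in (lborel :: 'n cc measure). False" by simp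
    then show False by (simp add: trivial_limit_def[symmetric] ae_filter_eq_bot_iff)
  qed
  ultimately show ?thesis by simp
qed

text \<open>Translating by \<open>q\<close> moves the point of evaluation to the origin. The factor
  exp (- Bf c p q), entire in \<open>p\<close>, compensates the change of the Gaussian under the
  translation, so that the mean value property applies to the product.\<close>

lemma reproducing:
  fixes H :: "'n::finite cc \<Rightarrow> complex"
  assumes c: "c > 1" and H: "entire H" "sqi (MQ c) H"
  shows "ip (MQ c) H (\<lambda>p. exp (Bf c p q)) = of_real (KQ TYPE('n) c) * H q"
proof -
  have mH: "H \<in> borel_measurable borel" by (rule entire_imp_measurable[OF H(1)])
  have mB: "(\<lambda>p. exp (Bf c q p)) \<in> borel_measurable borel"
  proof -
    have "(\<lambda>p. cnj (exp (Bf c p q))) \<in> borel_measurable borel"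
      using entire_imp_measurable[OF entire_exp[OF entire_Bf, of c q]] by measurable
    then show ?thesis by (simp add: exp_cnj Bf_cnj)
  qed
  have m: "(\<lambda>p. H p * exp (Bf c q p)) \<in> borel_measurable borel" using mH mB by measurable
  define H1 where "H1 p = H (p + q) * exp (- Bf c p q)" for p
  have H1: "entire H1" unfolding H1_def[abs_def]
    by (intro entire_mult entire_translate H(1) entire_exp entire_cmult[of _ "-1", simplified] entire_Bf)
  let ?g = "\<lambda>p. exp (- Qf c p) *\<^sub>R (H p * exp (Bf c q p))"
  have mg: "?g \<in> borel_measurable borel" using m by measurable
  have E: "H1 (p + (-q)) * of_real (exp (- Qf c (p + (-q)))) = ?g p" for p
  proof -
    have B1: "Bf c p (- q) = - Bf c p q" "Bf c (- q) q = - Bf c q q" for p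
      using Bf_cs_right[of c p "-1" q] Bf_cs[of c "-1" q q] cs_of_real[of "-1" q] by simp_all
    have Qm: "Qf c (- q) = Qf c q" using Qf_cs[of "-1" c q] cs_of_real[of "-1" q] by simp
    have R: "2 * complex_of_real (Re (Bf c p q)) = Bf c p q + Bf c q p"
      using complex_add_cnj[of "Bf c p q"] by (simp add: Bf_cnj)
    have "- Bf c (p + - q) q + of_real (- Qf c (p + - q)) = of_real (- Qf c p) + Bf c q p"
      unfolding Qf_add Bf_add_left B1 Qm using R by (simp add: Bf_self B1 algebra_simps)
    then have "exp (- Bf c (p + - q) q) * of_real (exp (- Qf c (p + - q))) = of_real (exp (- Qf c p)) * exp (Bf c q p)"
      unfolding exp_of_real[symmetric] exp_add[symmetric] by simp
    then show ?thesis unfolding H1_def by (simp add: scaleR_conv_of_real mult_ac)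
  qed
  have i: "integrable lborel ?g"
    using sqi_mult_integrable[OF H(2) sqi_exp_Bf(1)[OF c, of q]] m by (simp add: exp_cnj Bf_cnj integrable_MQ)
  have mh: "(\<lambda>p. H1 p * of_real (exp (- Qf c p))) \<in> borel_measurable borel"
    using entire_imp_measurable[OF H1] by measurable
  have iH1: "integrable lborel (\<lambda>p. H1 p * of_real (exp (- Qf c p)))"
    using lpres_integrable_iff[OF lpres_plus[of "-q"] mh] i unfolding E by simp
  have "ip (MQ c) H (\<lambda>p. exp (Bf c p q)) = (\<integral>p. ?g p \<partial>lborel)"
    unfolding ip_def exp_cnj Bf_cnj by (rule integral_MQ[OF m])
  also have "\<dots> = (\<integral>p. H1 p * of_real (exp (- Qf c p)) \<partial>lborel)"
    using lpres_integral[OF lpres_plus[of "-q"] mh] unfolding E .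
  also have "\<dots> = H1 0 * of_real (KQ TYPE('n) c)" unfolding KQ_def
  proof (rule entire_mean_value[OF H1 _ _ iH1])
    show "continuous_on UNIV (\<lambda>p::'n cc. exp (- Qf c p))" by (intro continuous_intros)
    show "integrable lborel (\<lambda>p::'n cc. exp (- Qf c p))"
      using integrable_exp_Qf[OF c, of "\<lambda>_. 1" 0] by simp
  qed (simp add: Qf_cs)
  also have "H1 0 = H q" by (simp add: H1_def linear_0[OF linear_Bf])
  finally show ?thesis by simp
qed

lemma evaluation_bound_Q:
  fixes H :: "'n::finite cc \<Rightarrow> complex"
  assumes c: "c > 1" and H: "entire H" "sqi (MQ c) H"
  shows "(cmod (H q))\<^sup>2 \<le> nm2 (MQ c) H * exp (Qf c q) / KQ TYPE('n) c"
proof -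
  have K: "KQ TYPE('n) c > 0" by (rule KQ_pos[OF c])
  have "(KQ TYPE('n) c)\<^sup>2 * (cmod (H q))\<^sup>2 \<le> nm2 (MQ c) H * (KQ TYPE('n) c * exp (Qf c q))"
    using ip_Cauchy_Schwarz[OF H(2) sqi_exp_Bf(1)[OF c, of q]]
    unfolding reproducing[OF c H] sqi_exp_Bf(2)[OF c] by (simp add: norm_mult power_mult_distrib)
  then show ?thesis using K by (simp add: field_simps power2_eq_square)
qed

section \<open>The weighted space\<close>

definition cth :: "real \<Rightarrow> real" where "cth t = cosh (2 * t) / sinh (2 * t)"

lemma cth_gt_1: "t > 0 \<Longrightarrow> cth t > 1"
proof -
  assume "t > 0"
  moreover have "sinh (2 * t) < cosh (2 * t)"
    using cosh_minus_sinh[of "2 * t"] exp_gt_zero[of "- (2 * t)"] by linarith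
  ultimately show ?thesis by (simp add: cth_def less_divide_eq)
qed

definition Ct :: "'n::finite itself \<Rightarrow> real \<Rightarrow> real" where
  "Ct _ t = (2 / (pi * sinh (2 * t))) ^ CARD('n)"

lemma Ct_pos: "t > 0 \<Longrightarrow> Ct TYPE('n::finite) t > 0"
  unfolding Ct_def by (intro zero_less_power divide_pos_pos mult_pos_pos) auto

lemma weight_eq:
  fixes p :: "'n::finite cc"
  shows "weight t p = Ct TYPE('n) t * exp (cth t * Re (S2 p) / 2 - Qf (cth t) p)"
proof -
  have "w1 t z w = 2 / (pi * sinh (2 * t)) * exp (cth t * Re (z\<^sup>2 + w\<^sup>2) / 2 - (cth t / 2 * ((cmod z)\<^sup>2 + (cmod w)\<^sup>2) + Im (w * cnj z)))" for z w
  proof -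
    have "Re w * Im z - Im w * Re z + (- (cosh (2 * t) / sinh (2 * t)) * ((Im z)\<^sup>2 + (Im w)\<^sup>2))
      = cth t * Re (z\<^sup>2 + w\<^sup>2) / 2 - (cth t / 2 * ((cmod z)\<^sup>2 + (cmod w)\<^sup>2) + Im (w * cnj z))"
      unfolding cmod_sq cth_def[symmetric] by (simp add: power2_eq_square field_simps)
    moreover have "w1 t z w = 2 / (pi * sinh (2 * t)) * (exp (Re w * Im z - Im w * Re z) * exp (- (cosh (2 * t) / sinh (2 * t)) * ((Im z)\<^sup>2 + (Im w)\<^sup>2)))"
      unfolding w1_def by simp
    ultimately show ?thesis unfolding exp_add[symmetric] by simp
  qed
  then have "weight t p = (\<Prod>i\<in>(UNIV::'n set). 2 / (pi * sinh (2 * t))) * exp (\<Sum>i\<in>UNIV. cth t * Re ((fst p $ i)\<^sup>2 + (snd p $ i)\<^sup>2) / 2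
      - (cth t / 2 * ((cmod (fst p $ i))\<^sup>2 + (cmod (snd p $ i))\<^sup>2) + Im (snd p $ i * cnj (fst p $ i))))"
    unfolding weight_eq_prod by (simp only: prod.distrib exp_sum[OF finite])
  also have "(\<Prod>i\<in>(UNIV::'n set). 2 / (pi * sinh (2 * t))) = Ct TYPE('n) t"
    by (simp add: Ct_def)
  also have "(\<Sum>i\<in>UNIV. cth t * Re ((fst p $ i)\<^sup>2 + (snd p $ i)\<^sup>2) / 2
      - (cth t / 2 * ((cmod (fst p $ i))\<^sup>2 + (cmod (snd p $ i))\<^sup>2) + Im (snd p $ i * cnj (fst p $ i)))) = cth t * Re (S2 p) / 2 - Qf (cth t) p"
    unfolding S2_def Qf_def sum_subtractf Re_sum sum_distrib_left sum_divide_distrib ..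
  finally show ?thesis .
qed

lemma weight_pos: "t > 0 \<Longrightarrow> weight t p > 0"
  unfolding weight_eq_prod by (intro prod_pos) (simp add: w1_pos)

lemma continuous_on_weight: "continuous_on S (weight t)"
  unfolding weight_eq[abs_def] by (intro continuous_intros) auto

lemma measurable_weight [measurable]: "weight t \<in> borel_measurable borel"
  by (rule borel_measurable_continuous_onI[OF continuous_on_weight])

definition Mt :: "real \<Rightarrow> 'n::finite cc measure" where
  "Mt t = density lborel (\<lambda>p. ennreal (weight t p))"

lemma measurable_Mt [simp]: "borel_measurable (Mt t) = borel_measurable borel"
  by (intro measurable_cong_sets) (simp_all add: Mt_def)

lemma integrable_Mt:
  fixes f :: "'n::finite cc \<Rightarrow> 'b::{banach,second_countable_topology}"
  assumes "t > 0" "f \<in> borel_measurable borel"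
  shows "integrable (Mt t) f \<longleftrightarrow> integrable lborel (\<lambda>p. weight t p *\<^sub>R f p)"
  unfolding Mt_def using assms by (subst integrable_density) (simp_all add: less_imp_le weight_pos)

lemma integral_Mt:
  fixes f :: "'n::finite cc \<Rightarrow> 'b::{banach,second_countable_topology}"
  assumes "t > 0" "f \<in> borel_measurable borel"
  shows "(\<integral>p. f p \<partial>(Mt t)) = (\<integral>p. weight t p *\<^sub>R f p \<partial>lborel)"
  unfolding Mt_def using assms by (subst integral_density) (simp_all add: less_imp_le weight_pos)

lemma sqi_Mt: "t > 0 \<Longrightarrow> sqi (Mt t) F \<longleftrightarrow> F \<in> borel_measurable borel \<and> integrable lborel (\<lambda>p. (cmod (F p))\<^sup>2 * weight t p)"
proof (cases "F \<in> borel_measurable borel")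
  case True
  assume t: "t > 0"
  have "(\<lambda>p. (cmod (F p))\<^sup>2) \<in> borel_measurable borel" using True by measurable
  from integrable_Mt[OF t this] show ?thesis using True by (simp add: sqi_def mult.commute)
qed (simp add: sqi_def)

lemma nm2_Mt: "t > 0 \<Longrightarrow> F \<in> borel_measurable borel \<Longrightarrow> nm2 (Mt t) F = (\<integral>p. (cmod (F p))\<^sup>2 * weight t p \<partial>lborel)"
  unfolding nm2_def by (subst integral_Mt) (auto simp: mult.commute)

text \<open>For \<open>c = cth t\<close> this is the entire Gaussian whose squared modulus accounts
  for the part of \<open>weight\<close> that is not invariant under unimodular scalars.\<close>

definition hfac :: "real \<Rightarrow> 'n::finite cc \<Rightarrow> complex" where
  "hfac c p = exp (of_real (c / 4) * S2 p)"

lemma entire_S2: "entire S2"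
  unfolding S2_def[abs_def] by (intro entire_sum entire_add entire_power entire_fst entire_snd)

lemma entire_hfac: "entire (hfac c)"
  unfolding hfac_def[abs_def] by (intro entire_exp entire_cmult entire_S2)

lemma weight_hfac:
  fixes p :: "'n::finite cc"
  shows "weight t p = Ct TYPE('n) t * ((cmod (hfac (cth t) p))\<^sup>2 * exp (- Qf (cth t) p))"
  unfolding weight_eq hfac_def by (simp add: exp_double[symmetric] exp_add[symmetric])

lemma sqi_Mt_MQ:
  fixes F :: "'n::finite cc \<Rightarrow> complex"
  assumes t: "t > 0" and F: "F \<in> borel_measurable borel"
  shows "sqi (Mt t) F \<longleftrightarrow> sqi (MQ (cth t)) (\<lambda>p. F p * hfac (cth t) p)"
    and "nm2 (Mt t) F = Ct TYPE('n) t * nm2 (MQ (cth t)) (\<lambda>p. F p * hfac (cth t) p)"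
proof -
  have h: "hfac (cth t) \<in> borel_measurable borel" by (rule entire_imp_measurable[OF entire_hfac])
  have m: "(\<lambda>p. F p * hfac (cth t) p) \<in> borel_measurable borel" using F h by measurable
  have m2: "(\<lambda>p. (cmod (F p * hfac (cth t) p))\<^sup>2) \<in> borel_measurable borel" using m by measurable
  have e: "(cmod (F p))\<^sup>2 * weight t p = Ct TYPE('n) t * (exp (- Qf (cth t) p) * (cmod (F p * hfac (cth t) p))\<^sup>2)" for p
    unfolding weight_hfac by (simp add: norm_mult power_mult_distrib)
  show "sqi (Mt t) F \<longleftrightarrow> sqi (MQ (cth t)) (\<lambda>p. F p * hfac (cth t) p)"
    unfolding sqi_Mt[OF t] e unfolding sqi_def using F m integrable_MQ[OF m2, of "cth t"] Ct_pos[OF t, where 'n='n] by simp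
  show "nm2 (Mt t) F = Ct TYPE('n) t * nm2 (MQ (cth t)) (\<lambda>p. F p * hfac (cth t) p)"
    unfolding nm2_Mt[OF t F] e unfolding nm2_def integral_MQ[OF m2] by simp
qed

text \<open>The reproducing kernel bounds point evaluations, and the factors that depend on the
  point are continuous, hence bounded on a ball.\<close>

lemma evaluation_bound:
  assumes t: "t > 0"
  shows "\<exists>K\<ge>0. \<forall>F :: 'n::finite cc \<Rightarrow> complex. entire F \<longrightarrow> sqi (Mt t) F \<longrightarrow> (\<forall>p\<in>cball 0 R. (cmod (F p))\<^sup>2 \<le> K * nm2 (Mt t) F)"
proof -
  let ?c = "cth t"
  let ?D = "Ct TYPE('n) t * KQ TYPE('n) ?c"
  let ?g = "\<lambda>p::'n cc. exp (Qf ?c p) / (?D * (cmod (hfac ?c p))\<^sup>2)"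
  have D: "?D > 0" using Ct_pos[OF t, where 'n='n] KQ_pos[OF cth_gt_1[OF t], where 'n='n] by simp
  have nz: "hfac ?c p \<noteq> 0" for p :: "'n cc" by (simp add: hfac_def)
  have "continuous_on (cball 0 R) ?g"
    using D nz by (intro continuous_intros entire_imp_continuous[OF entire_hfac]) auto
  then have "bounded (?g ` cball 0 R)"
    by (intro compact_imp_bounded compact_continuous_image compact_cball)
  then obtain K where "\<forall>x\<in>?g ` cball 0 R. norm x \<le> K"
    unfolding bounded_iff by blast
  then have K: "\<bar>?g p\<bar> \<le> K" if "p \<in> cball 0 R" for p
    using that unfolding real_norm_def by (intro bspec[of "?g ` cball 0 R" "\<lambda>x. \<bar>x\<bar> \<le> K"] imageI)
  have b: "(cmod (F p))\<^sup>2 \<le> \<bar>K\<bar> * nm2 (Mt t) F" if F: "entire F" "sqi (Mt t) F" and p: "p \<in> cball 0 R" for F :: "'n cc \<Rightarrow> complex" and p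
  proof -
    have mF: "F \<in> borel_measurable borel" by (rule entire_imp_measurable[OF F(1)])
    have "(cmod (F p * hfac ?c p))\<^sup>2 \<le> nm2 (MQ ?c) (\<lambda>p. F p * hfac ?c p) * exp (Qf ?c p) / KQ TYPE('n) ?c"
      using F sqi_Mt_MQ(1)[OF t mF] by (intro evaluation_bound_Q cth_gt_1 t entire_mult entire_hfac) auto
    also have "nm2 (MQ ?c) (\<lambda>p. F p * hfac ?c p) = nm2 (Mt t) F / Ct TYPE('n) t"
      using sqi_Mt_MQ(2)[OF t mF] Ct_pos[OF t, where 'n='n] by simp
    finally have "(cmod (F p))\<^sup>2 * (cmod (hfac ?c p))\<^sup>2 \<le> nm2 (Mt t) F * exp (Qf ?c p) / ?D"
      by (simp add: norm_mult power_mult_distrib)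
    then have "(cmod (F p))\<^sup>2 \<le> nm2 (Mt t) F * exp (Qf ?c p) / ?D / (cmod (hfac ?c p))\<^sup>2"
      using nz[of p] by (subst pos_le_divide_eq) auto
    also have "\<dots> = ?g p * nm2 (Mt t) F" by (simp add: field_simps)
    also have "\<dots> \<le> \<bar>K\<bar> * nm2 (Mt t) F"
      by (intro mult_right_mono nm2_nonneg order_trans[OF abs_ge_self order_trans[OF K[OF p] abs_ge_self]])
    finally show ?thesis .
  qed
  show ?thesis by (rule exI[of _ "\<bar>K\<bar>"]) (use b in auto)
qed

section \<open>The two orthogonal systems\<close>

type_synonym 'n ix = "(nat ^ 'n) \<times> (nat ^ 'n)"

definition SHi :: "'n::finite ix \<Rightarrow> 'n cc \<Rightarrow> complex" where "SHi i = SH (fst i) (snd i)"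

definition ev :: "'n::finite ix \<Rightarrow> real" where "ev i = eigval (snd i)"

definition Nt :: "real \<Rightarrow> 'n::finite ix \<Rightarrow> real" where "Nt t i = 2 ^ CARD('n) * exp (2 * ev i * t)"

lemma entire_SHi: "entire (SHi i)" unfolding SHi_def by (rule entire_SH)

lemma ev_ge: "ev (i :: 'n::finite ix) \<ge> 1"
proof -
  have "real CARD('n) \<ge> 1" by (simp add: Suc_leI)
  moreover have "0 \<le> 2 * real (\<Sum>j\<in>UNIV. snd i $ j)" by (simp add: sum_nonneg)
  ultimately show ?thesis unfolding ev_def eigval_def by linarith
qed

lemma prod_if_zero: "(\<Prod>i\<in>(UNIV::'n::finite set). if P i then f i else (0::complex)) = (if \<forall>i. P i then \<Prod>i\<in>UNIV. f i else 0)"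
  by (auto intro: prod.cong)

text \<open>Weight and special Hermite functions factor over the coordinates, so
  \<open>sh_gram_weight\<close> multiplies up and the exponents add to
  \<open>2 * ev i * t\<close>.\<close>

lemma SHi_gram_t:
  fixes i j :: "'n::finite ix"
  assumes t: "t > 0"
  shows "has_bochner_integral lborel (\<lambda>p. SHi i p * cnj (SHi j p) * of_real (weight t p)) (if i = j then of_real (Nt t i) else 0)"
proof -
  let ?f = "\<lambda>k p. sh (fst i $ k) (snd i $ k) (fst p) (snd p) * cnj (sh (fst j $ k) (snd j $ k) (fst p) (snd p)) * of_real (w1 t (fst p) (snd p))"
  let ?v = "\<lambda>k. if fst i $ k = fst j $ k \<and> snd i $ k = snd j $ k then complex_of_real (2 * exp (2 * (2 * real (snd i $ k) + 1) * t)) else 0"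
  have e: "SHi i p * cnj (SHi j p) * of_real (weight t p) = (\<Prod>k\<in>UNIV. ?f k (fst p $ k, snd p $ k))" for p
    unfolding SHi_def SH_def weight_eq_prod by (simp add: prod.distrib)
  have g: "has_bochner_integral lborel (?f k) (?v k)" for k by (rule sh_gram_weight[OF t])
  have ii: "integrable lborel (?f k)" for k using g[of k] by (simp add: has_bochner_integral_iff)
  have vv: "integral\<^sup>L lborel (?f k) = ?v k" for k using g[of k] by (simp only: has_bochner_integral_iff)
  have "has_bochner_integral lborel (\<lambda>p. SHi i p * cnj (SHi j p) * of_real (weight t p)) (\<Prod>k\<in>UNIV. ?v k)"
    unfolding e has_bochner_integral_iff using integral_vecpair_prod[of ?f, OF ii] unfolding vv by blast
  also have "(\<Prod>k\<in>UNIV. ?v k) = (if i = j then of_real (Nt t i) else 0)"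
  proof -
    have "(\<forall>k. fst i $ k = fst j $ k \<and> snd i $ k = snd j $ k) \<longleftrightarrow> i = j"
      by (auto simp: prod_eq_iff vec_eq_iff)
    moreover have "(\<Prod>k\<in>UNIV. complex_of_real (2 * exp (2 * (2 * real (snd i $ k) + 1) * t))) = of_real (Nt t i)"
    proof -
      have "(\<Sum>k\<in>UNIV. 2 * (2 * real (snd i $ k) + 1) * t) = 2 * ev i * t"
        unfolding ev_def eigval_def sum_distrib_right[symmetric] sum_distrib_left[symmetric]
        by (simp add: sum.distrib sum_distrib_left)
      then have "(\<Prod>k\<in>UNIV. (2 * exp (2 * (2 * real (snd i $ k) + 1) * t))) = Nt t i"
        unfolding Nt_def prod.distrib exp_sum[OF finite, symmetric] by simp
      then show ?thesis unfolding of_real_prod[symmetric] by simp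
    qed
    ultimately show ?thesis unfolding prod_if_zero by (simp only:)
  qed
  finally show ?thesis .
qed

lemma orthogonal_system_Mt:
  assumes t: "t > 0"
  shows "orthogonal_system (Mt t) (SHi :: 'n::finite ix \<Rightarrow> _) (Nt t)"
proof
  fix i j :: "'n ix"
  have m: "SHi i \<in> borel_measurable borel" for i :: "'n ix" by (rule entire_imp_measurable[OF entire_SHi])
  have "integrable lborel (\<lambda>p. cmod (SHi i p * cnj (SHi i p) * of_real (weight t p)))"
    using SHi_gram_t[OF t, of i i] by (auto simp: has_bochner_integral_iff)
  moreover have "\<bar>weight t p\<bar> = weight t p" for p :: "'n cc" using weight_pos[OF t] by (rule abs_of_pos)
  ultimately show "sqi (Mt t) (SHi i)"
    unfolding sqi_Mt[OF t] using m[of i] by (simp add: norm_mult power2_eq_square)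
  have m2: "(\<lambda>p. SHi i p * cnj (SHi j p)) \<in> borel_measurable borel" using m by measurable
  show "ip (Mt t) (SHi i) (SHi j) = (if i = j then of_real (Nt t i) else 0)"
    unfolding ip_def integral_Mt[OF t m2] using SHi_gram_t[OF t, of i j]
    by (simp add: has_bochner_integral_iff scaleR_conv_of_real mult.commute)
  show "0 < Nt t i" by (simp add: Nt_def)
qed

definition rr :: "'n::finite ix \<Rightarrow> (real ^ 'n) \<times> (real ^ 'n) \<Rightarrow> complex" where
  "rr i = special_Hermite (fst i) (snd i)"

lemma rr_eq: "rr i = restrict_real (SHi i)"
  unfolding rr_def SHi_def by (rule special_Hermite_eq)

lemma continuous_restrict_real: "entire F \<Longrightarrow> continuous_on UNIV (restrict_real F)"
proof -
  assume F: "entire F"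
  have "continuous_on UNIV (\<lambda>p :: (real^'a) \<times> (real^'a). F (\<chi> i. of_real (fst p $ i), \<chi> i. of_real (snd p $ i)))"
    by (intro continuous_on_compose2[OF entire_imp_continuous[OF F, of UNIV]] continuous_intros continuous_on_vec_lambda) auto
  then show ?thesis by (simp add: restrict_real_def case_prod_unfold)
qed

lemma measurable_restrict_real: "entire F \<Longrightarrow> restrict_real F \<in> borel_measurable borel"
  by (rule borel_measurable_continuous_onI[OF continuous_restrict_real])

lemma orthogonal_system_real:
  "orthogonal_system lborel (rr :: 'n::finite ix \<Rightarrow> _) (\<lambda>_. 1)"
proof
  have hb: "has_bochner_integral lborel (\<lambda>p. rr i p * cnj (rr j p)) (if i = j then 1 else 0)" for i j :: "'n ix"
  proof -
    let ?f = "\<lambda>k p. sh (fst i $ k) (snd i $ k) (of_real (fst p)) (of_real (snd p)) * cnj (sh (fst j $ k) (snd j $ k) (of_real (fst p)) (of_real (snd p)))"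
    let ?v = "\<lambda>k. if fst i $ k = fst j $ k \<and> snd i $ k = snd j $ k then 1 else 0 :: complex"
    have e: "rr i p * cnj (rr j p) = (\<Prod>k\<in>UNIV. ?f k (fst p $ k, snd p $ k))" for p
      unfolding rr_eq SHi_def SH_def restrict_real_def by (simp add: prod.distrib case_prod_unfold)
    have g: "has_bochner_integral lborel (?f k) (?v k)" for k by (rule sh_gram_real)
    have ii: "integrable lborel (?f k)" for k using g[of k] by (simp add: has_bochner_integral_iff)
    have vv: "integral\<^sup>L lborel (?f k) = ?v k" for k using g[of k] by (simp only: has_bochner_integral_iff)
    have "(\<forall>k. fst i $ k = fst j $ k \<and> snd i $ k = snd j $ k) \<longleftrightarrow> i = j"
      by (auto simp: prod_eq_iff vec_eq_iff)
    then have "(\<Prod>k\<in>UNIV. ?v k) = (if i = j then 1 else 0)" unfolding prod_if_zero by simp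
    then show ?thesis
      unfolding e has_bochner_integral_iff using integral_vecpair_prod[of ?f, OF ii] unfolding vv by simp
  qed
  fix i j :: "'n ix"
  have m: "rr i \<in> borel_measurable borel" unfolding rr_eq by (rule measurable_restrict_real[OF entire_SHi])
  have "integrable lborel (\<lambda>p. cmod (rr i p * cnj (rr i p)))"
    using hb[of i i] by (auto simp: has_bochner_integral_iff)
  then show "sqi lborel (rr i)" unfolding sqi_def using m by (simp add: norm_mult power2_eq_square)
  show "ip lborel (rr i) (rr j) = (if i = j then of_real 1 else 0)"
    unfolding ip_def using hb[of i j] by (simp add: has_bochner_integral_iff)
qed simp

section \<open>Series of special Hermite functions\<close>

definition psum :: "'n::finite ix set \<Rightarrow> ('n ix \<Rightarrow> complex) \<Rightarrow> 'n cc \<Rightarrow> complex" where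
  "psum S d p = (\<Sum>i\<in>S. d i * SHi i p)"

text \<open>Meaningful when the coefficients are square summable against \<open>Nt\<close>;
  convergence is then locally uniform by \<open>SE_convergence\<close>.\<close>

definition SE :: "('n::finite ix \<Rightarrow> complex) \<Rightarrow> 'n cc \<Rightarrow> complex" where
  "SE d p = lim (\<lambda>n. psum (stage n) d p)"

lemma entire_psum: "entire (psum S d)"
  unfolding psum_def[abs_def] by (intro entire_sum entire_cmult entire_SHi)

text \<open>Point evaluations are bounded on balls, so partial sums that are Cauchy in the weighted
  norm are uniformly Cauchy there.\<close>

lemma SE_convergence:
  fixes d :: "'n::finite ix \<Rightarrow> complex"
  assumes t: "t > 0" and sm: "(\<lambda>i. (cmod (d i))\<^sup>2 * Nt t i) summable_on UNIV"
  shows "uniform_limit (cball 0 R) (\<lambda>n. psum (stage n) d) (SE d) sequentially"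
proof -
  interpret O: orthogonal_system "Mt t" "SHi :: 'n ix \<Rightarrow> _" "Nt t" by (rule orthogonal_system_Mt[OF t])
  have fs: "O.fs = psum" by (simp add: fun_eq_iff O.fs_def psum_def)
  have nn: "0 \<le> (cmod (d i))\<^sup>2 * Nt t i" for i using O.N_pos[of i] by (simp add: less_imp_le)
  obtain K where K: "K \<ge> 0" "\<And>F p. entire F \<Longrightarrow> sqi (Mt t) F \<Longrightarrow> p \<in> cball 0 R \<Longrightarrow> (cmod (F p))\<^sup>2 \<le> K * nm2 (Mt t) (F :: 'n cc \<Rightarrow> complex)"
    using evaluation_bound[OF t, of R, where 'n='n] by blast
  let ?a = "\<lambda>n. \<Sum>i\<in>stage n. (cmod (d i))\<^sup>2 * Nt t i"
  have conv: "?a \<longlonglongrightarrow> (\<Sum>\<^sub>\<infinity>i. (cmod (d i))\<^sup>2 * Nt t i)"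
    using filterlim_compose[OF _ stage_limit, of "sum (\<lambda>i. (cmod (d i))\<^sup>2 * Nt t i)"] has_sum_infsum[OF sm] unfolding has_sum_def by auto
  have "uniformly_Cauchy_on (cball 0 R) (\<lambda>n. psum (stage n) d)"
  proof (rule uniformly_Cauchy_onI')
    fix e :: real assume e: "e > 0"
    have "e\<^sup>2 / (K + 1) > 0" using e K by simp
    from metric_CauchyD[OF LIMSEQ_imp_Cauchy[OF conv] this] obtain M where M: "\<And>m n. m \<ge> M \<Longrightarrow> n \<ge> M \<Longrightarrow> \<bar>?a m - ?a n\<bar> < e\<^sup>2 / (K + 1)"
      by (auto simp: dist_real_def)
    show "\<exists>M. \<forall>x\<in>cball 0 R. \<forall>m\<ge>M. \<forall>n>m. dist (psum (stage m) d x) (psum (stage n) d x) < e"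
    proof (intro exI[of _ M] ballI allI impI)
      fix p :: "'n cc" and m n assume p: "p \<in> cball 0 R" and mn: "M \<le> m" "m < n"
      have sub: "stage m \<subseteq> (stage n :: 'n ix set)" using mn by (auto simp: stage_def)
      have df: "psum (stage n) d q - psum (stage m) d q = psum (stage n - stage m) d q" for q
        unfolding psum_def by (simp add: sum_diff sub)
      have "(cmod (psum (stage n - stage m) d p))\<^sup>2 \<le> K * nm2 (Mt t) (psum (stage n - stage m) d)"
        using O.sqi_fs unfolding fs by (intro K entire_psum p)
      also have "nm2 (Mt t) (psum (stage n - stage m) d) = ?a n - ?a m"
        using O.nm2_fs[of "stage n - stage m" d] unfolding fs by (simp add: sum_diff sub)
      also have "K * (?a n - ?a m) \<le> K * (e\<^sup>2 / (K + 1))"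
        using M[of n m] mn K by (intro mult_left_mono) auto
      also have "\<dots> < e\<^sup>2" using e K by (simp add: field_simps)
      finally have "cmod (psum (stage n - stage m) d p) < e"
        using e power2_less_imp_less by fastforce
      then show "dist (psum (stage m) d p) (psum (stage n) d p) < e"
        by (metis df dist_commute dist_norm)
    qed
  qed
  then have "uniformly_convergent_on (cball 0 R) (\<lambda>n. psum (stage n) d)"
    by (rule Cauchy_uniformly_convergent)
  then show ?thesis unfolding uniformly_convergent_uniform_limit_iff SE_def[abs_def] .
qed

lemma SE_props:
  fixes d :: "'n::finite ix \<Rightarrow> complex"
  assumes t: "t > 0" and sm: "(\<lambda>i. (cmod (d i))\<^sup>2 * Nt t i) summable_on UNIV"
  shows "entire (SE d)" "(\<lambda>n. psum (stage n) d p) \<longlonglongrightarrow> SE d p"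
    "sqi (Mt t) (SE d)" "ip (Mt t) (SE d) (SHi i) = d i * of_real (Nt t i)"
    "nm2 (Mt t) (SE d) = (\<Sum>\<^sub>\<infinity>i. (cmod (d i))\<^sup>2 * Nt t i)"
proof -
  interpret O: orthogonal_system "Mt t" "SHi :: 'n ix \<Rightarrow> _" "Nt t" by (rule orthogonal_system_Mt[OF t])
  have fs: "O.fs = psum" by (simp add: fun_eq_iff O.fs_def psum_def)
  show E: "entire (SE d)" by (rule entire_limit[OF entire_psum SE_convergence[OF t sm]])
  show L: "(\<lambda>n. psum (stage n) d p) \<longlonglongrightarrow> SE d p" for p
    using tendsto_uniform_limitI[OF SE_convergence[OF t sm, of "norm p"]] by simp
  note S = O.series_limit[OF sm, of "SE d" "\<lambda>n. n"]
  have m: "SE d \<in> borel_measurable (Mt t)" using entire_imp_measurable[OF E] by simp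
  have ae: "AE x in Mt t. (\<lambda>n. O.fs (stage n) d x) \<longlonglongrightarrow> SE d x" unfolding fs using L by simp
  show "sqi (Mt t) (SE d)" "nm2 (Mt t) (SE d) = (\<Sum>\<^sub>\<infinity>i. (cmod (d i))\<^sup>2 * Nt t i)" using S(1,3) m ae by (auto simp: strict_mono_def)
  have "O.co (SE d) i = d i" using S(2) m ae by (simp add: strict_mono_def)
  then show "ip (Mt t) (SE d) (SHi i) = d i * of_real (Nt t i)"
    using O.N_pos[of i] by (simp add: O.co_def field_simps)
qed

section \<open>Uniqueness for the Fourier transform\<close>

text \<open>Trigonometric polynomials with arbitrary real frequencies, as an inductive span, so that
  statements about integrals extend to them by rule induction.\<close>

inductive TP :: "('a::euclidean_space \<Rightarrow> complex) \<Rightarrow> bool" where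
  TP_exp: "TP (\<lambda>p. exp (\<i> * of_real (\<xi> \<bullet> p)))"
| TP_add: "TP f \<Longrightarrow> TP g \<Longrightarrow> TP (\<lambda>p. f p + g p)"
| TP_cmult: "TP f \<Longrightarrow> TP (\<lambda>p. c * f p)"

lemma TP_const: "TP (\<lambda>p. c)"
  using TP_cmult[OF TP_exp[of 0], of c] by simp

lemma TP_mult: "TP f \<Longrightarrow> TP g \<Longrightarrow> TP (\<lambda>p. f p * g p)"
proof (induction rule: TP.induct)
  case (TP_exp \<xi>)
  from TP_exp show ?case
  proof (induction rule: TP.induct)
    case (TP_exp \<xi>')
    show ?case using TP.TP_exp[of "\<xi> + \<xi>'"] by (simp add: exp_add[symmetric] inner_add_left distrib_left)
  next
    case (TP_add f g)
    then show ?case using TP.TP_add by (auto simp: distrib_left)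
  next
    case (TP_cmult f c)
    then show ?case using TP.TP_cmult[of _ c] by (auto simp: mult.left_commute[of _ c])
  qed
next
  case (TP_add f g)
  then show ?case using TP.TP_add by (auto simp: distrib_right)
next
  case (TP_cmult f c)
  then show ?case using TP.TP_cmult[of _ c] by (auto simp: mult.assoc)
qed

lemma TP_sum: "(\<And>i. i \<in> I \<Longrightarrow> TP (f i)) \<Longrightarrow> TP (\<lambda>p. \<Sum>i\<in>I. f i p)"
  by (induction I rule: infinite_finite_induct) (auto intro: TP_const TP_add)

lemma TP_sin: "TP (\<lambda>p. of_real (sin (\<xi> \<bullet> p)))"
proof -
  have "TP (\<lambda>p. - \<i> / 2 * exp (\<i> * of_real (\<xi> \<bullet> p)) + \<i> / 2 * exp (\<i> * of_real ((- \<xi>) \<bullet> p)))"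
    by (intro TP_add TP_cmult TP_exp)
  moreover have "- \<i> / 2 * exp (\<i> * of_real (\<xi> \<bullet> p)) + \<i> / 2 * exp (\<i> * of_real ((- \<xi>) \<bullet> p)) = of_real (sin (\<xi> \<bullet> p))" for p :: 'a
    by (simp add: complex_eq_iff Re_exp Im_exp)
  ultimately show ?thesis by simp
qed

text \<open>A bounded approximation of the identity; composing a polynomial with it gives a trigonometric
  polynomial.\<close>

definition Sn :: "real \<Rightarrow> 'a::euclidean_space \<Rightarrow> 'a" where
  "Sn m p = (\<Sum>b\<in>Basis. (m * sin (p \<bullet> b / m)) *\<^sub>R b)"

lemma TP_poly: "real_polynomial_function P \<Longrightarrow> TP (\<lambda>p. of_real (P (Sn m p)))"
proof (induction rule: real_polynomial_function.induct)
  case (linear f)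
  have "TP (\<lambda>p. \<Sum>b\<in>Basis. of_real (m * f b) * of_real (sin ((b /\<^sub>R m) \<bullet> p)))"
    by (intro TP_sum TP_cmult TP_sin)
  moreover have "(\<Sum>b\<in>Basis. of_real (m * f b) * of_real (sin ((b /\<^sub>R m) \<bullet> p))) = complex_of_real (f (Sn m p))" for p
  proof -
    have "f (Sn m p) = (\<Sum>b\<in>Basis. (m * sin (p \<bullet> b / m)) * f b)"
      unfolding Sn_def linear_sum[OF bounded_linear.linear[OF linear]]
      by (simp add: linear_cmul[OF bounded_linear.linear[OF linear]])
    then show ?thesis by (simp add: inner_commute divide_inverse mult_ac)
  qed
  ultimately show ?case by simp
next
  case (const c) show ?case by (rule TP_const)
next
  case (add f g) then show ?case using TP_add by fastforce
next
  case (mult f g) then show ?case using TP_mult by fastforce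
qed

lemma norm_Sn: "m > 0 \<Longrightarrow> norm (Sn m (p::'a::euclidean_space)) \<le> m * DIM('a)"
proof -
  assume m: "m > 0"
  have "norm (Sn m p) \<le> (\<Sum>b\<in>(Basis::'a set). \<bar>m * sin (p \<bullet> b / m)\<bar>)"
    unfolding Sn_def by (rule order_trans[OF norm_sum]) (intro sum_mono, simp)
  also have "\<dots> \<le> (\<Sum>b\<in>(Basis::'a set). m)"
    using m by (intro sum_mono) (simp add: abs_mult)
  finally show ?thesis by (simp add: mult.commute)
qed

lemma Sn_limit: "(\<lambda>n. Sn (real (Suc n)) p) \<longlonglongrightarrow> p"
proof -
  have s: "(\<lambda>n. real (Suc n) * sin (x / real (Suc n))) \<longlonglongrightarrow> x" for x
    by real_asymp
  have "(\<lambda>n. Sn (real (Suc n)) p) \<longlonglongrightarrow> (\<Sum>b\<in>Basis. (p \<bullet> b) *\<^sub>R b)"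
    unfolding Sn_def by (intro tendsto_sum tendsto_scaleR s tendsto_const)
  then show ?thesis by (simp add: euclidean_representation)
qed

lemma continuous_on_Sn: "continuous_on S (Sn m)"
  unfolding Sn_def[abs_def] divide_inverse by (intro continuous_intros)

text \<open>The vanishing extends from trigonometric polynomials to bounded continuous functions,
  then to indicators of open sets, then to Borel sets. Stone-Weierstrass approximates
  \<open>g\<close> by a polynomial on the bounded range of \<open>Sn m\<close>; composing with
  \<open>Sn m\<close> makes the approximation uniform on the whole space.\<close>

lemma Fourier_unique:
  fixes h :: "'a::euclidean_space \<Rightarrow> complex"
  assumes h: "integrable lborel h" and z: "\<And>\<xi>. (\<integral>p. h p * exp (\<i> * of_real (\<xi> \<bullet> p)) \<partial>lborel) = 0"
  shows "AE p in lborel. h p = 0"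
proof -
  have mh[measurable]: "h \<in> borel_measurable borel" using borel_measurable_integrable[OF h] by simp
  have ib: "integrable lborel (\<lambda>p. h p * q p)" if "q \<in> borel_measurable borel" "\<And>p. norm (q p) \<le> C" for q C
  proof (rule Bochner_Integration.integrable_bound[OF integrable_mult_left[OF integrable_norm[OF h], of C]])
    show "(\<lambda>p. h p * q p) \<in> borel_measurable lborel" using that by measurable
    show "AE p in lborel. norm (h p * q p) \<le> norm (norm (h p) * C)"
      using that(2) norm_ge_zero[of "q undefined"] by (intro AE_I2) (simp add: norm_mult abs_mult mult_left_mono order_trans[OF _ abs_ge_self])
  qed
  have tp: "integrable lborel (\<lambda>p. h p * q p) \<and> (\<integral>p. h p * q p \<partial>lborel) = 0" if "TP q" for q
    using that
  proof (induction rule: TP.induct)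
    case (TP_exp \<xi>)
    show ?case using z by (intro conjI ib[of _ 1]) (auto intro!: borel_measurable_continuous_onI continuous_intros)
  next
    case (TP_add f g)
    then show ?case by (simp add: distrib_left)
  next
    case (TP_cmult f c)
    then show ?case by (simp add: mult.left_commute[of _ c])
  qed
  have bounded: "(\<integral>p. h p * of_real (g p) \<partial>lborel) = 0" if g: "continuous_on UNIV g" "\<And>p. \<bar>g p\<bar> \<le> 1" for g :: "'a \<Rightarrow> real"
  proof -
    have mg[measurable]: "g \<in> borel_measurable borel" by (rule borel_measurable_continuous_onI[OF g(1)])
    have mS[measurable]: "Sn m \<in> borel_measurable borel" for m by (rule borel_measurable_continuous_onI[OF continuous_on_Sn])
    have step: "(\<integral>p. h p * of_real (g (Sn m p)) \<partial>lborel) = 0" if m: "m > 0" for m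
    proof -
      let ?I = "\<integral>p. h p * of_real (g (Sn m p)) \<partial>lborel"
      have "norm ?I \<le> e * (\<integral>p. norm (h p) \<partial>lborel)" if e: "e > 0" for e
      proof -
        obtain P where P: "real_polynomial_function P" "\<And>x. x \<in> cball 0 (m * DIM('a)) \<Longrightarrow> \<bar>g x - P x\<bar> < e"
          using Stone_Weierstrass_real_polynomial_function[OF compact_cball continuous_on_subset[OF g(1) subset_UNIV] e] by blast
        have PS: "\<bar>g (Sn m p) - P (Sn m p)\<bar> \<le> e" for p
          using P(2)[of "Sn m p"] norm_Sn[OF m, of p] by auto
        note t = tp[OF TP_poly[OF P(1), of m]]
        have ig: "integrable lborel (\<lambda>p. h p * of_real (g (Sn m p)))"
          using g(2) by (intro ib[of _ 1]) (auto intro!: borel_measurable_of_real)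
        have "?I = (\<integral>p. h p * of_real (g (Sn m p)) - h p * of_real (P (Sn m p)) \<partial>lborel)"
          using t ig by simp
        also have "norm \<dots> \<le> (\<integral>p. norm (h p * of_real (g (Sn m p)) - h p * of_real (P (Sn m p))) \<partial>lborel)"
          by (rule integral_norm_bound)
        also have "\<dots> \<le> (\<integral>p. e * norm (h p) \<partial>lborel)"
        proof (rule integral_mono)
          show "integrable lborel (\<lambda>p. norm (h p * of_real (g (Sn m p)) - h p * of_real (P (Sn m p))))"
            using t ig by (intro integrable_norm Bochner_Integration.integrable_diff) auto
          show "norm (h p * of_real (g (Sn m p)) - h p * of_real (P (Sn m p))) \<le> e * norm (h p)" for p
          proof -
            have "norm (h p * of_real (g (Sn m p)) - h p * of_real (P (Sn m p))) = norm (h p) * \<bar>g (Sn m p) - P (Sn m p)\<bar>"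
              unfolding right_diff_distrib[symmetric] of_real_diff[symmetric] norm_mult norm_of_real ..
            also have "\<dots> \<le> norm (h p) * e" by (intro mult_left_mono PS) simp
            finally show ?thesis by (simp add: mult.commute)
          qed
        qed (use h in auto)
        finally show ?thesis by simp
      qed
      then have le: "norm ?I \<le> e * (\<integral>p. norm (h p) \<partial>lborel)" if "e > 0" for e using that .
      have nn: "0 \<le> (\<integral>p. norm (h p) \<partial>lborel)" by simp
      have "norm ?I \<le> 0 + e" if "e > 0" for e
      proof -
        have "e / ((\<integral>p. norm (h p) \<partial>lborel) + 1) > 0" using that nn by (intro divide_pos_pos) linarith+
        from le[OF this] have "norm ?I \<le> e * ((\<integral>p. norm (h p) \<partial>lborel) / ((\<integral>p. norm (h p) \<partial>lborel) + 1))" by simp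
        also have "\<dots> \<le> e * 1"
        proof (rule mult_left_mono)
          have "(\<integral>p. norm (h p) \<partial>lborel) + 1 > 0" using nn by linarith
          then show "(\<integral>p. norm (h p) \<partial>lborel) / ((\<integral>p. norm (h p) \<partial>lborel) + 1) \<le> 1"
            by (subst pos_divide_le_eq) auto
        qed (use that in simp)
        finally show ?thesis by simp
      qed
      then have "norm ?I \<le> 0" by (rule field_le_epsilon)
      then show ?thesis by simp
    qed
    \<comment> \<open>\<open>Sn m\<close> tends to the identity pointwise as m grows, and the norm
      of \<open>h\<close> dominates because \<open>g\<close> is bounded by 1.\<close>
    have "(\<lambda>n. \<integral>p. h p * of_real (g (Sn (real (Suc n)) p)) \<partial>lborel) \<longlonglongrightarrow> (\<integral>p. h p * of_real (g p) \<partial>lborel)"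
    proof (rule integral_dominated_convergence)
      show "integrable lborel (\<lambda>p. norm (h p))" using h by simp
      have "isCont g p" for p using g(1) by (simp add: continuous_on_eq_continuous_at)
      then show "AE p in lborel. (\<lambda>n. h p * of_real (g (Sn (real (Suc n)) p))) \<longlonglongrightarrow> h p * of_real (g p)"
        by (intro AE_I2 tendsto_mult tendsto_const tendsto_of_real isCont_tendsto_compose[OF _ Sn_limit])
      show "AE p in lborel. norm (h p * of_real (g (Sn (real (Suc n)) p))) \<le> norm (h p)" for n
        using g(2) by (intro AE_I2) (simp add: norm_mult mult_left_le)
    qed measurable
    then show ?thesis using step by (simp add: LIMSEQ_const_iff)
  qed
  have op: "(LINT p:U|lborel. h p) = 0" if U: "open U" for U
  proof (cases "U = UNIV")
    case True then show ?thesis using bounded[of "\<lambda>_. 1"] by (simp add: set_lebesgue_integral_def)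
  next
    case False
    have [measurable]: "U \<in> sets borel" using U by simp
    \<comment> \<open>Continuous functions that vanish off \<open>U\<close> and increase to its
      indicator. The whole space was treated separately because \<open>infdist\<close> to the empty
      set is 0.\<close>
    let ?g = "\<lambda>n p. min 1 (real n * infdist p (- U))"
    have "(\<lambda>n. \<integral>p. h p * of_real (?g n p) \<partial>lborel) \<longlonglongrightarrow> (\<integral>p. h p * of_real (indicator U p) \<partial>lborel)"
    proof (rule integral_dominated_convergence)
      show "integrable lborel (\<lambda>p. norm (h p))" using h by simp
      show "(\<lambda>p. h p * of_real (indicator U p)) \<in> borel_measurable lborel" using U by measurable
      have cg: "continuous_on UNIV (?g n)" for n by (intro continuous_intros)
      have [measurable]: "?g n \<in> borel_measurable borel" for n by (rule borel_measurable_continuous_onI[OF cg])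
      show "(\<lambda>p. h p * of_real (?g n p)) \<in> borel_measurable lborel" for n by measurable
      show "AE p in lborel. norm (h p * of_real (?g n p)) \<le> norm (h p)" for n
        by (intro AE_I2) (simp add: norm_mult mult_left_le infdist_nonneg)
      have "(\<lambda>n. ?g n p) \<longlonglongrightarrow> indicator U p" for p
      proof (cases "p \<in> U")
        case False then show ?thesis by (simp add: infdist_zero)
      next
        case True
        have "infdist p (- U) > 0"
          using True False U infdist_pos_not_in_closed[of "- U" p] by auto
        then obtain n0 where n0: "1 / infdist p (- U) < real n0" using reals_Archimedean2 by blast
        have "?g n p = 1" if "n \<ge> n0" for n
        proof -
          have "1 / infdist p (- U) \<le> real n" using n0 that by linarith
          then have "1 \<le> real n * infdist p (- U)" using \<open>infdist p (- U) > 0\<close> by (simp add: divide_le_eq)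
          then show ?thesis by simp
        qed
        then have "\<forall>\<^sub>F n in sequentially. ?g n p = 1" unfolding eventually_sequentially by blast
        then show ?thesis using True by (simp add: tendsto_eventually)
      qed
      then show "AE p in lborel. (\<lambda>n. h p * of_real (?g n p)) \<longlonglongrightarrow> h p * of_real (indicator U p)"
        by (intro AE_I2 tendsto_intros)
    qed
    moreover have "(\<integral>p. h p * of_real (?g n p) \<partial>lborel) = 0" for n
      by (intro bounded continuous_intros) (simp add: infdist_nonneg)
    ultimately have "(\<integral>p. h p * of_real (indicator U p) \<partial>lborel) = 0" by (simp add: LIMSEQ_const_iff)
    moreover have "h p * of_real (indicator U p) = indicator U p *\<^sub>R h p" for p by (auto split: split_indicator)
    ultimately show ?thesis unfolding set_lebesgue_integral_def by simp
  qed
  have A0: "(LINT p:A|lborel. h p) = 0" if "A \<in> sets borel" for A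
  proof -
    have "Int_stable {S :: 'a set. open S}" by (auto simp: Int_stable_def)
    moreover have "{S :: 'a set. open S} \<subseteq> Pow UNIV" by simp
    moreover have "A \<in> sigma_sets UNIV {S. open S}" using that by (simp add: borel_def)
    ultimately show ?thesis
    proof (induction rule: sigma_sets_induct_disjoint)
      case (basic A) then show ?case using op by simp
    next
      case empty show ?case by (simp add: set_lebesgue_integral_def)
    next
      case (compl A)
      then have A: "A \<in> sets borel" by (simp add: borel_def)
      have si: "set_integrable lborel B h" if "B \<in> sets borel" for B
        using that h by (intro integrable_mult_indicator[folded set_integrable_def]) auto
      have "(LINT p:A \<union> (UNIV - A)|lborel. h p) = (LINT p:A|lborel. h p) + (LINT p:UNIV - A|lborel. h p)"
        using A by (intro set_integral_Un si) auto
      then show ?case using compl(2) op[of UNIV] by simp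
    next
      case (union A)
      then have A: "A i \<in> sets borel" for i by (auto simp: borel_def)
      have "(LINT p:(\<Union>i. A i)|lborel. h p) = (\<Sum>i. LINT p:A i|lborel. h p)"
      proof (rule lebesgue_integral_countable_add)
        show "set_integrable lborel (\<Union>i. A i) h"
          using A h by (intro integrable_mult_indicator[folded set_integrable_def]) auto
      qed (use A union(1) in \<open>auto simp: disjoint_family_on_def\<close>)
      then show ?case using union by simp
    qed
  qed
  have si: "integrable lborel (\<lambda>p. indicator A p *\<^sub>R h p)" if "A \<in> sets borel" for A
    using that h by (intro integrable_mult_indicator) auto
  have "AE p in lborel. Re (h p) = 0"
  proof (rule density_unique_real[of lborel "\<lambda>p. Re (h p)" "\<lambda>_. 0"])
    fix A assume "A \<in> sets (lborel :: 'a measure)"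
    then have A: "A \<in> sets borel" by simp
    have "Re (LINT p:A|lborel. h p) = (LINT p:A|lborel. Re (h p))"
      unfolding set_lebesgue_integral_def using si[OF A] by (simp flip: integral_Re)
    then show "(LINT p:A|lborel. Re (h p)) = (LINT p:A|lborel. 0)"
      using A0[OF A] by (simp add: set_lebesgue_integral_def)
  qed (use h in auto)
  moreover have "AE p in lborel. Im (h p) = 0"
  proof (rule density_unique_real[of lborel "\<lambda>p. Im (h p)" "\<lambda>_. 0"])
    fix A assume "A \<in> sets (lborel :: 'a measure)"
    then have A: "A \<in> sets borel" by simp
    have "Im (LINT p:A|lborel. h p) = (LINT p:A|lborel. Im (h p))"
      unfolding set_lebesgue_integral_def using si[OF A] by (simp flip: integral_Im)
    then show "(LINT p:A|lborel. Im (h p)) = (LINT p:A|lborel. 0)"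
      using A0[OF A] by (simp add: set_lebesgue_integral_def)
  qed (use h in auto)
  ultimately show ?thesis by eventually_elim (simp add: complex_eq_iff)
qed

section \<open>Exponentials in the span\<close>

text \<open>Orthogonality to all powers of \<open>l\<close> passes to its exponential: the partial
  sums of the exponential series are dominated by exp |l|, which is integrable against
  \<open>f\<close> by assumption.\<close>

lemma exp_test:
  fixes f l :: "'a \<Rightarrow> complex"
  assumes m: "f \<in> borel_measurable M" "l \<in> borel_measurable M"
    and i: "integrable M (\<lambda>x. cmod (f x) * exp (cmod (l x)))"
    and z: "\<And>k. (\<integral>x. f x * cnj (l x ^ k) \<partial>M) = 0"
  shows "(\<integral>x. f x * cnj (exp (l x)) \<partial>M) = 0"
proof -
  let ?s = "\<lambda>n x. \<Sum>k<n. l x ^ k /\<^sub>R fact k"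
  have [measurable]: "f \<in> borel_measurable M" "l \<in> borel_measurable M" by fact+
  have b: "cmod (?s n x) \<le> exp (cmod (l x))" for n x
  proof -
    have "cmod (?s n x) \<le> (\<Sum>k<n. cmod (l x) ^ k /\<^sub>R fact k)"
      by (rule order_trans[OF norm_sum]) (simp add: norm_power)
    also have "\<dots> \<le> exp (cmod (l x))"
      unfolding exp_def by (rule sum_le_suminf[OF summable_exp_generic]) auto
    finally show ?thesis .
  qed
  have bk: "cmod (l x) ^ k \<le> fact k * exp (cmod (l x))" for k x
  proof -
    have "(\<Sum>j\<in>{k}. cmod (l x) ^ j /\<^sub>R fact j) \<le> exp (cmod (l x))"
      unfolding exp_def by (rule sum_le_suminf[OF summable_exp_generic]) auto
    then show ?thesis by (simp add: field_simps)
  qed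
  have ik: "integrable M (\<lambda>x. f x * cnj (l x ^ k))" for k
  proof (rule Bochner_Integration.integrable_bound[OF integrable_mult_left[OF i, of "fact k"]])
    have "cmod (f x) * cmod (l x) ^ k \<le> cmod (f x) * (fact k * exp (cmod (l x)))" for x
      by (intro mult_left_mono bk) simp
    then show "AE x in M. norm (f x * cnj (l x ^ k)) \<le> norm (cmod (f x) * exp (cmod (l x)) * fact k)"
      by (intro AE_I2) (simp add: norm_mult norm_power mult_ac)
  qed measurable
  have "(\<lambda>n. \<integral>x. f x * cnj (?s n x) \<partial>M) \<longlonglongrightarrow> (\<integral>x. f x * cnj (exp (l x)) \<partial>M)"
  proof (rule integral_dominated_convergence[OF _ _ i])
    show "AE x in M. (\<lambda>n. f x * cnj (?s n x)) \<longlonglongrightarrow> f x * cnj (exp (l x))"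
      by (intro AE_I2 tendsto_intros) (use exp_converges in \<open>auto simp: sums_def\<close>)
    show "AE x in M. norm (f x * cnj (?s n x)) \<le> cmod (f x) * exp (cmod (l x))" for n
      by (intro AE_I2) (simp only: norm_mult complex_mod_cnj mult_left_mono[OF b norm_ge_zero])
  qed measurable
  moreover have "(\<integral>x. f x * cnj (?s n x) \<partial>M) = 0" for n
  proof -
    have "f x * cnj (?s n x) = (\<Sum>k<n. (f x * cnj (l x ^ k)) /\<^sub>R fact k)" for x
      by (simp add: sum_distrib_left scaleR_conv_of_real mult.left_commute)
    then show ?thesis using ik z by (simp add: Bochner_Integration.integral_sum)
  qed
  ultimately show ?thesis by (simp add: LIMSEQ_const_iff)
qed

definition PPn :: "'n::finite ix \<Rightarrow> 'n cc \<Rightarrow> complex" where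
  "PPn i p = (\<Prod>k\<in>UNIV. PP (fst i $ k) (snd i $ k) (snd p $ k + \<i> * fst p $ k) (snd p $ k - \<i> * fst p $ k))"

text \<open>The span of the \<open>PPn\<close>. Stability under multiplication by linear forms makes
  it contain all their powers, and rule induction carries orthogonality from the \<open>PPn\<close>
  to the span.\<close>

inductive PS :: "('n::finite cc \<Rightarrow> complex) \<Rightarrow> bool" where
  PS_PP: "PS (PPn i)"
| PS_add: "PS f \<Longrightarrow> PS g \<Longrightarrow> PS (\<lambda>p. f p + g p)"
| PS_cmult: "PS f \<Longrightarrow> PS (\<lambda>p. c * f p)"

definition upd :: "nat ^ 'n::finite \<Rightarrow> 'n \<Rightarrow> nat \<Rightarrow> nat ^ 'n" where
  "upd v k m = (\<chi> j. if j = k then m else v $ j)"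

lemma PPn_split:
  "PPn i p = PP (fst i $ k) (snd i $ k) (snd p $ k + \<i> * fst p $ k) (snd p $ k - \<i> * fst p $ k)
     * (\<Prod>j\<in>UNIV - {k}. PP (fst i $ j) (snd i $ j) (snd p $ j + \<i> * fst p $ j) (snd p $ j - \<i> * fst p $ j))"
  unfolding PPn_def by (rule prod.remove) auto

lemma PPn_upd1: "PPn (upd (fst i) k m, snd i) p = PP m (snd i $ k) (snd p $ k + \<i> * fst p $ k) (snd p $ k - \<i> * fst p $ k)
     * (\<Prod>j\<in>UNIV - {k}. PP (fst i $ j) (snd i $ j) (snd p $ j + \<i> * fst p $ j) (snd p $ j - \<i> * fst p $ j))"
  unfolding PPn_split[of _ _ k] by (auto simp: upd_def intro!: prod.cong arg_cong2[where f="(*)"])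

lemma PPn_upd2: "PPn (fst i, upd (snd i) k m) p = PP (fst i $ k) m (snd p $ k + \<i> * fst p $ k) (snd p $ k - \<i> * fst p $ k)
     * (\<Prod>j\<in>UNIV - {k}. PP (fst i $ j) (snd i $ j) (snd p $ j + \<i> * fst p $ j) (snd p $ j - \<i> * fst p $ j))"
  unfolding PPn_split[of _ _ k] by (auto simp: upd_def intro!: prod.cong arg_cong2[where f="(*)"])

text \<open>The recursion of \<open>PP\<close> at the coordinate \<open>k\<close>, solved for the
  product with w + i z; where the lowered index would be negative its coefficient is 0.\<close>

lemma PS_mult_a: "PS g \<Longrightarrow> PS (\<lambda>p. (snd p $ k + \<i> * fst p $ k) * g p)"
proof (induction rule: PS.induct)
  case (PS_PP i)
  have e: "(snd p $ k + \<i> * fst p $ k) * PPn i p = PPn (upd (fst i) k (Suc (fst i $ k)), snd i) p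
      + (- 2 * of_nat (snd i $ k)) * PPn (fst i, upd (snd i) k (snd i $ k - 1)) p" for p
    unfolding PPn_upd1 PPn_upd2 PPn_split[of i p k] by (simp add: algebra_simps)
  show ?case unfolding e by (intro PS_add PS_cmult PS.PS_PP)
next
  case (PS_add f g) then show ?case using PS.PS_add by (auto simp: distrib_left)
next
  case (PS_cmult f c) then show ?case using PS.PS_cmult[of _ c] by (auto simp: mult.left_commute[of _ c])
qed

text \<open>As \<open>PS_mult_a\<close>, with \<open>PP_mult_b\<close> in place of the
  recursion.\<close>

lemma PS_mult_b: "PS g \<Longrightarrow> PS (\<lambda>p. - (snd p $ k - \<i> * fst p $ k) * g p)"
proof (induction rule: PS.induct)
  case (PS_PP i)
  have e: "- (snd p $ k - \<i> * fst p $ k) * PPn i p = PPn (fst i, upd (snd i) k (Suc (snd i $ k))) p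
      + (- 2 * of_nat (fst i $ k)) * PPn (upd (fst i) k (fst i $ k - 1), snd i) p" for p
  proof -
    define R where "R = (\<Prod>j\<in>UNIV - {k}. PP (fst i $ j) (snd i $ j) (snd p $ j + \<i> * fst p $ j) (snd p $ j - \<i> * fst p $ j))"
    show ?thesis
      unfolding PPn_upd1 PPn_upd2 PPn_split[of i p k] R_def[symmetric] mult.assoc[symmetric] PP_mult_b
      by (simp add: algebra_simps)
  qed
  show ?case unfolding e by (intro PS_add PS_cmult PS.PS_PP)
next
  case (PS_add f g) then show ?case using PS.PS_add by (auto simp: distrib_left)
next
  case (PS_cmult f c) then show ?case using PS.PS_cmult[of _ c] by (auto simp: mult.left_commute[of _ c])
qed

lemma PS_const: "PS (\<lambda>p :: 'n::finite cc. c)"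
proof -
  have "PPn (0, 0) p = 1" for p :: "'n cc" by (simp add: PPn_def)
  then show ?thesis using PS_cmult[OF PS_PP[of "(0, 0)"], of c, where 'n='n] by simp
qed

lemma PS_sum: "(\<And>i. i \<in> I \<Longrightarrow> PS (f i)) \<Longrightarrow> PS (\<lambda>p. \<Sum>i\<in>I. f i p)"
  by (induction I rule: infinite_finite_induct) (auto intro: PS_const PS_add)

definition LF :: "('n::finite cc \<Rightarrow> complex) \<Rightarrow> bool" where
  "LF l \<longleftrightarrow> (\<exists>s r. l = (\<lambda>p. \<Sum>k\<in>UNIV. s k * fst p $ k + r k * snd p $ k))"

lemma PS_mult_LF: assumes "LF l" "PS g" shows "PS (\<lambda>p. l p * g p)"
proof -
  obtain s r where l: "l = (\<lambda>p. \<Sum>k\<in>UNIV. s k * fst p $ k + r k * snd p $ k)" using assms(1) by (auto simp: LF_def)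
  let ?a = "\<lambda>p k. snd p $ k + \<i> * fst p $ k" and ?b = "\<lambda>p k. - (snd p $ k - \<i> * fst p $ k)"
  \<comment> \<open>In terms of \<open>?a\<close> = w + i z and \<open>?b\<close> = - (w - i z) one
    has z = - i (?a + ?b) / 2 and w = (?a - ?b) / 2.\<close>
  have "PS (\<lambda>p. \<Sum>k\<in>UNIV. ((- \<i> * s k + r k) / 2) * (?a p k * g p) + ((- \<i> * s k - r k) / 2) * (?b p k * g p))"
    by (intro PS_sum PS_add PS_cmult PS_mult_a PS_mult_b assms(2))
  moreover have "(\<Sum>k\<in>UNIV. ((- \<i> * s k + r k) / 2) * (?a p k * g p) + ((- \<i> * s k - r k) / 2) * (?b p k * g p)) = l p * g p" for p
    unfolding l sum_distrib_right
    by (intro sum.cong refl) (simp add: field_simps)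
  ultimately show ?thesis by simp
qed

lemma PS_power_LF: "LF l \<Longrightarrow> PS (\<lambda>p. l p ^ k)"
  by (induction k) (auto intro: PS_const PS_mult_LF)

lemma LF_linear: "LF l \<Longrightarrow> linear l"
  unfolding LF_def
  by (auto intro!: linearI simp: sum.distrib[symmetric] scaleR_conv_of_real[where 'a=complex] sum_distrib_left algebra_simps intro!: sum.cong)

lemma LF_bound: assumes "LF l" shows "\<exists>L\<ge>0. \<forall>p. cmod (l p) \<le> L * norm p"
proof -
  have "bounded_linear l" using LF_linear[OF assms] linear_conv_bounded_linear by blast
  from bounded_linear.nonneg_bounded[OF this] show ?thesis by (auto simp: mult.commute)
qed

lemma LF_entire: assumes "LF l" shows "entire l"
proof -
  obtain s r where l: "l = (\<lambda>p. \<Sum>k\<in>UNIV. s k * fst p $ k + r k * snd p $ k)" using assms(1) by (auto simp: LF_def)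
  show ?thesis unfolding l by (intro entire_sum entire_add entire_cmult entire_fst entire_snd)
qed

text \<open>The Gaussian exp (- S2 / 4) common to all \<open>SHi\<close>.\<close>

definition g0 :: "'n::finite cc \<Rightarrow> complex" where "g0 = hfac (-1)"

lemma entire_g0: "entire g0" unfolding g0_def by (rule entire_hfac)

lemma PPn_SHi: "\<exists>c. \<forall>p. g0 p * PPn i p = c * SHi i p"
proof -
  define cN :: complex where "cN = (\<Prod>k\<in>UNIV. of_real (1 / sqrt (2 * pi * 2 ^ (fst i $ k + snd i $ k) * fact (fst i $ k) * fact (snd i $ k))))"
  have nz: "cN \<noteq> 0" unfolding cN_def by (simp add: real_sqrt_eq_zero_cancel_iff)
  have gE: "g0 p = (\<Prod>k\<in>UNIV. exp (- ((fst p $ k)\<^sup>2 + (snd p $ k)\<^sup>2) / 4))" for p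
    unfolding g0_def hfac_def S2_def sum_distrib_left exp_sum[OF finite]
    by (intro prod.cong refl arg_cong[where f=exp]) (simp add: field_simps)
  have "SHi i p = cN * (g0 p * PPn i p)" for p
    unfolding SHi_def SH_def sh_def cN_def PPn_def prod.distrib gE by (simp only: mult_ac)
  then show ?thesis using nz by (intro exI[of _ "1 / cN"]) simp
qed

section \<open>Completeness in the weighted space\<close>

text \<open>After division by the Gaussian \<open>g0\<close>, the exponent of the weight depends only on \<open>w + i z\<close> and on the
  imaginary parts of \<open>z\<close> and \<open>w\<close>.\<close>

definition Aq :: "'n::finite cc \<Rightarrow> real" where
  "Aq p = (\<Sum>k\<in>UNIV. (cmod (snd p $ k + \<i> * fst p $ k))\<^sup>2)"

definition Yq :: "'n::finite cc \<Rightarrow> real" where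
  "Yq p = (\<Sum>k\<in>UNIV. (Im (fst p $ k))\<^sup>2 + (Im (snd p $ k))\<^sup>2)"

lemma Aq_nonneg: "0 \<le> Aq p" and Yq_nonneg: "0 \<le> Yq p"
  unfolding Aq_def Yq_def by (auto intro!: sum_nonneg)

lemma exponent_eq: "(c - 1) / 2 * Re (S2 p) - Qf c p = - (Aq p / 2 + (c - 1) * Yq p)"
  unfolding S2_def Qf_def Aq_def Yq_def Re_sum sum_distrib_left sum_divide_distrib sum.distrib[symmetric] sum_subtractf[symmetric]
    sum_negf[symmetric] cmod_sq
  by (intro sum.cong refl) (simp add: power2_eq_square field_simps)

text \<open>The real parts are recovered from w + i z and the imaginary parts: Re z = Im (w + i z) -
  Im w and Re w = Re (w + i z) + Im z. So decay in \<open>Aq\<close> and \<open>Yq\<close> is decay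
  in all directions.\<close>

lemma norm_le_Aq_Yq: "(norm p)\<^sup>2 \<le> 2 * Aq p + 3 * Yq p"
  unfolding norm_cc_sq Aq_def Yq_def sum_distrib_left sum.distrib[symmetric] cmod_sq
proof (rule sum_mono)
  fix k
  define x y u v where "x = Re (fst p $ k)" and "y = Im (fst p $ k)" and "u = Re (snd p $ k)" and "v = Im (snd p $ k)"
  have "0 \<le> (2 * (v + x) - x)\<^sup>2" "0 \<le> (2 * (u - y) - u)\<^sup>2" by simp_all
  have 1: "x\<^sup>2 \<le> 2 * (v + x)\<^sup>2 + 2 * v\<^sup>2" using sum_squares_bound[of "v + x" "- v"] by (simp add: power2_eq_square algebra_simps)
  have 2: "u\<^sup>2 \<le> 2 * (u - y)\<^sup>2 + 2 * y\<^sup>2" using sum_squares_bound[of "u - y" y] by (simp add: power2_eq_square algebra_simps)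
  have "x\<^sup>2 + y\<^sup>2 + (u\<^sup>2 + v\<^sup>2) \<le> 2 * ((u - y)\<^sup>2 + (v + x)\<^sup>2) + 3 * (y\<^sup>2 + v\<^sup>2)" using 1 2 by simp
  then show "(Re (fst p $ k))\<^sup>2 + (Im (fst p $ k))\<^sup>2 + ((Re (snd p $ k))\<^sup>2 + (Im (snd p $ k))\<^sup>2)
      \<le> 2 * ((Re (snd p $ k + \<i> * fst p $ k))\<^sup>2 + (Im (snd p $ k + \<i> * fst p $ k))\<^sup>2) + 3 * ((Im (fst p $ k))\<^sup>2 + (Im (snd p $ k))\<^sup>2)"
    by (simp add: x_def y_def u_def v_def)
qed

lemma weight_g0:
  fixes p :: "'n::finite cc"
  shows "weight t p * (cmod (g0 p))\<^sup>2 = Ct TYPE('n) t * exp (- (Aq p / 2 + (cth t - 1) * Yq p))"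
proof -
  have "(cmod (g0 p))\<^sup>2 = exp (- Re (S2 p) / 2)"
    unfolding g0_def hfac_def by (simp add: exp_double[symmetric])
  then have "weight t p * (cmod (g0 p))\<^sup>2 = Ct TYPE('n) t * exp ((cth t - 1) / 2 * Re (S2 p) - Qf (cth t) p)"
    unfolding weight_eq by (simp add: exp_add[symmetric] field_simps)
  then show ?thesis unfolding exponent_eq .
qed

lemma AY_bound: assumes "\<kappa> > 0" "a > 0" shows "\<exists>\<delta>>0. \<forall>p::'n::finite cc. \<delta> * (norm p)\<^sup>2 \<le> a * Aq p + \<kappa> * Yq p"
proof -
  let ?d = "min (a / 2) (\<kappa> / 3)"
  have d: "?d > 0" using assms by simp
  have "?d * (norm p)\<^sup>2 \<le> a * Aq p + \<kappa> * Yq p" for p :: "'n cc"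
  proof -
    have "?d * (norm p)\<^sup>2 \<le> ?d * (2 * Aq p + 3 * Yq p)" using d by (intro mult_left_mono norm_le_Aq_Yq) simp
    also have "\<dots> = (2 * ?d) * Aq p + (3 * ?d) * Yq p" by (simp add: algebra_simps)
    also have "\<dots> \<le> a * Aq p + \<kappa> * Yq p" by (intro add_mono mult_right_mono Aq_nonneg Yq_nonneg) auto
    finally show ?thesis .
  qed
  then show ?thesis using d by blast
qed

text \<open>By \<open>weight_g0\<close> and \<open>AY_bound\<close> the weight times the squared
  modulus of \<open>g0\<close> is bounded by a Gaussian in the norm, which absorbs exponential
  growth.\<close>

lemma sqi_g0:
  fixes u :: "'n::finite cc \<Rightarrow> complex"
  assumes t: "t > 0" and u: "u \<in> borel_measurable borel" "\<And>p. cmod (u p) \<le> exp (L * norm p)"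
  shows "sqi (Mt t) (\<lambda>p. g0 p * u p)"
proof -
  obtain \<delta> where \<delta>: "\<delta> > 0" "\<And>p::'n cc. \<delta> * (norm p)\<^sup>2 \<le> 1/2 * Aq p + (cth t - 1) * Yq p"
    using AY_bound[of "cth t - 1" "1/2"] cth_gt_1[OF t] by auto
  have g: "g0 \<in> borel_measurable borel" by (rule entire_imp_measurable[OF entire_g0])
  have m: "(\<lambda>p. g0 p * u p) \<in> borel_measurable borel" using g u(1) by measurable
  have "integrable lborel (\<lambda>p. (cmod (g0 p * u p))\<^sup>2 * weight t p)"
  proof (rule Bochner_Integration.integrable_bound)
    show "integrable lborel (\<lambda>p::'n cc. Ct TYPE('n) t * exp ((2 * L) * norm p - \<delta> * (norm p)\<^sup>2))"
      by (intro integrable_mult_right integrable_gauss_linear \<delta>)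
    show "(\<lambda>p. (cmod (g0 p * u p))\<^sup>2 * weight t p) \<in> borel_measurable lborel" using m by measurable
    have "(cmod (g0 p * u p))\<^sup>2 * weight t p \<le> Ct TYPE('n) t * exp ((2 * L) * norm p - \<delta> * (norm p)\<^sup>2)" for p
    proof -
      have "(cmod (g0 p * u p))\<^sup>2 * weight t p = (weight t p * (cmod (g0 p))\<^sup>2) * (cmod (u p))\<^sup>2"
        by (simp add: norm_mult power_mult_distrib)
      also have "\<dots> = Ct TYPE('n) t * (exp (- (Aq p / 2 + (cth t - 1) * Yq p)) * (cmod (u p))\<^sup>2)"
        unfolding weight_g0 by simp
      also have "\<dots> \<le> Ct TYPE('n) t * (exp (- (\<delta> * (norm p)\<^sup>2)) * exp ((2 * L) * norm p))"
      proof (intro mult_left_mono mult_mono)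
        show "(cmod (u p))\<^sup>2 \<le> exp ((2 * L) * norm p)"
          using power_mono[OF u(2)[of p], of 2] by (simp add: exp_double[symmetric] mult.assoc)
        show "exp (- (Aq p / 2 + (cth t - 1) * Yq p)) \<le> exp (- (\<delta> * (norm p)\<^sup>2))"
          using \<delta>(2)[of p] by simp
      qed (use Ct_pos[OF t, where 'n='n] in auto)
      also have "\<dots> = Ct TYPE('n) t * exp ((2 * L) * norm p - \<delta> * (norm p)\<^sup>2)" by (simp add: exp_add[symmetric])
      finally show ?thesis .
    qed
    moreover have "0 \<le> (cmod (g0 p * u p))\<^sup>2 * weight t p" for p using weight_pos[OF t, of p] by simp
    ultimately show "AE p in lborel. norm ((cmod (g0 p * u p))\<^sup>2 * weight t p) \<le> norm (Ct TYPE('n) t * exp ((2 * L) * norm p - \<delta> * (norm p)\<^sup>2))"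
      by (intro AE_I2) (simp only: real_norm_def abs_of_nonneg, rule order_trans[OF _ abs_ge_self])
  qed
  then show ?thesis using m by (simp add: sqi_Mt[OF t])
qed

text \<open>Stated for an abstract factor \<open>w\<close> and substitution \<open>r\<close>,
  because it serves both the weighted space, with \<open>r\<close> the identity, and the real space,
  with \<open>r\<close> the embedding into the complex one.\<close>

lemma ip_PS:
  assumes "\<And>i. sqi M (f i)" "\<And>i. ip M F (f i) = 0" "sqi M F"
    and f: "\<And>i. \<exists>c. \<forall>x. w x * PPn i (r x) = c * f i x"
  shows "PS g \<Longrightarrow> sqi M (\<lambda>x. w x * g (r x)) \<and> ip M F (\<lambda>x. w x * g (r x)) = 0"
proof (induction rule: PS.induct)
  case (PS_PP i)
  obtain c where "\<And>x. w x * PPn i (r x) = c * f i x" using f by blast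
  then have "(\<lambda>x. w x * PPn i (r x)) = (\<lambda>x. c * f i x)" by auto
  then show ?case using assms(1,2) by (simp add: sqi_cmult ip_cmult_right)
next
  case (PS_add g h)
  then have "ip M F (\<lambda>x. w x * g (r x) + w x * h (r x)) = 0"
    using ip_cnj[of M F "\<lambda>x. w x * g (r x) + w x * h (r x)"] ip_add[of M "\<lambda>x. w x * g (r x)" "\<lambda>x. w x * h (r x)" F] assms(3)
      ip_cnj[of M F "\<lambda>x. w x * g (r x)"] ip_cnj[of M F "\<lambda>x. w x * h (r x)"] by simp
  with PS_add show ?case by (auto simp: distrib_left intro: sqi_add)
next
  case (PS_cmult g c)
  have "(\<lambda>x. w x * (c * g (r x))) = (\<lambda>x. c * (w x * g (r x)))" by auto
  with PS_cmult show ?case by (simp add: sqi_cmult ip_cmult_right)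
qed

lemma ip_exp_LF_Mt:
  fixes F :: "'n::finite cc \<Rightarrow> complex"
  assumes t: "t > 0" and F: "sqi (Mt t) F" "\<And>i. ip (Mt t) F (SHi i) = 0" and l: "LF l"
  shows "ip (Mt t) F (\<lambda>p. g0 p * exp (l p)) = 0"
proof -
  interpret O: orthogonal_system "Mt t" "SHi :: 'n ix \<Rightarrow> _" "Nt t" by (rule orthogonal_system_Mt[OF t])
  obtain L where L: "\<And>p. cmod (l p) \<le> L * norm p" using LF_bound[OF l] by blast
  have ml: "l \<in> borel_measurable borel" by (rule entire_imp_measurable[OF LF_entire[OF l]])
  have mg: "g0 \<in> borel_measurable borel" by (rule entire_imp_measurable[OF entire_g0])
  have mF: "F \<in> borel_measurable borel" using sqi_measurable[OF F(1)] by simp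
  have ps: "ip (Mt t) F (\<lambda>p. g0 p * l p ^ k) = 0" for k
    using ip_PS[of "Mt t" SHi F g0 "\<lambda>p. p", OF O.sqi_e F(2) F(1) PPn_SHi PS_power_LF[OF l, of k]] by simp
  have mu: "(\<lambda>p. complex_of_real (exp (cmod (l p)))) \<in> borel_measurable borel" using ml by measurable
  have "sqi (Mt t) (\<lambda>p. g0 p * of_real (exp (cmod (l p))))"
    by (rule sqi_g0[OF t mu, of L]) (use L in simp)
  from integrable_norm[OF sqi_mult_integrable[OF F(1) this]]
  have i: "integrable (Mt t) (\<lambda>p. cmod (F p * cnj (g0 p)) * exp (cmod (l p)))" by (simp add: norm_mult mult_ac)
  have "(\<integral>p. (F p * cnj (g0 p)) * cnj (exp (l p)) \<partial>(Mt t)) = 0"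
  proof (rule exp_test[OF _ _ i])
    have "(\<lambda>p. F p * cnj (g0 p)) \<in> borel_measurable borel" using mF mg by measurable
    then show "(\<lambda>p. F p * cnj (g0 p)) \<in> borel_measurable (Mt t)" "l \<in> borel_measurable (Mt t)"
      using ml by simp_all
    show "(\<integral>p. (F p * cnj (g0 p)) * cnj (l p ^ k) \<partial>(Mt t)) = 0" for k
      using ps[of k] by (simp add: ip_def mult.assoc)
  qed
  then show ?thesis by (simp add: ip_def mult.assoc)
qed

lemma LF_Bf: "LF (\<lambda>p. Bf c p q)"
  unfolding LF_def
  by (intro exI[of _ "\<lambda>k. of_real (c / 2) * cnj (fst q $ k) + \<i> / 2 * cnj (snd q $ k)"]
      exI[of _ "\<lambda>k. of_real (c / 2) * cnj (snd q $ k) - \<i> / 2 * cnj (fst q $ k)"])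
    (auto simp: Bf_def algebra_simps intro!: sum.cong)

text \<open>Pairing of a real frequency with a complex point, complex linear in the point, so that
  exp (i xp) is entire.\<close>

definition xp :: "(real ^ 'n::finite) \<times> (real ^ 'n) \<Rightarrow> 'n cc \<Rightarrow> complex" where
  "xp \<xi> p = (\<Sum>k\<in>UNIV. of_real (fst \<xi> $ k) * fst p $ k + of_real (snd \<xi> $ k) * snd p $ k)"

lemma LF_xp: "LF (\<lambda>p. \<i> * xp \<xi> p)"
  unfolding LF_def
  by (intro exI[of _ "\<lambda>k. \<i> * of_real (fst \<xi> $ k)"] exI[of _ "\<lambda>k. \<i> * of_real (snd \<xi> $ k)"])
     (auto simp: xp_def sum_distrib_left distrib_left mult.assoc)

lemma LF_add: assumes "LF f" "LF g" shows "LF (\<lambda>p. f p + g p)"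
proof -
  obtain s r s' r' where "f = (\<lambda>p. \<Sum>k\<in>UNIV. s k * fst p $ k + r k * snd p $ k)" "g = (\<lambda>p. \<Sum>k\<in>UNIV. s' k * fst p $ k + r' k * snd p $ k)"
    using assms by (auto simp: LF_def)
  then show ?thesis unfolding LF_def
    by (intro exI[of _ "\<lambda>k. s k + s' k"] exI[of _ "\<lambda>k. r k + r' k"]) (auto simp: sum.distrib[symmetric] algebra_simps intro!: sum.cong)
qed

lemma norm_rr_sq: "(norm (\<xi> :: (real ^ 'n::finite) \<times> (real ^ 'n)))\<^sup>2 = (\<Sum>k\<in>UNIV. (fst \<xi> $ k)\<^sup>2 + (snd \<xi> $ k)\<^sup>2)"
proof -
  have v: "(norm (x::real^'n))\<^sup>2 = (\<Sum>i\<in>UNIV. (x $ i)\<^sup>2)" for x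
    by (simp add: norm_vec_def L2_set_def sum_nonneg)
  have "(norm \<xi>)\<^sup>2 = (norm (fst \<xi>))\<^sup>2 + (norm (snd \<xi>))\<^sup>2"
    by (metis norm_Pair prod.collapse real_sqrt_pow2 sum_power2_ge_zero)
  then show ?thesis by (simp add: v sum.distrib)
qed

text \<open>The Fourier transform of a Gaussian at complex arguments, coordinate by coordinate:
  averaging exponentials of linear forms yields the exponential of a quadratic one.\<close>

lemma gauss_superposition:
  fixes p :: "'n::finite cc"
  assumes \<kappa>: "\<kappa> > 0"
  shows "(\<integral>\<xi>. exp (\<i> * xp \<xi> p) * of_real (exp (- (norm \<xi>)\<^sup>2 / \<kappa>)) \<partial>lborel) = of_real ((pi * \<kappa>) ^ CARD('n)) * hfac (- \<kappa>) p"
proof -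
  let ?g = "\<lambda>z x. exp (\<i> * z * of_real x - of_real (1 / \<kappa> * x\<^sup>2))"
  let ?f = "\<lambda>k x. ?g (fst p $ k) (fst x) * ?g (snd p $ k) (snd x)"
  have g: "has_bochner_integral lborel (?g z) (of_real (sqrt (pi * \<kappa>)) * exp (- \<kappa> / 4 * z\<^sup>2))" for z :: complex
    using gauss_fourier[of "1 / \<kappa>" "\<i> * z"] \<kappa> by (simp add: has_bochner_integral_iff power_mult_distrib field_simps)
  have f: "has_bochner_integral lborel (?f k) (of_real (pi * \<kappa>) * exp (- \<kappa> / 4 * ((fst p $ k)\<^sup>2 + (snd p $ k)\<^sup>2)))" for k
  proof -
    have sq: "of_real (sqrt (pi * \<kappa>)) * of_real (sqrt (pi * \<kappa>)) = complex_of_real (pi * \<kappa>)"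
      unfolding of_real_mult[symmetric] using \<kappa> by simp
    have "(of_real (sqrt (pi * \<kappa>)) * exp (- \<kappa> / 4 * (fst p $ k)\<^sup>2)) * (of_real (sqrt (pi * \<kappa>)) * exp (- \<kappa> / 4 * (snd p $ k)\<^sup>2))
      = (of_real (sqrt (pi * \<kappa>)) * of_real (sqrt (pi * \<kappa>))) * (exp (- \<kappa> / 4 * (fst p $ k)\<^sup>2) * exp (- \<kappa> / 4 * (snd p $ k)\<^sup>2))"
      by (simp only: mult_ac)
    also have "\<dots> = of_real (pi * \<kappa>) * exp (- \<kappa> / 4 * ((fst p $ k)\<^sup>2 + (snd p $ k)\<^sup>2))"
      unfolding sq exp_add[symmetric] distrib_left ..
    finally have "(of_real (sqrt (pi * \<kappa>)) * exp (- \<kappa> / 4 * (fst p $ k)\<^sup>2)) * (of_real (sqrt (pi * \<kappa>)) * exp (- \<kappa> / 4 * (snd p $ k)\<^sup>2))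
      = of_real (pi * \<kappa>) * exp (- \<kappa> / 4 * ((fst p $ k)\<^sup>2 + (snd p $ k)\<^sup>2))" .
    with has_bochner_integral_pair_mult[OF g[of "fst p $ k"] g[of "snd p $ k"]] show ?thesis by simp
  qed
  have i: "integrable lborel (?f k)" and v: "integral\<^sup>L lborel (?f k) = of_real (pi * \<kappa>) * exp (- \<kappa> / 4 * ((fst p $ k)\<^sup>2 + (snd p $ k)\<^sup>2))" for k
    using f[of k] by (simp_all add: has_bochner_integral_iff)
  have e: "exp (\<i> * xp \<xi> p) * of_real (exp (- (norm \<xi>)\<^sup>2 / \<kappa>)) = (\<Prod>k\<in>UNIV. ?f k (fst \<xi> $ k, snd \<xi> $ k))" for \<xi>
  proof -
    have nn: "- (norm \<xi>)\<^sup>2 / \<kappa> = (\<Sum>k\<in>UNIV. - ((fst \<xi> $ k)\<^sup>2 + (snd \<xi> $ k)\<^sup>2) / \<kappa>)"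
      by (simp only: norm_rr_sq sum_negf[symmetric] sum_divide_distrib)
    show ?thesis
      unfolding nn xp_def exp_of_real[symmetric] exp_add[symmetric] exp_sum[OF finite, symmetric]
        of_real_sum sum_distrib_left sum.distrib[symmetric]
      by (intro arg_cong[where f=exp] sum.cong refl) (simp add: add_divide_distrib diff_divide_distrib algebra_simps)
  qed
  have "(\<integral>\<xi>. exp (\<i> * xp \<xi> p) * of_real (exp (- (norm \<xi>)\<^sup>2 / \<kappa>)) \<partial>lborel) = (\<Prod>k\<in>UNIV. integral\<^sup>L lborel (?f k))"
    unfolding e by (rule integral_vecpair_prod(2)[OF i])
  also have "\<dots> = of_real ((pi * \<kappa>) ^ CARD('n)) * hfac (- \<kappa>) p"
    unfolding v prod.distrib exp_sum[OF finite, symmetric] hfac_def S2_def sum_distrib_left by simp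
  finally show ?thesis .
qed

lemma norm_exp_xp: "cmod (exp (\<i> * xp \<xi> p)) \<le> exp (norm \<xi> * sqrt (Yq p))"
proof -
  define y :: "(real ^ 'a) \<times> (real ^ 'a)" where "y = (\<chi> k. Im (fst p $ k), \<chi> k. Im (snd p $ k))"
  have y: "norm y = sqrt (Yq p)"
    using norm_rr_sq[of y] by (simp add: y_def Yq_def real_sqrt_unique)
  have "- (\<xi> \<bullet> y) \<le> norm \<xi> * norm y" using norm_cauchy_schwarz[of "- \<xi>" y] by simp
  moreover have "Re (\<i> * xp \<xi> p) = - (\<xi> \<bullet> y)"
    by (simp add: xp_def y_def inner_prod_def inner_vec_def sum.distrib)
  ultimately show ?thesis unfolding norm_exp_eq_Re y by simp
qed

text \<open>The two coefficients have product 1; their ratio is tuned for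
  \<open>complete_Mt\<close>, where both Gaussians must keep a share.\<close>

lemma weighted_am_gm:
  fixes r s \<kappa> :: real
  assumes "\<kappa> > 0"
  shows "2 * r * s \<le> 5 / (4 * \<kappa>) * r\<^sup>2 + 4 * \<kappa> / 5 * s\<^sup>2"
proof -
  have "0 \<le> (5 * r - 4 * \<kappa> * s)\<^sup>2" by simp
  also have "\<dots> = (20 * \<kappa>) * (5 / (4 * \<kappa>) * r\<^sup>2 + 4 * \<kappa> / 5 * s\<^sup>2 - 2 * r * s)"
    using assms by (simp add: power2_eq_square algebra_simps)
  finally have "0 \<le> 5 / (4 * \<kappa>) * r\<^sup>2 + 4 * \<kappa> / 5 * s\<^sup>2 - 2 * r * s"
    using assms by (simp add: zero_le_mult_iff)
  then show ?thesis by simp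
qed

text \<open>Since hfac c g0 hfac (- \<kappa>) = 1, the reproducing kernel at \<open>q\<close>
  corresponds in the weighted space to g0 exp (Bf) hfac (- \<kappa>). \<open>exp_test\<close> is
  applied to linear exponents only; the quadratic one is therefore produced as a superposition over
  real frequencies \<xi>, and Fubini carries over the orthogonality of \<open>F\<close> to each
  exponential.\<close>

lemma complete_Mt:
  fixes F :: "'n::finite cc \<Rightarrow> complex"
  assumes t: "t > 0" and E: "entire F" and F: "sqi (Mt t) F" "\<And>i. ip (Mt t) F (SHi i) = 0"
  shows "F q = 0"
proof -
  define c where "c = cth t"
  define \<kappa> where "\<kappa> = c - 1"
  have c: "c > 1" unfolding c_def by (rule cth_gt_1[OF t])
  have \<kappa>: "\<kappa> > 0" using c by (simp add: \<kappa>_def)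
  let ?X = "lborel :: ((real ^ 'n) \<times> (real ^ 'n)) measure"
  have mF[measurable]: "F \<in> borel_measurable borel" by (rule entire_imp_measurable[OF E])
  have mg[measurable]: "g0 \<in> borel_measurable borel" by (rule entire_imp_measurable[OF entire_g0])
  have mB[measurable]: "(\<lambda>p. Bf c p q) \<in> borel_measurable borel" by (rule entire_imp_measurable[OF entire_Bf])
  have cx: "continuous_on UNIV (\<lambda>x :: ((real ^ 'n) \<times> (real ^ 'n)) \<times> 'n cc. xp (fst x) (snd x))"
    unfolding xp_def by (intro continuous_intros)
  have mx: "(\<lambda>x :: ((real ^ 'n) \<times> (real ^ 'n)) \<times> 'n cc. xp (fst x) (snd x)) \<in> borel_measurable (borel \<Otimes>\<^sub>M borel)"
    unfolding borel_prod by (rule borel_measurable_continuous_onI[OF cx])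
  let ?h = "\<lambda>\<xi> p. of_real (weight t p) * (F p * cnj (g0 p * exp (\<i> * xp \<xi> p + Bf c p q))) * of_real (exp (- (norm \<xi>)\<^sup>2 / \<kappa>))"
  have mh: "(\<lambda>x. ?h (fst x) (snd x)) \<in> borel_measurable (?X \<Otimes>\<^sub>M (lborel :: 'n cc measure))"
    using mx by measurable
  obtain L where L: "L \<ge> 0" "\<And>p. cmod (Bf c p q) \<le> L * norm p" using Bf_bound by blast
  \<comment> \<open>\<kappa> / 5 is what \<open>weighted_am_gm\<close> leaves of the decay in
    \<open>Yq\<close>; the frequencies keep 3 / (2 \<kappa>) - 5 / (4 \<kappa>) = 1 / (4
    \<kappa>).\<close>
  obtain \<delta> where \<delta>: "\<delta> > 0" "\<And>p::'n cc. \<delta> * (norm p)\<^sup>2 \<le> 1/2 * Aq p + \<kappa> / 5 * Yq p"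
    using AY_bound[of "\<kappa> / 5" "1/2"] \<kappa> by auto
  have ih: "integrable (?X \<Otimes>\<^sub>M (lborel :: 'n cc measure)) (\<lambda>x. ?h (fst x) (snd x))"
  proof (rule Bochner_Integration.integrable_bound[OF _ mh])
    have g1: "has_bochner_integral ?X (\<lambda>\<xi>. exp (- s * (norm \<xi>)\<^sup>2)) (\<integral>\<xi>. exp (- s * (norm \<xi>)\<^sup>2) \<partial>?X)" if "s > 0" for s
      using integrable_gauss[OF that] by (rule has_bochner_integral_integrable)
    have g2: "has_bochner_integral lborel (\<lambda>p. (cmod (F p))\<^sup>2 * weight t p) (nm2 (Mt t) F)"
      using F(1) sqi_Mt[OF t, of F] nm2_Mt[OF t mF] by (simp add: has_bochner_integral_iff)
    have g3: "has_bochner_integral (lborel :: 'n cc measure) (\<lambda>p. Ct TYPE('n) t * exp ((2 * L) * norm p - \<delta> * (norm p)\<^sup>2))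
        (\<integral>p. Ct TYPE('n) t * exp ((2 * L) * norm p - \<delta> * (norm p)\<^sup>2) \<partial>(lborel :: 'n cc measure))"
      by (intro has_bochner_integral_integrable integrable_mult_right integrable_gauss_linear \<delta>)
    have s: "1 / (2 * \<kappa>) > 0" "1 / (4 * \<kappa>) > 0" using \<kappa> by simp_all
    show "integrable (?X \<Otimes>\<^sub>M (lborel :: 'n cc measure)) (\<lambda>x. exp (- (1 / (2 * \<kappa>)) * (norm (fst x))\<^sup>2) * ((cmod (F (snd x)))\<^sup>2 * weight t (snd x))
        + exp (- (1 / (4 * \<kappa>)) * (norm (fst x))\<^sup>2) * (Ct TYPE('n) t * exp ((2 * L) * norm (snd x) - \<delta> * (norm (snd x))\<^sup>2)))"
      unfolding lborel_prod
      by (intro Bochner_Integration.integrable_add integrable.intros[OF has_bochner_integral_pair_mult[OF g1[OF s(1)] g2]]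
          integrable.intros[OF has_bochner_integral_pair_mult[OF g1[OF s(2)] g3]])
    have hb: "norm (?h \<xi> p) \<le> exp (- (1 / (2 * \<kappa>)) * (norm \<xi>)\<^sup>2) * ((cmod (F p))\<^sup>2 * weight t p)
        + exp (- (1 / (4 * \<kappa>)) * (norm \<xi>)\<^sup>2) * (Ct TYPE('n) t * exp ((2 * L) * norm p - \<delta> * (norm p)\<^sup>2))" for \<xi> p
    proof -
      define W where "W = weight t p"
      have W: "W > 0" unfolding W_def by (rule weight_pos[OF t])
      define r where "r = norm \<xi>"
      \<comment> \<open>The Gaussian in \<xi> is split one to three: the small share makes the term
        with \<open>F\<close> integrable in \<xi>, the large one pays for the growth of exp (i
        xp).\<close>
      define a b where "a = cmod (F p) * exp (- (1 / (4 * \<kappa>)) * r\<^sup>2)"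
        and "b = cmod (g0 p) * cmod (exp (\<i> * xp \<xi> p + Bf c p q)) * exp (- (3 / (4 * \<kappa>)) * r\<^sup>2)"
      have "norm (?h \<xi> p) = W * (a * b)"
      proof -
        have "exp (- (norm \<xi>)\<^sup>2 / \<kappa>) = exp (- (1 / (4 * \<kappa>)) * r\<^sup>2) * exp (- (3 / (4 * \<kappa>)) * r\<^sup>2)"
          unfolding exp_add[symmetric] r_def using \<kappa> by (simp add: field_simps)
        then show ?thesis using W unfolding W_def[symmetric] a_def b_def by (simp add: norm_mult)
      qed
      also have "\<dots> \<le> W * (a\<^sup>2 + b\<^sup>2)"
      proof (rule mult_left_mono)
        have "2 * (a * b) \<le> a\<^sup>2 + b\<^sup>2" using sum_squares_bound[of a b] by simp
        moreover have "0 \<le> a * b" unfolding a_def b_def by simp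
        ultimately show "a * b \<le> a\<^sup>2 + b\<^sup>2" by linarith
      qed (use W in simp)
      also have "\<dots> = W * a\<^sup>2 + W * b\<^sup>2" by (simp add: distrib_left)
      also have "W * a\<^sup>2 = exp (- (1 / (2 * \<kappa>)) * r\<^sup>2) * ((cmod (F p))\<^sup>2 * W)"
        unfolding a_def by (simp add: power_mult_distrib exp_double[symmetric])
      also have "W * b\<^sup>2 \<le> exp (- (1 / (4 * \<kappa>)) * r\<^sup>2) * (Ct TYPE('n) t * exp ((2 * L) * norm p - \<delta> * (norm p)\<^sup>2))"
      proof -
        have "cmod (exp (\<i> * xp \<xi> p + Bf c p q)) \<le> exp (r * sqrt (Yq p)) * exp (L * norm p)"
          unfolding exp_add norm_mult r_def
        proof (intro mult_mono norm_exp_xp)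
          show "cmod (exp (Bf c p q)) \<le> exp (L * norm p)"
            using norm_exp[of "Bf c p q"] L(2)[of p] by (meson exp_le_cancel_iff order_trans)
        qed auto
        then have "(cmod (exp (\<i> * xp \<xi> p + Bf c p q)))\<^sup>2 \<le> (exp (r * sqrt (Yq p)) * exp (L * norm p))\<^sup>2"
          by (intro power_mono) auto
        also have "\<dots> = exp (2 * r * sqrt (Yq p) + 2 * L * norm p)"
          by (simp add: power_mult_distrib exp_double[symmetric] exp_add[symmetric] mult.assoc)
        finally have e1: "(cmod (exp (\<i> * xp \<xi> p + Bf c p q)))\<^sup>2 \<le> exp (2 * r * sqrt (Yq p) + 2 * L * norm p)" .
        have "W * b\<^sup>2 = (weight t p * (cmod (g0 p))\<^sup>2) * ((cmod (exp (\<i> * xp \<xi> p + Bf c p q)))\<^sup>2 * exp (- (3 / (2 * \<kappa>)) * r\<^sup>2))"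
          unfolding b_def W_def by (simp add: power_mult_distrib exp_double[symmetric])
        also have "\<dots> \<le> (Ct TYPE('n) t * exp (- (Aq p / 2 + \<kappa> * Yq p))) * (exp (2 * r * sqrt (Yq p) + 2 * L * norm p) * exp (- (3 / (2 * \<kappa>)) * r\<^sup>2))"
          unfolding weight_g0 c_def[symmetric] \<kappa>_def[symmetric] using Ct_pos[OF t, where 'n='n]
          by (intro mult_left_mono mult_right_mono e1) auto
        also have "\<dots> = Ct TYPE('n) t * exp (- (Aq p / 2 + \<kappa> * Yq p) + (2 * r * sqrt (Yq p) + 2 * L * norm p) + - (3 / (2 * \<kappa>)) * r\<^sup>2)"
          by (simp only: exp_add mult.assoc)
        also have "\<dots> \<le> Ct TYPE('n) t * exp (- (1 / (4 * \<kappa>)) * r\<^sup>2 + ((2 * L) * norm p - \<delta> * (norm p)\<^sup>2))"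
        proof -
          have "2 * r * sqrt (Yq p) \<le> 5 / (4 * \<kappa>) * r\<^sup>2 + 4 * \<kappa> / 5 * (sqrt (Yq p))\<^sup>2"
            by (rule weighted_am_gm[OF \<kappa>])
          then have "2 * r * sqrt (Yq p) \<le> 5 / (4 * \<kappa>) * r\<^sup>2 + 4 * \<kappa> / 5 * Yq p"
            using Yq_nonneg[of p] by simp
          moreover have "3 / (2 * \<kappa>) * r\<^sup>2 = 5 / (4 * \<kappa>) * r\<^sup>2 + 1 / (4 * \<kappa>) * r\<^sup>2"
            using \<kappa> by (simp add: field_simps)
          ultimately have "- (Aq p / 2 + \<kappa> * Yq p) + (2 * r * sqrt (Yq p) + 2 * L * norm p) + - (3 / (2 * \<kappa>)) * r\<^sup>2
            \<le> - (1 / (4 * \<kappa>)) * r\<^sup>2 + ((2 * L) * norm p - \<delta> * (norm p)\<^sup>2)"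
            using \<delta>(2)[of p] by simp
          then show ?thesis using Ct_pos[OF t, where 'n='n] by (intro mult_left_mono) auto
        qed
        finally show ?thesis by (simp add: exp_add[symmetric] mult.left_commute[of _ "Ct TYPE('n) t"])
      qed
      finally show ?thesis unfolding W_def r_def by simp
    qed
    show "AE x in ?X \<Otimes>\<^sub>M (lborel :: 'n cc measure). norm (?h (fst x) (snd x)) \<le> norm (exp (- (1 / (2 * \<kappa>)) * (norm (fst x))\<^sup>2) * ((cmod (F (snd x)))\<^sup>2 * weight t (snd x))
        + exp (- (1 / (4 * \<kappa>)) * (norm (fst x))\<^sup>2) * (Ct TYPE('n) t * exp ((2 * L) * norm (snd x) - \<delta> * (norm (snd x))\<^sup>2)))"
      by (intro AE_I2) (simp only: real_norm_def, rule order_trans[OF hb abs_ge_self])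
  qed
  have inner0: "(\<integral>p. ?h \<xi> p \<partial>lborel) = 0" for \<xi>
  proof -
    have m: "(\<lambda>p. F p * cnj (g0 p * exp (\<i> * xp \<xi> p + Bf c p q))) \<in> borel_measurable borel"
    proof -
      have "(\<lambda>p. \<i> * xp \<xi> p) \<in> borel_measurable borel" by (rule entire_imp_measurable[OF LF_entire[OF LF_xp]])
      then show ?thesis by measurable
    qed
    have "ip (Mt t) F (\<lambda>p. g0 p * exp (\<i> * xp \<xi> p + Bf c p q)) = 0"
      by (rule ip_exp_LF_Mt[OF t F LF_add[OF LF_xp LF_Bf]])
    then have "(\<integral>p. of_real (weight t p) * (F p * cnj (g0 p * exp (\<i> * xp \<xi> p + Bf c p q))) \<partial>lborel) = 0"
      unfolding ip_def integral_Mt[OF t m] by (simp add: scaleR_conv_of_real)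
    then show ?thesis by simp
  qed
  have "0 = (\<integral>\<xi>. (\<integral>p. ?h \<xi> p \<partial>lborel) \<partial>?X)" unfolding inner0 by simp
  also have "\<dots> = (\<integral>p. (\<integral>\<xi>. ?h \<xi> p \<partial>?X) \<partial>lborel)"
    using lborel_pair.Fubini_integral[of ?h] ih by (simp add: case_prod_unfold)
  also have "\<dots> = (\<integral>p. of_real ((pi * \<kappa>) ^ CARD('n) * Ct TYPE('n) t) * (exp (- Qf c p) *\<^sub>R (F p * hfac c p * cnj (exp (Bf c p q)))) \<partial>lborel)"
  proof (rule Bochner_Integration.integral_cong[OF refl])
    fix p :: "'n cc"
    have "(\<integral>\<xi>. ?h \<xi> p \<partial>?X) = (\<integral>\<xi>. (of_real (weight t p) * (F p * cnj (g0 p * exp (Bf c p q)))) * cnj (exp (\<i> * xp \<xi> p) * of_real (exp (- (norm \<xi>)\<^sup>2 / \<kappa>))) \<partial>?X)"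
      by (intro Bochner_Integration.integral_cong refl) (simp add: exp_add mult_ac)
    also have "\<dots> = (of_real (weight t p) * (F p * cnj (g0 p * exp (Bf c p q)))) * cnj (of_real ((pi * \<kappa>) ^ CARD('n)) * hfac (- \<kappa>) p)"
      unfolding integral_mult_right_zero Bochner_Integration.integral_cnj gauss_superposition[OF \<kappa>] ..
    also have "\<dots> = of_real ((pi * \<kappa>) ^ CARD('n) * Ct TYPE('n) t) * (exp (- Qf c p) *\<^sub>R (F p * hfac c p * cnj (exp (Bf c p q))))"
    proof -
      \<comment> \<open>The three parameters c, -1 and - \<kappa> = 1 - c add up to 0.\<close>
      have 1: "hfac c p * g0 p * hfac (- \<kappa>) p = 1"
        unfolding g0_def hfac_def exp_add[symmetric] by (simp add: \<kappa>_def algebra_simps add_divide_distrib diff_divide_distrib)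
      have "complex_of_real (weight t p) = of_real (Ct TYPE('n) t) * of_real (exp (- Qf c p)) * (hfac c p * cnj (hfac c p))"
        unfolding weight_hfac c_def[symmetric] by (simp add: complex_norm_square del: of_real_power)
      then have "of_real (weight t p) * cnj (g0 p) * cnj (hfac (- \<kappa>) p) = of_real (Ct TYPE('n) t) * of_real (exp (- Qf c p)) * (hfac c p * cnj (hfac c p * g0 p * hfac (- \<kappa>) p))"
        by simp
      then have "of_real (weight t p) * cnj (g0 p) * cnj (hfac (- \<kappa>) p) = of_real (Ct TYPE('n) t) * of_real (exp (- Qf c p)) * hfac c p"
        unfolding 1 by simp
      moreover have "(of_real (weight t p) * (F p * cnj (g0 p * exp (Bf c p q)))) * cnj (of_real ((pi * \<kappa>) ^ CARD('n)) * hfac (- \<kappa>) p)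
        = (of_real (weight t p) * cnj (g0 p) * cnj (hfac (- \<kappa>) p)) * (of_real ((pi * \<kappa>) ^ CARD('n)) * F p * cnj (exp (Bf c p q)))"
        by simp
      ultimately show ?thesis by (simp add: scaleR_conv_of_real)
    qed
    finally show "(\<integral>\<xi>. ?h \<xi> p \<partial>?X) = of_real ((pi * \<kappa>) ^ CARD('n) * Ct TYPE('n) t) * (exp (- Qf c p) *\<^sub>R (F p * hfac c p * cnj (exp (Bf c p q))))" .
  qed
  also have "\<dots> = of_real ((pi * \<kappa>) ^ CARD('n) * Ct TYPE('n) t) * ip (MQ c) (\<lambda>p. F p * hfac c p) (\<lambda>p. exp (Bf c p q))"
  proof -
    have "hfac c \<in> borel_measurable borel" by (rule entire_imp_measurable[OF entire_hfac])
    then have m: "(\<lambda>p. F p * hfac c p * cnj (exp (Bf c p q))) \<in> borel_measurable borel" by measurable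
    show ?thesis unfolding ip_def integral_MQ[OF m] by (rule integral_mult_right_zero)
  qed
  also have "ip (MQ c) (\<lambda>p. F p * hfac c p) (\<lambda>p. exp (Bf c p q)) = of_real (KQ TYPE('n) c) * (F q * hfac c q)"
    using F(1) sqi_Mt_MQ(1)[OF t mF] unfolding c_def[symmetric]
    by (intro reproducing c entire_mult E entire_hfac) auto
  finally have "of_real ((pi * \<kappa>) ^ CARD('n) * Ct TYPE('n) t) * (of_real (KQ TYPE('n) c) * (F q * hfac c q)) = 0" by simp
  moreover have "complex_of_real ((pi * \<kappa>) ^ CARD('n) * Ct TYPE('n) t) \<noteq> 0" using \<kappa> Ct_pos[OF t, where 'n='n] by simp
  moreover have "complex_of_real (KQ TYPE('n) c) \<noteq> 0" using KQ_pos[OF c, where 'n='n] by simp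
  moreover have "hfac c q \<noteq> 0" by (simp add: hfac_def)
  ultimately show ?thesis by (metis mult_eq_0_iff)
qed

section \<open>Completeness on the real space\<close>

definition cplx :: "(real ^ 'n::finite) \<times> (real ^ 'n) \<Rightarrow> 'n cc" where
  "cplx p = (\<chi> i. of_real (fst p $ i), \<chi> i. of_real (snd p $ i))"

lemma restrict_real_cplx: "restrict_real F p = F (cplx p)"
  by (simp add: restrict_real_def cplx_def case_prod_unfold)

text \<open>Orthogonality to polynomials times the Gaussian passes to exponentials times the
  Gaussian by \<open>exp_test\<close>; so the product of \<open>f\<close> with the Gaussian has
  vanishing Fourier transform.\<close>

lemma complete_real:
  fixes f :: "(real ^ 'n::finite) \<times> (real ^ 'n) \<Rightarrow> complex"
  assumes F: "sqi lborel f" "\<And>i. ip lborel f (rr i) = 0"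
  shows "AE p in lborel. f p = 0"
proof -
  interpret O: orthogonal_system lborel "rr :: 'n ix \<Rightarrow> _" "\<lambda>_. 1" by (rule orthogonal_system_real)
  let ?g = "\<lambda>p :: (real ^ 'n) \<times> (real ^ 'n). g0 (cplx p)"
  have g: "?g p = of_real (exp (- (norm p)\<^sup>2 / 4))" for p
    unfolding g0_def hfac_def S2_def cplx_def norm_rr_sq exp_of_real[symmetric]
    by (rule arg_cong[where f=exp]) (simp add: sum_distrib_left sum_divide_distrib sum_negf)
  have mf[measurable]: "f \<in> borel_measurable borel" using F(1) by (simp add: sqi_def)
  have sg: "sqi lborel (\<lambda>p. ?g p * of_real (exp (C * norm p)))" for C
  proof -
    have "(cmod (?g p * of_real (exp (C * norm p))))\<^sup>2 = exp ((2 * C) * norm p - (1/2) * (norm p)\<^sup>2)" for p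
      unfolding g by (simp add: norm_mult power_mult_distrib exp_double[symmetric] exp_add[symmetric])
    moreover have "(\<lambda>p. ?g p * of_real (exp (C * norm p))) \<in> borel_measurable borel"
      unfolding g by (intro borel_measurable_continuous_onI continuous_intros) simp_all
    ultimately show ?thesis using integrable_gauss_linear[of "1/2" "2 * C", where 'a="(real^'n) \<times> (real^'n)"] by (simp add: sqi_def)
  qed
  let ?h = "\<lambda>p. f p * ?g p"
  have gc: "cnj (?g p) = ?g p" for p unfolding g by simp
  have ih: "integrable lborel ?h"
    using sqi_mult_integrable[OF F(1) sg[of 0]] by (simp add: gc)
  have mg[measurable]: "?g \<in> borel_measurable borel"
    unfolding g by (intro borel_measurable_continuous_onI continuous_intros) simp
  have "AE p in lborel. ?h p = 0"
  proof (rule Fourier_unique[OF ih])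
    fix \<xi> :: "(real ^ 'n) \<times> (real ^ 'n)"
    \<comment> \<open>The sign compensates the conjugation in the inner product.\<close>
    let ?l = "\<lambda>p. \<i> * xp (- \<xi>) (cplx p)"
    have l: "?l p = - (\<i> * of_real (\<xi> \<bullet> p))" for p
      by (simp add: xp_def cplx_def inner_prod_def inner_vec_def sum.distrib sum_negf sum_subtractf algebra_simps)
    have nl: "cmod (?l p) \<le> norm \<xi> * norm p" for p
      unfolding l using Cauchy_Schwarz_ineq2[of \<xi> p] by (simp add: norm_mult)
    have ml: "?l \<in> borel_measurable borel" unfolding l
      by (intro borel_measurable_continuous_onI continuous_intros)
    have fr: "\<exists>c. \<forall>p. ?g p * PPn i (cplx p) = c * rr i p" for i :: "'n ix"
    proof -
      obtain c where "\<And>p. g0 p * PPn i p = c * SHi i p" using PPn_SHi[of i] by blast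
      then show ?thesis unfolding rr_eq restrict_real_cplx by blast
    qed
    have ps: "ip lborel f (\<lambda>p. ?g p * ?l p ^ k) = 0" for k
      using ip_PS[of lborel rr f ?g cplx, OF O.sqi_e F(2) F(1) fr PS_power_LF[OF LF_xp, of "- \<xi>" k]] by simp
    have "integrable lborel (\<lambda>p. cmod (?h p) * exp (norm \<xi> * norm p))"
      using integrable_norm[OF sqi_mult_integrable[OF F(1) sg[of "norm \<xi>"]]] by (simp add: norm_mult gc mult_ac)
    then have i: "integrable lborel (\<lambda>p. cmod (?h p) * exp (cmod (?l p)))"
    proof (rule Bochner_Integration.integrable_bound)
      show "(\<lambda>p. cmod (?h p) * exp (cmod (?l p))) \<in> borel_measurable lborel" using ml by measurable
      show "AE p in lborel. norm (cmod (?h p) * exp (cmod (?l p))) \<le> norm (cmod (?h p) * exp (norm \<xi> * norm p))"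
      proof (rule AE_I2)
        fix p
        have "exp (cmod (?l p)) \<le> exp (norm \<xi> * norm p)" using nl by simp
        from mult_left_mono[OF this norm_ge_zero[of "?h p"]]
        show "norm (cmod (?h p) * exp (cmod (?l p))) \<le> norm (cmod (?h p) * exp (norm \<xi> * norm p))"
          by (simp only: real_norm_def abs_mult abs_norm_cancel abs_exp_cancel)
      qed
    qed
    have "(\<integral>p. ?h p * cnj (exp (?l p)) \<partial>lborel) = 0"
    proof (rule exp_test[OF _ _ i])
      show "?h \<in> borel_measurable lborel" "?l \<in> borel_measurable lborel" using ml by measurable
      show "(\<integral>p. ?h p * cnj (?l p ^ k) \<partial>lborel) = 0" for k
        using ps[of k] by (simp add: ip_def gc mult.assoc)
    qed
    moreover have "cnj (exp (?l p)) = exp (\<i> * of_real (\<xi> \<bullet> p))" for p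
      unfolding l exp_cnj by simp
    ultimately show "(\<integral>p. ?h p * exp (\<i> * of_real (\<xi> \<bullet> p)) \<partial>lborel) = 0" by simp
  qed
  then show ?thesis by eventually_elim (simp add: g)
qed

section \<open>Time derivatives of the weight\<close>

lemma has_derivative_cth: "s > 0 \<Longrightarrow> (cth has_real_derivative 2 - 2 * (cth s)\<^sup>2) (at s)"
proof -
  assume s: "s > 0"
  then have n: "sinh (2 * s) \<noteq> 0" by simp
  have "(cth has_real_derivative (2 * sinh (2 * s) * sinh (2 * s) - cosh (2 * s) * (2 * cosh (2 * s))) / (sinh (2 * s))\<^sup>2) (at s)"
    unfolding cth_def[abs_def] using n by (auto intro!: derivative_eq_intros simp: power2_eq_square)
  moreover have "(2 * sinh (2 * s) * sinh (2 * s) - cosh (2 * s) * (2 * cosh (2 * s))) / (sinh (2 * s))\<^sup>2 = 2 - 2 * (cth s)\<^sup>2"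
    unfolding cth_def using n by (simp add: diff_divide_distrib power_divide power2_eq_square)
  ultimately show ?thesis by simp
qed

lemma cth_antimono: assumes "0 < s" "s \<le> t" shows "cth t \<le> cth s"
proof -
  have p: "sinh (2 * s) > 0" "sinh (2 * t) > 0" using assms by simp_all
  have "sinh (2 * t - 2 * s) \<ge> 0" using assms by simp
  then have "cosh (2 * t) * sinh (2 * s) \<le> cosh (2 * s) * sinh (2 * t)" by (simp add: sinh_diff mult.commute)
  then show ?thesis unfolding cth_def using p by (simp add: divide_le_eq pos_le_divide_eq mult.commute)
qed

definition Xq :: "'n::finite cc \<Rightarrow> real" where
  "Xq p = (\<Sum>k\<in>UNIV. Re (snd p $ k) * Im (fst p $ k) - Im (snd p $ k) * Re (fst p $ k))"

text \<open>Time enters only through \<open>sinh (2 * s)\<close> and \<open>cth s\<close>, and the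
  point enters the time-dependent factor only through \<open>Yq\<close>. Time derivatives thus
  concern functions of one real variable with \<open>Yq p\<close> as a parameter.\<close>

lemma weight_form:
  fixes p :: "'n::finite cc"
  shows "weight s p = ((2 / pi) ^ CARD('n) * exp (Xq p)) * (inverse (sinh (2 * s)) ^ CARD('n) * exp (- cth s * Yq p))"
proof -
  have w: "w1 s z w = (2 / pi) * exp (Re w * Im z - Im w * Re z) * (inverse (sinh (2 * s)) * exp (- cth s * ((Im z)\<^sup>2 + (Im w)\<^sup>2)))" for z w
  proof -
    have *: "4 * a * (1 / (2 * pi * b) * c) = (2 / pi) * a * (inverse b * c)" for a b c :: real
      by (cases "b = 0") (simp_all add: field_simps)
    show ?thesis unfolding w1_def * cth_def ..
  qed
  show ?thesis
    unfolding weight_eq_prod w prod.distrib exp_sum[OF finite, symmetric] Xq_def Yq_def sum_distrib_left by simp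
qed

text \<open>The \<open>j\<close>-th derivative of the weight in \<open>s\<close> is the weight times a polynomial in \<open>Yq\<close>; its \<open>i\<close>-th
  coefficient is the value at \<open>coth (2 s)\<close> of the polynomial \<open>qq n j i\<close>, where \<open>n\<close> is the dimension and
  \<open>coth (2 s)\<close> has derivative \<open>2 - 2 coth (2 s)\<^sup>2\<close>.\<close>

fun qq :: "real \<Rightarrow> nat \<Rightarrow> nat \<Rightarrow> real poly" where
  "qq n 0 i = (if i = 0 then 1 else 0)"
| "qq n (Suc j) i = [:2, 0, -2:] * pderiv (qq n j i) + [:0, - 2 * n:] * qq n j i
     + (if i = 0 then 0 else [:-2, 0, 2:] * qq n j (i - 1))"

lemma qq_zero: "i > j \<Longrightarrow> qq n j i = 0"
  by (induction j arbitrary: i) auto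

text \<open>The leading coefficient (2 C^2 - 2)^j is positive for C > 1, which makes every time
  derivative of the weight positive for large \<open>Yq\<close>.\<close>

lemma qq_lead: "qq n j j = [:-2, 0, 2:] ^ j"
proof (induction j)
  case (Suc j)
  have "qq n j (Suc j) = 0" by (rule qq_zero) simp
  then show ?case using Suc by simp
qed simp

definition RR :: "real \<Rightarrow> nat \<Rightarrow> real \<Rightarrow> real \<Rightarrow> real" where
  "RR n j C r = (\<Sum>i\<le>j. poly (qq n j i) C * r ^ i)"

text \<open>The first sum differentiates the coefficients in time; the factor of
  \<open>RR n j C r\<close> is the logarithmic derivative of the weight.\<close>

lemma RR_Suc:
  "RR n (Suc j) C r = (\<Sum>i\<le>j. poly (pderiv (qq n j i)) C * (2 - 2 * C\<^sup>2) * r ^ i) + (- 2 * n * C + 2 * (C\<^sup>2 - 1) * r) * RR n j C r"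
proof -
  have z: "qq n j (Suc j) = 0" by (rule qq_zero) simp
  have "RR n (Suc j) C r = (\<Sum>i\<le>Suc j. (poly (pderiv (qq n j i)) C * (2 - 2 * C\<^sup>2) + (- 2 * n * C) * poly (qq n j i) C) * r ^ i)
      + (\<Sum>i\<le>Suc j. (if i = 0 then 0 else 2 * (C\<^sup>2 - 1) * poly (qq n j (i - 1)) C) * r ^ i)"
    unfolding RR_def sum.distrib[symmetric]
    by (intro sum.cong refl) (simp add: algebra_simps power2_eq_square)
  also have "(\<Sum>i\<le>Suc j. (if i = 0 then 0 else 2 * (C\<^sup>2 - 1) * poly (qq n j (i - 1)) C) * r ^ i) = 2 * (C\<^sup>2 - 1) * r * RR n j C r"
    unfolding sum.atMost_Suc_shift by (simp add: RR_def sum_distrib_left mult_ac)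
  also have "(\<Sum>i\<le>Suc j. (poly (pderiv (qq n j i)) C * (2 - 2 * C\<^sup>2) + (- 2 * n * C) * poly (qq n j i) C) * r ^ i)
      = (\<Sum>i\<le>j. poly (pderiv (qq n j i)) C * (2 - 2 * C\<^sup>2) * r ^ i) + (- 2 * n * C) * RR n j C r"
  proof -
    have "(\<Sum>i\<le>Suc j. (poly (pderiv (qq n j i)) C * (2 - 2 * C\<^sup>2) + (- 2 * n * C) * poly (qq n j i) C) * r ^ i)
      = (\<Sum>i\<le>j. (poly (pderiv (qq n j i)) C * (2 - 2 * C\<^sup>2) + (- 2 * n * C) * poly (qq n j i) C) * r ^ i)"
      by (simp add: z del: qq.simps)
    also have "\<dots> = (\<Sum>i\<le>j. poly (pderiv (qq n j i)) C * (2 - 2 * C\<^sup>2) * r ^ i) + (- 2 * n * C) * RR n j C r"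
      unfolding RR_def sum_distrib_left sum.distrib[symmetric] by (intro sum.cong refl) (simp only: distrib_right mult.assoc)
    finally show ?thesis .
  qed
  finally show ?thesis by (simp add: algebra_simps)
qed

definition DW :: "nat \<Rightarrow> real \<Rightarrow> 'n::finite cc \<Rightarrow> real" where
  "DW j s p = RR (real CARD('n)) j (cth s) (Yq p) * weight s p"

lemma DW_0: "DW 0 s p = weight s p" by (simp add: DW_def RR_def)

lemma has_derivative_DW:
  fixes p :: "'n::finite cc"
  assumes s: "s > 0"
  shows "((\<lambda>s. DW j s p) has_real_derivative DW (Suc j) s p) (at s)"
proof -
  let ?n = "CARD('n)" and ?c = "cth s" and ?r = "Yq p"
  have n0: "sinh (2 * s) \<noteq> 0" using s by simp
  \<comment> \<open>A successor, so that the lowered exponent in the power rule simplifies.\<close>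
  obtain n' where n': "?n = Suc n'" using zero_less_card_finite[where 'a='n] by (metis gr0_implies_Suc)
  have d1: "((\<lambda>s. inverse (sinh (2 * s)) ^ ?n) has_real_derivative - 2 * real ?n * ?c * inverse (sinh (2 * s)) ^ ?n) (at s)"
  proof -
    have "((\<lambda>s. inverse (sinh (2 * s))) has_real_derivative - (inverse (sinh (2 * s)) * (cosh (2 * s) * 2) * inverse (sinh (2 * s)))) (at s)"
      using n0 by (auto intro!: derivative_eq_intros)
    from DERIV_power[OF this, of ?n] show ?thesis
      by (rule DERIV_cong) (use n0 in \<open>simp add: n' cth_def field_simps\<close>)
  qed
  have d2: "((\<lambda>s. exp (- cth s * ?r)) has_real_derivative exp (- ?c * ?r) * (- (2 - 2 * ?c\<^sup>2) * ?r)) (at s)"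
    by (auto intro!: derivative_eq_intros has_derivative_cth[OF s] simp: algebra_simps)
  have dw: "((\<lambda>s. weight s p) has_real_derivative (- 2 * real ?n * ?c + 2 * (?c\<^sup>2 - 1) * ?r) * weight s p) (at s)"
    unfolding weight_form
    by (rule DERIV_cong[OF DERIV_cmult[OF DERIV_mult[OF d1 d2]]]) (simp add: algebra_simps)
  have dr: "((\<lambda>s. RR (real ?n) j (cth s) ?r) has_real_derivative (\<Sum>i\<le>j. poly (pderiv (qq (real ?n) j i)) ?c * (2 - 2 * ?c\<^sup>2) * ?r ^ i)) (at s)"
    unfolding RR_def
    by (intro DERIV_sum DERIV_cmult_right DERIV_chain2[OF poly_DERIV has_derivative_cth[OF s]])
  show ?thesis unfolding DW_def
    by (rule DERIV_cong[OF DERIV_mult[OF dr dw]]) (simp add: RR_Suc algebra_simps)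
qed

text \<open>\<open>deriv\<close> depends on a neighbourhood only, and the induction hypothesis holds
  on the open half line of positive times.\<close>

lemma deriv_weight: "s > 0 \<Longrightarrow> (deriv ^^ j) (\<lambda>s. weight s p) s = DW j s p"
proof (induction j arbitrary: s)
  case 0 show ?case by (simp add: DW_0)
next
  case (Suc j)
  have "\<forall>\<^sub>F x in nhds s. x > 0" using Suc.prems by (rule order_tendstoD(1)[OF filterlim_ident])
  then have "\<forall>\<^sub>F x in nhds s. (deriv ^^ j) (\<lambda>s. weight s p) x = DW j x p"
    by eventually_elim (rule Suc.IH)
  then have "deriv ((deriv ^^ j) (\<lambda>s. weight s p)) s = deriv (\<lambda>s. DW j s p) s"
    by (rule deriv_cong_ev) simp
  then show ?case using DERIV_imp_deriv[OF has_derivative_DW[OF Suc.prems]] by simp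
qed

lemma weight_deriv_DW: "t > 0 \<Longrightarrow> weight_deriv m t p = DW (2 * m) t p"
  unfolding weight_deriv_def by (rule deriv_weight)

lemma continuous_on_Yq: "continuous_on S Yq"
  unfolding Yq_def[abs_def] by (intro continuous_intros)

lemma continuous_on_Aq: "continuous_on S Aq"
  unfolding Aq_def[abs_def] by (intro continuous_intros)

lemma measurable_DW [measurable]: "DW j s \<in> borel_measurable borel"
proof -
  have "continuous_on UNIV (\<lambda>p. DW j s p)"
    unfolding DW_def RR_def by (intro continuous_intros continuous_on_Yq continuous_on_weight)
  then show ?thesis by (rule borel_measurable_continuous_onI)
qed

section \<open>Finite differences\<close>

text \<open>Iterated backward difference with step \<open>h\<close>; it samples only times up to
  \<open>s\<close>, where the weighted norms are finite.\<close>

fun nab :: "nat \<Rightarrow> real \<Rightarrow> (real \<Rightarrow> real) \<Rightarrow> real \<Rightarrow> real" where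
  "nab 0 h f s = f s"
| "nab (Suc k) h f s = nab k h (\<lambda>s. f s - f (s - h)) s"

text \<open>The family \<open>f\<close> lists successive derivatives. The induction hypothesis is
  applied to the differenced family, which is controlled only beyond \<open>a + h\<close>, and one
  more mean value step supplies the last derivative.\<close>

lemma nab_mean_value:
  assumes "\<And>j x. a < x \<Longrightarrow> (f j has_real_derivative f (Suc j) x) (at x)" "h > 0" "a < s - real k * h"
  shows "\<exists>\<xi>. s - real k * h \<le> \<xi> \<and> \<xi> \<le> s \<and> nab k h (f 0) s = h ^ k * f k \<xi>"
  using assms
proof (induction k arbitrary: f a)
  case 0 then show ?case by (intro exI[of _ s]) simp
next
  case (Suc k)
  have "\<exists>\<xi>. s - real k * h \<le> \<xi> \<and> \<xi> \<le> s \<and> nab k h (\<lambda>x. f 0 x - f 0 (x - h)) s = h ^ k * (f k \<xi> - f k (\<xi> - h))"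
  proof (rule Suc.IH[of "a + h" "\<lambda>j x. f j x - f j (x - h)"])
    fix j x assume x: "a + h < x"
    have d: "(f j has_real_derivative f (Suc j) x) (at x)" using x Suc.prems by auto
    have "(f j has_real_derivative f (Suc j) (x - h)) (at (x - h))" using x Suc.prems by auto
    moreover have "((\<lambda>x. x - h) has_real_derivative 1) (at x)" by (auto intro!: derivative_eq_intros)
    ultimately have "((\<lambda>x. f j (x - h)) has_real_derivative f (Suc j) (x - h) * 1) (at x)" by (rule DERIV_chain2)
    then have "((\<lambda>x. f j (x - h)) has_real_derivative f (Suc j) (x - h)) (at x)" by simp
    from DERIV_diff[OF d this] show "((\<lambda>x. f j x - f j (x - h)) has_real_derivative f (Suc j) x - f (Suc j) (x - h)) (at x)" .
  qed (use Suc.prems in \<open>auto simp: algebra_simps\<close>)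
  then obtain \<xi> where \<xi>: "s - real k * h \<le> \<xi>" "\<xi> \<le> s" "nab k h (\<lambda>x. f 0 x - f 0 (x - h)) s = h ^ k * (f k \<xi> - f k (\<xi> - h))"
    by blast
  have "\<exists>z>\<xi> - h. z < \<xi> \<and> f k \<xi> - f k (\<xi> - h) = (\<xi> - (\<xi> - h)) * f (Suc k) z"
  proof (rule MVT2)
    fix x assume "\<xi> - h \<le> x"
    then have "a < x" using \<xi>(1) Suc.prems(3) by (simp add: algebra_simps)
    then show "(f k has_real_derivative f (Suc k) x) (at x)" by (rule Suc.prems(1))
  qed (use Suc.prems in simp)
  then obtain z where "\<xi> - h < z" "z < \<xi>" "f k \<xi> - f k (\<xi> - h) = h * f (Suc k) z" by auto
  then show ?case using \<xi> by (intro exI[of _ z]) (auto simp: algebra_simps)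
qed

lemma nab_exp: "nab k h (\<lambda>s. c * exp (l * s)) s = c * exp (l * s) * (1 - exp (- l * h)) ^ k"
proof (induction k arbitrary: c)
  case (Suc k)
  have "(\<lambda>s. c * exp (l * s) - c * exp (l * (s - h))) = (\<lambda>s. (c * (1 - exp (- l * h))) * exp (l * s))"
    by (simp add: fun_eq_iff right_diff_distrib left_diff_distrib exp_diff exp_minus field_simps)
  then show ?case using Suc.IH[of "c * (1 - exp (- l * h))"] by (simp add: mult_ac)
qed simp

lemma nab_integral:
  assumes "\<And>s. s \<le> t \<Longrightarrow> t - real k * h \<le> s \<Longrightarrow> integrable M (\<phi> s)" "h > 0"
  shows "integrable M (\<lambda>p. nab k h (\<lambda>s. \<phi> s p) t) \<and> (\<integral>p. nab k h (\<lambda>s. \<phi> s p) t \<partial>M) = nab k h (\<lambda>s. \<integral>p. \<phi> s p \<partial>M) t"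
  using assms
proof (induction k arbitrary: \<phi>)
  case 0 then show ?case by simp
next
  case (Suc k)
  have i: "integrable M (\<phi> s)" "integrable M (\<phi> (s - h))" if "s \<le> t" "t - real k * h \<le> s" for s
    using that Suc.prems(2) by (intro Suc.prems(1); simp add: algebra_simps)+
  have "nab k h (\<lambda>s. \<integral>p. \<phi> s p - \<phi> (s - h) p \<partial>M) t = nab k h (\<lambda>s. (\<integral>p. \<phi> s p \<partial>M) - (\<integral>p. \<phi> (s - h) p \<partial>M)) t"
  proof -
    \<comment> \<open>A congruence restricted to the sampled times: splitting the integral of a
      difference needs integrability, which is assumed only there.\<close>
    have *: "nab k h f t = nab k h g t" if "\<And>s. s \<le> t \<Longrightarrow> t - real k * h \<le> s \<Longrightarrow> f s = g s" for f g
      using that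
    proof (induction k arbitrary: f g)
      case (Suc k)
      show ?case unfolding nab.simps
        by (rule Suc.IH, intro arg_cong2[where f=minus] Suc.prems) (use \<open>h > 0\<close> in \<open>auto simp: algebra_simps\<close>)
    qed simp
    show ?thesis by (rule *) (simp add: i)
  qed
  moreover have "integrable M (\<lambda>p. nab k h (\<lambda>s. \<phi> s p - \<phi> (s - h) p) t) \<and> (\<integral>p. nab k h (\<lambda>s. \<phi> s p - \<phi> (s - h) p) t \<partial>M) = nab k h (\<lambda>s. \<integral>p. \<phi> s p - \<phi> (s - h) p \<partial>M) t"
    by (rule Suc.IH) (use i Suc.prems in auto)
  ultimately show ?case by simp
qed

lemma nab_has_sum:
  assumes "\<And>s. s \<le> t \<Longrightarrow> t - real k * h \<le> s \<Longrightarrow> ((\<lambda>i. \<phi> s i) has_sum (\<Phi> s)) A" "h > 0"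
  shows "((\<lambda>i. nab k h (\<lambda>s. \<phi> s i) t) has_sum (nab k h \<Phi> t)) A"
  using assms
proof (induction k arbitrary: \<phi> \<Phi>)
  case (Suc k)
  show ?case unfolding nab.simps
  proof (rule Suc.IH)
    fix s assume s: "s \<le> t" "t - real k * h \<le> s"
    have 1: "(\<phi> s has_sum \<Phi> s) A" "(\<phi> (s - h) has_sum \<Phi> (s - h)) A"
      using s Suc.prems(2) by (intro Suc.prems(1); simp add: algebra_simps)+
    from has_sum_add[OF 1(1) has_sum_cmult_right[OF 1(2), of "-1"]]
    show "((\<lambda>i. \<phi> s i - \<phi> (s - h) i) has_sum (\<Phi> s - \<Phi> (s - h))) A" by simp
  qed (rule Suc.prems(2))
qed simp

lemma nab_mult: "nab k h (\<lambda>s. c * f s) t = c * nab k h f t"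
  by (induction k arbitrary: f) (simp_all add: right_diff_distrib[symmetric])

section \<open>Bounds for the weight\<close>

text \<open>The ratio depends on the point through an exponential in \<open>Yq\<close> alone; both
  the monotonicity in time and the gain between two times come from it.\<close>

lemma weight_ratio:
  fixes p :: "'n::finite cc"
  assumes "0 < s" "s \<le> t"
  shows "weight s p = (sinh (2 * t) / sinh (2 * s)) ^ CARD('n) * exp (- (cth s - cth t) * Yq p) * weight t p"
proof -
  have p: "sinh (2 * s) > 0" "sinh (2 * t) > 0" using assms by simp_all
  have "inverse (sinh (2 * s)) = sinh (2 * t) / sinh (2 * s) * inverse (sinh (2 * t))" using p by (simp add: field_simps)
  then have 1: "inverse (sinh (2 * s)) ^ CARD('n) = (sinh (2 * t) / sinh (2 * s)) ^ CARD('n) * inverse (sinh (2 * t)) ^ CARD('n)"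
    unfolding power_mult_distrib[symmetric] by simp
  have 2: "exp (- cth s * Yq p) = exp (- (cth s - cth t) * Yq p) * exp (- cth t * Yq p)"
    unfolding exp_add[symmetric] by (simp add: algebra_simps)
  show ?thesis unfolding weight_form 1 2 by (simp only: mult_ac)
qed

lemma weight_mono:
  fixes p :: "'n::finite cc"
  assumes "0 < s" "s \<le> t"
  shows "weight s p \<le> (sinh (2 * t) / sinh (2 * s)) ^ CARD('n) * weight t p"
proof -
  have p: "sinh (2 * s) > 0" "sinh (2 * t) > 0" using assms by simp_all
  have "exp (- (cth s - cth t) * Yq p) \<le> 1"
    using cth_antimono[OF assms] Yq_nonneg[of p] by (simp add: mult_nonpos_nonneg)
  then have "(sinh (2 * t) / sinh (2 * s)) ^ CARD('n) * exp (- (cth s - cth t) * Yq p) * weight t p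
     \<le> (sinh (2 * t) / sinh (2 * s)) ^ CARD('n) * 1 * weight t p"
    using p weight_pos[of t p] assms by (intro mult_right_mono mult_left_mono) auto
  then show ?thesis unfolding weight_ratio[OF assms] by simp
qed

lemma RR_upper: "\<exists>K\<ge>0. \<forall>C\<in>{a..b}. \<forall>r\<ge>0. \<bar>RR n j C r\<bar> \<le> K * (1 + r) ^ j"
proof -
  have "\<exists>B. \<forall>C\<in>{a..b}. \<bar>poly (qq n j i) C\<bar> \<le> B" for i
  proof -
    have "compact ((\<lambda>C. poly (qq n j i) C) ` {a..b})" by (intro compact_continuous_image continuous_intros compact_Icc)
    then have "bounded ((\<lambda>C. poly (qq n j i) C) ` {a..b})" by (rule compact_imp_bounded)
    then show ?thesis unfolding bounded_iff by auto
  qed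
  then obtain B where B: "\<And>i C. C \<in> {a..b} \<Longrightarrow> \<bar>poly (qq n j i) C\<bar> \<le> B i" by metis
  have "\<bar>RR n j C r\<bar> \<le> (\<Sum>i\<le>j. \<bar>B i\<bar>) * (1 + r) ^ j" if "C \<in> {a..b}" "r \<ge> 0" for C r
  proof -
    have "\<bar>RR n j C r\<bar> \<le> (\<Sum>i\<le>j. \<bar>poly (qq n j i) C * r ^ i\<bar>)" unfolding RR_def by (rule sum_abs)
    also have "\<dots> \<le> (\<Sum>i\<le>j. \<bar>B i\<bar> * (1 + r) ^ j)"
    proof (rule sum_mono)
      fix i assume "i \<in> {..j}"
      have "r ^ i \<le> (1 + r) ^ i" using that by (intro power_mono) auto
      also have "\<dots> \<le> (1 + r) ^ j" using that \<open>i \<in> {..j}\<close> by (intro power_increasing) auto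
      finally have "r ^ i \<le> (1 + r) ^ j" .
      moreover have "\<bar>poly (qq n j i) C\<bar> \<le> \<bar>B i\<bar>" using B[OF that(1), of i] by linarith
      ultimately show "\<bar>poly (qq n j i) C * r ^ i\<bar> \<le> \<bar>B i\<bar> * (1 + r) ^ j"
        unfolding abs_mult using that by (intro mult_mono) auto
    qed
    finally show ?thesis by (simp add: sum_distrib_right)
  qed
  then show ?thesis by (intro exI[of _ "\<Sum>i\<le>j. \<bar>B i\<bar>"]) (auto intro: sum_nonneg)
qed

lemma RR_lower:
  assumes C: "C > 1"
  shows "\<exists>\<rho>\<ge>0. \<exists>\<delta>>0. \<forall>r\<ge>\<rho>. \<delta> * (1 + r) ^ j \<le> RR n j C r"
proof (cases j)
  case 0 then show ?thesis by (intro exI[of _ 0] conjI exI[of _ 1]) (auto simp: RR_def)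
next
  case (Suc j')
  define a where "a = (2 * C\<^sup>2 - 2) ^ j"
  have "C\<^sup>2 > 1" using C by (simp add: power2_eq_square less_1_mult)
  then have a: "a > 0" by (simp add: a_def)
  have lead: "poly (qq n j j) C = a" unfolding qq_lead a_def by (simp add: power2_eq_square algebra_simps)
  define B where "B = (\<Sum>i\<le>j'. \<bar>poly (qq n j i) C\<bar>)"
  have B: "B \<ge> 0" unfolding B_def by (rule sum_nonneg) simp
  \<comment> \<open>Beyond 1 one has 1 + r \<le> 2 r, and beyond 2 B / a the lower order terms
    amount to at most half of the leading one.\<close>
  define \<rho> where "\<rho> = max 1 (2 * B / a)"
  have "(a / 2 / 2 ^ j) * (1 + r) ^ j \<le> RR n j C r" if r: "r \<ge> \<rho>" for r
  proof -
    have r1: "r \<ge> 1" "2 * B / a \<le> r" using r by (auto simp: \<rho>_def)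
    have Br: "B \<le> a / 2 * r" using r1(2) a by (simp add: field_simps)
    have "RR n j C r = (\<Sum>i\<le>j'. poly (qq n j i) C * r ^ i) + a * r ^ j"
      unfolding RR_def lead[symmetric] Suc by simp
    moreover have "\<bar>\<Sum>i\<le>j'. poly (qq n j i) C * r ^ i\<bar> \<le> B * r ^ j'"
    proof -
      have "\<bar>\<Sum>i\<le>j'. poly (qq n j i) C * r ^ i\<bar> \<le> (\<Sum>i\<le>j'. \<bar>poly (qq n j i) C * r ^ i\<bar>)" by (rule sum_abs)
      also have "\<dots> \<le> (\<Sum>i\<le>j'. \<bar>poly (qq n j i) C\<bar> * r ^ j')"
        unfolding abs_mult using r1 by (intro sum_mono mult_left_mono) (auto intro: power_increasing)
      finally show ?thesis by (simp add: B_def sum_distrib_right)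
    qed
    moreover have "B * r ^ j' \<le> a / 2 * r ^ j"
      using mult_right_mono[OF Br, of "r ^ j'"] r1 by (simp add: Suc mult.assoc)
    ultimately have "a / 2 * r ^ j \<le> RR n j C r" by linarith
    moreover have "(1 + r) ^ j \<le> (2 * r) ^ j" using r1 by (intro power_mono) auto
    then have "(a / 2 / 2 ^ j) * (1 + r) ^ j \<le> (a / 2 / 2 ^ j) * (2 * r) ^ j" using a by (intro mult_left_mono) auto
    then have "(a / 2 / 2 ^ j) * (1 + r) ^ j \<le> a / 2 * r ^ j" by (simp add: power_mult_distrib)
    ultimately show ?thesis by linarith
  qed
  moreover have "\<rho> \<ge> 0" by (simp add: \<rho>_def)
  moreover have "a / 2 / 2 ^ j > 0" using a by simp
  ultimately show ?thesis by blast
qed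

lemma DW_lower:
  assumes t: "t > 0"
  shows "\<exists>\<rho>\<ge>0. \<exists>\<delta>>0. \<forall>p::'n::finite cc. Yq p \<ge> \<rho> \<longrightarrow> \<delta> * ((1 + Yq p) ^ j * weight t p) \<le> \<bar>DW j t p\<bar>"
proof -
  obtain \<rho> \<delta> where b: "\<rho> \<ge> 0" "\<delta> > 0" "\<And>r. r \<ge> \<rho> \<Longrightarrow> \<delta> * (1 + r) ^ j \<le> RR (real CARD('n)) j (cth t) r"
    using RR_lower[OF cth_gt_1[OF t], of j "real CARD('n)"] by blast
  have "\<delta> * ((1 + Yq p) ^ j * weight t p) \<le> \<bar>DW j t p\<bar>" if "Yq p \<ge> \<rho>" for p :: "'n cc"
  proof -
    have "\<delta> * (1 + Yq p) ^ j * weight t p \<le> DW j t p"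
      unfolding DW_def using weight_pos[OF t, of p] by (intro mult_right_mono b that) simp
    then show ?thesis by (simp add: mult.assoc)
  qed
  then show ?thesis using b by blast
qed

text \<open>Domination uniform in time. Above the threshold of \<open>DW_lower\<close> the
  derivative at \<open>t\<close> suffices; below it that derivative may vanish, and
  \<open>weight t p\<close> takes over because \<open>Yq\<close> is bounded there.\<close>

lemma DW_dominated:
  assumes t: "t > 0"
  shows "\<exists>K\<ge>0. \<forall>s\<in>{t/2..t}. \<forall>p::'n::finite cc. \<bar>DW j s p\<bar> \<le> K * (\<bar>DW j t p\<bar> + weight t p)"
proof -
  obtain \<rho> \<delta> where l: "\<rho> \<ge> 0" "\<delta> > 0" "\<And>p::'n cc. Yq p \<ge> \<rho> \<Longrightarrow> \<delta> * ((1 + Yq p) ^ j * weight t p) \<le> \<bar>DW j t p\<bar>"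
    using DW_lower[OF t, of j, where 'n='n] by blast
  obtain K where K: "K \<ge> 0" "\<And>C r. C \<in> {cth t..cth (t/2)} \<Longrightarrow> r \<ge> 0 \<Longrightarrow> \<bar>RR (real CARD('n)) j C r\<bar> \<le> K * (1 + r) ^ j"
    using RR_upper[of "cth t" "cth (t/2)" "real CARD('n)" j] by blast
  define S where "S = (sinh (2 * t) / sinh t) ^ CARD('n)"
  have S: "S \<ge> 0" unfolding S_def using t by simp
  define K' where "K' = K * S * (1 / \<delta> + (1 + \<rho>) ^ j)"
  have K': "K' \<ge> 0" unfolding K'_def using K S l by simp
  have "\<bar>DW j s p\<bar> \<le> K' * (\<bar>DW j t p\<bar> + weight t p)" if s: "s \<in> {t/2..t}" for s and p :: "'n cc"
  proof -
    have s0: "s > 0" "s \<le> t" "t / 2 \<le> s" using s t by auto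
    have y: "Yq p \<ge> 0" by (rule Yq_nonneg)
    have w: "weight t p > 0" by (rule weight_pos[OF t])
    have cs: "cth s \<in> {cth t..cth (t/2)}" using cth_antimono[of s t] cth_antimono[of "t/2" s] s0 t by auto
    have "weight s p \<le> (sinh (2 * t) / sinh (2 * s)) ^ CARD('n) * weight t p" by (rule weight_mono[OF s0(1,2)])
    also have "\<dots> \<le> S * weight t p"
      unfolding S_def using s0 t w by (intro mult_right_mono power_mono divide_left_mono) auto
    finally have ws: "weight s p \<le> S * weight t p" .
    have "\<bar>DW j s p\<bar> = \<bar>RR (real CARD('n)) j (cth s) (Yq p)\<bar> * weight s p"
      unfolding DW_def abs_mult using weight_pos[OF s0(1), of p] by simp
    also have "\<dots> \<le> (K * (1 + Yq p) ^ j) * (S * weight t p)"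
      using K cs y ws weight_pos[OF s0(1), of p] by (intro mult_mono) auto
    also have "\<dots> = K * S * ((1 + Yq p) ^ j * weight t p)" by (simp add: mult_ac)
    also have "\<dots> \<le> K * S * ((1 / \<delta> + (1 + \<rho>) ^ j) * (\<bar>DW j t p\<bar> + weight t p))"
    proof (rule mult_left_mono)
      show "(1 + Yq p) ^ j * weight t p \<le> (1 / \<delta> + (1 + \<rho>) ^ j) * (\<bar>DW j t p\<bar> + weight t p)"
      proof (cases "Yq p \<ge> \<rho>")
        case True
        then have "(1 + Yq p) ^ j * weight t p \<le> 1 / \<delta> * \<bar>DW j t p\<bar>" using l by (simp add: field_simps)
        also have "\<dots> \<le> (1 / \<delta> + (1 + \<rho>) ^ j) * (\<bar>DW j t p\<bar> + weight t p)"
          using l w by (intro mult_mono) auto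
        finally show ?thesis .
      next
        case False
        then have "(1 + Yq p) ^ j * weight t p \<le> (1 + \<rho>) ^ j * weight t p"
          using y w by (intro mult_right_mono power_mono) auto
        also have "\<dots> \<le> (1 / \<delta> + (1 + \<rho>) ^ j) * (\<bar>DW j t p\<bar> + weight t p)"
          using l w by (intro mult_mono) auto
        finally show ?thesis .
      qed
    qed (use K S in simp)
    finally show ?thesis by (simp add: K'_def mult.assoc)
  qed
  then show ?thesis using K' by blast
qed

lemma poly_exp_decay: assumes "\<epsilon> > 0" shows "\<exists>K\<ge>0. \<forall>r\<ge>0. (1 + r) ^ j * exp (- \<epsilon> * r) \<le> (K::real)"
proof -
  let ?K = "exp \<epsilon> * fact j / \<epsilon> ^ j"
  have "(1 + r) ^ j * exp (- \<epsilon> * r) \<le> ?K" if "r \<ge> 0" for r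
  proof -
    have "(\<Sum>k\<in>{j}. (\<epsilon> * (1 + r)) ^ k /\<^sub>R fact k) \<le> exp (\<epsilon> * (1 + r))"
      unfolding exp_def using assms that by (intro sum_le_suminf summable_exp_generic) auto
    then have "(\<epsilon> * (1 + r)) ^ j \<le> fact j * (exp \<epsilon> * exp (\<epsilon> * r))"
      by (simp add: field_simps exp_add)
    then have "(1 + r) ^ j \<le> ?K * exp (\<epsilon> * r)"
      unfolding power_mult_distrib using assms by (simp add: field_simps)
    then have "(1 + r) ^ j * exp (- \<epsilon> * r) \<le> ?K * exp (\<epsilon> * r) * exp (- \<epsilon> * r)" by (intro mult_right_mono) auto
    also have "\<dots> = ?K" by (simp add: mult.assoc exp_add[symmetric])
    finally show ?thesis .
  qed
  then show ?thesis using assms by (intro exI[of _ ?K]) auto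
qed

text \<open>Passing from \<open>t\<close> to \<open>t + 1\<close> gains an exponential factor in
  \<open>Yq\<close>, which absorbs the polynomial. This places finite sums, square integrable at
  every positive time, in \<open>G_space\<close>.\<close>

lemma DW_le_later_weight:
  assumes t: "t > 0"
  shows "\<exists>K\<ge>0. \<forall>p::'n::finite cc. \<bar>DW j t p\<bar> \<le> K * weight (t + 1) p"
proof -
  define \<epsilon> where "\<epsilon> = cth t - cth (t + 1)"
  have p: "sinh (2 * t) > 0" "sinh (2 * (t + 1)) > 0" using t by simp_all
  have "sinh (2 * (t + 1) - 2 * t) > 0" by simp
  then have "cosh (2 * (t + 1)) * sinh (2 * t) < cosh (2 * t) * sinh (2 * (t + 1))"
    unfolding sinh_diff by (simp add: mult.commute)
  then have \<epsilon>: "\<epsilon> > 0" unfolding \<epsilon>_def cth_def using p by (simp add: divide_less_eq pos_less_divide_eq mult.commute)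
  obtain K1 where K1: "K1 \<ge> 0" "\<And>r. r \<ge> 0 \<Longrightarrow> (1 + r) ^ j * exp (- \<epsilon> * r) \<le> K1" using poly_exp_decay[OF \<epsilon>] by blast
  obtain K where K: "K \<ge> 0" "\<And>r. r \<ge> 0 \<Longrightarrow> \<bar>RR (real CARD('n)) j (cth t) r\<bar> \<le> K * (1 + r) ^ j"
    using RR_upper[of "cth t" "cth t" "real CARD('n)" j] by auto
  define S where "S = (sinh (2 * (t + 1)) / sinh (2 * t)) ^ CARD('n)"
  have S: "S \<ge> 0" unfolding S_def using p by simp
  have "\<bar>DW j t p\<bar> \<le> K * S * K1 * weight (t + 1) p" for p :: "'n cc"
  proof -
    have y: "Yq p \<ge> 0" by (rule Yq_nonneg)
    have w: "weight (t + 1) p > 0" using t by (intro weight_pos) simp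
    have "\<bar>DW j t p\<bar> = \<bar>RR (real CARD('n)) j (cth t) (Yq p)\<bar> * weight t p"
      unfolding DW_def abs_mult using weight_pos[OF t, of p] by simp
    also have "\<dots> \<le> (K * (1 + Yq p) ^ j) * weight t p"
      using K y weight_pos[OF t, of p] by (intro mult_right_mono) auto
    also have "weight t p = S * exp (- \<epsilon> * Yq p) * weight (t + 1) p"
      unfolding S_def \<epsilon>_def using t by (intro weight_ratio) auto
    also have "(K * (1 + Yq p) ^ j) * (S * exp (- \<epsilon> * Yq p) * weight (t + 1) p) = K * S * ((1 + Yq p) ^ j * exp (- \<epsilon> * Yq p)) * weight (t + 1) p"
      by (simp only: mult_ac)
    also have "\<dots> \<le> K * S * K1 * weight (t + 1) p"
      using K S K1(2)[OF y] w by (intro mult_right_mono mult_left_mono) auto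
    finally show ?thesis .
  qed
  then show ?thesis using K S K1 by (intro exI[of _ "K * S * K1"]) auto
qed

section \<open>Square integrability with respect to the weight\<close>

text \<open>In one coordinate \<open>z\<close> changes by i \<zeta> and \<open>w\<close> by \<zeta>,
  so w + i z does not move.\<close>

lemma Aq_shift: "Aq (p + cs \<zeta> (axis k \<i>, axis k 1)) = Aq p"
  unfolding Aq_def
  by (intro sum.cong refl arg_cong[where f="\<lambda>z. (cmod z)\<^sup>2"]) (auto simp: axis_def algebra_simps)

lemma Yq_shift:
  assumes "Yq p \<le> r\<^sup>2" "r \<ge> 0"
  shows "(cmod \<zeta>)\<^sup>2 - 2 * cmod \<zeta> * r \<le> Yq (p + cs \<zeta> (axis k \<i>, axis k 1))"
    and "Yq (p + cs \<zeta> (axis k \<i>, axis k 1)) \<le> r\<^sup>2 + (cmod \<zeta>)\<^sup>2 + 2 * cmod \<zeta> * r"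
proof -
  let ?\<eta> = "Complex (Im (fst p $ k)) (Im (snd p $ k))"
  have "Yq (p + cs \<zeta> (axis k \<i>, axis k 1)) = (\<Sum>j\<in>UNIV. ((Im (fst p $ j))\<^sup>2 + (Im (snd p $ j))\<^sup>2) + (if j = k then 2 * Re (?\<eta> * cnj \<zeta>) + (cmod \<zeta>)\<^sup>2 else 0))"
    unfolding Yq_def cmod_sq by (intro sum.cong refl) (auto simp: axis_def power2_eq_square algebra_simps)
  then have e: "Yq (p + cs \<zeta> (axis k \<i>, axis k 1)) = Yq p + (2 * Re (?\<eta> * cnj \<zeta>) + (cmod \<zeta>)\<^sup>2)"
    unfolding sum.distrib Yq_def by simp
  have "(Im (fst p $ k))\<^sup>2 + (Im (snd p $ k))\<^sup>2 \<le> Yq p"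
    unfolding Yq_def by (rule member_le_sum) auto
  then have "(cmod ?\<eta>)\<^sup>2 \<le> r\<^sup>2" using assms by (simp add: cmod_power2)
  then have "cmod ?\<eta> \<le> r" using assms(2) by (rule power2_le_imp_le)
  then have "cmod (?\<eta> * cnj \<zeta>) \<le> r * cmod \<zeta>" unfolding norm_mult by (simp add: mult_right_mono)
  then have "\<bar>Re (?\<eta> * cnj \<zeta>)\<bar> \<le> r * cmod \<zeta>" using abs_Re_le_cmod order_trans by blast
  then show "(cmod \<zeta>)\<^sup>2 - 2 * cmod \<zeta> * r \<le> Yq (p + cs \<zeta> (axis k \<i>, axis k 1))"
    "Yq (p + cs \<zeta> (axis k \<i>, axis k 1)) \<le> r\<^sup>2 + (cmod \<zeta>)\<^sup>2 + 2 * cmod \<zeta> * r"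
    unfolding e using assms Yq_nonneg[of p] by (auto simp: abs_le_iff mult_ac)
qed

text \<open>The translations used here leave \<^const>\<open>Aq\<close> fixed and move the imaginary parts out of the
  region \<^prop>\<open>Yq p \<le> r\<^sup>2\<close>, so averaging over a circle of translations controls that region by an annulus.\<close>

lemma annulus_bound:
  fixes f :: "'n::finite cc \<Rightarrow> complex"
  assumes f: "entire f" and r: "r \<ge> 0"
  defines "\<phi> \<equiv> \<lambda>p. cmod (f p) * exp (- Aq p / 2)"
  shows "(\<integral>\<^sup>+p. ennreal (\<phi> p * of_bool (Yq p \<le> r\<^sup>2)) \<partial>lborel)
      \<le> (\<integral>\<^sup>+p. ennreal (\<phi> p * of_bool (r\<^sup>2 \<le> Yq p \<and> Yq p \<le> r\<^sup>2 + (3 * r + 1)\<^sup>2 + 2 * (3 * r + 1) * r)) \<partial>lborel)"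
proof -
  interpret C: finite_measure circ by (rule finite_measure_circ)
  interpret P: pair_sigma_finite circ "lborel :: 'n cc measure" ..
  \<comment> \<open>This radius satisfies d^2 - 2 d r \<ge> r^2, so by \<open>Yq_shift\<close> every
    translated point has \<open>Yq\<close> at least r^2.\<close>
  define d where "d = 3 * r + 1"
  define R where "R = r\<^sup>2 + d\<^sup>2 + 2 * d * r"
  \<comment> \<open>Any coordinate will do; one exists because types are nonempty.\<close>
  obtain k :: 'n where True by simp
  define v where "v = (\<lambda>\<theta>. cs (of_real d * cis \<theta>) (axis k \<i>, axis k 1) :: 'n cc)"
  define \<psi> where "\<psi> = (\<lambda>p. ennreal (\<phi> p * of_bool (r\<^sup>2 \<le> Yq p \<and> Yq p \<le> R)))"
  have d: "d > 0" using r by (simp add: d_def)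
  have cv: "cmod (of_real d * cis \<theta>) = d" for \<theta> using d by (simp add: norm_mult)
  have Y [measurable]: "Yq \<in> borel_measurable borel" and A [measurable]: "Aq \<in> borel_measurable borel"
    by (intro borel_measurable_continuous_onI continuous_on_Yq continuous_on_Aq)+
  have fm [measurable]: "f \<in> borel_measurable borel" by (rule entire_imp_measurable[OF f])
  have \<phi>m [measurable]: "\<phi> \<in> borel_measurable borel" unfolding \<phi>_def by measurable
  have \<psi>m: "\<psi> \<in> borel_measurable borel"
    unfolding \<psi>_def of_bool_def by measurable
  \<comment> \<open>The mean of \<open>f\<close> over the circle of translations bounds its value at
    the centre; \<open>Aq\<close> is constant along the circle, so the Gaussian factor passes
    through the mean.\<close>
  have pw: "ennreal (2 * pi) * ennreal (\<phi> p * of_bool (Yq p \<le> r\<^sup>2)) \<le> (\<integral>\<^sup>+\<theta>. \<psi> (p + v \<theta>) \<partial>circ)" for p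
  proof (cases "Yq p \<le> r\<^sup>2")
    case True
    let ?g = "\<lambda>\<theta>. f (p + v \<theta>) * of_real (exp (- Aq p / 2))"
    have h: "integrable circ (\<lambda>\<theta>. f (p + v \<theta>))" "(\<integral>\<theta>. f (p + v \<theta>) \<partial>circ) = of_real (2 * pi) * f p"
      using integral_circ_mean[OF entire_slice(1)[OF f, of p "(axis k \<i>, axis k 1)"] d, of 0] by (simp_all add: v_def)
    have gi: "integrable circ ?g" using h(1) by simp
    have gv: "(\<integral>\<theta>. ?g \<theta> \<partial>circ) = of_real (2 * pi) * f p * of_real (exp (- Aq p / 2))" using h by simp
    have "norm (\<integral>\<theta>. ?g \<theta> \<partial>circ) = 2 * pi * \<phi> p" unfolding gv \<phi>_def by (simp add: norm_mult)
    then have "ennreal (2 * pi) * ennreal (\<phi> p * of_bool (Yq p \<le> r\<^sup>2)) = ennreal (norm (\<integral>\<theta>. ?g \<theta> \<partial>circ))"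
      using True by (simp add: ennreal_mult'[symmetric])
    also have "\<dots> \<le> (\<integral>\<^sup>+\<theta>. ennreal (norm (?g \<theta>)) \<partial>circ)" by (rule integral_norm_bound_ennreal[OF gi])
    also have "\<dots> = (\<integral>\<^sup>+\<theta>. \<psi> (p + v \<theta>) \<partial>circ)"
    proof (rule nn_integral_cong)
      fix \<theta>
      have a: "Aq (p + v \<theta>) = Aq p" unfolding v_def by (rule Aq_shift)
      have "d\<^sup>2 - 2 * d * r \<le> Yq (p + v \<theta>)" "Yq (p + v \<theta>) \<le> R"
        using Yq_shift[OF True r, of "of_real d * cis \<theta>" k] unfolding cv v_def R_def by auto
      moreover have "r\<^sup>2 \<le> d\<^sup>2 - 2 * d * r"
      proof -
        have "d\<^sup>2 - 2 * d * r = r\<^sup>2 + (2 * r\<^sup>2 + 4 * r + 1)" unfolding d_def by (simp add: power2_eq_square algebra_simps)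
        moreover have "0 \<le> 2 * r\<^sup>2 + 4 * r + 1" using r by simp
        ultimately show ?thesis by linarith
      qed
      ultimately show "ennreal (norm (?g \<theta>)) = \<psi> (p + v \<theta>)"
        unfolding \<psi>_def \<phi>_def a by (simp add: norm_mult)
    qed
    finally show ?thesis .
  qed simp
  have vm: "v \<in> circ \<rightarrow>\<^sub>M borel"
  proof -
    have "continuous_on UNIV v" unfolding v_def by (intro continuous_intros)
    from measurable_compose[OF sets_circ_measurable borel_measurable_continuous_onI[OF this]] show ?thesis .
  qed
  have "(\<lambda>x. snd x + v (fst x)) \<in> (circ \<Otimes>\<^sub>M (lborel :: 'n cc measure)) \<rightarrow>\<^sub>M borel"
    using measurable_compose[OF measurable_fst vm] by measurable
  from measurable_compose[OF this \<psi>m] have jm: "(\<lambda>x. \<psi> (snd x + v (fst x))) \<in> borel_measurable (circ \<Otimes>\<^sub>M lborel)" .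
  have "ennreal (2 * pi) * (\<integral>\<^sup>+p. ennreal (\<phi> p * of_bool (Yq p \<le> r\<^sup>2)) \<partial>lborel)
      = (\<integral>\<^sup>+p. ennreal (2 * pi) * ennreal (\<phi> p * of_bool (Yq p \<le> r\<^sup>2)) \<partial>lborel)"
    by (rule nn_integral_cmult[symmetric]) (unfold of_bool_def, measurable)
  also have "\<dots> \<le> (\<integral>\<^sup>+p. \<integral>\<^sup>+\<theta>. \<psi> (p + v \<theta>) \<partial>circ \<partial>lborel)" by (intro nn_integral_mono pw)
  also have "\<dots> = (\<integral>\<^sup>+\<theta>. \<integral>\<^sup>+p. \<psi> (p + v \<theta>) \<partial>lborel \<partial>circ)"
    using P.Fubini[OF jm] by simp
  also have "\<dots> = (\<integral>\<^sup>+\<theta>. (\<integral>\<^sup>+p. \<psi> p \<partial>lborel) \<partial>circ)"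
    by (intro nn_integral_cong lpres_nn_integral[OF lpres_plus \<psi>m])
  also have "\<dots> = ennreal (2 * pi) * (\<integral>\<^sup>+p. \<psi> p \<partial>lborel)"
    by (simp add: circ_def emeasure_restrict_space space_restrict_space mult.commute)
  finally show ?thesis
    unfolding \<psi>_def R_def d_def by (subst (asm) ennreal_mult_le_mult_iff) auto
qed

lemma hfac_inverse: "hfac 1 p * g0 p = 1"
  unfolding hfac_def g0_def exp_add[symmetric] by simp

text \<open>Where \<open>Yq\<close> is large the derivative dominates the weight. The remaining
  strip is unbounded in the real directions, and there \<open>annulus_bound\<close> estimates the
  integral by one over a region where the derivative dominates again.\<close>

lemma G_space_sqi:
  fixes F :: "'n::finite cc \<Rightarrow> complex"
  assumes t: "t > 0" and F: "F \<in> G_space t m"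
  shows "sqi (Mt t) F"
proof -
  have E: "entire F" and i: "integrable lborel (\<lambda>p. (cmod (F p))\<^sup>2 * \<bar>DW (2 * m) t p\<bar>)"
    using F by (auto simp: G_space_def weight_deriv_DW[OF t])
  have Fm [measurable]: "F \<in> borel_measurable borel" by (rule entire_imp_measurable[OF E])
  obtain \<rho> \<delta> where l: "\<rho> \<ge> 0" "\<delta> > 0" "\<And>p::'n cc. Yq p \<ge> \<rho> \<Longrightarrow> \<delta> * ((1 + Yq p) ^ (2 * m) * weight t p) \<le> \<bar>DW (2 * m) t p\<bar>"
    using DW_lower[OF t, of "2 * m", where 'n='n] by blast
  have lw: "weight t p \<le> (1 / \<delta>) * \<bar>DW (2 * m) t p\<bar>" if "Yq p \<ge> \<rho>" for p :: "'n cc"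
  proof -
    have "1 * weight t p \<le> (1 + Yq p) ^ (2 * m) * weight t p"
      using Yq_nonneg[of p] weight_pos[OF t, of p] by (intro mult_right_mono one_le_power) auto
    also have "\<dots> \<le> (1 / \<delta>) * \<bar>DW (2 * m) t p\<bar>" using l that by (simp add: field_simps)
    finally show ?thesis by simp
  qed
  define r where "r = sqrt \<rho>"
  have r: "r \<ge> 0" "r\<^sup>2 = \<rho>" using l by (simp_all add: r_def)
  define \<kappa> where "\<kappa> = cth t - 1"
  have \<kappa>: "\<kappa> > 0" using cth_gt_1[OF t] by (simp add: \<kappa>_def)
  define C where "C = Ct TYPE('n) t"
  have C: "C > 0" unfolding C_def by (rule Ct_pos[OF t])
  \<comment> \<open>Squared, because the mean value inequality is needed for |F|^2; the factor
    \<open>hfac 1\<close> is the inverse of \<open>g0\<close> and brings the weight into the form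
    \<open>weight_g0\<close>.\<close>
  define f where "f = (\<lambda>p. (F p * hfac 1 p) ^ 2)"
  define \<phi> where "\<phi> = (\<lambda>p. cmod (f p) * exp (- Aq p / 2))"
  have f: "entire f" unfolding f_def by (intro entire_power entire_mult E entire_hfac)
  have Fw: "(cmod (F p))\<^sup>2 * weight t p = C * (\<phi> p * exp (- \<kappa> * Yq p))" for p
  proof -
    have "F p = F p * hfac 1 p * g0 p" using hfac_inverse[of p] by (simp add: mult.assoc)
    then have "(cmod (F p))\<^sup>2 * weight t p = cmod (f p) * (weight t p * (cmod (g0 p))\<^sup>2)"
      unfolding f_def by (metis norm_mult norm_power power_mult_distrib mult.assoc mult.commute)
    also have "\<dots> = C * (\<phi> p * exp (- \<kappa> * Yq p))"
      unfolding weight_g0 C_def \<phi>_def \<kappa>_def minus_add_distrib exp_add by (simp add: algebra_simps)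
    finally show ?thesis .
  qed
  have \<phi>0: "\<phi> p \<ge> 0" for p by (simp add: \<phi>_def)
  define R where "R = r\<^sup>2 + (3 * r + 1)\<^sup>2 + 2 * (3 * r + 1) * r"
  have DWm: "(\<lambda>p. (cmod (F p))\<^sup>2 * \<bar>DW (2 * m) t p\<bar>) \<in> borel_measurable borel" by measurable
  have DWf: "(\<integral>\<^sup>+p. ennreal ((cmod (F p))\<^sup>2 * \<bar>DW (2 * m) t p\<bar>) \<partial>lborel) < \<infinity>"
    using i unfolding integrable_iff_bounded by (simp add: abs_mult)
  have "(\<integral>\<^sup>+p. ennreal (\<phi> p * of_bool (r\<^sup>2 \<le> Yq p \<and> Yq p \<le> R)) \<partial>lborel)
      \<le> (\<integral>\<^sup>+p. ennreal (exp (\<kappa> * R) / (C * \<delta>)) * ennreal ((cmod (F p))\<^sup>2 * \<bar>DW (2 * m) t p\<bar>) \<partial>lborel)"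
  proof (rule nn_integral_mono)
    fix p :: "'n cc"
    show "ennreal (\<phi> p * of_bool (r\<^sup>2 \<le> Yq p \<and> Yq p \<le> R)) \<le> ennreal (exp (\<kappa> * R) / (C * \<delta>)) * ennreal ((cmod (F p))\<^sup>2 * \<bar>DW (2 * m) t p\<bar>)"
    proof (cases "r\<^sup>2 \<le> Yq p \<and> Yq p \<le> R")
      case True
      have "exp (\<kappa> * R) * exp (- \<kappa> * Yq p) \<ge> 1"
        unfolding exp_add[symmetric] using True \<kappa> by (simp add: mult_left_mono)
      then have "\<phi> p * 1 \<le> \<phi> p * (exp (\<kappa> * R) * exp (- \<kappa> * Yq p))" by (intro mult_left_mono \<phi>0)
      also have "\<dots> = exp (\<kappa> * R) / C * ((cmod (F p))\<^sup>2 * weight t p)" unfolding Fw using C by simp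
      also have "\<dots> \<le> exp (\<kappa> * R) / C * ((cmod (F p))\<^sup>2 * ((1 / \<delta>) * \<bar>DW (2 * m) t p\<bar>))"
        using C True r by (intro mult_left_mono lw) auto
      also have "\<dots> = exp (\<kappa> * R) / (C * \<delta>) * ((cmod (F p))\<^sup>2 * \<bar>DW (2 * m) t p\<bar>)" by simp
      finally show ?thesis using True C l by (simp add: ennreal_mult'[symmetric] ennreal_leI)
    qed (simp only: of_bool_eq_0_iff of_bool_eq mult_zero_right ennreal_0 zero_le)
  qed
  also have "\<dots> = ennreal (exp (\<kappa> * R) / (C * \<delta>)) * (\<integral>\<^sup>+p. ennreal ((cmod (F p))\<^sup>2 * \<bar>DW (2 * m) t p\<bar>) \<partial>lborel)"
    by (rule nn_integral_cmult) (use DWm in measurable)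
  also have "\<dots> < \<infinity>" using DWf by (simp add: ennreal_mult_less_top)
  finally have ann: "(\<integral>\<^sup>+p. ennreal (\<phi> p * of_bool (Yq p \<le> r\<^sup>2)) \<partial>lborel) < \<infinity>"
    using annulus_bound[OF f r(1)] unfolding \<phi>_def R_def by (rule le_less_trans[rotated])
  have \<phi>m: "(\<lambda>p. \<phi> p * of_bool (Yq p \<le> r\<^sup>2)) \<in> borel_measurable borel"
  proof -
    have [measurable]: "Yq \<in> borel_measurable (borel :: 'n cc measure)" "Aq \<in> borel_measurable (borel :: 'n cc measure)" "f \<in> borel_measurable borel"
      by (intro borel_measurable_continuous_onI continuous_on_Yq continuous_on_Aq entire_imp_measurable f)+
    show ?thesis unfolding \<phi>_def of_bool_def by measurable
  qed
  have "(\<integral>\<^sup>+p. ennreal (norm ((cmod (F p))\<^sup>2 * weight t p)) \<partial>lborel)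
     \<le> (\<integral>\<^sup>+p. ennreal (1 / \<delta>) * ennreal ((cmod (F p))\<^sup>2 * \<bar>DW (2 * m) t p\<bar>) + ennreal C * ennreal (\<phi> p * of_bool (Yq p \<le> r\<^sup>2)) \<partial>lborel)"
  proof (rule nn_integral_mono)
    fix p :: "'n cc"
    have w: "norm ((cmod (F p))\<^sup>2 * weight t p) = (cmod (F p))\<^sup>2 * weight t p" using weight_pos[OF t, of p] by simp
    show "ennreal (norm ((cmod (F p))\<^sup>2 * weight t p)) \<le> ennreal (1 / \<delta>) * ennreal ((cmod (F p))\<^sup>2 * \<bar>DW (2 * m) t p\<bar>) + ennreal C * ennreal (\<phi> p * of_bool (Yq p \<le> r\<^sup>2))"
    proof (cases "Yq p \<le> r\<^sup>2")
      case True
      have "exp (- \<kappa> * Yq p) \<le> 1" using \<kappa> Yq_nonneg[of p] by simp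
      then have "(cmod (F p))\<^sup>2 * weight t p \<le> C * (\<phi> p * 1)"
        unfolding Fw using C \<phi>0 by (intro mult_left_mono) auto
      then have "ennreal ((cmod (F p))\<^sup>2 * weight t p) \<le> ennreal C * ennreal (\<phi> p)"
        using C by (simp add: ennreal_mult'[symmetric] ennreal_leI)
      then show ?thesis unfolding w using True by (simp add: add_increasing)
    next
      case False
      then have "(cmod (F p))\<^sup>2 * weight t p \<le> (cmod (F p))\<^sup>2 * ((1 / \<delta>) * \<bar>DW (2 * m) t p\<bar>)"
        using r by (intro mult_left_mono lw) auto
      also have "\<dots> = (1 / \<delta>) * ((cmod (F p))\<^sup>2 * \<bar>DW (2 * m) t p\<bar>)" by simp
      finally have "ennreal ((cmod (F p))\<^sup>2 * weight t p) \<le> ennreal (1 / \<delta>) * ennreal ((cmod (F p))\<^sup>2 * \<bar>DW (2 * m) t p\<bar>)"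
        using l by (simp add: ennreal_mult'[symmetric] ennreal_leI)
      then show ?thesis unfolding w using False by simp
    qed
  qed
  also have "\<dots> = ennreal (1 / \<delta>) * (\<integral>\<^sup>+p. ennreal ((cmod (F p))\<^sup>2 * \<bar>DW (2 * m) t p\<bar>) \<partial>lborel)
      + ennreal C * (\<integral>\<^sup>+p. ennreal (\<phi> p * of_bool (Yq p \<le> r\<^sup>2)) \<partial>lborel)"
    using DWm \<phi>m by (subst nn_integral_add) (auto simp: nn_integral_cmult)
  also have "\<dots> < \<infinity>" using DWf ann by (simp add: ennreal_mult_less_top)
  finally show ?thesis
    unfolding sqi_Mt[OF t] by (intro conjI Fm integrableI_bounded) measurable
qed

section \<open>The norm of the weighted space in terms of coefficients\<close>

text \<open>The difference between \<open>F\<close> and the series of its coefficients is entire and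
  orthogonal to all \<open>SHi\<close>, hence 0 by completeness.\<close>

lemma entire_SE_expansion:
  fixes F :: "'n::finite cc \<Rightarrow> complex"
  assumes t: "t > 0" and E: "entire F" and F: "sqi (Mt t) F"
  shows "\<exists>d. (\<lambda>i. (cmod (d i))\<^sup>2 * Nt t i) summable_on UNIV \<and> F = SE d"
proof -
  interpret O: orthogonal_system "Mt t" "SHi :: 'n ix \<Rightarrow> _" "Nt t" by (rule orthogonal_system_Mt[OF t])
  have sm: "(\<lambda>i. (cmod (O.co F i))\<^sup>2 * Nt t i) summable_on UNIV" by (rule O.Bessel_summable[OF F])
  note P = SE_props[OF t sm]
  have "ip (Mt t) F (SHi i) = O.co F i * of_real (Nt t i)" for i
    using O.N_pos[of i] by (simp add: O.co_def)
  then have "ip (Mt t) (\<lambda>p. F p - SE (O.co F) p) (SHi i) = 0" for i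
    unfolding ip_diff[OF F P(3) O.sqi_e] P(4) by simp
  then have "F q - SE (O.co F) q = 0" for q
    using complete_Mt[OF t entire_diff[OF E P(1)] sqi_diff[OF F P(3)]] by blast
  then show ?thesis using sm by (intro exI[of _ "O.co F"]) (simp add: fun_eq_iff)
qed

lemma psum_in_G_space:
  fixes d :: "'n::finite ix \<Rightarrow> complex"
  assumes t: "t > 0"
  shows "psum S d \<in> G_space t m"
proof -
  have t1: "t + 1 > 0" using t by simp
  interpret O: orthogonal_system "Mt (t + 1)" "SHi :: 'n ix \<Rightarrow> _" "Nt (t + 1)" by (rule orthogonal_system_Mt[OF t1])
  have "sqi (Mt (t + 1)) (psum S d)" unfolding psum_def[abs_def] by (intro sqi_sum sqi_cmult O.sqi_e)
  then have i: "integrable lborel (\<lambda>p. (cmod (psum S d p))\<^sup>2 * weight (t + 1) p)" unfolding sqi_Mt[OF t1] by simp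
  obtain K where K: "K \<ge> 0" "\<And>p::'n cc. \<bar>DW (2 * m) t p\<bar> \<le> K * weight (t + 1) p"
    using DW_le_later_weight[OF t, of "2 * m", where 'n='n] by blast
  have [measurable]: "psum S d \<in> borel_measurable borel" by (rule entire_imp_measurable[OF entire_psum])
  have "integrable lborel (\<lambda>p. (cmod (psum S d p))\<^sup>2 * \<bar>DW (2 * m) t p\<bar>)"
  proof (rule Bochner_Integration.integrable_bound[OF integrable_mult_right[OF i, of K]])
    show "AE p in lborel. norm ((cmod (psum S d p))\<^sup>2 * \<bar>DW (2 * m) t p\<bar>) \<le> norm (K * ((cmod (psum S d p))\<^sup>2 * weight (t + 1) p))"
    proof (rule AE_I2)
      fix p
      have "(cmod (psum S d p))\<^sup>2 * \<bar>DW (2 * m) t p\<bar> \<le> (cmod (psum S d p))\<^sup>2 * (K * weight (t + 1) p)"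
        by (intro mult_left_mono K) simp
      then show "norm ((cmod (psum S d p))\<^sup>2 * \<bar>DW (2 * m) t p\<bar>) \<le> norm (K * ((cmod (psum S d p))\<^sup>2 * weight (t + 1) p))"
        using K(1) weight_pos[OF t1, of p] by (simp add: abs_mult mult_ac)
    qed
  qed measurable
  then show ?thesis unfolding G_space_def weight_deriv_DW[OF t] by (simp add: entire_psum)
qed

lemma one_minus_exp_quotient_tendsto:
  fixes x :: real and h :: "nat \<Rightarrow> real"
  assumes "h \<longlonglongrightarrow> 0" "\<And>k. h k > 0"
  shows "(\<lambda>k. (1 - exp (- x * h k)) / h k) \<longlonglongrightarrow> x"
proof -
  have "((\<lambda>s. exp (- x * s)) has_real_derivative - x) (at 0)"
    by (auto intro!: derivative_eq_intros)
  then have "((\<lambda>s. (exp (- x * s) - 1) / s) \<longlongrightarrow> - x) (at 0)" unfolding has_field_derivative_iff by simp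
  moreover have "filterlim h (at 0) sequentially"
    unfolding filterlim_at using assms by (auto intro!: always_eventually simp: less_imp_neq[symmetric])
  ultimately have "(\<lambda>k. (exp (- x * h k) - 1) / h k) \<longlonglongrightarrow> - x" by (rule filterlim_compose)
  from tendsto_minus[OF this] show ?thesis by (simp add: minus_divide_left)
qed

text \<open>Differentiating \<open>s \<mapsto> \<integral> |F|\<^sup>2 weight s\<close> an even number of times under the integral and under the
  sum: both sides are compared for finite differences in \<open>s\<close>, whose coefficients are nonnegative.\<close>

lemma G_norm_has_sum:
  fixes d :: "'n::finite ix \<Rightarrow> complex"
  assumes t: "t > 0" and sm: "(\<lambda>i. (cmod (d i))\<^sup>2 * Nt t i) summable_on UNIV" and G: "SE d \<in> G_space t m"
  shows "((\<lambda>i. (cmod (d i))\<^sup>2 * Nt t i * (2 * ev i) ^ (2 * m)) has_sum (\<integral>p. (cmod (SE d p))\<^sup>2 * weight_deriv m t p \<partial>lborel)) UNIV"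
proof -
  define K where "K = 2 * m"
  \<comment> \<open>\<open>K\<close> such steps reach back at most t / 2, so the sampled times stay
    away from 0 and \<open>DW_dominated\<close> applies to them.\<close>
  define h where "h = (\<lambda>k. t / (2 * (real K + 1)) / real (Suc k))"
  have h: "h k > 0" for k using t by (simp add: h_def)
  have h0: "h \<longlonglongrightarrow> 0"
    unfolding h_def using LIMSEQ_Suc[OF lim_const_over_n] by blast
  have Kh: "real K * h k \<le> t / 2" for k
  proof -
    have "t / (2 * (real K + 1)) / real (Suc k) \<le> t / (2 * (real K + 1)) / 1" using t by (intro divide_left_mono) auto
    then have "h k \<le> t / (2 * (real K + 1))" unfolding h_def by simp
    then have "real K * h k \<le> real K * (t / (2 * (real K + 1)))" by (intro mult_left_mono) auto
    also have "\<dots> \<le> t / 2" using t by (simp add: field_simps)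
    finally show ?thesis .
  qed
  have smp: "s > 0" if "t - real K * h k \<le> s" for s k using Kh[of k] t that by linarith
  define \<Phi> where "\<Phi> = (\<lambda>s. \<integral>p. (cmod (SE d p))\<^sup>2 * weight s p \<partial>lborel)"
  have E: "entire (SE d)" using SE_props(1)[OF t sm] .
  have Fm [measurable]: "SE d \<in> borel_measurable borel" by (rule entire_imp_measurable[OF E])
  have Nt0: "0 \<le> Nt s i" for s and i :: "'n ix" by (simp add: Nt_def)
  have sms: "(\<lambda>i. (cmod (d i))\<^sup>2 * Nt s i) summable_on UNIV" if "s \<le> t" for s
  proof (rule summable_on_comparison_test[OF sm])
    fix i :: "'n ix"
    have "ev i * s \<le> ev i * t" using that ev_ge[of i] by (intro mult_left_mono) auto
    then show "(cmod (d i))\<^sup>2 * Nt s i \<le> (cmod (d i))\<^sup>2 * Nt t i"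
      unfolding Nt_def by (intro mult_left_mono) auto
  qed (use Nt0 in simp)
  have hs: "((\<lambda>i. (cmod (d i))\<^sup>2 * Nt s i) has_sum \<Phi> s) UNIV" and ii: "integrable lborel (\<lambda>p. (cmod (SE d p))\<^sup>2 * weight s p)"
    if s: "s > 0" "s \<le> t" for s
  proof -
    note P = SE_props[OF s(1) sms[OF s(2)]]
    show "integrable lborel (\<lambda>p. (cmod (SE d p))\<^sup>2 * weight s p)" using P(3) unfolding sqi_Mt[OF s(1)] by simp
    have "\<Phi> s = (\<Sum>\<^sub>\<infinity>i. (cmod (d i))\<^sup>2 * Nt s i)" unfolding \<Phi>_def nm2_Mt[OF s(1) Fm, symmetric] by (rule P(5))
    then show "((\<lambda>i. (cmod (d i))\<^sup>2 * Nt s i) has_sum \<Phi> s) UNIV" using has_sum_infsum[OF sms[OF s(2)]] by simp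
  qed
  let ?a = "\<lambda>i. (cmod (d i))\<^sup>2 * Nt t i * (2 * ev i) ^ K"
  let ?b = "\<lambda>k i. (cmod (d i))\<^sup>2 * Nt t i * ((1 - exp (- (2 * ev i) * h k)) / h k) ^ K"
  let ?I = "\<lambda>k. \<integral>p. (cmod (SE d p))\<^sup>2 * (nab K (h k) (\<lambda>s. weight s p) t / h k ^ K) \<partial>lborel"
  let ?J = "\<integral>p. (cmod (SE d p))\<^sup>2 * DW K t p \<partial>lborel"
  have bs: "((?b k) has_sum ?I k) UNIV" for k
  proof -
    have "((\<lambda>i. nab K (h k) (\<lambda>s. (cmod (d i))\<^sup>2 * Nt s i) t) has_sum (nab K (h k) \<Phi> t)) UNIV"
      by (rule nab_has_sum) (use hs smp h in auto)
    moreover have "nab K (h k) (\<lambda>s. (cmod (d i))\<^sup>2 * Nt s i) t = (cmod (d i))\<^sup>2 * Nt t i * (1 - exp (- (2 * ev i) * h k)) ^ K" for i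
      using nab_exp[of K "h k" "(cmod (d i))\<^sup>2 * 2 ^ CARD('n)" "2 * ev i" t] by (simp add: Nt_def mult.assoc)
    moreover have "nab K (h k) \<Phi> t = (\<integral>p. nab K (h k) (\<lambda>s. (cmod (SE d p))\<^sup>2 * weight s p) t \<partial>lborel)"
      unfolding \<Phi>_def by (rule nab_integral[THEN conjunct2, symmetric]) (use ii smp h in auto)
    ultimately have "((\<lambda>i. (cmod (d i))\<^sup>2 * Nt t i * (1 - exp (- (2 * ev i) * h k)) ^ K) has_sum
        (\<integral>p. (cmod (SE d p))\<^sup>2 * nab K (h k) (\<lambda>s. weight s p) t \<partial>lborel)) UNIV"
      by (simp only: nab_mult[of K _ _ "\<lambda>s. weight s _"])
    from has_sum_cmult_left[OF this, of "1 / h k ^ K"]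
    show ?thesis by (simp add: power_divide)
  qed
  have Gi: "integrable lborel (\<lambda>p. (cmod (SE d p))\<^sup>2 * \<bar>DW K t p\<bar>)"
    using G unfolding G_space_def weight_deriv_DW[OF t] K_def by simp
  obtain L where L: "L \<ge> 0" "\<And>s (p::'n cc). s \<in> {t/2..t} \<Longrightarrow> \<bar>DW K s p\<bar> \<le> L * (\<bar>DW K t p\<bar> + weight t p)"
    using DW_dominated[OF t, of K, where 'n='n] by blast
  \<comment> \<open>The difference quotient of the weight is its derivative at an intermediate time,
    which depends on the point but is squeezed to \<open>t\<close>; this gives the pointwise limit
    and the domination at once.\<close>
  have mv: "\<exists>\<xi>. t - real K * h k \<le> \<xi> \<and> \<xi> \<le> t \<and> nab K (h k) (\<lambda>s. weight s p) t = h k ^ K * DW K \<xi> p" for k and p :: "'n cc"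
    using nab_mean_value[of 0 "\<lambda>j s. DW j s p" "h k" t K, OF has_derivative_DW h smp[of k, OF order_refl]]
    by (simp add: DW_0)
  then obtain \<xi> where \<xi>: "\<And>k p. t - real K * h k \<le> \<xi> k p" "\<And>k p. \<xi> k p \<le> t"
      "\<And>k p. nab K (h k) (\<lambda>s. weight s (p::'n cc)) t = h k ^ K * DW K (\<xi> k p) p" by metis
  have q: "nab K (h k) (\<lambda>s. weight s p) t / h k ^ K = DW K (\<xi> k p) p" for k and p :: "'n cc"
    using \<xi>(3)[of k p] h[of k] by simp
  have Ilim: "?I \<longlonglongrightarrow> ?J"
  proof (rule integral_dominated_convergence)
    show "(\<lambda>p. (cmod (SE d p))\<^sup>2 * DW K t p) \<in> borel_measurable lborel" by measurable
    show "(\<lambda>p. (cmod (SE d p))\<^sup>2 * (nab K (h k) (\<lambda>s. weight s p) t / h k ^ K)) \<in> borel_measurable lborel" for k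
    proof -
      have "integrable lborel (\<lambda>p. nab K (h k) (\<lambda>s. (cmod (SE d p))\<^sup>2 * weight s p) t)"
        by (rule nab_integral[THEN conjunct1]) (use ii smp h in auto)
      then have "(\<lambda>p. (cmod (SE d p))\<^sup>2 * nab K (h k) (\<lambda>s. weight s p) t) \<in> borel_measurable lborel"
        unfolding nab_mult by (rule borel_measurable_integrable)
      then have "(\<lambda>p. (cmod (SE d p))\<^sup>2 * nab K (h k) (\<lambda>s. weight s p) t / h k ^ K) \<in> borel_measurable lborel" by measurable
      then show ?thesis by simp
    qed
    show "integrable lborel (\<lambda>p. L * ((cmod (SE d p))\<^sup>2 * \<bar>DW K t p\<bar> + (cmod (SE d p))\<^sup>2 * weight t p))"
      using Gi ii[OF t order_refl] by simp
    show "AE p in lborel. (\<lambda>k. (cmod (SE d p))\<^sup>2 * (nab K (h k) (\<lambda>s. weight s p) t / h k ^ K)) \<longlonglongrightarrow> (cmod (SE d p))\<^sup>2 * DW K t p"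
    proof (rule AE_I2)
      fix p :: "'n cc"
      have "(\<lambda>k. t - real K * h k) \<longlonglongrightarrow> t - real K * 0" by (intro tendsto_intros h0)
      then have "(\<lambda>k. t - real K * h k) \<longlonglongrightarrow> t" by simp
      then have "(\<lambda>k. \<xi> k p) \<longlonglongrightarrow> t"
        by (rule real_tendsto_sandwich[rotated 2, where h="\<lambda>_. t"]) (simp_all add: \<xi>(1,2))
      from isCont_tendsto_compose[OF DERIV_isCont[OF has_derivative_DW[OF t]] this]
      show "(\<lambda>k. (cmod (SE d p))\<^sup>2 * (nab K (h k) (\<lambda>s. weight s p) t / h k ^ K)) \<longlonglongrightarrow> (cmod (SE d p))\<^sup>2 * DW K t p"
        unfolding q by (rule tendsto_mult_left)
    qed
    show "AE p in lborel. norm ((cmod (SE d p))\<^sup>2 * (nab K (h k) (\<lambda>s. weight s p) t / h k ^ K)) \<le> L * ((cmod (SE d p))\<^sup>2 * \<bar>DW K t p\<bar> + (cmod (SE d p))\<^sup>2 * weight t p)" for k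
    proof (rule AE_I2)
      fix p :: "'n cc"
      have "t / 2 \<le> \<xi> k p" using \<xi>(1)[of k p] Kh[of k] by linarith
      then have "\<bar>DW K (\<xi> k p) p\<bar> \<le> L * (\<bar>DW K t p\<bar> + weight t p)" using \<xi>(2) by (intro L) simp
      then have "(cmod (SE d p))\<^sup>2 * \<bar>DW K (\<xi> k p) p\<bar> \<le> (cmod (SE d p))\<^sup>2 * (L * (\<bar>DW K t p\<bar> + weight t p))" by (rule mult_left_mono) simp
      then show "norm ((cmod (SE d p))\<^sup>2 * (nab K (h k) (\<lambda>s. weight s p) t / h k ^ K)) \<le> L * ((cmod (SE d p))\<^sup>2 * \<bar>DW K t p\<bar> + (cmod (SE d p))\<^sup>2 * weight t p)"
        unfolding q by (simp add: abs_mult algebra_simps)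
    qed
  qed
  \<comment> \<open>Each quotient lies between 0 and its limit \<open>2 * ev i\<close>, so the limit
    series bounds the difference series term by term.\<close>
  have q0: "0 \<le> (1 - exp (- (2 * ev i) * h k)) / h k" and q1: "(1 - exp (- (2 * ev i) * h k)) / h k \<le> 2 * ev i" for i :: "'n ix" and k
  proof -
    show "0 \<le> (1 - exp (- (2 * ev i) * h k)) / h k"
      using h[of k] ev_ge[of i] by (intro divide_nonneg_pos) auto
    have "1 - (2 * ev i) * h k \<le> exp (- (2 * ev i) * h k)" using exp_ge_add_one_self[of "- (2 * ev i) * h k"] by simp
    then show "(1 - exp (- (2 * ev i) * h k)) / h k \<le> 2 * ev i" using h[of k] by (simp add: pos_divide_le_eq)
  qed
  have b0: "0 \<le> ?b k i" for k i using q0[of i k] Nt0[of t i] by (intro mult_nonneg_nonneg zero_le_power) auto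
  have ba: "?b k i \<le> ?a i" for k i using q0[of i k] q1[of i k] Nt0[of t i] by (intro mult_left_mono power_mono) auto
  have a0: "0 \<le> ?a i" for i using b0 ba order_trans by blast
  have blim: "(\<lambda>k. ?b k i) \<longlonglongrightarrow> ?a i" for i
    by (intro tendsto_intros one_minus_exp_quotient_tendsto h0 h)
  \<comment> \<open>Finite parts of the limit series are limits of finite parts of nonnegative
    series, which the integrals bound. This yields convergence and one inequality; the termwise
    bound gives the other.\<close>
  have Sle: "sum ?a S \<le> ?J" if S: "finite S" for S
  proof (rule LIMSEQ_le[OF tendsto_sum Ilim])
    show "(\<lambda>k. ?b k i) \<longlonglongrightarrow> ?a i" for i by (rule blim)
    show "\<exists>N. \<forall>n\<ge>N. sum (?b n) S \<le> ?I n"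
    proof (intro exI allI impI)
      fix n
      have "sum (?b n) S = infsum (?b n) S" using S by simp
      also have "\<dots> \<le> infsum (?b n) UNIV"
        by (intro infsum_mono_neutral has_sum_imp_summable[OF bs]) (use S b0 in simp_all)
      also have "\<dots> = ?I n" using bs by (rule infsumI)
      finally show "sum (?b n) S \<le> ?I n" .
    qed
  qed
  have asum: "?a summable_on UNIV"
    by (rule nonneg_bdd_above_summable_on) (use a0 Sle in \<open>auto intro!: bdd_aboveI\<close>)
  have "infsum ?a UNIV \<le> ?J"
    by (rule infsum_le_finite_sums[OF asum]) (use Sle in auto)
  moreover have "?J \<le> infsum ?a UNIV"
  proof (rule LIMSEQ_le_const2[OF Ilim], intro exI allI impI)
    fix n
    have "?I n = infsum (?b n) UNIV" using bs by (rule infsumI[symmetric])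
    also have "\<dots> \<le> infsum ?a UNIV" using ba by (intro infsum_mono asum has_sum_imp_summable[OF bs])
    finally show "?I n \<le> infsum ?a UNIV" .
  qed
  ultimately have "infsum ?a UNIV = ?J" by simp
  then show ?thesis using has_sum_infsum[OF asum] unfolding weight_deriv_DW[OF t] K_def by simp
qed

section \<open>Weighted square summable coefficients\<close>

definition W :: "nat \<Rightarrow> ('n::finite ix \<Rightarrow> complex) set" where
  "W m = {c. (\<lambda>i. ev i ^ (2 * m) * (cmod (c i))\<^sup>2) summable_on UNIV}"

definition wnorm :: "nat \<Rightarrow> ('n::finite ix \<Rightarrow> complex) \<Rightarrow> real" where
  "wnorm m c = sqrt (\<Sum>\<^sub>\<infinity>i. ev i ^ (2 * m) * (cmod (c i))\<^sup>2)"

lemma L2_set_W: "L2_set (\<lambda>i. ev i ^ m * cmod (c i)) S = sqrt (\<Sum>i\<in>S. ev i ^ (2 * m) * (cmod (c i))\<^sup>2)"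
  unfolding L2_set_def by (simp add: power_mult_distrib power_mult[symmetric] mult.commute)

lemma W_term_nonneg: "0 \<le> ev i ^ (2 * m) * (cmod (c i))\<^sup>2"
  using ev_ge[of i] by (intro mult_nonneg_nonneg zero_le_power) auto

lemma wnorm_nonneg: "0 \<le> wnorm m c"
  unfolding wnorm_def by (intro real_sqrt_ge_zero infsum_nonneg W_term_nonneg)

lemma wnorm_sq: "(wnorm m c)\<^sup>2 = (\<Sum>\<^sub>\<infinity>i. ev i ^ (2 * m) * (cmod (c i))\<^sup>2)"
  unfolding wnorm_def by (intro real_sqrt_pow2 infsum_nonneg W_term_nonneg)

text \<open>Membership and norm are controlled by finite sections, where Minkowski's inequality for
  \<open>L2_set\<close> is available.\<close>

lemma W_boundedI:
  assumes "\<And>S. finite S \<Longrightarrow> L2_set (\<lambda>i. ev i ^ m * cmod (c i)) S \<le> B"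
  shows "c \<in> W m" "wnorm m c \<le> B"
proof -
  have B: "B \<ge> 0" using assms[of "{}"] by simp
  have le: "(\<Sum>i\<in>S. ev i ^ (2 * m) * (cmod (c i))\<^sup>2) \<le> B\<^sup>2" if "finite S" for S
  proof -
    have "(sqrt (\<Sum>i\<in>S. ev i ^ (2 * m) * (cmod (c i))\<^sup>2))\<^sup>2 \<le> B\<^sup>2"
      using assms[OF that] unfolding L2_set_W by (intro power_mono) (auto intro: sum_nonneg W_term_nonneg)
    then show ?thesis by (simp add: sum_nonneg W_term_nonneg)
  qed
  have sm: "(\<lambda>i. ev i ^ (2 * m) * (cmod (c i))\<^sup>2) summable_on UNIV"
    by (rule nonneg_bdd_above_summable_on) (use le W_term_nonneg in \<open>auto intro!: bdd_aboveI\<close>)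
  then show "c \<in> W m" by (simp add: W_def)
  have "(\<Sum>\<^sub>\<infinity>i. ev i ^ (2 * m) * (cmod (c i))\<^sup>2) \<le> B\<^sup>2"
    by (rule infsum_le_finite_sums[OF sm]) (use le in auto)
  then show "wnorm m c \<le> B" unfolding wnorm_def using B by (simp add: real_le_lsqrt)
qed

lemma L2_set_le_wnorm: "c \<in> W m \<Longrightarrow> finite S \<Longrightarrow> L2_set (\<lambda>i. ev i ^ m * cmod (c i)) S \<le> wnorm m c"
  unfolding L2_set_W wnorm_def W_def
  by (intro real_sqrt_le_mono finite_sum_le_infsum) (auto intro: W_term_nonneg)

lemma W_add:
  assumes "c \<in> W m" "d \<in> W m"
  shows "(\<lambda>i. c i + d i) \<in> W m" "wnorm m (\<lambda>i. c i + d i) \<le> wnorm m c + wnorm m d"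
proof -
  have "L2_set (\<lambda>i. ev i ^ m * cmod (c i + d i)) S \<le> wnorm m c + wnorm m d" if S: "finite S" for S
  proof -
    have "L2_set (\<lambda>i. ev i ^ m * cmod (c i + d i)) S \<le> L2_set (\<lambda>i. ev i ^ m * cmod (c i) + ev i ^ m * cmod (d i)) S"
    proof (rule L2_set_mono)
      fix i :: "'a ix"
      have e: "0 \<le> ev i" using ev_ge[of i] by linarith
      then show "0 \<le> ev i ^ m * cmod (c i + d i)" by simp
      show "ev i ^ m * cmod (c i + d i) \<le> ev i ^ m * cmod (c i) + ev i ^ m * cmod (d i)"
        using mult_left_mono[OF norm_triangle_ineq[of "c i" "d i"], of "ev i ^ m"] e by (simp add: distrib_left)
    qed
    also have "\<dots> \<le> L2_set (\<lambda>i. ev i ^ m * cmod (c i)) S + L2_set (\<lambda>i. ev i ^ m * cmod (d i)) S" by (rule L2_set_triangle_ineq)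
    also have "\<dots> \<le> wnorm m c + wnorm m d" using assms S by (intro add_mono L2_set_le_wnorm)
    finally show ?thesis .
  qed
  from W_boundedI[OF this] show "(\<lambda>i. c i + d i) \<in> W m" "wnorm m (\<lambda>i. c i + d i) \<le> wnorm m c + wnorm m d" by auto
qed

lemma W_scale:
  shows "c \<in> W m \<Longrightarrow> (\<lambda>i. a * c i) \<in> W m" "wnorm m (\<lambda>i. a * c i) = cmod a * wnorm m c"
proof -
  have e: "(\<lambda>i. ev i ^ (2 * m) * (cmod (a * c i))\<^sup>2) = (\<lambda>i. (cmod a)\<^sup>2 * (ev i ^ (2 * m) * (cmod (c i))\<^sup>2))"
    by (simp add: fun_eq_iff norm_mult power_mult_distrib)
  show "c \<in> W m \<Longrightarrow> (\<lambda>i. a * c i) \<in> W m" unfolding W_def mem_Collect_eq e by (rule summable_on_cmult_right)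
  show "wnorm m (\<lambda>i. a * c i) = cmod a * wnorm m c"
    unfolding wnorm_def e infsum_cmult_right' by (simp add: real_sqrt_mult)
qed

lemma W_diff:
  assumes "c \<in> W m" "d \<in> W m"
  shows "(\<lambda>i. c i - d i) \<in> W m" "wnorm m (\<lambda>i. c i - d i) \<le> wnorm m c + wnorm m d"
  using W_add[OF assms(1) W_scale(1)[OF assms(2), of "-1"]] W_scale(2)[of m "-1" d] by simp_all

lemma wnorm_diff_triangle:
  assumes "c \<in> W m" "d \<in> W m" "b \<in> W m"
  shows "wnorm m (\<lambda>i. c i - d i) \<le> wnorm m (\<lambda>i. c i - b i) + wnorm m (\<lambda>i. d i - b i)"
  using W_diff(2)[OF W_diff(1)[OF assms(1,3)] W_diff(1)[OF assms(2,3)]] by simp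

lemma wnorm_diff_commute: "wnorm m (\<lambda>i. c i - d i) = wnorm m (\<lambda>i. d i - c i)"
  by (simp add: wnorm_def norm_minus_commute)

lemma wnorm_abs_diff:
  assumes "c \<in> W m" "d \<in> W m"
  shows "\<bar>wnorm m c - wnorm m d\<bar> \<le> wnorm m (\<lambda>i. c i - d i)"
proof -
  have "wnorm m c \<le> wnorm m (\<lambda>i. c i - d i) + wnorm m d" if "c \<in> W m" "d \<in> W m" for c d :: "'a ix \<Rightarrow> complex"
    using W_add(2)[OF W_diff(1)[OF that] that(2)] by simp
  from this[OF assms] this[OF assms(2,1)] show ?thesis unfolding wnorm_diff_commute[of m d c] by linarith
qed

text \<open>The eigenvalues are at least 1, so the weighted norm dominates every single
  coefficient.\<close>

lemma cmod_le_wnorm: assumes "c \<in> W m" shows "cmod (c i) \<le> wnorm m c"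
proof -
  have "1 * cmod (c i) \<le> ev i ^ m * cmod (c i)"
    by (intro mult_right_mono one_le_power ev_ge) simp
  also have "\<dots> = L2_set (\<lambda>i. ev i ^ m * cmod (c i)) {i}" using ev_ge[of i] by (simp add: L2_set_def abs_mult)
  also have "\<dots> \<le> wnorm m c" by (rule L2_set_le_wnorm[OF assms]) simp
  finally show ?thesis by simp
qed

lemma W_l2: assumes "c \<in> W m" shows "c \<in> W 0"
proof -
  have "(\<lambda>i. (cmod (c i))\<^sup>2) summable_on UNIV"
  proof (rule summable_on_comparison_test)
    show "(\<lambda>i. ev i ^ (2 * m) * (cmod (c i))\<^sup>2) summable_on UNIV" using assms by (simp add: W_def)
    fix i :: "'a ix"
    have "1 * (cmod (c i))\<^sup>2 \<le> ev i ^ (2 * m) * (cmod (c i))\<^sup>2" by (intro mult_right_mono one_le_power ev_ge) simp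
    then show "(cmod (c i))\<^sup>2 \<le> ev i ^ (2 * m) * (cmod (c i))\<^sup>2" by simp
  qed simp
  then show ?thesis by (simp add: W_def)
qed

text \<open>The coordinatewise limit is the norm limit: the Cauchy estimate passes to the limit on
  finite sections, and \<open>W_boundedI\<close> extends it to the whole sequence.\<close>

lemma W_complete:
  assumes X: "\<And>k. X k \<in> W m" and C: "\<And>e. e > 0 \<Longrightarrow> \<exists>N. \<forall>j\<ge>N. \<forall>k\<ge>N. wnorm m (\<lambda>i. X j i - X k i) < e"
  shows "\<exists>c\<in>W m. (\<lambda>k. wnorm m (\<lambda>i. X k i - c i)) \<longlonglongrightarrow> 0"
proof -
  have "Cauchy (\<lambda>k. X k i)" for i
  proof (rule metric_CauchyI)
    fix e :: real assume "e > 0"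
    then obtain N where N: "\<And>j k. j \<ge> N \<Longrightarrow> k \<ge> N \<Longrightarrow> wnorm m (\<lambda>i. X j i - X k i) < e" using C by blast
    show "\<exists>N. \<forall>j\<ge>N. \<forall>k\<ge>N. dist (X j i) (X k i) < e"
    proof (intro exI allI impI)
      fix j k assume "j \<ge> N" "k \<ge> N"
      then show "dist (X j i) (X k i) < e"
        using N[of j k] cmod_le_wnorm[OF W_diff(1)[OF X[of j] X[of k]], of i] by (simp add: dist_norm)
    qed
  qed
  then have "\<exists>l. (\<lambda>k. X k i) \<longlonglongrightarrow> l" for i using Cauchy_convergent convergent_def by blast
  then obtain c where c: "\<And>i. (\<lambda>k. X k i) \<longlonglongrightarrow> c i" by metis
  have key: "(\<lambda>i. X j i - c i) \<in> W m \<and> wnorm m (\<lambda>i. X j i - c i) \<le> e"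
    if N: "\<And>j k. j \<ge> N \<Longrightarrow> k \<ge> N \<Longrightarrow> wnorm m (\<lambda>i. X j i - X k i) < e" and j: "j \<ge> N" for j N e
  proof -
    have "L2_set (\<lambda>i. ev i ^ m * cmod (X j i - c i)) S \<le> e" if S: "finite S" for S
    proof (rule LIMSEQ_le_const2)
      show "(\<lambda>k. L2_set (\<lambda>i. ev i ^ m * cmod (X j i - X k i)) S) \<longlonglongrightarrow> L2_set (\<lambda>i. ev i ^ m * cmod (X j i - c i)) S"
        unfolding L2_set_def by (intro tendsto_intros c)
      show "\<exists>N. \<forall>k\<ge>N. L2_set (\<lambda>i. ev i ^ m * cmod (X j i - X k i)) S \<le> e"
      proof (intro exI[of _ N] allI impI)
        fix k assume "k \<ge> N"
        then show "L2_set (\<lambda>i. ev i ^ m * cmod (X j i - X k i)) S \<le> e"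
          using L2_set_le_wnorm[OF W_diff(1)[OF X[of j] X[of k]] S] N[OF j] by force
      qed
    qed
    from W_boundedI[OF this] show ?thesis by blast
  qed
  \<comment> \<open>Any fixed tolerance shows that the limit lies in \<open>W m\<close>, as a
    difference of two members.\<close>
  obtain N where "\<And>j k. j \<ge> N \<Longrightarrow> k \<ge> N \<Longrightarrow> wnorm m (\<lambda>i. X j i - X k i) < 1" using C[of 1] by auto
  from key[OF this order_refl] have "(\<lambda>i. X N i - c i) \<in> W m" by blast
  from W_diff(1)[OF X[of N] this] have cW: "c \<in> W m" by simp
  have "(\<lambda>k. wnorm m (\<lambda>i. X k i - c i)) \<longlonglongrightarrow> 0"
  proof (rule metric_LIMSEQ_I)
    fix e :: real assume e: "e > 0"
    then obtain N where "\<And>j k. j \<ge> N \<Longrightarrow> k \<ge> N \<Longrightarrow> wnorm m (\<lambda>i. X j i - X k i) < e / 2" using C[of "e / 2"] by auto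
    from key[OF this] have le: "wnorm m (\<lambda>i. X j i - c i) \<le> e / 2" if "j \<ge> N" for j using that by blast
    show "\<exists>no. \<forall>n\<ge>no. dist (wnorm m (\<lambda>i. X n i - c i)) 0 < e"
    proof (intro exI allI impI)
      fix n assume "n \<ge> N"
      from le[OF this] show "dist (wnorm m (\<lambda>i. X n i - c i)) 0 < e"
        using e wnorm_nonneg[of m "\<lambda>i. X n i - c i"] by (simp add: dist_real_def)
    qed
  qed
  then show ?thesis using cW by blast
qed

text \<open>The squared error of a truncation is the tail of a convergent series.\<close>

lemma W_truncation:
  assumes c: "c \<in> W m"
  shows "(\<lambda>i. if i \<in> stage k then c i else 0) \<in> W m"
    and "(\<lambda>k. wnorm m (\<lambda>i. (if i \<in> stage k then c i else 0) - c i)) \<longlonglongrightarrow> 0"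
proof -
  let ?w = "\<lambda>i. ev i ^ (2 * m) * (cmod (c i))\<^sup>2"
  let ?x = "\<lambda>k i. (if i \<in> stage k then c i else 0)"
  have sm: "?w summable_on UNIV" using c by (simp add: W_def)
  have fin: "((\<lambda>i. ev i ^ (2 * m) * (cmod (?x k i))\<^sup>2) has_sum (\<Sum>i\<in>stage k. ?w i)) UNIV" for k
    by (rule has_sum_finite_neutralI[of "stage k"]) auto
  then show "?x k \<in> W m" for k by (auto simp: W_def summable_on_def)
  have "((\<lambda>i. ev i ^ (2 * m) * (cmod (?x k i - c i))\<^sup>2) has_sum (infsum ?w UNIV - (\<Sum>i\<in>stage k. ?w i))) UNIV" for k
  proof -
    have "((\<lambda>i. ?w i - ev i ^ (2 * m) * (cmod (?x k i))\<^sup>2) has_sum (infsum ?w UNIV - (\<Sum>i\<in>stage k. ?w i))) UNIV"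
      using has_sum_add[OF has_sum_infsum[OF sm] has_sum_cmult_right[OF fin[of k], of "-1"]] by simp
    moreover have "(\<lambda>i. ?w i - ev i ^ (2 * m) * (cmod (?x k i))\<^sup>2) = (\<lambda>i. ev i ^ (2 * m) * (cmod (?x k i - c i))\<^sup>2)" by auto
    ultimately show ?thesis by simp
  qed
  then have e: "wnorm m (\<lambda>i. ?x k i - c i) = sqrt (infsum ?w UNIV - (\<Sum>i\<in>stage k. ?w i))" for k
    unfolding wnorm_def by (simp add: infsumI)
  have "(\<lambda>k. \<Sum>i\<in>stage k. ?w i) \<longlonglongrightarrow> infsum ?w UNIV"
    using filterlim_compose[OF _ stage_limit, of "sum ?w"] has_sum_infsum[OF sm] unfolding has_sum_def by auto
  then have "(\<lambda>k. sqrt (infsum ?w UNIV - (\<Sum>i\<in>stage k. ?w i))) \<longlonglongrightarrow> sqrt (infsum ?w UNIV - infsum ?w UNIV)"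
    by (intro tendsto_intros)
  then show "(\<lambda>k. wnorm m (\<lambda>i. ?x k i - c i)) \<longlonglongrightarrow> 0" unfolding e by simp
qed

section \<open>Classes of square integrable functions\<close>

lemma L2_fun_iff: "f \<in> L2_fun \<longleftrightarrow> sqi lborel f"
  by (simp add: L2_fun_def sqi_def)

lemma equiv_L2_rel: "equiv L2_fun L2_rel"
proof (rule equivI)
  show "trans L2_rel"
  proof (rule transI)
    fix f g h assume a: "(f, g) \<in> L2_rel" "(g, h) \<in> L2_rel"
    then have "AE p in lborel. f p = g p" "AE p in lborel. g p = h p" by (auto simp: L2_rel_def)
    then have "AE p in lborel. f p = h p" by eventually_elim simp
    then show "(f, h) \<in> L2_rel" using a by (auto simp: L2_rel_def)
  qed
  show "sym L2_rel" by (rule symI) (auto simp: L2_rel_def eq_commute)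
qed (auto simp: L2_rel_def refl_on_def)

definition cls :: "((real ^ 'n::finite) \<times> (real ^ 'n) \<Rightarrow> complex) \<Rightarrow> 'n L2_class" where
  "cls f = L2_rel `` {f}"

lemma cls_in_L2: "sqi lborel f \<Longrightarrow> cls f \<in> L2"
  unfolding L2_def cls_def by (rule quotientI) (simp add: L2_fun_iff)

lemma L2_E: assumes "A \<in> L2" obtains f where "sqi lborel f" "A = cls f"
  using assms unfolding L2_def by (elim quotientE) (auto simp: L2_fun_iff cls_def)

lemma mem_cls: "g \<in> cls f \<longleftrightarrow> sqi lborel f \<and> sqi lborel g \<and> (AE p in lborel. f p = g p)"
  by (simp add: cls_def L2_rel_def L2_fun_iff)

lemma cls_self: "sqi lborel f \<Longrightarrow> f \<in> cls f" by (simp add: mem_cls)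

lemma cls_eqI: "sqi lborel f \<Longrightarrow> sqi lborel g \<Longrightarrow> AE p in lborel. f p = g p \<Longrightarrow> cls f = cls g"
  unfolding cls_def by (rule equiv_class_eq[OF equiv_L2_rel]) (simp add: L2_rel_def L2_fun_iff)

definition cf :: "'n::finite L2_class \<Rightarrow> 'n ix \<Rightarrow> complex" where
  "cf A i = coef A (fst i) (snd i)"

text \<open>The integral does not depend on the representative, so \<open>the_elem\<close> in
  \<open>coef\<close> picks its only value.\<close>

lemma cf_cls:
  assumes f: "sqi lborel f"
  shows "cf (cls f) i = ip lborel f (rr i)"
proof -
  interpret O: orthogonal_system lborel "rr :: 'a ix \<Rightarrow> _" "\<lambda>_. 1" by (rule orthogonal_system_real)
  have "the_elem ((\<lambda>f. \<integral>p. f p * cnj (special_Hermite (fst i) (snd i) p) \<partial>lborel) ` cls f)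
      = (\<integral>p. f p * cnj (special_Hermite (fst i) (snd i) p) \<partial>lborel)"
  proof (rule the_elem_image_unique)
    show "cls f \<noteq> {}" using cls_self[OF f] by blast
    fix g assume "g \<in> cls f"
    then have g: "sqi lborel g" "AE p in lborel. f p = g p" by (auto simp: mem_cls)
    have m: "special_Hermite (fst i) (snd i) \<in> borel_measurable lborel"
      using sqi_measurable[OF O.sqi_e[of i]] by (simp add: rr_def)
    show "(\<integral>p. g p * cnj (special_Hermite (fst i) (snd i) p) \<partial>lborel) = (\<integral>p. f p * cnj (special_Hermite (fst i) (snd i) p) \<partial>lborel)"
      using g(2) sqi_measurable[OF f] sqi_measurable[OF g(1)] m by (intro integral_cong_AE) auto
  qed
  then show ?thesis by (simp add: cf_def coef_def ip_def rr_def)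
qed

lemma L2_add_cls:
  assumes f: "sqi lborel f" and g: "sqi lborel g"
  shows "L2_add (cls f) (cls g) = cls (\<lambda>p. f p + g p)"
proof -
  have "L2_rel `` {\<lambda>p. f' p + g' p} = cls (\<lambda>p. f p + g p)" if "f' \<in> cls f" "g' \<in> cls g" for f' g'
  proof -
    have a: "sqi lborel f'" "sqi lborel g'" "AE p in lborel. f p = f' p" "AE p in lborel. g p = g' p" using that by (auto simp: mem_cls)
    from a(3,4) have "AE p in lborel. f' p + g' p = f p + g p" by eventually_elim simp
    from cls_eqI[OF sqi_add[OF a(1,2)] sqi_add[OF f g] this] show ?thesis by (simp only: cls_def)
  qed
  then have "L2_add (cls f) (cls g) = (\<Union>f'\<in>cls f. \<Union>g'\<in>cls g. cls (\<lambda>p. f p + g p))"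
    unfolding L2_add_def by (intro SUP_cong refl) blast
  then show ?thesis using cls_self[OF f] cls_self[OF g] by auto
qed

lemma L2_scale_cls:
  assumes f: "sqi lborel f"
  shows "L2_scale a (cls f) = cls (\<lambda>p. a * f p)"
proof -
  have "L2_rel `` {\<lambda>p. a * f' p} = cls (\<lambda>p. a * f p)" if "f' \<in> cls f" for f'
  proof -
    have b: "sqi lborel f'" "AE p in lborel. f p = f' p" using that by (auto simp: mem_cls)
    from b(2) have "AE p in lborel. a * f' p = a * f p" by eventually_elim simp
    from cls_eqI[OF sqi_cmult[OF b(1)] sqi_cmult[OF f] this] show ?thesis by (simp only: cls_def)
  qed
  then have "L2_scale a (cls f) = (\<Union>f'\<in>cls f. cls (\<lambda>p. a * f p))"
    unfolding L2_scale_def by (intro SUP_cong refl) blast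
  then show ?thesis using cls_self[OF f] by auto
qed

lemma cf_L2_add:
  assumes "A \<in> L2" "B \<in> L2"
  shows "L2_add A B \<in> L2" "cf (L2_add A B) = (\<lambda>i. cf A i + cf B i)"
proof -
  interpret O: orthogonal_system lborel "rr :: 'a ix \<Rightarrow> _" "\<lambda>_. 1" by (rule orthogonal_system_real)
  obtain f g where fg: "sqi lborel f" "A = cls f" "sqi lborel g" "B = cls g" using assms by (metis L2_E)
  show "L2_add A B \<in> L2" unfolding fg L2_add_cls[OF fg(1,3)] by (intro cls_in_L2 sqi_add fg)
  show "cf (L2_add A B) = (\<lambda>i. cf A i + cf B i)"
    unfolding fg(2,4) L2_add_cls[OF fg(1,3)] by (simp add: fun_eq_iff cf_cls sqi_add fg ip_add O.sqi_e)
qed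

lemma cf_L2_scale:
  assumes "A \<in> L2"
  shows "L2_scale a A \<in> L2" "cf (L2_scale a A) = (\<lambda>i. a * cf A i)"
proof -
  obtain f where f: "sqi lborel f" "A = cls f" using assms by (metis L2_E)
  show "L2_scale a A \<in> L2" unfolding f L2_scale_cls[OF f(1)] by (intro cls_in_L2 sqi_cmult f)
  show "cf (L2_scale a A) = (\<lambda>i. a * cf A i)"
    unfolding f(2) L2_scale_cls[OF f(1)] by (simp add: fun_eq_iff cf_cls sqi_cmult f ip_cmult)
qed

lemma AE_eq_of_ip_eq:
  assumes "sqi lborel f" "sqi lborel g" "\<And>i. ip lborel f (rr i) = ip lborel g (rr i)"
  shows "AE p in lborel. f p = g p"
proof -
  interpret O: orthogonal_system lborel "rr :: 'a ix \<Rightarrow> _" "\<lambda>_. 1" by (rule orthogonal_system_real)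
  have "ip lborel (\<lambda>p. f p - g p) (rr i) = 0" for i by (simp add: ip_diff assms O.sqi_e)
  from complete_real[OF sqi_diff[OF assms(1,2)] this] show ?thesis by simp
qed

lemma cf_inj:
  assumes "A \<in> L2" "B \<in> L2" "cf A = cf B"
  shows "A = B"
proof -
  obtain f g where fg: "sqi lborel f" "A = cls f" "sqi lborel g" "B = cls g" using assms by (metis L2_E)
  have "ip lborel f (rr i) = ip lborel g (rr i)" for i
    using fun_cong[OF assms(3), of i] unfolding fg(2,4) cf_cls[OF fg(1)] cf_cls[OF fg(3)] .
  from AE_eq_of_ip_eq[OF fg(1,3) this] show ?thesis unfolding fg by (intro cls_eqI fg)
qed

lemma cf_in_W: assumes "A \<in> L2" shows "cf A \<in> W 0"
proof -
  interpret O: orthogonal_system lborel "rr :: 'a ix \<Rightarrow> _" "\<lambda>_. 1" by (rule orthogonal_system_real)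
  obtain f where f: "sqi lborel f" "A = cls f" using assms by (metis L2_E)
  have "cf A = O.co f" unfolding f by (simp add: fun_eq_iff cf_cls f O.co_def)
  then show ?thesis using O.Bessel_summable[OF f(1)] by (simp add: W_def)
qed

lemma ex_cf: assumes "c \<in> W 0" shows "\<exists>A\<in>L2. cf A = (c :: 'n::finite ix \<Rightarrow> complex)"
proof -
  interpret O: orthogonal_system lborel "rr :: 'n ix \<Rightarrow> _" "\<lambda>_. 1" by (rule orthogonal_system_real)
  \<comment> \<open>A Gaussian serves as the nowhere vanishing function demanded by
    \<open>Riesz_Fischer\<close>.\<close>
  have "integrable lborel (\<lambda>p :: (real ^ 'n) \<times> (real ^ 'n). exp (- 2 * (norm p)\<^sup>2))" by (rule integrable_gauss) simp
  then have g: "sqi lborel (\<lambda>p :: (real ^ 'n) \<times> (real ^ 'n). of_real (exp (- (norm p)\<^sup>2)))"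
    unfolding sqi_def by (auto simp: exp_double[symmetric] intro!: borel_measurable_continuous_onI continuous_intros)
  have "(\<lambda>i. (cmod (c i))\<^sup>2 * 1) summable_on UNIV" using assms by (simp add: W_def)
  from O.Riesz_Fischer[OF this g] obtain f where f: "sqi lborel f" "O.co f = c" by auto
  have "cf (cls f) i = c i" for i using fun_cong[OF f(2), of i] by (simp add: cf_cls f(1) O.co_def)
  then have "cf (cls f) = c" ..
  then show ?thesis using cls_in_L2[OF f(1)] by blast
qed

lemma Laguerre_Sobolev_iff: "A \<in> Laguerre_Sobolev m \<longleftrightarrow> A \<in> L2 \<and> cf A \<in> W m"
  by (simp add: Laguerre_Sobolev_def W_def cf_def ev_def case_prod_unfold)

lemma Laguerre_Sobolev_norm_eq: "Laguerre_Sobolev_norm m A = wnorm m (cf A)"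
  by (simp add: Laguerre_Sobolev_norm_def wnorm_def cf_def ev_def case_prod_unfold)

lemma bij_cf: "bij_betw cf (Laguerre_Sobolev m) (W m :: ('n::finite ix \<Rightarrow> complex) set)"
proof (rule bij_betw_imageI)
  show "inj_on cf (Laguerre_Sobolev m)" by (rule inj_onI) (simp add: Laguerre_Sobolev_iff cf_inj)
  have "c \<in> cf ` Laguerre_Sobolev m" if c: "c \<in> W m" for c :: "'n ix \<Rightarrow> complex"
  proof -
    from ex_cf[OF W_l2[OF c]] obtain A where "A \<in> L2" "cf A = c" by blast
    then show ?thesis using c by (auto simp: Laguerre_Sobolev_iff)
  qed
  then show "cf ` Laguerre_Sobolev m = (W m :: ('n ix \<Rightarrow> complex) set)" by (auto simp: Laguerre_Sobolev_iff)
qed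

section \<open>The special Hermite semigroup\<close>

text \<open>The action of e^(-tL) on coefficients.\<close>

definition damp :: "real \<Rightarrow> ('n::finite ix \<Rightarrow> complex) \<Rightarrow> 'n ix \<Rightarrow> complex" where
  "damp t c i = of_real (exp (- ev i * t)) * c i"

definition ES :: "real \<Rightarrow> ('n::finite ix \<Rightarrow> complex) \<Rightarrow> 'n cc \<Rightarrow> complex" where
  "ES t c = SE (damp t c)"

text \<open>The damping cancels the growth of the weighted norms exactly, leaving 2^n: square
  summable data satisfy the summability condition of \<open>SE_props\<close>.\<close>

lemma damp_Nt: "(cmod (damp t c i))\<^sup>2 * Nt t i = 2 ^ CARD('n) * (cmod (c i))\<^sup>2" for i :: "'n::finite ix"
proof -
  have "(exp (- ev i * t))\<^sup>2 * exp (2 * ev i * t) = 1" by (simp add: exp_double[symmetric] exp_add[symmetric])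
  then show ?thesis unfolding damp_def Nt_def norm_mult power_mult_distrib by (simp add: mult_ac)
qed

lemma damp_summable:
  assumes "c \<in> W 0"
  shows "(\<lambda>i. (cmod (damp t c i))\<^sup>2 * Nt t i) summable_on UNIV"
  unfolding damp_Nt using assms by (intro summable_on_cmult_right) (simp add: W_def)

lemma ES_props:
  fixes c :: "'n::finite ix \<Rightarrow> complex"
  assumes t: "t > 0" and c: "c \<in> W 0"
  shows "entire (ES t c)" "(\<lambda>n. psum (stage n) (damp t c) p) \<longlonglongrightarrow> ES t c p"
    "sqi (Mt t) (ES t c)" "ip (Mt t) (ES t c) (SHi i) = damp t c i * of_real (Nt t i)"
  unfolding ES_def using SE_props[OF t damp_summable[OF c]] by auto

lemma ES_add:
  assumes t: "t > 0" and "c \<in> W 0" "d \<in> W 0"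
  shows "ES t (\<lambda>i. c i + d i) = (\<lambda>p. ES t c p + ES t d p)"
proof
  fix p
  have "psum S (damp t (\<lambda>i. c i + d i)) p = psum S (damp t c) p + psum S (damp t d) p" for S
    by (simp add: psum_def damp_def distrib_left distrib_right sum.distrib)
  then have "(\<lambda>n. psum (stage n) (damp t c) p + psum (stage n) (damp t d) p) \<longlonglongrightarrow> ES t (\<lambda>i. c i + d i) p"
    using ES_props(2)[OF t W_add(1)[OF assms(2,3)], of p] by simp
  moreover have "(\<lambda>n. psum (stage n) (damp t c) p + psum (stage n) (damp t d) p) \<longlonglongrightarrow> ES t c p + ES t d p"
    using assms by (intro tendsto_add ES_props)
  ultimately show "ES t (\<lambda>i. c i + d i) p = ES t c p + ES t d p" by (rule LIMSEQ_unique)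
qed

lemma ES_scale:
  assumes t: "t > 0" and "c \<in> W 0"
  shows "ES t (\<lambda>i. a * c i) = (\<lambda>p. a * ES t c p)"
proof
  fix p
  have "psum S (damp t (\<lambda>i. a * c i)) p = a * psum S (damp t c) p" for S
    by (simp add: psum_def damp_def sum_distrib_left mult_ac)
  then have "(\<lambda>n. a * psum (stage n) (damp t c) p) \<longlonglongrightarrow> ES t (\<lambda>i. a * c i) p"
    using ES_props(2)[OF t W_scale(1)[OF assms(2), of a], of p] by simp
  moreover have "(\<lambda>n. a * psum (stage n) (damp t c) p) \<longlonglongrightarrow> a * ES t c p"
    using assms by (intro tendsto_mult_left ES_props)
  ultimately show "ES t (\<lambda>i. a * c i) p = a * ES t c p" by (rule LIMSEQ_unique)
qed

lemma AE_eq_continuous: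
  fixes f g :: "'a::euclidean_space \<Rightarrow> complex"
  assumes "continuous_on UNIV f" "continuous_on UNIV g" "AE x in lborel. f x = g x"
  shows "f = g"
proof -
  have o: "open {x. f x \<noteq> g x}" using assms(1,2) by (rule open_Collect_neq)
  have "{x. f x \<noteq> g x} \<in> null_sets lborel"
    using assms(3) o AE_iff_null_sets[of "{x. f x \<noteq> g x}" lborel] by simp
  then have "negligible {x. f x \<noteq> g x}"
    unfolding negligible_iff_null_sets by (rule null_sets_completionI)
  then have "{x. f x \<noteq> g x} = {}" using open_not_negligible[OF o] by blast
  then show ?thesis by (auto simp: fun_eq_iff)
qed

text \<open>The defining limit is recognised through \<open>series_limit\<close>, where the error in
  L2 is the tail of a series. It is unique because any limit has the damped coefficients, by
  Cauchy-Schwarz, and coefficients determine the class.\<close>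

lemma semigroup_eq:
  fixes A :: "'n::finite L2_class"
  assumes t: "t > 0" and A: "A \<in> L2"
  shows "sqi lborel (restrict_real (ES t (cf A)))"
    and "special_Hermite_semigroup t A = cls (restrict_real (ES t (cf A)))"
proof -
  interpret O: orthogonal_system lborel "rr :: 'n ix \<Rightarrow> _" "\<lambda>_. 1" by (rule orthogonal_system_real)
  let ?d = "damp t (cf A)" and ?f = "restrict_real (ES t (cf A))"
  have c: "cf A \<in> W 0" by (rule cf_in_W[OF A])
  have sm: "(\<lambda>i. (cmod (?d i))\<^sup>2 * 1) summable_on UNIV"
  proof (rule summable_on_comparison_test)
    show "(\<lambda>i. (cmod (cf A i))\<^sup>2) summable_on UNIV" using c by (simp add: W_def)
    fix i :: "'n ix"
    have "exp (- ev i * t) \<le> 1" using t ev_ge[of i] by simp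
    then have "cmod (?d i) \<le> 1 * cmod (cf A i)" unfolding damp_def norm_mult by (intro mult_right_mono) auto
    then show "(cmod (?d i))\<^sup>2 * 1 \<le> (cmod (cf A i))\<^sup>2" by (simp add: power_mono)
  qed simp
  have m: "?f \<in> borel_measurable lborel" using measurable_restrict_real[OF ES_props(1)[OF t c]] by simp
  have fsp: "O.fs S ?d p = psum S ?d (cplx p)" for S p
    by (simp add: O.fs_def psum_def rr_eq restrict_real_cplx)
  have ae: "AE p in lborel. (\<lambda>n. O.fs (stage n) ?d p) \<longlonglongrightarrow> ?f p"
    unfolding fsp restrict_real_cplx by (intro AE_I2 ES_props(2)[OF t c])
  note L = O.series_limit[OF sm m _ ae, unfolded strict_mono_def, simplified]
  show F: "sqi lborel ?f" by (rule L(1))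
  have pf: "semigroup_partial_sum t A S = O.fs S ?d" for S
    by (simp add: fun_eq_iff semigroup_partial_sum_def O.fs_def damp_def cf_def rr_def ev_def case_prod_unfold)
  have cong: "(\<integral>p. (cmod (g p - O.fs S ?d p))\<^sup>2 \<partial>lborel) = nm2 lborel (\<lambda>p. f p - O.fs S ?d p)" if "g \<in> cls f" for f g S
  proof -
    have a: "sqi lborel g" "sqi lborel f" "AE p in lborel. f p = g p" using that by (auto simp: mem_cls)
    note [measurable] = sqi_measurable[OF a(1)] sqi_measurable[OF a(2)] sqi_measurable[OF O.sqi_fs]
    have "AE p in lborel. (cmod (g p - O.fs S ?d p))\<^sup>2 = (cmod (f p - O.fs S ?d p))\<^sup>2" using a(3) by eventually_elim simp
    then show ?thesis unfolding nm2_def by (intro integral_cong_AE) measurable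
  qed
  show "special_Hermite_semigroup t A = cls ?f"
    unfolding special_Hermite_semigroup_def pf
  proof (rule the_equality, intro conjI ballI)
    show "cls ?f \<in> L2" by (rule cls_in_L2[OF F])
    fix g assume g: "g \<in> cls ?f"
    have hs: "((\<lambda>i. (cmod (?d i))\<^sup>2) has_sum (\<Sum>\<^sub>\<infinity>i. (cmod (?d i))\<^sup>2)) UNIV" using sm by simp
    have "((\<lambda>S. (\<Sum>\<^sub>\<infinity>i. (cmod (?d i))\<^sup>2) - (\<Sum>i\<in>S. (cmod (?d i))\<^sup>2)) \<longlongrightarrow> 0) (finite_subsets_at_top UNIV)"
      using tendsto_diff[OF tendsto_const[of "\<Sum>\<^sub>\<infinity>i. (cmod (?d i))\<^sup>2"] hs[unfolded has_sum_def]] by simp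
    then show "((\<lambda>S. \<integral>p. (cmod (g p - O.fs S ?d p))\<^sup>2 \<partial>lborel) \<longlongrightarrow> 0) (finite_subsets_at_top UNIV)"
      unfolding cong[OF g]
      by (rule Lim_transform_eventually) (auto intro!: eventually_finite_subsets_at_top_weakI simp: L(4))
  next
    fix B assume B: "B \<in> L2 \<and> (\<forall>g\<in>B. ((\<lambda>S. \<integral>p. (cmod (g p - O.fs S ?d p))\<^sup>2 \<partial>lborel) \<longlongrightarrow> 0) (finite_subsets_at_top UNIV))"
    then obtain g where g: "sqi lborel g" "B = cls g" by (metis L2_E)
    have lim: "((\<lambda>S. nm2 lborel (\<lambda>p. g p - O.fs S ?d p)) \<longlongrightarrow> 0) (finite_subsets_at_top UNIV)"
      using B cls_self[OF g(1)] unfolding g(2) nm2_def by blast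
    have "ip lborel g (rr i) = ?d i" for i
    proof -
      have "(cmod (ip lborel g (rr i) - ?d i))\<^sup>2 \<le> nm2 lborel (\<lambda>p. g p - O.fs S ?d p)" if "finite S" "{i} \<subseteq> S" for S
      proof -
        have "ip lborel g (rr i) - ?d i = ip lborel (\<lambda>p. g p - O.fs S ?d p) (rr i)"
          using that O.ip_fs_e[OF that(1), of ?d i] by (simp add: ip_diff[OF g(1) O.sqi_fs O.sqi_e])
        moreover have "nm2 lborel (rr i) = 1" using ip_self[of lborel "rr i"] O.gram[of i i] by simp
        ultimately show ?thesis using ip_Cauchy_Schwarz[OF sqi_diff[OF g(1) O.sqi_fs] O.sqi_e, of S ?d i] by simp
      qed
      then have "\<forall>\<^sub>F S in finite_subsets_at_top UNIV. (cmod (ip lborel g (rr i) - ?d i))\<^sup>2 \<le> nm2 lborel (\<lambda>p. g p - O.fs S ?d p)"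
        unfolding eventually_finite_subsets_at_top by (intro exI[of _ "{i}"]) auto
      from tendsto_lowerbound[OF lim this] show ?thesis by simp
    qed
    moreover have "ip lborel ?f (rr i) = ?d i" for i
      using fun_cong[OF L(2), of i] by (simp add: O.co_def)
    ultimately have "AE p in lborel. g p = ?f p" by (intro AE_eq_of_ip_eq g F) simp
    then show "B = cls ?f" unfolding g(2) by (intro cls_eqI g F)
  qed
qed

text \<open>A class contains at most one continuous function, and an entire function is determined
  by its restriction to real points; hence the definite description has one solution.\<close>

lemma semigroup_entire_eq:
  fixes A :: "'n::finite L2_class"
  assumes t: "t > 0" and A: "A \<in> L2"
  shows "semigroup_entire t A = ES t (cf A)"
  unfolding semigroup_entire_def semigroup_eq(2)[OF assms]
proof (rule the_equality)
  have E: "entire (ES t (cf A))" by (rule ES_props(1)[OF t cf_in_W[OF A]])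
  show "entire (ES t (cf A)) \<and> restrict_real (ES t (cf A)) \<in> cls (restrict_real (ES t (cf A)))"
    by (intro conjI E cls_self semigroup_eq(1)[OF assms])
  fix F assume F: "entire F \<and> restrict_real F \<in> cls (restrict_real (ES t (cf A)))"
  then have "AE p in lborel. restrict_real (ES t (cf A)) p = restrict_real F p" by (simp add: mem_cls)
  then have "restrict_real (ES t (cf A)) = restrict_real F"
    using F E by (intro AE_eq_continuous continuous_restrict_real) auto
  then have z: "restrict_real (\<lambda>p. F p - ES t (cf A) p) (x, u) = 0" for x u
    unfolding restrict_real_cplx by (metis restrict_real_cplx right_minus_eq)
  have "F p - ES t (cf A) p = 0" for p
    by (rule entire_eq_0_if_restrict[OF entire_diff]) (use F E z in auto)
  then show "F = ES t (cf A)" by (simp add: fun_eq_iff)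
qed

section \<open>The completion\<close>

text \<open>The inverse of \<open>ES t\<close>: division by \<open>Nt\<close> extracts the
  coefficient of the series, and exp (ev i * t) removes the damping.\<close>

definition gc :: "real \<Rightarrow> ('n::finite cc \<Rightarrow> complex) \<Rightarrow> 'n ix \<Rightarrow> complex" where
  "gc t F i = ip (Mt t) F (SHi i) * of_real (exp (ev i * t) / Nt t i)"

lemma gc_ES:
  fixes c :: "'n::finite ix \<Rightarrow> complex"
  assumes "t > 0" "c \<in> W 0" shows "gc t (ES t c) = c"
proof
  fix i :: "'n ix"
  have "complex_of_real (Nt t i) \<noteq> 0" by (simp add: Nt_def)
  moreover have "complex_of_real (exp (- ev i * t)) * of_real (exp (ev i * t)) = 1"
    unfolding of_real_mult[symmetric] exp_add[symmetric] by simp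
  ultimately show "gc t (ES t c) i = c i"
    unfolding gc_def ES_props(4)[OF assms] damp_def of_real_divide by (simp add: mult_ac)
qed

text \<open>The factor 2^n comes from \<open>Nt\<close>, the factor 4^m from differentiating exp (2
  \<lambda> s) 2 m times.\<close>

definition kap :: "'n::finite itself \<Rightarrow> nat \<Rightarrow> real" where
  "kap _ m = sqrt (2 ^ CARD('n) * 4 ^ m)"

lemma kap_pos: "kap TYPE('n::finite) m > 0" by (simp add: kap_def)

context
  fixes t :: real and m :: nat
  assumes t: "t > 0"
begin

lemma G_space_expansion:
  fixes F :: "'n::finite cc \<Rightarrow> complex"
  assumes F: "F \<in> G_space t m"
  shows "gc t F \<in> W m" "ES t (gc t F) = F"
    "(\<integral>p. (cmod (F p))\<^sup>2 * weight_deriv m t p \<partial>lborel) = (kap TYPE('n) m * wnorm m (gc t F))\<^sup>2"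
proof -
  have "entire F" using F by (simp add: G_space_def)
  from entire_SE_expansion[OF t this G_space_sqi[OF t F]]
  obtain d where sm: "(\<lambda>i. (cmod (d i))\<^sup>2 * Nt t i) summable_on UNIV" and FS: "F = SE d" by blast
  define c where "c = (\<lambda>i. of_real (exp (ev i * t)) * d i)"
  have "complex_of_real (exp (- ev i * t)) * of_real (exp (ev i * t)) = 1" for i :: "'n ix"
    unfolding of_real_mult[symmetric] exp_add[symmetric] by simp
  then have dc: "damp t c = d" unfolding damp_def c_def by (simp add: fun_eq_iff mult.assoc[symmetric])
  have "(\<lambda>i. 1 / 2 ^ CARD('n) * ((cmod (damp t c i))\<^sup>2 * Nt t i)) summable_on UNIV"
    unfolding dc by (intro summable_on_cmult_right sm)
  then have c0: "c \<in> W 0" unfolding damp_Nt by (simp add: W_def)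
  have Fc: "F = ES t c" by (simp add: ES_def dc FS)
  have g: "gc t F = c" unfolding Fc by (rule gc_ES[OF t c0])
  show "ES t (gc t F) = F" unfolding g by (rule Fc[symmetric])
  let ?I = "\<integral>p. (cmod (F p))\<^sup>2 * weight_deriv m t p \<partial>lborel"
  have "((\<lambda>i. (cmod (d i))\<^sup>2 * Nt t i * (2 * ev i) ^ (2 * m)) has_sum ?I) UNIV"
    using G_norm_has_sum[OF t sm, of m] F unfolding FS by simp
  moreover have "(cmod (d i))\<^sup>2 * Nt t i * (2 * ev i) ^ (2 * m) = (2 ^ CARD('n) * 4 ^ m) * (ev i ^ (2 * m) * (cmod (c i))\<^sup>2)" for i
  proof -
    have "(2 * ev i) ^ (2 * m) = 4 ^ m * ev i ^ (2 * m)" by (simp add: power_mult_distrib power_mult)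
    then show ?thesis using damp_Nt[of t c i] unfolding dc by simp
  qed
  ultimately have h: "((\<lambda>i. (2 ^ CARD('n) * 4 ^ m) * (ev i ^ (2 * m) * (cmod (c i))\<^sup>2)) has_sum ?I) UNIV" by (simp only:)
  from has_sum_cmult_right[OF h, of "1 / (2 ^ CARD('n) * 4 ^ m)"]
  have h2: "((\<lambda>i. ev i ^ (2 * m) * (cmod (c i))\<^sup>2) has_sum (?I / (2 ^ CARD('n) * 4 ^ m))) UNIV" by simp
  then show "gc t F \<in> W m" unfolding g W_def by (auto intro: has_sum_imp_summable)
  have "(wnorm m c)\<^sup>2 = ?I / (2 ^ CARD('n) * 4 ^ m)" unfolding wnorm_sq by (rule infsumI[OF h2])
  then show "?I = (kap TYPE('n) m * wnorm m (gc t F))\<^sup>2" unfolding g by (simp add: kap_def power_mult_distrib)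
qed

text \<open>The absolute value gives a genuine measure, whose L2 theory supplies the closure of
  \<open>G_space\<close> under sums and the integrability of inner products.\<close>

definition MD :: "'n::finite cc measure" where
  "MD = density lborel (\<lambda>p. ennreal \<bar>weight_deriv m t p\<bar>)"

lemma measurable_weight_deriv [measurable]: "weight_deriv m t \<in> borel_measurable borel"
  unfolding weight_deriv_DW[OF t, abs_def] by (rule measurable_DW)

lemma integrable_MD:
  fixes f :: "_ \<Rightarrow> 'b::{banach,second_countable_topology}"
  assumes "f \<in> borel_measurable borel"
  shows "integrable MD f \<longleftrightarrow> integrable lborel (\<lambda>p. \<bar>weight_deriv m t p\<bar> *\<^sub>R f p)"
  unfolding MD_def by (rule integrable_density) (use assms in auto)

lemma G_space_iff: "F \<in> G_space t m \<longleftrightarrow> entire F \<and> sqi MD F"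
proof -
  have "sqi MD F \<longleftrightarrow> integrable lborel (\<lambda>p. (cmod (F p))\<^sup>2 * \<bar>weight_deriv m t p\<bar>)" if "entire F"
  proof -
    have [measurable]: "F \<in> borel_measurable borel" by (rule entire_imp_measurable[OF that])
    have "F \<in> borel_measurable MD" by (simp add: MD_def)
    moreover have "integrable MD (\<lambda>p. (cmod (F p))\<^sup>2) \<longleftrightarrow> integrable lborel (\<lambda>p. \<bar>weight_deriv m t p\<bar> *\<^sub>R (cmod (F p))\<^sup>2)"
      by (rule integrable_MD) measurable
    ultimately show ?thesis by (simp add: sqi_def mult.commute)
  qed
  then show ?thesis unfolding G_space_def by auto
qed

lemma G_space_closed:
  "(\<lambda>p. 0) \<in> G_space t m"
  "F \<in> G_space t m \<Longrightarrow> G \<in> G_space t m \<Longrightarrow> (\<lambda>p. F p + G p) \<in> G_space t m"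
  "F \<in> G_space t m \<Longrightarrow> G \<in> G_space t m \<Longrightarrow> (\<lambda>p. F p - G p) \<in> G_space t m"
  "F \<in> G_space t m \<Longrightarrow> (\<lambda>p. a * F p) \<in> G_space t m"
  unfolding G_space_iff
  by (auto intro: entire_const sqi_0 entire_add sqi_add entire_diff sqi_diff entire_cmult sqi_cmult)

lemma G_inner_integrable:
  assumes "F \<in> G_space t m" "G \<in> G_space t m"
  shows "integrable lborel (\<lambda>p. F p * cnj (G p) * of_real (weight_deriv m t p))"
proof -
  have s: "entire F" "entire G" "sqi MD F" "sqi MD G" using assms by (auto simp: G_space_iff)
  have [measurable]: "F \<in> borel_measurable borel" "G \<in> borel_measurable borel" using s entire_imp_measurable by auto
  have "integrable lborel (\<lambda>p. \<bar>weight_deriv m t p\<bar> *\<^sub>R (F p * cnj (G p)))"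
    by (subst integrable_MD[symmetric]) (use sqi_mult_integrable[OF s(3,4)] in auto)
  then show ?thesis
  proof (rule Bochner_Integration.integrable_bound)
    show "AE p in lborel. norm (F p * cnj (G p) * of_real (weight_deriv m t p)) \<le> norm (\<bar>weight_deriv m t p\<bar> *\<^sub>R (F p * cnj (G p)))"
      by (rule AE_I2) (simp add: norm_mult)
  qed measurable
qed

lemma G_inner_self: "G_inner t m F F = of_real (\<integral>p. (cmod (F p))\<^sup>2 * weight_deriv m t p \<partial>lborel)"
  unfolding G_inner_def integral_complex_of_real[symmetric]
  by (rule Bochner_Integration.integral_cong) (simp_all add: complex_norm_square del: of_real_power)

lemma G_norm_eq: "F \<in> G_space t m \<Longrightarrow> G_norm t m F = kap TYPE('n) m * wnorm m (gc t F)"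
  for F :: "'n::finite cc \<Rightarrow> complex"
  unfolding G_norm_def G_inner_self using kap_pos[where 'n='n, of m] wnorm_nonneg[of m "gc t F"]
  by (simp add: G_space_expansion(3))

text \<open>Definiteness is the point: it cannot be seen from a density of varying sign, but the
  form is a positive multiple of the squared \<open>wnorm\<close>, which vanishes only for zero
  coefficients.\<close>

lemma inner_product_G: "inner_product_on (G_space t m :: ('n::finite cc \<Rightarrow> complex) set) (G_inner t m)"
  unfolding inner_product_on_def
proof (intro conjI ballI allI impI)
  fix F G H :: "'n cc \<Rightarrow> complex" and a
  assume F: "F \<in> G_space t m"
  show "G_inner t m (\<lambda>p. a * F p) G = a * G_inner t m F G"
    unfolding G_inner_def by (simp add: mult.assoc)
  show "G_inner t m G F = cnj (G_inner t m F G)"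
    unfolding G_inner_def Bochner_Integration.integral_cnj[symmetric] by (simp add: mult_ac)
  assume G: "G \<in> G_space t m" and H: "H \<in> G_space t m"
  show "G_inner t m (\<lambda>p. F p + G p) H = G_inner t m F H + G_inner t m G H"
    unfolding G_inner_def using G_inner_integrable[OF F H] G_inner_integrable[OF G H] by (simp add: distrib_right)
next
  fix F :: "'n cc \<Rightarrow> complex" assume F: "F \<in> G_space t m" "F \<noteq> (\<lambda>p. 0)"
  have "wnorm m (gc t F) \<noteq> 0"
  proof
    assume "wnorm m (gc t F) = 0"
    then have "gc t F i = 0" for i using cmod_le_wnorm[OF G_space_expansion(1)[OF F(1)], of i] by simp
    then have z: "(\<lambda>i. 0 * gc t F i) = gc t F" by (simp add: fun_eq_iff)
    have "F = ES t (\<lambda>i. 0 * gc t F i)" unfolding z by (rule G_space_expansion(2)[OF F(1), symmetric])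
    also have "\<dots> = (\<lambda>p. 0)" using ES_scale[OF t W_l2[OF G_space_expansion(1)[OF F(1)]], of 0] by simp
    finally show False using F(2) by simp
  qed
  then show "0 < Re (G_inner t m F F)"
    unfolding G_inner_self G_space_expansion(3)[OF F(1)] using kap_pos[where 'n='n, of m] by simp
qed (simp_all add: G_space_closed)

lemma gc_add: "F \<in> G_space t m \<Longrightarrow> G \<in> G_space t m \<Longrightarrow> gc t (\<lambda>p. F p + G p) = (\<lambda>i. gc t F i + gc t G i)"
  and gc_diff: "F \<in> G_space t m \<Longrightarrow> G \<in> G_space t m \<Longrightarrow> gc t (\<lambda>p. F p - G p) = (\<lambda>i. gc t F i - gc t G i)"
  and gc_scale: "gc t (\<lambda>p. a * F p) = (\<lambda>i. a * gc t F i)"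
  for F G :: "'n::finite cc \<Rightarrow> complex"
proof -
  interpret O: orthogonal_system "Mt t" "SHi :: 'n ix \<Rightarrow> _" "Nt t" by (rule orthogonal_system_Mt[OF t])
  show "gc t (\<lambda>p. F p + G p) = (\<lambda>i. gc t F i + gc t G i)" if "F \<in> G_space t m" "G \<in> G_space t m"
    using that by (simp add: fun_eq_iff gc_def ip_add G_space_sqi[OF t] O.sqi_e distrib_right add_divide_distrib)
  show "gc t (\<lambda>p. F p - G p) = (\<lambda>i. gc t F i - gc t G i)" if "F \<in> G_space t m" "G \<in> G_space t m"
    using that by (simp add: fun_eq_iff gc_def ip_diff G_space_sqi[OF t] O.sqi_e left_diff_distrib diff_divide_distrib)
  show "gc t (\<lambda>p. a * F p) = (\<lambda>i. a * gc t F i)" by (simp add: fun_eq_iff gc_def ip_cmult)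
qed

text \<open>Limits of sequences in \<open>G_space\<close> are taken among coefficients, where
  completeness is available.\<close>

definition conv :: "'n::finite holo_seq \<Rightarrow> ('n ix \<Rightarrow> complex) \<Rightarrow> bool" where
  "conv X c \<longleftrightarrow> (\<forall>k. X k \<in> G_space t m) \<and> c \<in> W m \<and> (\<lambda>k. wnorm m (\<lambda>i. gc t (X k) i - c i)) \<longlonglongrightarrow> 0"

lemma convD:
  assumes "conv X c"
  shows "X k \<in> G_space t m" "c \<in> W m" "gc t (X k) \<in> W m" "(\<lambda>k. wnorm m (\<lambda>i. gc t (X k) i - c i)) \<longlonglongrightarrow> 0"
  using assms G_space_expansion(1) by (auto simp: conv_def)

lemma conv_unique:
  fixes c d :: "'n::finite ix \<Rightarrow> complex"
  assumes "conv X c" "conv X d" shows "c = d"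
proof
  fix i :: "'n ix"
  have "(\<lambda>k. gc t (X k) i) \<longlonglongrightarrow> c i" if c: "conv X c" for c
  proof -
    have "norm (gc t (X k) i - c i) \<le> wnorm m (\<lambda>i. gc t (X k) i - c i)" for k
      using cmod_le_wnorm[OF W_diff(1)[OF convD(3,2)[OF c]], of k i] .
    from Lim_null_comparison[OF always_eventually[OF allI, OF this] convD(4)[OF c]]
    show ?thesis by (rule LIM_zero_cancel)
  qed
  from this[OF assms(1)] this[OF assms(2)] show "c i = d i" by (rule LIMSEQ_unique)
qed

text \<open>Density of finite sums: the truncations of \<open>c\<close> are the coefficients of
  members of \<open>G_space\<close>.\<close>

lemma conv_ex:
  fixes c :: "'n::finite ix \<Rightarrow> complex"
  assumes c: "c \<in> W m" shows "\<exists>X. conv X c"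
proof -
  let ?x = "\<lambda>k i. if i \<in> stage k then c i else 0"
  \<comment> \<open>Beyond stage \<open>k\<close> the partial sums of the truncated sequence no
    longer change, so its series is the finite sum.\<close>
  have "psum (stage k) (damp t c) = ES t (?x k)" for k
  proof
    fix p :: "'n cc"
    have "(\<lambda>n. psum (stage n) (damp t (?x k)) p) \<longlonglongrightarrow> ES t (?x k) p"
      by (rule ES_props(2)[OF t W_l2[OF W_truncation(1)[OF c]]])
    moreover have "\<forall>\<^sub>F n in sequentially. (stage k :: 'n ix set) \<subseteq> stage n" by (rule stage_eventually) simp
    then have "\<forall>\<^sub>F n in sequentially. psum (stage n) (damp t (?x k)) p = psum (stage k) (damp t c) p"
    proof eventually_elim
      case (elim n)
      then show ?case unfolding psum_def damp_def by (intro sum.mono_neutral_cong_right) auto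
    qed
    then have "(\<lambda>n. psum (stage n) (damp t (?x k)) p) \<longlonglongrightarrow> psum (stage k) (damp t c) p"
      by (rule tendsto_eventually)
    ultimately show "psum (stage k) (damp t c) p = ES t (?x k) p" by (rule LIMSEQ_unique[rotated])
  qed
  then have "gc t (psum (stage k) (damp t c)) = ?x k" for k
    using gc_ES[OF t W_l2[OF W_truncation(1)[OF c]]] by simp
  then have "conv (\<lambda>k. psum (stage k) (damp t c)) c"
    unfolding conv_def using c W_truncation(2)[OF c] by (simp add: psum_in_G_space[OF t])
  then show ?thesis by blast
qed

lemma G_norm_diff:
  fixes X Y :: "'n::finite cc \<Rightarrow> complex"
  assumes "X \<in> G_space t m" "Y \<in> G_space t m"
  shows "G_norm t m (\<lambda>p. X p - Y p) = kap TYPE('n) m * wnorm m (\<lambda>i. gc t X i - gc t Y i)"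
  using assms by (simp add: G_norm_eq G_space_closed gc_diff)

text \<open>By \<open>G_norm_diff\<close> the map \<open>gc t\<close> scales distances by
  \<open>kap\<close>, so Cauchy sequences in \<open>G_space\<close> become convergent ones in the
  complete space \<open>W m\<close>.\<close>

lemma G_Cauchy_iff: "X \<in> G_Cauchy t m \<longleftrightarrow> (\<exists>c. conv X c)" for X :: "'n::finite holo_seq"
proof
  let ?k = "kap TYPE('n) m"
  have k: "?k > 0" by (rule kap_pos)
  assume X: "X \<in> G_Cauchy t m"
  then have G: "X k \<in> G_space t m" for k by (auto simp: G_Cauchy_def)
  have "\<exists>c\<in>W m. (\<lambda>k. wnorm m (\<lambda>i. gc t (X k) i - c i)) \<longlonglongrightarrow> 0"
  proof (rule W_complete)
    show "gc t (X k) \<in> W m" for k by (rule G_space_expansion(1)[OF G])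
    fix e :: real assume "e > 0"
    then have "?k * e > 0" using k by simp
    then obtain N where "\<And>i j. i \<ge> N \<Longrightarrow> j \<ge> N \<Longrightarrow> G_norm t m (\<lambda>p. X i p - X j p) < ?k * e"
      using X unfolding G_Cauchy_def by blast
    then show "\<exists>N. \<forall>i\<ge>N. \<forall>j\<ge>N. wnorm m (\<lambda>l. gc t (X i) l - gc t (X j) l) < e"
      unfolding G_norm_diff[OF G G] using k by auto
  qed
  then show "\<exists>c. conv X c" unfolding conv_def using G by blast
next
  let ?k = "kap TYPE('n) m"
  have k: "?k > 0" by (rule kap_pos)
  assume "\<exists>c. conv X c"
  then obtain c where c: "conv X c" by blast
  note D = convD[OF c]
  have "\<exists>N. \<forall>i\<ge>N. \<forall>j\<ge>N. G_norm t m (\<lambda>p. X i p - X j p) < e" if "e > 0" for e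
  proof -
    have "e / (2 * ?k) > 0" using that k by simp
    from order_tendstoD(2)[OF D(4) this] obtain N where N: "\<And>n. n \<ge> N \<Longrightarrow> wnorm m (\<lambda>i. gc t (X n) i - c i) < e / (2 * ?k)"
      unfolding eventually_sequentially by blast
    have "G_norm t m (\<lambda>p. X i p - X j p) < e" if ij: "i \<ge> N" "j \<ge> N" for i j
    proof -
      have "wnorm m (\<lambda>l. gc t (X i) l - gc t (X j) l) < e / (2 * ?k) + e / (2 * ?k)"
        using wnorm_diff_triangle[OF D(3)[of i] D(3)[of j] D(2)] N[OF ij(1)] N[OF ij(2)] by linarith
      then show ?thesis unfolding G_norm_diff[OF D(1) D(1)] using k by (simp add: field_simps)
    qed
    then show ?thesis by blast
  qed
  then show "X \<in> G_Cauchy t m" unfolding G_Cauchy_def using D(1) by blast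
qed

lemma B_rel_iff: "(X, Y) \<in> B_rel t m \<longleftrightarrow> (\<exists>c. conv X c \<and> conv Y c)" for X Y :: "'n::finite holo_seq"
proof
  let ?k = "kap TYPE('n) m"
  have k: "?k > 0" by (rule kap_pos)
  assume a: "(X, Y) \<in> B_rel t m"
  then obtain c d where c: "conv X c" and d: "conv Y d" unfolding B_rel_def G_Cauchy_iff by auto
  note C = convD[OF c] and D = convD[OF d]
  have "(\<lambda>k. G_norm t m (\<lambda>p. X k p - Y k p)) \<longlonglongrightarrow> 0" using a by (simp add: B_rel_def)
  then have "(\<lambda>k. ?k * wnorm m (\<lambda>i. gc t (X k) i - gc t (Y k) i)) \<longlonglongrightarrow> 0" unfolding G_norm_diff[OF C(1) D(1)] .
  from tendsto_mult_left[OF this, of "1 / ?k"] have l: "(\<lambda>k. wnorm m (\<lambda>i. gc t (X k) i - gc t (Y k) i)) \<longlonglongrightarrow> 0" using k by simp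
  \<comment> \<open>The limit \<open>d\<close> of \<open>Y\<close> is a limit of \<open>X\<close>
    too, by the triangle inequality.\<close>
  have "(\<lambda>k. wnorm m (\<lambda>i. gc t (X k) i - d i)) \<longlonglongrightarrow> 0"
  proof (rule tendsto_sandwich[OF _ _ tendsto_const])
    show "\<forall>\<^sub>F k in sequentially. 0 \<le> wnorm m (\<lambda>i. gc t (X k) i - d i)" by (simp add: wnorm_nonneg)
    show "\<forall>\<^sub>F k in sequentially. wnorm m (\<lambda>i. gc t (X k) i - d i) \<le> wnorm m (\<lambda>i. gc t (X k) i - gc t (Y k) i) + wnorm m (\<lambda>i. gc t (Y k) i - d i)"
      using wnorm_diff_triangle[OF C(3) D(2) D(3)] by (intro always_eventually allI) (metis wnorm_diff_commute)
    show "(\<lambda>k. wnorm m (\<lambda>i. gc t (X k) i - gc t (Y k) i) + wnorm m (\<lambda>i. gc t (Y k) i - d i)) \<longlonglongrightarrow> 0"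
      using tendsto_add[OF l D(4)] by simp
  qed
  then have "conv X d" unfolding conv_def using C(1) D(2) by blast
  then show "\<exists>c. conv X c \<and> conv Y c" using d by blast
next
  assume "\<exists>c. conv X c \<and> conv Y c"
  then obtain c where c: "conv X c" and d: "conv Y c" by blast
  note C = convD[OF c] and D = convD[OF d]
  have "(\<lambda>k. wnorm m (\<lambda>i. gc t (X k) i - gc t (Y k) i)) \<longlonglongrightarrow> 0"
  proof (rule tendsto_sandwich[OF _ _ tendsto_const])
    show "\<forall>\<^sub>F k in sequentially. 0 \<le> wnorm m (\<lambda>i. gc t (X k) i - gc t (Y k) i)" by (simp add: wnorm_nonneg)
    show "\<forall>\<^sub>F k in sequentially. wnorm m (\<lambda>i. gc t (X k) i - gc t (Y k) i) \<le> wnorm m (\<lambda>i. gc t (X k) i - c i) + wnorm m (\<lambda>i. gc t (Y k) i - c i)"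
      using wnorm_diff_triangle[OF C(3) D(3) C(2)] by (intro always_eventually allI)
    show "(\<lambda>k. wnorm m (\<lambda>i. gc t (X k) i - c i) + wnorm m (\<lambda>i. gc t (Y k) i - c i)) \<longlonglongrightarrow> 0"
      using tendsto_add[OF C(4) D(4)] by simp
  qed
  from tendsto_mult_left[OF this, of "kap TYPE('n) m"]
  have "(\<lambda>k. G_norm t m (\<lambda>p. X k p - Y k p)) \<longlonglongrightarrow> 0" unfolding G_norm_diff[OF C(1) D(1)] by simp
  then show "(X, Y) \<in> B_rel t m" unfolding B_rel_def using c d by (auto simp: G_Cauchy_iff)
qed

text \<open>All sequences with limit \<open>c\<close> form one class of the completion, which is
  thereby parametrised by \<open>W m\<close> without a choice of representatives.\<close>

definition KB :: "('n::finite ix \<Rightarrow> complex) \<Rightarrow> 'n holo_seq set" where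
  "KB c = {X. conv X c}"

lemma B_rel_class: assumes "conv X c" shows "B_rel t m `` {X} = KB c"
  unfolding KB_def using assms by (auto simp: B_rel_iff dest: conv_unique[OF assms])

lemma KB_nonempty: "c \<in> W m \<Longrightarrow> KB c \<noteq> {}" using conv_ex by (auto simp: KB_def)

lemma bij_KB: "bij_betw KB (W m) (B_space t m :: 'n::finite holo_seq set set)"
proof (rule bij_betw_imageI)
  show "inj_on KB (W m :: ('n ix \<Rightarrow> complex) set)"
  proof (rule inj_onI)
    fix c d :: "'n ix \<Rightarrow> complex" assume c: "c \<in> W m" and eq: "KB c = KB d"
    obtain X where X: "X \<in> KB c" using KB_nonempty[OF c] by blast
    then have "X \<in> KB d" using eq by simp
    then show "c = d" using X unfolding KB_def mem_Collect_eq by (intro conv_unique)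
  qed
  show "KB ` W m = (B_space t m :: 'n holo_seq set set)"
  proof (intro equalityI subsetI)
    fix b :: "'n holo_seq set" assume "b \<in> KB ` W m"
    then obtain c where c: "c \<in> W m" "b = KB c" by blast
    then obtain X where X: "conv X c" using conv_ex by blast
    then have "b = B_rel t m `` {X}" using c(2) B_rel_class[OF X] by simp
    moreover have "X \<in> G_Cauchy t m" unfolding G_Cauchy_iff using X by blast
    ultimately show "b \<in> B_space t m" unfolding B_space_def by (simp add: quotientI)
  next
    fix b :: "'n holo_seq set" assume "b \<in> B_space t m"
    then obtain X where X: "X \<in> G_Cauchy t m" "b = B_rel t m `` {X}" unfolding B_space_def by (rule quotientE)
    then obtain c where c: "conv X c" by (auto simp: G_Cauchy_iff)
    then show "b \<in> KB ` W m" using X B_rel_class convD(2) by blast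
  qed
qed

lemma conv_add: assumes "conv X c" "conv Y d" shows "conv (\<lambda>k p. X k p + Y k p) (\<lambda>i. c i + d i)"
proof -
  note C = convD[OF assms(1)] and D = convD[OF assms(2)]
  have "(\<lambda>k. wnorm m (\<lambda>i. (gc t (X k) i + gc t (Y k) i) - (c i + d i))) \<longlonglongrightarrow> 0"
  proof (rule tendsto_sandwich[OF _ _ tendsto_const])
    show "\<forall>\<^sub>F k in sequentially. 0 \<le> wnorm m (\<lambda>i. (gc t (X k) i + gc t (Y k) i) - (c i + d i))" by (simp add: wnorm_nonneg)
    show "\<forall>\<^sub>F k in sequentially. wnorm m (\<lambda>i. (gc t (X k) i + gc t (Y k) i) - (c i + d i)) \<le> wnorm m (\<lambda>i. gc t (X k) i - c i) + wnorm m (\<lambda>i. gc t (Y k) i - d i)"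
      using W_add(2)[OF W_diff(1)[OF C(3,2)] W_diff(1)[OF D(3,2)]]
      by (intro always_eventually allI) (simp add: add_diff_add)
    show "(\<lambda>k. wnorm m (\<lambda>i. gc t (X k) i - c i) + wnorm m (\<lambda>i. gc t (Y k) i - d i)) \<longlonglongrightarrow> 0"
      using tendsto_add[OF C(4) D(4)] by simp
  qed
  then show ?thesis unfolding conv_def gc_add[OF C(1) D(1)] using C D W_add(1) G_space_closed(2) by blast
qed

lemma conv_scale: assumes "conv X c" shows "conv (\<lambda>k p. a * X k p) (\<lambda>i. a * c i)"
proof -
  note C = convD[OF assms]
  have "wnorm m (\<lambda>i. a * gc t (X k) i - a * c i) = cmod a * wnorm m (\<lambda>i. gc t (X k) i - c i)" for k
    unfolding right_diff_distrib[symmetric] by (rule W_scale(2))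
  moreover have "(\<lambda>k. cmod a * wnorm m (\<lambda>i. gc t (X k) i - c i)) \<longlonglongrightarrow> 0"
    using tendsto_mult_left[OF C(4), of "cmod a"] by simp
  ultimately have "(\<lambda>k. wnorm m (\<lambda>i. a * gc t (X k) i - a * c i)) \<longlonglongrightarrow> 0" by simp
  then show ?thesis unfolding conv_def gc_scale using G_space_closed(4)[OF C(1)] W_scale(1)[OF C(2)] by blast
qed

lemma B_add_KB:
  assumes "c \<in> W m" "d \<in> W m" shows "B_add t m (KB c) (KB d) = KB (\<lambda>i. c i + d i)"
proof -
  have "B_add t m (KB c) (KB d) = (\<Union>X\<in>KB c. \<Union>Y\<in>KB d. KB (\<lambda>i. c i + d i))"
    unfolding B_add_def by (intro SUP_cong refl B_rel_class conv_add) (simp_all add: KB_def)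
  then show ?thesis using KB_nonempty assms by auto
qed

lemma B_scale_KB:
  assumes "c \<in> W m" shows "B_scale t m a (KB c) = KB (\<lambda>i. a * c i)"
proof -
  have "B_scale t m a (KB c) = (\<Union>X\<in>KB c. KB (\<lambda>i. a * c i))"
    unfolding B_scale_def by (intro SUP_cong refl B_rel_class conv_scale) (simp add: KB_def)
  then show ?thesis using KB_nonempty assms by auto
qed

lemma B_norm_KB:
  fixes c :: "'n::finite ix \<Rightarrow> complex"
  assumes c: "c \<in> W m" shows "B_norm t m (KB c) = kap TYPE('n) m * wnorm m c"
proof -
  have l: "lim (\<lambda>k. G_norm t m (X k)) = kap TYPE('n) m * wnorm m c" if "X \<in> KB c" for X
  proof -
    have "conv X c" using that by (simp add: KB_def)
    note C = convD[OF this]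
    have "(\<lambda>k. wnorm m (gc t (X k))) \<longlonglongrightarrow> wnorm m c"
    proof (rule Lim_null_comparison[THEN LIM_zero_cancel])
      show "\<forall>\<^sub>F k in sequentially. norm (wnorm m (gc t (X k)) - wnorm m c) \<le> wnorm m (\<lambda>i. gc t (X k) i - c i)"
        unfolding real_norm_def by (intro always_eventually allI wnorm_abs_diff C)
    qed (rule C(4))
    from tendsto_mult_left[OF this, of "kap TYPE('n) m"] show ?thesis
      unfolding G_norm_eq[OF C(1)] by (rule limI)
  qed
  obtain X where X: "X \<in> KB c" using KB_nonempty[OF c] by blast
  have "the_elem ((\<lambda>X. lim (\<lambda>k. G_norm t m (X k))) ` KB c) = lim (\<lambda>k. G_norm t m (X k))"
    by (rule the_elem_image_unique) (use X l in auto)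
  then show ?thesis unfolding B_norm_def l[OF X] .
qed

lemma B_embed_KB: assumes "F \<in> G_space t m" shows "B_embed t m F = KB (gc t F)"
  unfolding B_embed_def
  by (rule B_rel_class) (use assms G_space_expansion(1)[OF assms] in \<open>simp add: conv_def wnorm_def\<close>)

section \<open>The isometry\<close>

lemma semigroup_entire_LS: "A \<in> Laguerre_Sobolev m \<Longrightarrow> semigroup_entire t A = ES t (cf A)"
  by (rule semigroup_entire_eq[OF t]) (simp add: Laguerre_Sobolev_iff)

text \<open>\<open>gc t\<close> is a left inverse; surjectivity holds because the target is an image
  of the Sobolev space, which \<open>cf\<close> maps onto \<open>W m\<close>.\<close>

lemma bij_ES: "bij_betw (ES t) (W m) (holo_Laguerre_Sobolev t m :: ('n::finite cc \<Rightarrow> complex) set)"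
proof (rule bij_betw_imageI)
  show "inj_on (ES t) (W m :: ('n ix \<Rightarrow> complex) set)" by (rule inj_on_inverseI[where g="gc t"]) (intro gc_ES t W_l2)
  have "semigroup_entire t ` Laguerre_Sobolev m = ES t ` cf ` (Laguerre_Sobolev m :: 'n L2_class set)"
    unfolding image_image by (intro image_cong refl semigroup_entire_LS)
  then show "ES t ` W m = (holo_Laguerre_Sobolev t m :: ('n cc \<Rightarrow> complex) set)"
    unfolding holo_Laguerre_Sobolev_def bij_betw_imp_surj_on[OF bij_cf] by (rule sym)
qed

lemma holo_norm_ES:
  fixes c :: "'n::finite ix \<Rightarrow> complex"
  assumes c: "c \<in> W m" shows "holo_Laguerre_Sobolev_norm t m (ES t c) = wnorm m c"
proof -
  have "c \<in> cf ` Laguerre_Sobolev m" unfolding bij_betw_imp_surj_on[OF bij_cf] by (rule c)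
  then obtain A where A: "A \<in> Laguerre_Sobolev m" "cf A = c" by blast
  have "inj_on (semigroup_entire t) (Laguerre_Sobolev m :: 'n L2_class set)"
  proof (rule inj_onI)
    fix A B :: "'n L2_class"
    assume a: "A \<in> Laguerre_Sobolev m" "B \<in> Laguerre_Sobolev m" "semigroup_entire t A = semigroup_entire t B"
    then have w: "A \<in> L2" "B \<in> L2" "cf A \<in> W 0" "cf B \<in> W 0" by (auto simp: Laguerre_Sobolev_iff intro: W_l2)
    have "ES t (cf A) = ES t (cf B)" using a by (simp add: semigroup_entire_LS)
    then have "gc t (ES t (cf A)) = gc t (ES t (cf B))" by simp
    then show "A = B" unfolding gc_ES[OF t w(3)] gc_ES[OF t w(4)] by (rule cf_inj[OF w(1,2)])
  qed
  then have "the_inv_into (Laguerre_Sobolev m) (semigroup_entire t) (ES t c) = A"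
    using A semigroup_entire_LS by (intro the_inv_into_f_eq) auto
  then show ?thesis by (simp add: holo_Laguerre_Sobolev_norm_def Laguerre_Sobolev_norm_eq A)
qed

text \<open>The completion and the holomorphic Sobolev space are both parametrised by
  \<open>W m\<close>; this map matches the parameters.\<close>

definition JB :: "'n::finite holo_seq set \<Rightarrow> 'n cc \<Rightarrow> complex" where
  "JB b = ES t (inv_into (W m) KB b)"

lemma JB_KB: "c \<in> W m \<Longrightarrow> JB (KB c) = ES t c"
  unfolding JB_def by (simp add: inv_into_f_f[OF bij_betw_imp_inj_on[OF bij_KB]])

lemma B_space_E: assumes "b \<in> B_space t m" obtains c where "c \<in> W m" "b = KB c"
  using assms bij_KB unfolding bij_betw_def by blast

lemma JB_identification: "B_identification t m (JB :: 'n::finite holo_seq set \<Rightarrow> _)"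
  unfolding B_identification_def
proof (intro conjI)
  show "bij_betw JB (B_space t m) (holo_Laguerre_Sobolev t m :: ('n cc \<Rightarrow> complex) set)"
    unfolding JB_def[abs_def] using bij_betw_trans[OF bij_betw_inv_into[OF bij_KB] bij_ES] by (simp add: comp_def)
  show "linear_map_on (B_space t m) (B_add t m) (B_scale t m) (\<lambda>F G p. F p + G p) (\<lambda>a F p. a * F p) (JB :: 'n holo_seq set \<Rightarrow> _)"
    unfolding linear_map_on_def
  proof (intro conjI ballI allI)
    fix b b' :: "'n holo_seq set" and a assume b: "b \<in> B_space t m"
    then obtain c where c: "c \<in> W m" "b = KB c" by (rule B_space_E)
    show "JB (B_scale t m a b) = (\<lambda>p. a * JB b p)"
      using c by (simp add: B_scale_KB JB_KB W_scale ES_scale[OF t W_l2])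
    assume "b' \<in> B_space t m"
    then obtain c' where c': "c' \<in> W m" "b' = KB c'" by (rule B_space_E)
    show "JB (B_add t m b b') = (\<lambda>p. JB b p + JB b' p)"
      using c c' by (simp add: B_add_KB JB_KB W_add ES_add[OF t W_l2 W_l2])
  qed
  show "\<forall>F\<in>G_space t m. JB (B_embed t m F) = (F :: 'n cc \<Rightarrow> complex)"
    by (simp add: B_embed_KB JB_KB G_space_expansion)
  show "\<exists>k>0. \<forall>b\<in>B_space t m. holo_Laguerre_Sobolev_norm t m (JB b :: 'n cc \<Rightarrow> complex) = k * B_norm t m b"
  \<comment> \<open>The norm of the completion carries the factor \<open>kap\<close>, the
    holomorphic norm carries none.\<close>
  proof (intro exI[of _ "1 / kap TYPE('n) m"] conjI ballI)
    fix b :: "'n holo_seq set" assume "b \<in> B_space t m"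
    then obtain c where c: "c \<in> W m" "b = KB c" by (rule B_space_E)
    then show "holo_Laguerre_Sobolev_norm t m (JB b) = 1 / kap TYPE('n) m * B_norm t m b"
      using kap_pos[where 'n='n, of m] by (simp add: JB_KB holo_norm_ES B_norm_KB)
  qed (simp add: kap_pos)
qed

end

theorem theorem3p2:
  fixes t :: real and m :: nat
  assumes "t > 0"
  shows "inner_product_on
           (G_space t m :: ((complex ^ 'n::finite) \<times> (complex ^ 'n) \<Rightarrow> complex) set)
           (G_inner t m) \<and>
         (\<exists>J :: 'n holo_seq set \<Rightarrow> (complex ^ 'n) \<times> (complex ^ 'n) \<Rightarrow> complex.
            B_identification t m J \<and>
            (\<exists>T :: 'n L2_class \<Rightarrow> 'n holo_seq set.
               (\<forall>A\<in>Laguerre_Sobolev m. J (T A) = semigroup_entire t A) \<and>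
               bij_betw T (Laguerre_Sobolev m) (B_space t m) \<and>
               linear_map_on (Laguerre_Sobolev m) L2_add L2_scale (B_add t m) (B_scale t m) T \<and>
               (\<exists>c>0. \<forall>A\<in>Laguerre_Sobolev m.
                  B_norm t m (T A) = c * Laguerre_Sobolev_norm m A)))"
proof (intro conjI exI[of _ "JB t m"] exI[of _ "\<lambda>A. KB t m (cf A)"] exI[of _ "kap TYPE('n) m"] ballI)
  show "inner_product_on (G_space t m :: ((complex ^ 'n::finite) \<times> (complex ^ 'n) \<Rightarrow> complex) set) (G_inner t m)"
    by (rule inner_product_G[OF assms])
  show "B_identification t m (JB t m :: 'n holo_seq set \<Rightarrow> _)" by (rule JB_identification[OF assms])
  \<comment> \<open>Two parametrisations by \<open>W m\<close> are composed: L2 classes by their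
    coefficients, points of the completion by their limits.\<close>
  show "bij_betw (\<lambda>A. KB t m (cf A)) (Laguerre_Sobolev m) (B_space t m :: 'n holo_seq set set)"
    using bij_betw_trans[OF bij_cf bij_KB[OF assms]] by (simp add: comp_def)
  show "linear_map_on (Laguerre_Sobolev m) L2_add L2_scale (B_add t m) (B_scale t m) (\<lambda>A :: 'n L2_class. KB t m (cf A))"
    unfolding linear_map_on_def
    by (simp add: Laguerre_Sobolev_iff cf_L2_add cf_L2_scale B_add_KB[OF assms] B_scale_KB[OF assms])
  show "kap TYPE('n) m > 0" by (rule kap_pos)
  fix A :: "'n L2_class" assume A: "A \<in> Laguerre_Sobolev m"
  then have "cf A \<in> W m" by (simp add: Laguerre_Sobolev_iff)
  then show "JB t m (KB t m (cf A)) = semigroup_entire t A" "B_norm t m (KB t m (cf A)) = kap TYPE('n) m * Laguerre_Sobolev_norm m A"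
    using A by (simp_all add: JB_KB[OF assms] semigroup_entire_LS[OF assms] B_norm_KB[OF assms] Laguerre_Sobolev_norm_eq)
qed

end
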